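(* Let $d\ge2$, $p\in[1,\infty]$, and let $\mathcal{T}_0$ be an initial triangulation of $\Omega\subset\mathbb{R}^d$ satisfying the matching neighbor condition. Let $\mathcal{T}$ be any mesh resulting from successive application of the BiSec-MT algorithm to $\mathcal{T}_0$, and let $\rho\in L^1(\Omega)$ be a weight with grading $\gamma_\rho$ (with respect to the face-based distance $\delta_{\mathrm{CR}}$ on $\mathcal{T}$) such that $$\gamma_\rho\,2^{\frac1d+\left|\frac12-\frac1p\right|}<\frac{d+\sqrt{d+2}}{d-\sqrt{d+2}}$$ (the right-hand side being $\infty$ for $d=2$). Then $$\|\rho\,\nabla_{\mathrm{NC}}Q_{\mathrm{CR}}u\|_p\le c\,\|\rho\,\nabla u\|_p\qquad\text{for all }u\in W^{1,p}(\Omega),$$ where the constant $c$ depends solely on the initial triangulation $\mathcal{T}_0$ and $\gamma_\rho$. In particular, for all dimensions $d\ge2$ one has the $W^{1,2}$-stability $\|\nabla_{\mathrm{NC}}Q_{\mathrm{CR}}u\|_2\le c\|\nabla u\|_2$ for all $u\in W^{1,2}(\Omega)$, and $W^{1,p}$-stability $\|\nabla_{\mathrm{NC}}Q_{\mathrm{CR}}u\|_p\le c\|\nabla u\|_p$ for all $u\in W^{1,p}(\Omega)$ holds for all $p\in[1,\infty]$ and all dimensions $2\le d\le32$.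
   Context: $\Omega\subset\mathbb{R}^d$ is a bounded polyhedral (connected) domain. For a regular triangulation $\mathcal{T}$ of $\Omega$ into closed simplices, $\mathcal{F}$ is the set of faces ($(d-1)$-simplices), $\mathrm{mid}(f)$ the barycenter of $f\in\mathcal{F}$, and the Crouzeix–Raviart space $\mathrm{CR}^1(\mathcal{T})$ consists of the functions $v\in L^\infty(\Omega)$ that are affine on each $T\in\mathcal{T}$ and continuous at $\mathrm{mid}(f)$ for all $f\in\mathcal{F}$. $Q_{\mathrm{CR}}$ is the $L^2$-projection onto it: $\langle Q_{\mathrm{CR}}u,v\rangle=\langle u,v\rangle$ for all $v\in\mathrm{CR}^1(\mathcal{T})$, where $\langle\cdot,\cdot\rangle$ is the $L^2(\Omega)$ pairing, extended to $u\in L^1(\Omega)$ by the same formula. $\nabla_{\mathrm{NC}}$ is the element-wise gradient. $\|\cdot\|_p$ is the norm of $L^p(\Omega)$. Distance $\delta_{\mathrm{CR}}$: distinct $T,T'\in\mathcal{T}$ are (face) neighbors if they share a face $f\in\mathcal{F}$; $\delta_{\mathrm{CR}}(T,T')$ is the smallest $N\in\mathbb{N}_0$ such that there are $T_0=T,\dots,T_N=T'$ in $\mathcal{T}$ with consecutive ones being face neighbors. A positive function $\rho\in L^1(\Omega)$ is a weight with grading $\gamma_\rho\ge1$ if for all $T,T'\in\mathcal{T}$: $\operatorname{ess\,sup}_T\rho\le\gamma_\rho\operatorname{ess\,inf}_T\rho$; and if $\delta_{\mathrm{CR}}(T,T')=1$, then $\operatorname{ess\,sup}_{T'}\rho\le\gamma_\rho\operatorname{ess\,sup}_T\rho$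 and $\operatorname{ess\,inf}_{T'}\rho\le\gamma_\rho\operatorname{ess\,inf}_T\rho$. BiSec-MT (bisection of Maubach and Traxler, in Stevenson's notation). A tagged simplex $T=(x_0,\dots,x_d)_\gamma$ is a $d$-simplex with ordered vertices and type $\gamma\in\{0,\dots,d-1\}$. Its refinement edge is $x_0x_d$ and its children, obtained by bisection at $\bar x=\frac{x_0+x_d}2$, are $(x_0,\bar x,x_1,\dots,x_\gamma,x_{\gamma+1},\dots,x_{d-1})_{(\gamma+1)\bmod d}$ and $(x_d,\bar x,x_1,\dots,x_\gamma,x_{d-1},\dots,x_{\gamma+1})_{(\gamma+1)\bmod d}$. Put $T_R=(x_d,x_1,\dots,x_\gamma,x_{d-1},\dots,x_{\gamma+1},x_0)_\gamma$. Two tagged simplices $T,T'$ are reflected neighbors if they share a $(d-1)$-face, have the same type, and the ordered vertex sequence of $T$ or of $T_R$ coincides with that of $T'$ in all but one position. Matching neighbor condition: $\mathcal{T}_0$ is a conforming triangulation of $\Omega$ into tagged simplices of the same type such that for any $T,T'\in\mathcal{T}_0$ sharing a $(d-1)$-face: if the refinement edge of $T$ or $T'$ is contained in $T\cap T'$, then $T,T'$ are reflected neighbors; otherwise the pair of neighboring children of $T$ and $T'$ are reflected neighbors. A mesh resulting from successive application of BiSec-MT to $\mathcal{T}_0$ is obtained by repeatedly marking simplices, bisecting them, and taking the smallest conforming refinement (by further bisections); such meshes are conforming. *)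

theory Defs
  imports "HOL-Analysis.Analysis" "HOL-Probability.Essential_Supremum"
begin

section \<open>Lebesgue and Sobolev spaces\<close>

definition ennpowr :: "ennreal \<Rightarrow> real \<Rightarrow> ennreal" where
  "ennpowr a r = (if a = \<infinity> then \<infinity> else ennreal (enn2real a powr r))"

text \<open>The norm takes the value \<open>\<infinity>\<close> for a measurable function outside $L^p(\Omega)$.  Functions are
  total; their values outside \<open>\<Omega>\<close> play no role.\<close>

definition Lp_norm ::
  "'a::euclidean_space set \<Rightarrow> ennreal \<Rightarrow> ('a \<Rightarrow> 'b::euclidean_space) \<Rightarrow> ennreal" where
  "Lp_norm \<Omega> p f =
     (if p = \<infinity> then esssup (lebesgue_on \<Omega>) (\<lambda>x. ennreal (norm (f x)))
      else ennpowr (\<integral>\<^sup>+ x. ennreal (norm (f x) powr enn2real p) \<partial>lebesgue_on \<Omega>) (1 / enn2real p))"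

definition Lp :: "'a::euclidean_space set \<Rightarrow> ennreal \<Rightarrow> ('a \<Rightarrow> 'b::euclidean_space) set" where
  "Lp \<Omega> p = {f. f \<in> borel_measurable (lebesgue_on \<Omega>) \<and> Lp_norm \<Omega> p f < \<infinity>}"

definition L2_pairing :: "'a::euclidean_space set \<Rightarrow> ('a \<Rightarrow> real) \<Rightarrow> ('a \<Rightarrow> real) \<Rightarrow> real" where
  "L2_pairing \<Omega> u v = integral\<^sup>L (lebesgue_on \<Omega>) (\<lambda>x. u x * v x)"

definition partial_deriv :: "'a::euclidean_space \<Rightarrow> ('a \<Rightarrow> real) \<Rightarrow> 'a \<Rightarrow> real" where
  "partial_deriv b f x = frechet_derivative f (at x) b"

fun Ck :: "nat \<Rightarrow> ('a::euclidean_space \<Rightarrow> real) \<Rightarrow> bool" where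
  "Ck 0 f \<longleftrightarrow> continuous_on UNIV f"
| "Ck (Suc k) f \<longleftrightarrow> (\<forall>x. f differentiable (at x)) \<and> (\<forall>b\<in>Basis. Ck k (partial_deriv b f))"

definition test_function :: "'a::euclidean_space set \<Rightarrow> ('a \<Rightarrow> real) \<Rightarrow> bool" where
  "test_function \<Omega> \<phi> \<longleftrightarrow>
     (\<forall>k. Ck k \<phi>) \<and> compact (closure {x. \<phi> x \<noteq> 0}) \<and> closure {x. \<phi> x \<noteq> 0} \<subseteq> \<Omega>"

definition locally_integrable ::
  "'a::euclidean_space set \<Rightarrow> ('a \<Rightarrow> 'b::euclidean_space) \<Rightarrow> bool" where
  "locally_integrable \<Omega> f \<longleftrightarrow> (\<forall>K. compact K \<and> K \<subseteq> \<Omega> \<longrightarrow> integrable (lebesgue_on K) f)"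

definition has_weak_gradient ::
  "'a::euclidean_space set \<Rightarrow> ('a \<Rightarrow> real) \<Rightarrow> ('a \<Rightarrow> 'a) \<Rightarrow> bool" where
  "has_weak_gradient \<Omega> u g \<longleftrightarrow>
     locally_integrable \<Omega> u \<and> locally_integrable \<Omega> g \<and>
     (\<forall>\<phi>. test_function \<Omega> \<phi> \<longrightarrow> (\<forall>b\<in>Basis.
        L2_pairing \<Omega> u (partial_deriv b \<phi>) = - L2_pairing \<Omega> (\<lambda>x. g x \<bullet> b) \<phi>))"

text \<open>Unique up to null sets in the open set \<open>\<Omega>\<close>.\<close>

definition weak_gradient :: "'a::euclidean_space set \<Rightarrow> ('a \<Rightarrow> real) \<Rightarrow> 'a \<Rightarrow> 'a" where
  "weak_gradient \<Omega> u = (SOME g. has_weak_gradient \<Omega> u g)"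

definition W1 :: "'a::euclidean_space set \<Rightarrow> ennreal \<Rightarrow> ('a \<Rightarrow> real) set" where
  "W1 \<Omega> p = {u. u \<in> Lp \<Omega> p \<and> (\<exists>g. g \<in> Lp \<Omega> p \<and> has_weak_gradient \<Omega> u g)}"


section \<open>Triangulations and the Crouzeix--Raviart space\<close>

text \<open>The interior of a finite union of polytopes is open, bounded and equal to the interior of
  its closure; slit domains are excluded.\<close>

definition polyhedral_domain :: "'a::euclidean_space set \<Rightarrow> bool" where
  "polyhedral_domain \<Omega> \<longleftrightarrow>
     \<Omega> \<noteq> {} \<and> connected \<Omega> \<and> (\<exists>P. finite P \<and> (\<forall>S\<in>P. polytope S) \<and> \<Omega> = interior (\<Union>P))"

definition triangulates :: "'a::euclidean_space set set \<Rightarrow> 'a set \<Rightarrow> bool" where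
  "triangulates \<T> \<Omega> \<longleftrightarrow>
     triangulation \<T> \<and> (\<forall>T\<in>\<T>. int DIM('a) simplex T) \<and> \<Union>\<T> = closure \<Omega>"

definition faces :: "'a::euclidean_space set set \<Rightarrow> 'a set set" where
  "faces \<T> = {f. \<exists>T\<in>\<T>. f facet_of T}"

definition barycenter :: "'a::euclidean_space set \<Rightarrow> 'a" where
  "barycenter f = (\<Sum>x | x extreme_point_of f. x) /\<^sub>R real (card {x. x extreme_point_of f})"

text \<open>The elements are representatives of classes in $L^\infty(\Omega)$.  Their values on the
  skeleton are arbitrary except at the points \<open>barycenter f\<close>; since these functions may jump across
  faces, they are affine on the interiors of the closed simplices only.  At the barycenter of a
  boundary face the continuity merely prescribes the value of the representative.\<close>

definition CR1 :: "'a::euclidean_space set \<Rightarrow> 'a set set \<Rightarrow> ('a \<Rightarrow> real) set" where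
  "CR1 \<Omega> \<T> = {v. v \<in> Lp \<Omega> \<infinity>
     \<and> (\<forall>T\<in>\<T>. \<exists>a b. \<forall>x\<in>interior T. v x = a \<bullet> x + b)
     \<and> (\<forall>f\<in>faces \<T>. continuous (at (barycenter f) within closure \<Omega>) v)}"

text \<open>A representative of the projection; the projection is unique up to null sets.\<close>

definition Q_CR :: "'a::euclidean_space set \<Rightarrow> 'a set set \<Rightarrow> ('a \<Rightarrow> real) \<Rightarrow> 'a \<Rightarrow> real" where
  "Q_CR \<Omega> \<T> u =
     (SOME w. w \<in> CR1 \<Omega> \<T> \<and> (\<forall>v\<in>CR1 \<Omega> \<T>. L2_pairing \<Omega> w v = L2_pairing \<Omega> u v))"

text \<open>The value on the skeleton, a null set, is set to zero.\<close>

definition grad_NC :: "'a::euclidean_space set set \<Rightarrow> ('a \<Rightarrow> real) \<Rightarrow> 'a \<Rightarrow> 'a" where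
  "grad_NC \<T> v x = (if \<exists>T\<in>\<T>. x \<in> interior T then (THE D. GDERIV v x :> D) else 0)"


section \<open>Weights\<close>

definition face_neighbors :: "'a::euclidean_space set set \<Rightarrow> ('a set \<times> 'a set) set" where
  "face_neighbors \<T> = {(T, T'). T \<in> \<T> \<and> T' \<in> \<T> \<and> T \<noteq> T' \<and>
     (\<exists>f\<in>faces \<T>. f facet_of T \<and> f facet_of T')}"

text \<open>The infimum of the empty set is \<open>\<infinity>\<close>.\<close>

definition dist_CR :: "'a::euclidean_space set set \<Rightarrow> 'a set \<Rightarrow> 'a set \<Rightarrow> enat" where
  "dist_CR \<T> T T' = Inf (enat ` {N. (T, T') \<in> face_neighbors \<T> ^^ N})"

definition ess_sup_on :: "'a::euclidean_space set \<Rightarrow> ('a \<Rightarrow> real) \<Rightarrow> ereal" where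
  "ess_sup_on T \<rho> = esssup (lebesgue_on T) (\<lambda>x. ereal (\<rho> x))"

definition ess_inf_on :: "'a::euclidean_space set \<Rightarrow> ('a \<Rightarrow> real) \<Rightarrow> ereal" where
  "ess_inf_on T \<rho> = - esssup (lebesgue_on T) (\<lambda>x. - ereal (\<rho> x))"

definition weight_with_grading ::
  "'a::euclidean_space set \<Rightarrow> 'a set set \<Rightarrow> real \<Rightarrow> ('a \<Rightarrow> real) \<Rightarrow> bool" where
  "weight_with_grading \<Omega> \<T> \<gamma> \<rho> \<longleftrightarrow>
     1 \<le> \<gamma> \<and> \<rho> \<in> Lp \<Omega> 1 \<and> (AE x in lebesgue_on \<Omega>. 0 < \<rho> x) \<and>
     (\<forall>T\<in>\<T>. ess_sup_on T \<rho> \<le> ereal \<gamma> * ess_inf_on T \<rho>) \<and>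
     (\<forall>T\<in>\<T>. \<forall>T'\<in>\<T>. dist_CR \<T> T T' = 1 \<longrightarrow>
        ess_sup_on T' \<rho> \<le> ereal \<gamma> * ess_sup_on T \<rho> \<and>
        ess_inf_on T' \<rho> \<le> ereal \<gamma> * ess_inf_on T \<rho>)"


section \<open>Bisection\<close>

text \<open>The tagged simplex $(x_0,\dots,x_d)_\gamma$ is encoded as \<open>([x\<^sub>0, \<dots>, x\<^sub>d], \<gamma>)\<close>.\<close>

type_synonym 'a tagged = "'a list \<times> nat"

definition hull_of :: "'a::euclidean_space tagged \<Rightarrow> 'a set" where
  "hull_of T = convex hull (set (fst T))"

definition tagged_simplex :: "'a::euclidean_space tagged \<Rightarrow> bool" where
  "tagged_simplex T \<longleftrightarrow>
     length (fst T) = DIM('a) + 1 \<and> distinct (fst T) \<and> \<not> affine_dependent (set (fst T)) \<and>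
     snd T < DIM('a)"

definition inner_vertices :: "'a list \<Rightarrow> 'a list" where
  "inner_vertices xs = butlast (tl xs)"

text \<open>With \<open>ys\<close> $= (x_1,\dots,x_{d-1})$, the lists \<open>take \<gamma> ys\<close> and \<open>drop \<gamma> ys\<close> are
  $x_1,\dots,x_\gamma$ and $x_{\gamma+1},\dots,x_{d-1}$.\<close>

definition children :: "'a::euclidean_space tagged \<Rightarrow> 'a tagged set" where
  "children T = (case T of (xs, \<gamma>) \<Rightarrow>
     let ys = inner_vertices xs; m = midpoint (hd xs) (last xs); \<gamma>' = (\<gamma> + 1) mod DIM('a)
     in {(hd xs # m # take \<gamma> ys @ drop \<gamma> ys, \<gamma>'),
         (last xs # m # take \<gamma> ys @ rev (drop \<gamma> ys), \<gamma>')})"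

definition reflect :: "'a tagged \<Rightarrow> 'a tagged" where
  "reflect T = (case T of (xs, \<gamma>) \<Rightarrow>
     let ys = inner_vertices xs
     in (last xs # take \<gamma> ys @ rev (drop \<gamma> ys) @ [hd xs], \<gamma>))"

definition refinement_edge :: "'a::euclidean_space tagged \<Rightarrow> 'a set" where
  "refinement_edge T = closed_segment (hd (fst T)) (last (fst T))"

definition share_face :: "'a::euclidean_space tagged \<Rightarrow> 'a tagged \<Rightarrow> bool" where
  "share_face T T' \<longleftrightarrow> T \<noteq> T' \<and> (\<exists>f. f facet_of hull_of T \<and> f facet_of hull_of T')"

definition differ_in_one :: "'a list \<Rightarrow> 'a list \<Rightarrow> bool" where
  "differ_in_one xs ys \<longleftrightarrow>
     length xs = length ys \<and> (\<exists>!i. i < length xs \<and> xs ! i \<noteq> ys ! i)"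

definition reflected_neighbors :: "'a::euclidean_space tagged \<Rightarrow> 'a tagged \<Rightarrow> bool" where
  "reflected_neighbors T T' \<longleftrightarrow>
     share_face T T' \<and> snd T = snd T' \<and>
     (differ_in_one (fst T) (fst T') \<or> differ_in_one (fst (reflect T)) (fst T'))"

definition conforming :: "'a::euclidean_space tagged set \<Rightarrow> 'a set \<Rightarrow> bool" where
  "conforming M \<Omega> \<longleftrightarrow>
     (\<forall>T\<in>M. tagged_simplex T) \<and> inj_on hull_of M \<and> triangulates (hull_of ` M) \<Omega>"

text \<open>If no refinement edge lies in the common face of \<open>T\<close> and \<open>T'\<close>, then exactly one child of
  each of them has this face as a facet.  These are the neighboring children.\<close>

definition matching_neighbor_condition ::
  "'a::euclidean_space tagged set \<Rightarrow> 'a set \<Rightarrow> bool" where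
  "matching_neighbor_condition M \<Omega> \<longleftrightarrow>
     conforming M \<Omega> \<and> (\<exists>\<gamma>. \<forall>T\<in>M. snd T = \<gamma>) \<and>
     (\<forall>T\<in>M. \<forall>T'\<in>M. share_face T T' \<longrightarrow>
        (if refinement_edge T \<subseteq> hull_of T \<inter> hull_of T' \<or>
            refinement_edge T' \<subseteq> hull_of T \<inter> hull_of T'
         then reflected_neighbors T T'
         else \<exists>C\<in>children T. \<exists>C'\<in>children T'. reflected_neighbors C C'))"

definition bisect :: "'a::euclidean_space tagged set \<Rightarrow> 'a tagged set \<Rightarrow> 'a tagged set" where
  "bisect M S = (M - S) \<union> (\<Union>T\<in>S. children T)"

definition refinement :: "'a::euclidean_space tagged set \<Rightarrow> 'a tagged set \<Rightarrow> bool" where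
  "refinement = (\<lambda>M M'. \<exists>T\<in>M. M' = bisect M {T})\<^sup>*\<^sup>*"

definition smallest_conforming_refinement ::
  "'a::euclidean_space set \<Rightarrow> 'a tagged set \<Rightarrow> 'a tagged set \<Rightarrow> bool" where
  "smallest_conforming_refinement \<Omega> M M' \<longleftrightarrow>
     refinement M M' \<and> conforming M' \<Omega> \<and>
     (\<forall>N. refinement M N \<and> conforming N \<Omega> \<longrightarrow> refinement M' N)"

inductive BiSec_mesh ::
  "'a::euclidean_space set \<Rightarrow> 'a tagged set \<Rightarrow> 'a tagged set \<Rightarrow> bool"
  for \<Omega> :: "'a set" and M\<^sub>0 :: "'a tagged set" where
  initial: "BiSec_mesh \<Omega> M\<^sub>0 M\<^sub>0"
| refine: "BiSec_mesh \<Omega> M\<^sub>0 M \<Longrightarrow> S \<subseteq> M \<Longrightarrow>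
     smallest_conforming_refinement \<Omega> (bisect M S) M' \<Longrightarrow> BiSec_mesh \<Omega> M\<^sub>0 M'"


section \<open>The bound on the grading\<close>

definition CR_threshold :: "nat \<Rightarrow> ereal" where
  "CR_threshold d =
     (if d = 2 then \<infinity> else ereal ((real d + sqrt (real d + 2)) / (real d - sqrt (real d + 2))))"

text \<open>\<open>inverse \<infinity> = 0\<close> in \<^typ>\<open>ennreal\<close>, so the exponent is $1/d + 1/2$ for $p = \infty$.\<close>

definition grading_factor :: "nat \<Rightarrow> ennreal \<Rightarrow> real" where
  "grading_factor d p = 2 powr (1 / real d + \<bar>1 / 2 - enn2real (inverse p)\<bar>)"

end

theory Submission
  imports Defs "HOL-Probability.Probability"
begin

text \<open>At the barycenters of the faces the values of the projection, minus means of \<open>u\<close> over adjacent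
  elements, solve a linear system whose element matrices are a multiple of the identity minus a
  rank-one term.  Testing with weighted coefficients gives a weighted $L^2$ estimate if the weight
  oscillates little within each element.  In a mesh created by bisection the levels of face neighbours
  differ by at most one, and an element has at most one coarser face neighbour, namely across the face
  opposite its newest vertex; hence the factor $2^{\ell/d}$ that turns coefficients into gradients on
  level \<open>\<ell>\<close> only costs what the threshold allows.  Multiplying the weight by powers of a slowly varying
  majorant of $|\rho x|^p$, or of the right-hand side, extrapolates to all finite \<open>p\<close> with constants
  independent of \<open>p\<close>, and \<open>p = \<infinity>\<close> follows in the limit.  The right-hand side is bounded by a
  Poincare inequality on pairs of neighbouring elements.\<close>

section \<open>Simplices and barycentric coordinates\<close>

text \<open>The threshold is where the local quadratic form loses definiteness. With test
  coefficients w_f^2 x_f and y_f = w_f x_f the rank-one term of an element becomes (d-2)(sum w_f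
  y_f)(sum y_f / w_f). If, after scaling, all w_f lie in [1/\<tau>, \<tau>], it is at most
  (d-2)(d+1)(\<tau>^2 + 1/\<tau>^2 + 2)/4 times sum y_f^2, and equating this with the diagonal d^2
  gives \<tau>^2 = (d + sqrt(d+2))/(d - sqrt(d+2)). The obstacle is uniformity: the constant may
  depend neither on the mesh, nor on p, nor on the distance to the threshold. Hence \<epsilon>, b1,
  b, \<delta> are fixed before p, and every constant is kept in the form c^p until the p-th root is
  taken, which also permits the limit p = \<infinity>. In the majorant, decay along paths pays for
  the volume of the elements reached: a step to a coarser element may double the volume and
  therefore costs a factor 2. Levels are compared through uniform refinements, facet by facet:
  elements are paired across facets, and of three simplices on one facet two overlap.\<close>

abbreviation nn_lborel :: "('a::euclidean_space \<Rightarrow> ennreal) \<Rightarrow> ennreal" (binder "NN " 10) where "nn_lborel f \<equiv> nn_integral lborel f"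

abbreviation int_lborel :: "('a::euclidean_space => real) => real" (binder "IL " 10) where "int_lborel f \<equiv> integral\<^sup>L lborel f"

definition full_simplex :: "'a::euclidean_space set => bool" where "full_simplex V \<longleftrightarrow> card V = DIM('a) + 1 \<and> \<not> affine_dependent V"

text \<open>The gradient of the barycentric coordinate of \<open>v\<close>, pinned down by its
  values on the edges at \<open>v\<close>, so that no matrix has to be inverted.\<close>

definition bary_grad :: "'a::euclidean_space set => 'a => 'a" where "bary_grad V v = (SOME g. \<forall>w\<in>V - {v}. g \<bullet> (v - w) = 1)"

definition bary :: "'a::euclidean_space set => 'a => 'a => real" where "bary V v x = 1 + bary_grad V v \<bullet> (x - v)"

lemma full_simplex_finite: "full_simplex V ==> finite V" by (simp add: full_simplex_def aff_independent_finite)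

text \<open>The differences w - v are linearly independent, so some linear functional equals -1 on
  all of them; the vector representing it is a witness for the choice in
  \<open>bary_grad\<close>.\<close>

lemma bary_grad_diff:
 assumes "full_simplex V" "v \<in> V" "w \<in> V" "w ~= v"
 shows "bary_grad V v \<bullet> (v - w) = 1"
proof -
 let ?S = "(%x. - v + x) ` (V - {v})"
 have ind: "independent ?S" using assms affine_dependent_iff_dependent[of v "V - {v}"] by (simp add: full_simplex_def insert_absorb)
 obtain h :: "'a => real" where h: "linear h" "\<forall>x\<in>?S. h x = -1" using linear_independent_extend[OF ind, of "%_. -1"] by auto
 define g where "g = (\<Sum>b\<in>Basis. h b *\<^sub>R b)"
 have hg: "h x = g \<bullet> x" for x
 proof -
  have "h x = h (\<Sum>b\<in>Basis. (x \<bullet> b) *\<^sub>R b)" by (simp add: euclidean_representation)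
  also have "... = (\<Sum>b\<in>Basis. (x \<bullet> b) * h b)" using h(1) by (simp add: linear_sum linear_cmul)
  finally show ?thesis by (simp add: g_def inner_sum_right inner_commute[of _ x] mult.commute)
 qed
 have "\<forall>w\<in>V - {v}. g \<bullet> (v - w) = 1" using h(2) by (simp add: field_simps hg inner_diff_right)
 then have "\<forall>w\<in>V - {v}. bary_grad V v \<bullet> (v - w) = 1" unfolding bary_grad_def by (rule someI)
 with assms show ?thesis by simp
qed

lemma bary_vertex:
 assumes "full_simplex V" "v \<in> V" "w \<in> V"
 shows "bary V v w = (if v = w then 1 else 0)" using bary_grad_diff[OF assms(1,2,3)] by (auto simp: bary_def inner_diff_right)

lemma bary_affine_comb:
 assumes "finite S" "sum c S = 1"
 shows "bary V v (\<Sum>w\<in>S. c w *\<^sub>R f w) = (\<Sum>w\<in>S. c w * bary V v (f w))"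
proof -
 have "(\<Sum>w\<in>S. c w * bary V v (f w)) = (\<Sum>w\<in>S. c w * (1 - bary_grad V v \<bullet> v) + c w * (bary_grad V v \<bullet> f w))" by (simp add: bary_def algebra_simps)
 also have "... = (1 - bary_grad V v \<bullet> v) + bary_grad V v \<bullet> (\<Sum>w\<in>S. c w *\<^sub>R f w)"
  by (simp add: sum.distrib sum_distrib_right[symmetric] assms inner_sum_right)
 finally show ?thesis by (simp add: bary_def inner_diff_right)
qed

lemma bary_comb:
 assumes "full_simplex V" "v \<in> V" "sum c V = 1"
 shows "bary V v (\<Sum>w\<in>V. c w *\<^sub>R w) = c v"
proof -
 have fin: "finite V" using assms(1) by (rule full_simplex_finite)
 have "bary V v (\<Sum>w\<in>V. c w *\<^sub>R w) = (\<Sum>w\<in>V. c w * bary V v w)" by (rule bary_affine_comb[OF fin assms(3)])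
 also have "... = (\<Sum>w\<in>V. if w = v then c w else 0)" by (intro sum.cong) (auto simp: bary_vertex assms(1,2))
 finally show ?thesis using fin assms(2) by simp
qed

lemma full_simplex_affine_hull: "full_simplex V ==> affine hull V = UNIV" by (simp add: full_simplex_def affine_independent_span_gt)

lemma
 assumes V: "full_simplex V"
 shows bary_sum: "(\<Sum>v\<in>V. bary V v x) = 1" and bary_repr: "(\<Sum>v\<in>V. bary V v x *\<^sub>R v) = x"
proof -
 have fin: "finite V" using V by (rule full_simplex_finite)
 have "x \<in> affine hull V" by (simp add: full_simplex_affine_hull[OF V])
 then obtain c where c: "sum c V = 1" "(\<Sum>v\<in>V. c v *\<^sub>R v) = x" by (auto simp: affine_hull_finite[OF fin])
 have e: "bary V v x = c v" if "v \<in> V" for v using bary_comb[OF V that c(1)] c(2) by simp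
 show "(\<Sum>v\<in>V. bary V v x) = 1" using c(1) e by simp
 show "(\<Sum>v\<in>V. bary V v x *\<^sub>R v) = x" using c(2) e by simp
qed

lemma convex_hull_bary:
 assumes V: "full_simplex V"
 shows "convex hull V = {x. \<forall>v\<in>V. 0 \<le> bary V v x}"
proof (intro set_eqI iffI)
 fix x assume "x \<in> convex hull V"
 then obtain c where c: "\<forall>v\<in>V. 0 \<le> c v" "sum c V = 1" "(\<Sum>v\<in>V. c v *\<^sub>R v) = x" by (auto simp: convex_hull_finite[OF full_simplex_finite[OF V]])
 then show "x \<in> {x. \<forall>v\<in>V. 0 \<le> bary V v x}" using bary_comb[OF V _ c(2)] by auto
next
 fix x assume "x \<in> {x. \<forall>v\<in>V. 0 \<le> bary V v x}"
 then show "x \<in> convex hull V" using bary_sum[OF V, of x] bary_repr[OF V, of x] by (auto simp: convex_hull_finite[OF full_simplex_finite[OF V]])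
qed

lemma interior_bary:
 assumes V: "full_simplex V"
 shows "interior (convex hull V) = {x. \<forall>v\<in>V. 0 < bary V v x}"
proof -
 have "interior (convex hull V) =
   {y. \<exists>u. (\<forall>x \<in> V. 0 < u x) \<and> sum u V = 1 \<and> (\<Sum>x\<in>V. u x *\<^sub>R x) = y}"
  using V interior_convex_hull_explicit_minimal[of V] by (simp add: full_simplex_def)
 also have "... = {x. \<forall>v\<in>V. 0 < bary V v x}"
 proof (intro set_eqI iffI; clarsimp)
  fix u :: "'a => real" and v assume "\<forall>x\<in>V. 0 < u x" "sum u V = 1" "v \<in> V"
  then show "0 < bary V v (\<Sum>x\<in>V. u x *\<^sub>R x)" by (simp add: bary_comb[OF V])
 next
  fix x assume "\<forall>v\<in>V. 0 < bary V v x"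
  then show "\<exists>u. (\<forall>x\<in>V. 0 < u x) \<and> sum u V = 1 \<and> (\<Sum>x\<in>V. u x *\<^sub>R x) = x" using bary_sum[OF V, of x] bary_repr[OF V, of x] by auto
 qed
 finally show ?thesis .
qed

lemma bary_continuous [continuous_intros]: "continuous_on S f ==> continuous_on S (%x. bary V v (f x))" unfolding bary_def by (intro continuous_intros)

lemma bary_line: "bary V v (x + t *\<^sub>R (y - x)) = (1 - t) * bary V v x + t * bary V v y" by (simp add: bary_def algebra_simps)

lemma bary_inj:
 assumes "full_simplex V" "!!v. v \<in> V ==> bary V v x = bary V v y"
 shows "x = y"
proof -
 have "x = (\<Sum>v\<in>V. bary V v x *\<^sub>R v)" by (simp add: bary_repr assms(1))
 also have "... = (\<Sum>v\<in>V. bary V v y *\<^sub>R v)" by (simp add: assms(2))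
 finally show ?thesis by (simp add: bary_repr assms(1))
qed

text \<open>The difference of two candidates is orthogonal to all edges at \<open>v\<close>, and
  these span the space.\<close>

lemma bary_grad_unique:
 assumes V: "full_simplex V" "v \<in> V" and g: "!!w. w \<in> V ==> w ~= v ==> g \<bullet> (v - w) = 1"
 shows "bary_grad V v = g"
proof -
 let ?h = "bary_grad V v - g"
 have "?h \<bullet> (w - v) = 0" if "w \<in> V" for w using g[OF that] bary_grad_diff[OF V that] by (cases "w = v") (auto simp: inner_diff_left inner_diff_right)
 then have "?h \<bullet> (x - v) = 0" for x
 proof -
  have "x - v = (\<Sum>w\<in>V. bary V w x *\<^sub>R (w - v))"
   using bary_sum[OF V(1), of x] bary_repr[OF V(1), of x] by (simp add: scaleR_diff_right sum_subtractf scaleR_left.sum[symmetric])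
  then show ?thesis using \<open>!!w. w \<in> V ==> ?h \<bullet> (w - v) = 0\<close> by (simp add: inner_sum_right)
 qed
 from this[of "v + ?h"] show ?thesis by simp
qed

lemma full_simplex_image:
 assumes V: "full_simplex V" and t: "t ~= 0"
 shows "full_simplex ((%z. a + t *\<^sub>R z) ` V)"
proof -
 have "(%z. a + t *\<^sub>R z) ` V = (%z. a + z) ` (%z. t *\<^sub>R z) ` V" by auto
 moreover have "\<not> affine_dependent ((%z. t *\<^sub>R z) ` V)"
  using V affine_independent_iff_card[of V] affine_independent_iff_card[of "(%z. t *\<^sub>R z) ` V"] t by (simp add: full_simplex_def card_image inj_on_def)
 ultimately show ?thesis using V by (simp add: full_simplex_def card_image inj_on_def affine_dependent_translation_eq[symmetric] t)
qed

text \<open>Gradients scale inversely to lengths. As only finitely many shapes occur up to dilation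
  and translation, this bounds all gradients in \<open>shape_regular\<close>.\<close>

lemma bary_grad_image:
 assumes V: "full_simplex V" "v \<in> V" and t: "t ~= 0"
 shows "bary_grad ((%z. a + t *\<^sub>R z) ` V) (a + t *\<^sub>R v) = bary_grad V v /\<^sub>R t"
proof (intro bary_grad_unique full_simplex_image V t)
 fix w assume w: "w \<in> (%z. a + t *\<^sub>R z) ` V" "w ~= a + t *\<^sub>R v"
 then obtain z where z: "z \<in> V" "w = a + t *\<^sub>R z" "z ~= v" by auto
 then have "a + t *\<^sub>R v - w = t *\<^sub>R (v - z)" by (simp add: scaleR_diff_right)
 then show "(bary_grad V v /\<^sub>R t) \<bullet> (a + t *\<^sub>R v - w) = 1" using bary_grad_diff[OF V z(1,3)] t by simp
qed (use V in auto)

lemma bary_lipschitz: "\<bar>bary V v x - bary V v y\<bar> \<le> norm (bary_grad V v) * norm (x - y)"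
proof -
 have "bary V v x - bary V v y = bary_grad V v \<bullet> (x - y)" by (simp add: bary_def inner_diff_right)
 then show ?thesis by (simp add: Cauchy_Schwarz_ineq2)
qed

section \<open>Affine changes of variables and the mass matrix\<close>

lemma nn_integral_lborel_translate:
 fixes h :: "'a::euclidean_space => ennreal"
 assumes "h \<in> borel_measurable borel"
 shows "(NN x. h (a + x)) = (NN x. h x)"
proof -
 have "(NN x. h x) = (\<integral>\<^sup>+x. h x \<partial>distr lborel borel ((+) a))" by (simp add: lborel_distr_plus)
 also have "... = (NN x. h (a + x))" using assms by (simp add: nn_integral_distr)
 finally show ?thesis ..
qed

lemma nn_integral_lborel_reflect:
 fixes h :: "'a::euclidean_space => ennreal"
 assumes [measurable]: "h \<in> borel_measurable borel"
 shows "(NN x. h (a - x)) = (NN x. h x)"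
proof -
 have "(NN x. h x) = (\<integral>\<^sup>+x. h x \<partial>density (distr lborel borel (%x. a + (-1) *\<^sub>R x)) (%x. ennreal (\<bar>-1\<bar> ^ DIM('a))))"
  by (subst lborel_affine[of "-1" a, symmetric]) auto
 also have "... = (NN x. h (a - x))" by (simp add: density_1 nn_integral_distr)
 finally show ?thesis ..
qed

lemma emeasure_lborel_open_pos:
 fixes S :: "'a::euclidean_space set"
 assumes "open S" "x \<in> S"
 shows "emeasure lborel S ~= 0"
proof
 assume "emeasure lborel S = 0"
 then have "S \<in> null_sets lborel" using assms(1) by auto
 then have "negligible S" by (metis negligible_iff_null_sets null_sets_completionI)
 then show False using open_not_negligible[OF assms(1)] assms(2) by auto
qed

text \<open>The image of Lebesgue measure under a linear bijection is translation invariant.  By Tonelli,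
  $\int h\,d\lambda\int g\,d\nu=\int h\,d\nu\int g\,d\lambda$ for translation invariant \<open>\<lambda>\<close> and
  \<open>\<nu>\<close>, so that no determinant is needed.\<close>

lemma nn_integral_linear_bij:
 fixes f :: "'a::euclidean_space => 'a"
 assumes f: "linear f" "inj f"
 obtains c where "0 < c" "!!h :: 'a => ennreal. h \<in> borel_measurable borel ==> (NN x. h (f x)) = ennreal c * (NN x. h x)"
proof -
 obtain f' where f': "linear f'" "!!x. f' (f x) = x" "!!x. f (f' x) = x" using linear_injective_isomorphism[OF f] by auto
 let ?A = "borel_measurable borel"
 have [measurable]: "f \<in> ?A" "f' \<in> ?A" by (intro borel_measurable_continuous_onI linear_continuous_on linear_conv_bounded_linear[THEN iffD1] f(1) f'(1))+
 have key: "(NN x. h x) * (NN y. g (f y)) = (NN y. h (f y)) * (NN x. g x)"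
  if [measurable]: "h \<in> ?A" "g \<in> ?A"
  for h g :: "'a => ennreal"
 proof -
  have "(NN x. h x) * (NN y. g (f y)) = (NN y. NN x. h x * g (f y))" by (simp add: nn_integral_multc nn_integral_cmult)
  also have "... = (NN y. NN x. h (f y + x) * g (f y))" by (simp add: nn_integral_multc nn_integral_lborel_translate)
  also have "... = (NN x. NN y. h (f y + x) * g (f y))" by (intro lborel_pair.Fubini') simp
  also have "... = (NN x. NN y. h (f y) * g (f y - x))"
  proof (rule nn_integral_cong)
   fix x
   let ?B = "(NN y. h (f y + x) * g (f y))"
   have "?B = (NN y. h (f (- f' x + y) + x) * g (f (- f' x + y)))" by (rule nn_integral_lborel_translate[symmetric]) simp
   then show "?B = (NN y. h (f y) * g (f y - x))" by (simp add: linear_diff[OF f(1)] f'(3))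
  qed
  also have "... = (NN y. NN x. h (f y) * g (f y - x))" by (intro lborel_pair.Fubini'[symmetric]) simp
  finally show ?thesis by (simp add: nn_integral_cmult nn_integral_lborel_reflect nn_integral_multc)
 qed
 let ?Q = "cbox 0 One :: 'a set"
 \<comment> \<open>The unit cube has measure 1, so \<open>key\<close> with this \<open>g\<close>
   identifies the factor as the measure of the preimage of the cube.\<close>
 define g :: "'a => ennreal" where "g = indicator ?Q"
 have im: "f -` ?Q = f' ` ?Q"
 proof
  show "f -` ?Q \<subseteq> f' ` ?Q" by (rule subsetI, rule image_eqI[of _ f' "f _"]) (auto simp: f')
  show "f' ` ?Q \<subseteq> f -` ?Q" by (auto simp: f')
 qed
 let ?C = "(f -` ?Q)"
 have comp: "compact ?C" using f'(1) by (auto simp: linear_continuous_on linear_conv_bounded_linear im intro!: compact_continuous_image)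
 \<comment> \<open>The open cube has a nonempty open preimage, which makes \<open>c\<close>
   positive.\<close>
 let ?D = "f -` box 0 One"
 have "open ?D" using f(1) by (intro open_vimage open_box) (simp_all add: linear_continuous_on linear_conv_bounded_linear)
 moreover have "f' ((1/2) *\<^sub>R One) \<in> ?D" by (simp add: f' mem_box)
 ultimately have pos: "emeasure lborel ?D ~= 0" using emeasure_lborel_open_pos by auto
 have "(NN y. g (f y)) = (NN y. indicator ?C y)" by (simp add: g_def indicator_def)
 also have "... = emeasure lborel ?C" using comp by (simp add: borel_compact)
 finally have gf: "(NN y. g (f y)) = emeasure lborel ?C" .
 define c where "c = measure lborel ?C"
 have c: "emeasure lborel ?C = ennreal c" unfolding c_def using emeasure_compact_finite[OF comp] by (simp add: emeasure_eq_ennreal_measure)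
 have "emeasure lborel ?D \<le> emeasure lborel ?C" using comp box_subset_cbox by (intro emeasure_mono) (auto simp: borel_compact)
 then have "0 < c" using pos c by (metis ennreal_eq_0_iff le_zero_eq not_le)
 moreover have "(NN x. h (f x)) = ennreal c * (NN x. h x)"
  if "h \<in> ?A" for h :: "'a => ennreal" using key[OF that, of g] gf c by (simp add: g_def mult.commute)
 ultimately show thesis by (rule that)
qed

text \<open>Keeping the barycentric coordinates while renaming the vertices by \<pi> defines an
  affine bijection, whose linear part is handled by \<open>nn_integral_linear_bij\<close>. The
  number \<open>c\<close> is the reciprocal of its Jacobian.\<close>

lemma affine_transport:
 fixes V W :: "'a::euclidean_space set"
 assumes V: "full_simplex V" and W: "full_simplex W" and \<pi>: "bij_betw \<pi> V W"
 obtains \<phi> c where "0 < c" "continuous_on UNIV \<phi>" "!!v x. v \<in> V ==> bary W (\<pi> v) (\<phi> x) = bary V v x" "!!h :: 'a => real. h \<in> borel_measurable borel ==>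
    (IL x. h (\<phi> x)) = c * (IL x. h x)"
proof -
 have finV: "finite V" and finW: "finite W" using V W full_simplex_finite by auto
 define \<phi> where "\<phi> x = (\<Sum>v\<in>V. bary V v x *\<^sub>R \<pi> v)" for x
 define L where "L x = \<phi> x - \<phi> 0" for x
 have b: "bary W (\<pi> v) (\<phi> x) = bary V v x" if v: "v \<in> V" for v x
 proof -
  have "bary W (\<pi> v) (\<phi> x) = (\<Sum>w\<in>V. bary V w x * bary W (\<pi> v) (\<pi> w))" unfolding \<phi>_def by (rule bary_affine_comb[OF finV bary_sum[OF V]])
  also have "... = (\<Sum>w\<in>V. if v = w then bary V w x else 0)" using \<pi> v bij_betwE[OF \<pi>]
   by (intro sum.cong refl) (auto simp: bary_vertex[OF W] bij_betw_def inj_on_def)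
  finally show ?thesis using v finV by simp
 qed
 have Leq: "L x = (\<Sum>v\<in>V. (bary_grad V v \<bullet> x) *\<^sub>R \<pi> v)" for x by (simp add: L_def \<phi>_def sum_subtractf[symmetric] bary_def algebra_simps)
 have lin: "linear L" unfolding Leq by (intro linear_compose_sum ballI) (auto simp: linear_iff algebra_simps)
 have inj: "inj L"
 proof (rule injI)
  fix x y assume "L x = L y"
  then have "\<phi> x = \<phi> y" by (simp add: L_def)
  then show "x = y" using b by (intro bary_inj[OF V]) metis
 qed
 let ?B = "borel_measurable borel"
 obtain c where c: "0 < c" "!!h. h \<in> ?B ==> (NN x. h (L x)) = ennreal c * (NN x. h x)" using nn_integral_linear_bij[OF lin inj] by auto
 have cont: "continuous_on UNIV \<phi>" unfolding \<phi>_def by (intro continuous_intros)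
 then have [measurable]: "\<phi> \<in> ?B" by (rule borel_measurable_continuous_onI)
 let ?A = "distr lborel borel \<phi>"
 let ?C = "density lborel (%_. ennreal c)"
 \<comment> \<open>An identity of measures transfers to signed integrands without any integrability
   assumption.\<close>
 have eq: "?A = ?C"
 proof (rule measure_eqI)
  fix A :: "'a set" assume "A \<in> sets ?A"
  then have [measurable]: "A \<in> sets borel" by simp
  have "emeasure ?A A = (\<integral>\<^sup>+x. indicator A x \<partial>?A)" by simp
  also have "... = (NN x. indicator A (\<phi> 0 + L x))" by (subst nn_integral_distr) (auto simp: L_def)
  also have "... = ennreal c * (NN x. indicator A (\<phi> 0 + x))" by (rule c(2)) simp
  finally show "emeasure ?A A = emeasure ?C A" by (simp add: nn_integral_lborel_translate nn_integral_cmult emeasure_density)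
 qed simp
 show thesis
 proof (rule that[OF c(1) cont b])
  fix h :: "'a => real" assume [measurable]: "h \<in> ?B"
  have "(IL x. h (\<phi> x)) = (LINT x|?A. h x)" by (simp add: integral_distr)
  also have "... = c * (IL x. h x)" unfolding eq using c(1) by (subst integral_density) auto
  finally show "(IL x. h (\<phi> x)) = c * (IL x. h x)" .
 qed
qed

section \<open>Moments of barycentric coordinates over a simplex\<close>

definition simplex_integral :: "'a::euclidean_space set => ('a => real) => real" where "simplex_integral V F = (IL x. indicator (convex hull V) x * F x)"

definition simplex_volume :: "'a::euclidean_space set => real" where "simplex_volume V = measure lborel (convex hull V)"

lemma compact_hull: "full_simplex V ==> compact (convex hull V)" by (simp add: full_simplex_finite finite_imp_compact_convex_hull)

lemma borel_hull [measurable]: "full_simplex V ==> convex hull V \<in> sets borel" by (intro borel_compact compact_hull)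

lemma borel_bary [measurable]: "bary V v \<in> borel_measurable borel" by (intro borel_measurable_continuous_onI bary_continuous) simp

lemma simplex_integral_const: "full_simplex V ==> simplex_integral V (%_. a) = a * simplex_volume V" by (simp add: simplex_integral_def simplex_volume_def)

lemma simplex_integrable:
 fixes F :: "'a::euclidean_space => real"
 assumes V: "full_simplex V" and F: "F \<in> borel_measurable borel" and bd: "!!x. x \<in> convex hull V ==> \<bar>F x\<bar> \<le> M"
 shows "integrable lborel (%x. indicator (convex hull V) x * F x)"
proof (rule Bochner_Integration.integrable_bound)
 let ?A = "indicator (convex hull V)"
 show "integrable lborel (%x. ?A x * M)" using emeasure_compact_finite[OF compact_hull[OF V]] V by simp
 show "AE x in lborel. norm (?A x * F x) \<le> norm (?A x * M)" using order_trans[OF bd abs_ge_self] by (simp add: indicator_def)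
qed (use V F in measurable)

lemma bary_bounds:
 assumes V: "full_simplex V" "v \<in> V" "x \<in> convex hull V"
 shows "0 \<le> bary V v x" "bary V v x \<le> 1"
proof -
 have nn: "\<forall>w\<in>V. 0 \<le> bary V w x" using V by (simp add: convex_hull_bary)
 then show "0 \<le> bary V v x" using V by simp
 have "bary V v x \<le> (\<Sum>w\<in>V. bary V w x)" using nn V(2) full_simplex_finite[OF V(1)] by (intro member_le_sum) auto
 then show "bary V v x \<le> 1" by (simp add: bary_sum[OF V(1)])
qed

lemma simplex_volume_pos:
 assumes V: "full_simplex V"
 shows "0 < simplex_volume V"
proof -
 have card: "card V = DIM('a) + 1" using V by (simp add: full_simplex_def)
 let ?z = "\<Sum>v\<in>V. (1 / real (card V)) *\<^sub>R v"
 have "sum (%_. 1 / real (card V)) V = 1" using card by simp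
 from bary_comb[OF V _ this] have "?z \<in> interior (convex hull V)" by (simp add: interior_bary[OF V] card)
 then have "emeasure lborel (interior (convex hull V)) ~= 0" using emeasure_lborel_open_pos by auto
 moreover have "emeasure lborel (interior (convex hull V)) \<le> emeasure lborel (convex hull V)" using V by (intro emeasure_mono interior_subset) auto
 ultimately have "emeasure lborel (convex hull V) ~= 0" by auto
 then show ?thesis using emeasure_compact_finite[OF compact_hull[OF V]] by (simp add: simplex_volume_def measure_def enn2real_positive_iff zero_less_iff_neq_zero)
qed

text \<open>An affine bijection that matches the two chosen vertices carries one integral into the
  other. The case W = V contains the symmetry of a simplex under permutations of its
  vertices.\<close>

lemma simplex_integral_transport:
 fixes P :: "real => real => real"
 assumes V: "full_simplex (V :: 'a::euclidean_space set)" "v \<in> V" "w \<in> V" "v ~= w" and W: "full_simplex (W :: 'a set)" "v' \<in> W" "w' \<in> W" "v' ~= w'"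
  and P: "(%p. P (fst p) (snd p)) \<in> borel_measurable (borel \<Otimes>\<^sub>M borel)"
 shows "simplex_integral V (%x. P (bary V v x) (bary V w x)) * simplex_volume W =
  simplex_integral W (%x. P (bary W v' x) (bary W w' x)) * simplex_volume V"
proof -
 let ?A = "W - {v', w'}"
 let ?C = "V - {v, w}"
 obtain \<pi>0 where \<pi>0: "bij_betw \<pi>0 ?C ?A" using finite_same_card_bij[of "?C" "?A"] V W full_simplex_finite by (auto simp: full_simplex_def)
 define \<pi> where "\<pi> = \<pi>0(v := v', w := w')"
 have "bij_betw \<pi> ?C ?A" using \<pi>0 by (rule bij_betw_cong[THEN iffD1, rotated]) (auto simp: \<pi>_def)
 moreover have "bij_betw \<pi> {v, w} {v', w'}" using V(4) W(4) by (intro bij_betw_imageI) (auto simp: \<pi>_def)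
 ultimately have "bij_betw \<pi> (?C \<union> {v, w}) (?A \<union> {v', w'})" by (rule bij_betw_combine) auto
 moreover have "?C \<union> {v, w} = V" "?A \<union> {v', w'} = W" using V W by auto
 ultimately have \<pi>: "bij_betw \<pi> V W" by simp
 obtain \<phi> c where c: "0 < c" and cont: "continuous_on UNIV \<phi>" and b: "!!v x. v \<in> V ==> bary W (\<pi> v) (\<phi> x) = bary V v x"
  and int: "!!h :: 'a => real. h \<in> borel_measurable borel ==> (IL x. h (\<phi> x)) = c * (IL x. h x)" by (rule affine_transport[OF V(1) W(1) \<pi>]) (rule that)
 let ?B = "convex hull W"
 have ind: "indicator ?B (\<phi> x) = (indicator (convex hull V) x :: real)" for x
 proof -
  have "\<phi> x \<in> ?B \<longleftrightarrow> (\<forall>v\<in>V. 0 \<le> bary W (\<pi> v) (\<phi> x))" using \<pi> by (auto simp: convex_hull_bary[OF W(1)] bij_betw_def)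
  then show ?thesis by (simp add: b convex_hull_bary[OF V(1)] indicator_def)
 qed
 have [measurable]: "?B \<in> sets borel" by (rule borel_hull[OF W(1)])
 have key: "simplex_integral V (%x. Q (bary V v x) (bary V w x)) =
   c * simplex_integral W (%x. Q (bary W v' x) (bary W w' x))"
  if [measurable]: "(%p. Q (fst p) (snd p)) \<in> borel_measurable (borel \<Otimes>\<^sub>M borel)"
  for Q :: "real => real => real"
 proof -
  have "(%x. indicator ?B x * Q (bary W v' x) (bary W w' x)) \<in> borel_measurable borel" using measurable_compose[OF measurable_Pair[OF borel_bary[of W v'] borel_bary[of W w']] that] by simp
  from int[OF this] show ?thesis using b[OF V(2)] b[OF V(3)] V(4) by (simp add: simplex_integral_def ind \<pi>_def)
 qed
 \<comment> \<open>The constant function identifies the factor \<open>c\<close> as a ratio of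
   volumes.\<close>
 show ?thesis using key[OF P] key[of "%_ _. 1"] by (simp add: simplex_integral_const V W)
qed

lemma bary_level_null:
 assumes V: "full_simplex V" "a \<in> V" "b \<in> V" "a ~= b"
 shows "AE x in lborel. bary V a x ~= bary V b x"
proof -
 let ?A = "bary_grad V"
 let ?g = "?A a - ?A b"
 have "negligible {x. ?g \<bullet> x = ?A a \<bullet> a - ?A b \<bullet> b}" using bary_grad_diff[OF V(1,3,2)] V(4) by (auto simp: inner_diff_right intro!: negligible_hyperplane)
 moreover have "{x. ?g \<bullet> x = ?A a \<bullet> a - ?A b \<bullet> b} = {x. bary V a x = bary V b x}" by (auto simp: bary_def inner_diff_left inner_diff_right)
 ultimately have "{x. bary V a x = bary V b x} \<in> null_sets lebesgue" by (simp add: negligible_iff_null_sets)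
 then have "AE x in lebesgue. bary V a x ~= bary V b x" by (intro AE_I'[of "{x. bary V a x = bary V b x}"]) auto
 then show ?thesis by (simp add: AE_completion_iff)
qed

context
 fixes V :: "'a::euclidean_space set" and a b :: 'a
 assumes V: "full_simplex V" "a \<in> V" "b \<in> V" "a ~= b"
begin

lemma bisected_full_simplex: "full_simplex (insert (midpoint a b) (V - {b}))" "midpoint a b \<notin> V" and bary_bisected:
  "x \<in> V ==> bary V x y = (if x = b then 0 else bary (insert (midpoint a b) (V - {b})) x y) +
    (if x = a \<or> x = b then bary (insert (midpoint a b) (V - {b})) (midpoint a b) y / 2 else 0)"
proof -
 let ?m = "midpoint a b" and ?W = "insert (midpoint a b) (V - {b})"
 have fin: "finite V" using V full_simplex_finite by auto
 have bm: "bary V x ?m = (if x = a \<or> x = b then 1/2 else 0)" if "x \<in> V" for x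
 proof -
  have "?m = a + (1/2) *\<^sub>R (b - a)" by (simp add: scaleR_left_distrib[symmetric] midpoint_def algebra_simps)
  then show ?thesis using that V by (simp add: bary_line bary_vertex)
 qed
 show m: "?m \<notin> V"
 proof
  assume "?m \<in> V"
  with bm[OF \<open>?m \<in> V\<close>] show False by (simp add: bary_vertex V)
 qed
 have card: "card ?W = DIM('a) + 1" using V m fin by (simp add: full_simplex_def)
 \<comment> \<open>The removed vertex is an affine combination of \<open>a\<close> and the midpoint,
   so the new vertices still span everything.\<close>
 have "b = 2 *\<^sub>R ?m - a" by (simp add: midpoint_def)
 also have "... = 2 *\<^sub>R ?m + (-1) *\<^sub>R a" by simp
 also have "... \<in> affine hull ?W" using V by (intro mem_affine[OF affine_affine_hull] hull_inc) auto
 finally have "V \<subseteq> affine hull ?W" by (auto intro: hull_inc)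
 then have "affine hull V \<subseteq> affine hull ?W" by (metis hull_minimal affine_affine_hull)
 then have "affine hull ?W = UNIV" using full_simplex_affine_hull[OF V(1)] by auto
 then have "aff_dim ?W = DIM('a)" by (metis aff_dim_UNIV aff_dim_affine_hull)
 then show W: "full_simplex ?W" using card fin by (simp add: full_simplex_def affine_independent_iff_card)
 assume x: "x \<in> V"
 have finW: "finite ?W" using fin by simp
 have "bary V x y = bary V x (\<Sum>w\<in>?W. bary ?W w y *\<^sub>R w)" by (simp add: bary_repr[OF W])
 also have "... = (\<Sum>w\<in>?W. bary ?W w y * bary V x w)" by (rule bary_affine_comb[OF finW bary_sum[OF W]])
 also have "... = bary ?W ?m y * bary V x ?m + (\<Sum>w\<in>V - {b}. bary ?W w y * bary V x w)" using fin m by simp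
 also have "(\<Sum>w\<in>V - {b}. bary ?W w y * bary V x w) = (\<Sum>w\<in>V - {b}. if x = w then bary ?W w y else 0)" by (intro sum.cong refl) (auto simp: bary_vertex V x)
 finally show "bary V x y = (if x = b then 0 else bary ?W x y) + (if x = a \<or> x = b then bary ?W ?m y / 2 else 0)" using x fin by (simp add: bm)
qed

text \<open>On the bisecting hyperplane the coordinates of \<open>a\<close> and \<open>b\<close>
  agree. In the new coordinates \<open>a\<close> gets their difference and the midpoint twice the
  coordinate of \<open>b\<close>.\<close>

lemma hull_bisected: "convex hull (insert (midpoint a b) (V - {b})) = {x \<in> convex hull V. bary V b x \<le> bary V a x}"
proof -
 let ?m = "midpoint a b" and ?W = "insert (midpoint a b) (V - {b})"
 note W = bisected_full_simplex
 let ?A = "bary V b"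
 have a: "bary ?W a y = bary V a y - ?A y" "bary ?W ?m y = 2 * ?A y" for y using bary_bisected[OF V(2), of y] bary_bisected[OF V(3), of y] V(4) by auto
 have o: "bary ?W x y = bary V x y" if "x \<in> V" "x ~= a" "x ~= b" for x y using bary_bisected[OF that(1), of y] that by auto
 have "(\<forall>v\<in>?W. 0 \<le> bary ?W v y) \<longleftrightarrow> (\<forall>v\<in>V. 0 \<le> bary V v y) \<and> ?A y \<le> bary V a y" for y
 proof
  assume *: "\<forall>v\<in>?W. 0 \<le> bary ?W v y"
  then have "0 \<le> bary ?W a y" "0 \<le> bary ?W ?m y" using V by auto
  then have "?A y \<le> bary V a y" "0 \<le> ?A y" by (auto simp: a)
  moreover have "0 \<le> bary V v y" if "v \<in> V" "v ~= a" "v ~= b" for v using bspec[OF *, of v] o[OF that, of y] that by simp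
  ultimately show "(\<forall>v\<in>V. 0 \<le> bary V v y) \<and> ?A y \<le> bary V a y" by force
 next
  assume *: "(\<forall>v\<in>V. 0 \<le> bary V v y) \<and> ?A y \<le> bary V a y"
  show "\<forall>v\<in>?W. 0 \<le> bary ?W v y"
  proof
   fix v assume "v \<in> ?W"
   then consider "v = ?m" | "v = a" | "v \<in> V" "v ~= a" "v ~= b" by auto
   then show "0 \<le> bary ?W v y" using * a[of y] o[of v y] V by cases auto
  qed
 qed
 then show ?thesis by (simp add: convex_hull_bary[OF W(1)] convex_hull_bary[OF V(1)])
qed

end

lemma continuous_bary [continuous_intros]: "continuous_on S (bary V v)" using bary_continuous[of S "%x. x"] by simp

lemma simplex_integrable_cont:
 fixes F :: "'a::euclidean_space => real"
 assumes V: "full_simplex V" and F: "continuous_on UNIV F"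
 shows "integrable lborel (%x. indicator (convex hull V) x * F x)"
proof -
 obtain M where "!!x. x \<in> convex hull V ==> \<bar>F x\<bar> \<le> M" using compact_imp_bounded[of "F ` (convex hull V)"] F by (auto simp: bounded_iff intro!: continuous_on_subset compact_continuous_image compact_hull V)
 then show ?thesis by (intro simplex_integrable[OF V]) (auto intro: borel_measurable_continuous_onI F)
qed

lemma simplex_integral_add:
 assumes "full_simplex V" "continuous_on UNIV F" "continuous_on UNIV G"
 shows "simplex_integral V (%x. F x + G x) = simplex_integral V F + simplex_integral V G"
 using simplex_integrable_cont[OF assms(1,2)] simplex_integrable_cont[OF assms(1,3)] by (simp add: simplex_integral_def distrib_left)

lemma simplex_integral_cmult: "simplex_integral V (%x. k * F x) = k * simplex_integral V F"
by (simp add: field_simps simplex_integral_def)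

lemma simplex_integral_sum:
 assumes "full_simplex V" "finite S" "!!s. s \<in> S ==> continuous_on UNIV (F s)"
 shows "simplex_integral V (%x. \<Sum>s\<in>S. F s x) = (\<Sum>s\<in>S. simplex_integral V (F s))" using assms(2,3)
proof (induction S rule: finite_induct)
 case empty
 show ?case by (simp add: simplex_integral_def)
next
 case (insert s S)
 then show ?case by (simp add: simplex_integral_add[OF assms(1)] continuous_on_sum)
qed

text \<open>Exchanging \<open>a\<close> and \<open>b\<close> maps one half of the simplex onto the
  other and preserves a symmetric integrand; the common boundary of the halves is null.\<close>

lemma simplex_integral_half:
 fixes V :: "'a::euclidean_space set"
 assumes V: "full_simplex V" "a \<in> V" "b \<in> V" "a ~= b" and g: "continuous_on UNIV (%p. g (fst p) (snd p))" "!!s t. g s t = g t s"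
 defines "W \<equiv> insert (midpoint a b) (V - {b})"
 shows "simplex_integral V (%x. g (bary V a x) (bary V b x)) =
  2 * simplex_integral W (%x. g (bary V a x) (bary V b x))"
proof -
 let ?C = "bary V b"
 let ?D = "bary V a"
 let ?h = "%x. g (?D x) (?C x)"
 \<comment> \<open>\<open>P\<close> and \<open>P'\<close> restrict \<open>g\<close> to the two
   halves; the strict inequality assigns the bisecting hyperplane to one of them only.\<close>
 define P where "P s t = (if t \<le> s then g s t else (0::real))" for s t :: real
 define P' where "P' s t = (if s < t then g s t else (0::real))" for s t :: real
 let ?A = "borel_measurable (borel \<Otimes>\<^sub>M borel)"
 have [measurable]: "(%p. g (fst p) (snd p)) \<in> ?A" using g(1) by (simp add: borel_prod borel_measurable_continuous_onI)
 have Pm[measurable]: "(%p. P (fst p) (snd p)) \<in> ?A" "(%p. P' (fst p) (snd p)) \<in> ?A" by (auto simp: P_def P'_def)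
 have bp: "(%x. (bary V v x, bary V w x)) \<in> borel \<rightarrow>\<^sub>M borel \<Otimes>\<^sub>M borel" for v w by simp
 have m: "(%x. Q (bary V v x) (bary V w x)) \<in> borel_measurable borel"
  if "(%p. Q (fst p) (snd p)) \<in> ?A" for Q :: "real => real => real" and v w using measurable_compose[OF bp that, of v w] by simp
 note mP = m[OF Pm(1), of a b] and mP' = m[OF Pm(2), of b a] m[OF Pm(2), of a b]
 let ?E = "convex hull V"
 obtain M where M: "!!x. x \<in> ?E ==> \<bar>?h x\<bar> \<le> M" using compact_imp_bounded[of "?h ` ?E"] continuous_on_compose2[OF g(1) continuous_on_Pair[OF continuous_bary[of UNIV V a] continuous_bary[of UNIV V b]]] by (auto simp: bounded_iff intro!: continuous_on_subset compact_continuous_image compact_hull V)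
 have [measurable]: "?E \<in> sets borel" by (rule borel_hull[OF V(1)])
 have iP: "integrable lborel (%x. indicator ?E x * P (?D x) (?C x))" using M order_trans[OF abs_ge_zero M] by (intro simplex_integrable[OF V(1) mP, of M]) (auto simp: P_def)
 have iP': "integrable lborel (%x. indicator ?E x * P' (?D x) (?C x))" using M order_trans[OF abs_ge_zero M] by (intro simplex_integrable[OF V(1) mP'(2), of M]) (auto simp: P'_def)
 let ?B = "simplex_integral V"
 have "?B ?h = ?B (%x. P (?D x) (?C x) + P' (?D x) (?C x))" unfolding simplex_integral_def by (intro Bochner_Integration.integral_cong refl) (auto simp: P_def P'_def)
 also have "... = ?B (%x. P (?D x) (?C x)) + ?B (%x. P' (?D x) (?C x))" using iP iP' by (simp add: simplex_integral_def distrib_left)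
 also have "?B (%x. P' (?D x) (?C x)) = ?B (%x. P' (?C x) (?D x))" using simplex_integral_transport[OF V V(1,3,2) V(4)[symmetric] Pm(2)] simplex_volume_pos[OF V(1)] by simp
 also have "... = ?B (%x. P (?D x) (?C x))" unfolding simplex_integral_def
  by (intro integral_cong_AE) (use bary_level_null[OF V] g(2) mP mP' in \<open>auto simp: P_def P'_def\<close>)
 finally show ?thesis by (auto simp: simplex_integral_def P_def W_def hull_bisected[OF V] indicator_def intro!: Bochner_Integration.integral_cong)
qed

lemma simplex_volume_bisected:
 assumes "full_simplex V" "a \<in> V" "b \<in> V" "a ~= b"
 shows "simplex_volume V = 2 * simplex_volume (insert (midpoint a b) (V - {b}))"
 using simplex_integral_half[OF assms, of "%_ _. 1"] bisected_full_simplex(1)[OF assms] assms(1) by (simp add: simplex_integral_const)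

context
 fixes V :: "'a::euclidean_space set"
 assumes V: "full_simplex V"
begin

lemma full_simplex_two:
 assumes "v \<in> V"
 obtains w where "w \<in> V" "w ~= v"
proof -
 have "V ~= {v}" using V by (auto simp: full_simplex_def)
 then show thesis using assms that by auto
qed

lemma simplex_integral_bary:
 assumes v: "v \<in> V"
 shows "(real DIM('a) + 1) * simplex_integral V (bary V v) = simplex_volume V"
proof -
 let ?A = "simplex_integral V"
 have eq: "?A (bary V w) = ?A (bary V v)" if w: "w \<in> V" for w
 proof (cases "w = v")
  case False
  then show ?thesis using simplex_integral_transport[OF V w v False V v w False[symmetric], of "%s t. s"] simplex_volume_pos[OF V] by simp
 qed simp
 have "simplex_volume V = ?A (%x. \<Sum>w\<in>V. bary V w x)" using simplex_integral_const[OF V, of 1] by (simp add: bary_sum[OF V])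
 also have "... = (\<Sum>w\<in>V. ?A (bary V w))" by (intro simplex_integral_sum V full_simplex_finite continuous_intros)
 finally show ?thesis using eq V by (simp add: full_simplex_def)
qed

text \<open>Two equations determine the moments: the coordinates sum to one, and bisecting an edge
  relates the mixed moment on the simplex to both moments on its half. This replaces iterated
  integration.\<close>

lemma simplex_integral_bary_product:
 assumes vw: "v \<in> V" "w \<in> V"
 shows "(real DIM('a) + 1) * (real DIM('a) + 2) * simplex_integral V (%x. bary V v x * bary V w x) = (if v = w then 2 else 1) * simplex_volume V"
proof -
 obtain b where b: "b \<in> V" "v ~= b" using full_simplex_two[OF vw(1)] by auto
 define W where "W = insert (midpoint v b) (V - {b})"
 let ?m = "midpoint v b"
 note W = bisected_full_simplex[OF V vw(1) b, folded W_def]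
 have finV: "finite V" using V by (rule full_simplex_finite)
 let ?A = "simplex_integral V"
 let ?D = "bary V v"
 define A where "A = ?A (%x. ?D x * ?D x)"
 let ?E = "(%x. ?D x * bary V b x)"
 define B where "B = ?A ?E"
 have off: "?A (%x. ?D x * bary V u x) = B" if u: "u \<in> V" "v ~= u" for u
  using simplex_integral_transport[OF V vw(1) u V vw(1) b, of "%s t. s * t"] simplex_volume_pos[OF V] by (simp add: B_def)
 have "?A ?D = ?A (%x. \<Sum>u\<in>V. ?D x * bary V u x)" by (simp add: sum_distrib_left[symmetric] bary_sum[OF V])
 also have "... = (\<Sum>u\<in>V. ?A (%x. ?D x * bary V u x))" by (intro simplex_integral_sum V finV continuous_intros)
 also have "... = A + (\<Sum>u\<in>V - {v}. ?A (%x. ?D x * bary V u x))" using vw(1) finV by (simp add: sum.remove A_def)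
 also have "(\<Sum>u\<in>V - {v}. ?A (%x. ?D x * bary V u x)) = (\<Sum>u\<in>V - {v}. B)" by (intro sum.cong refl off) auto
 finally have 1: "A + real DIM('a) * B = ?A ?D" using V vw(1) by (simp add: full_simplex_def)
 have mW: "?m \<in> W" "v \<in> W" "v ~= ?m" using vw W by (auto simp: W_def)
 let ?C = "bary W ?m"
 have bb: "?D x = bary W v x + ?C x / 2" "bary V b x = ?C x / 2" for x
  using bary_bisected[OF V vw(1) b vw(1), of x] bary_bisected[OF V vw(1) b b(1), of x] b(2) by (auto simp: W_def)
 let ?B = "simplex_integral W"
 have "B = 2 * ?B ?E" unfolding B_def W_def by (rule simplex_integral_half[OF V vw(1) b]) (simp_all add: mult.commute continuous_on_mult continuous_on_fst continuous_on_snd)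
 also have "?E = (%x. (1/2) * (bary W v x * ?C x) + (1/4) * (?C x * ?C x))" by (simp add: bb algebra_simps)
 also have "?B ... = (1/2) * ?B (%x. bary W v x * ?C x) + (1/4) * ?B (%x. ?C x * ?C x)"
  by (simp only: simplex_integral_add[OF W(1)] simplex_integral_cmult continuous_on_add continuous_on_mult
    continuous_on_const continuous_bary)
 finally have 2: "B = ?B (%x. bary W v x * ?C x) + ?B (%x. ?C x * ?C x) / 2" by simp
 have vol: "simplex_volume V = 2 * simplex_volume W" "0 < simplex_volume W" using simplex_volume_bisected[OF V vw(1) b] simplex_volume_pos[OF W(1)] by (auto simp: W_def)
 have "?B (%x. bary W v x * ?C x) = B / 2" using simplex_integral_transport[OF V vw(1) b W(1) mW(2,1,3), of "%s t. s * t"] vol by (simp add: B_def)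
 moreover have "?B (%x. ?C x * ?C x) = A / 2" using simplex_integral_transport[OF V vw(1) b W(1) mW(1,2) mW(3)[symmetric], of "%s t. s * s"] vol by (simp add: A_def)
 \<comment> \<open>The bisection identity now reads B = B/2 + A/4.\<close>
 ultimately have "A = 2 * B" using 2 by simp
 moreover have "(real DIM('a) + 1) * (A + real DIM('a) * B) = simplex_volume V" using simplex_integral_bary[OF vw(1)] 1 by simp
 ultimately have "(real DIM('a) + 1) * (real DIM('a) + 2) * B = simplex_volume V" "A = 2 * B" by (auto simp: algebra_simps)
 then show ?thesis using off[OF vw(2)] by (auto simp: A_def)
qed

text \<open>The Crouzeix--Raviart basis function of the face opposite \<open>v\<close> is \<open>1 - d * bary V v\<close>.\<close>

lemma mass_matrix:
 assumes vw: "v \<in> V" "w \<in> V"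
 shows "(real DIM('a) + 1) * (real DIM('a) + 2) *
   simplex_integral V (%x. (1 - DIM('a) * bary V v x) * (1 - DIM('a) * bary V w x)) = ((if v = w then (real DIM('a))^2 else 0) - (real DIM('a) - 2)) * simplex_volume V"
proof -
 let ?d = "real DIM('a)" and ?I = "simplex_integral V"
 let ?B = "bary V w"
 let ?C = "bary V v"
 let ?A = "?I (%x. (1 - ?d * ?C x) * (1 - ?d * ?B x))"
 have "?A =
   ?I (%x. 1 + ((- ?d) * ?C x + ((- ?d) * ?B x + ?d^2 * (?C x * ?B x))))" by (simp add: algebra_simps power2_eq_square)
 also have "... = ?I (%x. 1) + ((- ?d) * ?I ?C + ((- ?d) * ?I ?B + ?d^2 * ?I (%x. ?C x * ?B x)))"
  by (simp only: simplex_integral_add[OF V] simplex_integral_cmult continuous_on_add continuous_on_mult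
    continuous_on_const continuous_bary)
 finally have e: "?A =
   simplex_volume V - ?d * ?I ?C - ?d * ?I ?B + ?d^2 * ?I (%x. ?C x * ?B x)" by (simp add: simplex_integral_const[OF V])
 have "(?d + 1) * (?d + 2) * ?A = (?d + 1) * (?d + 2) * simplex_volume V - ?d * (?d + 2) * ((?d + 1) * ?I ?C)
   - ?d * (?d + 2) * ((?d + 1) * ?I ?B)
   + ?d^2 * ((?d + 1) * (?d + 2) * ?I (%x. ?C x * ?B x))" unfolding e by argo
 also have "... = ((if v = w then ?d^2 else 0) - (?d - 2)) * simplex_volume V"
  unfolding simplex_integral_bary[OF vw(1)] simplex_integral_bary[OF vw(2)] simplex_integral_bary_product[OF vw] by (simp add: algebra_simps power2_eq_square)
 finally show ?thesis .
qed

end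

section \<open>Neighbouring simplices\<close>

lemma bary_on_facet:
 assumes "full_simplex V" "F \<subseteq> V" "sum c F = 1" "v \<in> V"
 shows "bary V v (\<Sum>w\<in>F. c w *\<^sub>R w) = (if v \<in> F then c v else 0)"
proof -
 have fin: "finite F" using assms(1,2) full_simplex_finite finite_subset by auto
 have "bary V v (\<Sum>w\<in>F. c w *\<^sub>R w) = (\<Sum>w\<in>F. c w * bary V v w)" by (rule bary_affine_comb[OF fin assms(3)])
 also have "... = (\<Sum>w\<in>F. if v = w then c w else 0)" using assms by (intro sum.cong refl) (auto simp: bary_vertex)
 finally show ?thesis using fin by simp
qed

lemma hull_subset_bary_zero:
 assumes "full_simplex V" "S \<subseteq> V" "x \<in> convex hull S" "v \<in> V" "v \<notin> S"
 shows "bary V v x = 0"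
proof -
 have "finite S" using assms(1,2) full_simplex_finite finite_subset by auto
 then obtain c where "sum c S = 1" "x = (\<Sum>w\<in>S. c w *\<^sub>R w)" using assms(3) by (auto simp: convex_hull_finite)
 then show ?thesis using bary_on_facet[OF assms(1,2) _ assms(4)] assms(5) by simp
qed

lemma hull_subset_iff:
 assumes "full_simplex V" "S \<subseteq> V" "v \<in> V"
 shows "v \<in> convex hull S \<longleftrightarrow> v \<in> S" using hull_subset_bary_zero[OF assms(1,2) _ assms(3), of v] bary_vertex[OF assms(1,3,3)] by (auto intro: hull_inc)

text \<open>A face of a simplex is spanned by some of its vertices, which are the extreme points of
  that face. The intersection is a face of both simplices, so both descriptions use the same
  vertices.\<close>

lemma simplex_Int_face:
 assumes V: "full_simplex V" and W: "full_simplex W" and f: "(convex hull V \<inter> convex hull W) face_of (convex hull V)"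
   "(convex hull V \<inter> convex hull W) face_of (convex hull W)"
 shows "convex hull V \<inter> convex hull W = convex hull (V \<inter> W)"
proof -
 obtain S where S: "S \<subseteq> V" "convex hull V \<inter> convex hull W = convex hull S" using f(1) V by (auto simp: face_of_convex_hull_affine_independent full_simplex_def)
 obtain S' where S': "S' \<subseteq> W" "convex hull V \<inter> convex hull W = convex hull S'" using f(2) W by (auto simp: face_of_convex_hull_affine_independent full_simplex_def)
 have ind: "\<not> affine_dependent S" "\<not> affine_dependent S'" using V W S(1) S'(1) affine_independent_subset by (auto simp: full_simplex_def)
 have "S = S'" using extreme_point_of_convex_hull_affine_independent[OF ind(1)] extreme_point_of_convex_hull_affine_independent[OF ind(2)] S(2) S'(2) by auto
 have "v \<in> S" if "v \<in> V \<inter> W" for v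
 proof -
  have "v \<in> convex hull S" using that S(2) by (metis Int_iff hull_inc)
  then show ?thesis using hull_subset_iff[OF V S(1)] that by auto
 qed
 then have "S = V \<inter> W" using S(1) S'(1) \<open>S = S'\<close> by auto
 then show ?thesis using S(2) by simp
qed

text \<open>Some vertex of \<open>V\<close> is missing from \<open>W\<close>; its coordinate
  vanishes on the common face but is positive inside \<open>V\<close>.\<close>

lemma simplex_interiors_disjoint:
 assumes V: "full_simplex V" and W: "full_simplex W" and I: "convex hull V \<inter> convex hull W = convex hull (V \<inter> W)" and ne: "V ~= W"
 shows "interior (convex hull V) \<inter> interior (convex hull W) = {}"
proof (rule ccontr)
 assume "interior (convex hull V) \<inter> interior (convex hull W) ~= {}"
 then obtain x where x: "x \<in> interior (convex hull V)" "x \<in> interior (convex hull W)" by auto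
 then have xI: "x \<in> convex hull (V \<inter> W)" using I interior_subset by auto
 have "card V = card W" "finite V" "finite W" using V W full_simplex_finite by (auto simp: full_simplex_def)
 then obtain v where v: "v \<in> V" "v \<notin> W" using ne card_subset_eq by auto
 with x(1) v(1) show False using hull_subset_bary_zero[OF V _ xI v(1)] by (auto simp: interior_bary[OF V])
qed

text \<open>Two simplices on a common facet \<open>F\<close> with apexes \<open>p\<close> and
  \<open>q\<close>; the sign of \<open>bary V p q\<close> tells whether they lie on the same side of
  it.\<close>

locale facet_pair =
 fixes F :: "'a::euclidean_space set" and p q :: 'a
 assumes P: "full_simplex (insert p F)" "p \<notin> F" and Q: "full_simplex (insert q F)" "q \<notin> F"
begin

abbreviation "V \<equiv> insert p F"
abbreviation "W \<equiv> insert q F"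

text \<open>Both sides are affine in \<open>x\<close>, vanish on \<open>F\<close> and agree at
  \<open>q\<close>.\<close>

lemma bary_apex: "bary V p x = bary V p q * bary W q x"
proof -
 have fin: "finite W" using full_simplex_finite[OF Q(1)] .
 have "bary V p x = bary V p (\<Sum>w\<in>W. bary W w x *\<^sub>R w)" by (simp only: bary_repr[OF Q(1)])
 also have "... = (\<Sum>w\<in>W. bary W w x * bary V p w)" by (rule bary_affine_comb[OF fin bary_sum[OF Q(1)]])
 finally show ?thesis using P fin Q(2) by (auto simp: bary_vertex intro!: sum.neutral)
qed

lemma bary_apex_nonzero: "bary V p q ~= 0" using bary_apex[of p] bary_vertex[OF P(1), of p p] by auto

text \<open>Moving from the barycenter of \<open>F\<close> slightly towards \<open>q\<close> makes
  every coordinate positive in both simplices.\<close>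

lemma same_side_overlap:
 assumes "0 < bary V p q"
 shows "interior (convex hull V) \<inter> interior (convex hull W) ~= {}"
proof -
 have fin: "finite F" and card: "card F = DIM('a)" using P full_simplex_finite[OF P(1)] by (auto simp: full_simplex_def)
 then have ne: "real (card F) > 0" by simp
 define c where "c = (\<Sum>w\<in>F. (1 / real (card F)) *\<^sub>R w)"
 have s1: "(\<Sum>w\<in>F. 1 / real (card F)) = 1" using ne by simp
 have cV: "bary V v c = (if v \<in> F then 1 / real (card F) else 0)" if "v \<in> V" for v unfolding c_def using that s1 by (intro bary_on_facet[OF P(1)]) auto
 have cW: "bary W v c = (if v \<in> F then 1 / real (card F) else 0)" if "v \<in> W" for v unfolding c_def using that s1 by (intro bary_on_facet[OF Q(1)]) auto
 have "((%t. (1 - t) * (1 / real (card F)) + t * bary V v q) \<longlongrightarrow> (1 - 0) * (1 / real (card F)) + 0 * bary V v q) (at_right 0)" for v by (intro tendsto_intros)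
 then have "\<forall>\<^sub>F t in at_right 0. 0 < (1 - t) * (1 / real (card F)) + t * bary V v q" for v
  using ne by (intro order_tendstoD(1)[of _ "(1 - 0) * (1 / real (card F)) + 0 * bary V v q"]) auto
 then have "\<forall>\<^sub>F t in at_right 0. \<forall>v\<in>F. 0 < (1 - t) * (1 / real (card F)) + t * bary V v q" using fin by (simp add: eventually_ball_finite)
 moreover have "\<forall>\<^sub>F t in at_right (0::real). 0 < t \<and> t < 1" by (auto simp: eventually_at_right[of 0 1] intro: exI[of _ 1])
 ultimately have "\<forall>\<^sub>F t in at_right 0. (\<forall>v\<in>F. 0 < (1 - t) * (1 / real (card F)) + t * bary V v q) \<and> 0 < t \<and> t < 1" by eventually_elim auto
 then obtain t where t: "\<forall>v\<in>F. 0 < (1 - t) * (1 / real (card F)) + t * bary V v q" "0 < t" "t < 1" using eventually_happens'[OF trivial_limit_at_right_real] by blast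
 define x where "x = c + t *\<^sub>R (q - c)"
 have "x \<in> interior (convex hull V)" unfolding interior_bary[OF P(1)] using t assms by (auto simp: x_def bary_line cV)
 moreover have "x \<in> interior (convex hull W)" unfolding interior_bary[OF Q(1)] using t ne Q by (auto simp: x_def bary_line cW bary_vertex)
 ultimately show ?thesis by auto
qed

lemma opposite_cover:
 assumes "bary V p q < 0" "!!v. v \<in> F ==> 0 \<le> bary V v y" "!!v. v \<in> F ==> 0 \<le> bary W v y"
 shows "0 \<le> bary V p y ==> y \<in> convex hull V" "bary V p y \<le> 0 ==> y \<in> convex hull W"
using assms(2) bary_apex[of y] assms(1) assms(3) by (auto simp: convex_hull_bary[OF P(1)] mult_le_0_iff convex_hull_bary[OF Q(1)])

text \<open>Near such a point all coordinates belonging to \<open>F\<close> stay positive in both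
  simplices, so only the side of \<open>F\<close> decides which simplex contains a nearby
  point.\<close>

lemma facet_point_interior:
 assumes "bary V p q < 0" "!!v. v \<in> F ==> 0 < c v" "sum c F = 1"
 shows "(\<Sum>v\<in>F. c v *\<^sub>R v) \<in> interior (convex hull V \<union> convex hull W)"
proof -
 have fin: "finite F" using full_simplex_finite[OF P(1)] by auto
 let ?O = "\<Inter>v\<in>F. {y. 0 < bary V v y \<and> 0 < bary W v y}"
 have "open ?O" using fin by (intro open_INT ballI open_Collect_conj open_Collect_less continuous_intros)
 moreover have "?O \<subseteq> convex hull V \<union> convex hull W"
 proof
  fix y assume "y \<in> ?O"
  then show "y \<in> convex hull V \<union> convex hull W" using opposite_cover[OF assms(1), of y] by force
 qed
 moreover have "(\<Sum>v\<in>F. c v *\<^sub>R v) \<in> ?O" using bary_on_facet[OF P(1) subset_insertI assms(3)] bary_on_facet[OF Q(1) subset_insertI assms(3)] assms(2) by simp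
 ultimately show ?thesis by (meson interior_maximal subsetD)
qed

end

text \<open>Sides multiply by \<open>bary_apex\<close>, so of three apexes two lie on the same side
  of the facet. All counts of elements at a facet rest on this.\<close>

lemma three_simplices_overlap:
 assumes "full_simplex (insert p F)" "p \<notin> F" "full_simplex (insert q F)" "q \<notin> F" "full_simplex (insert r F)" "r \<notin> F"
 shows "interior (convex hull insert p F) \<inter> interior (convex hull insert q F) ~= {} \<or>
  interior (convex hull insert p F) \<inter> interior (convex hull insert r F) ~= {} \<or>
  interior (convex hull insert q F) \<inter> interior (convex hull insert r F) ~= {}"
proof -
 interpret pq: facet_pair F p q by unfold_locales (use assms in auto)
 interpret pr: facet_pair F p r by unfold_locales (use assms in auto)
 interpret qr: facet_pair F q r by unfold_locales (use assms in auto)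
 have "bary (insert p F) p r = bary (insert p F) p q * bary (insert q F) q r" by (rule pq.bary_apex)
 then consider "0 < bary (insert p F) p q" | "0 < bary (insert p F) p r" | "0 < bary (insert q F) q r"
  using pq.bary_apex_nonzero qr.bary_apex_nonzero mult_neg_neg[of "bary (insert p F) p q" "bary (insert q F) q r"] by argo
 then show ?thesis using pq.same_side_overlap pr.same_side_overlap qr.same_side_overlap by auto
qed

section \<open>Tagged simplices\<close>

lemma differ_in_one_Nil [simp]: "\<not> differ_in_one [] ys" "\<not> differ_in_one xs []" by (auto simp: differ_in_one_def)

text \<open>A common prefix and suffix around one exchanged entry suit concatenation and reversal
  better than indices.\<close>

lemma differ_in_one_iff: "differ_in_one xs ys \<longleftrightarrow> (\<exists>u x y w. xs = u @ x # w \<and> ys = u @ y # w \<and> x ~= y)"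
proof
 assume "differ_in_one xs ys"
 then have len: "length xs = length ys" and ex: "\<exists>!i. i < length xs \<and> xs ! i ~= ys ! i" by (auto simp: differ_in_one_def)
 from ex obtain i where i: "i < length xs" "xs ! i ~= ys ! i" and u: "!!j. j < length xs ==> xs ! j ~= ys ! j ==> j = i" by blast
 have "take i xs = take i ys"
 proof (rule nth_take_lemma)
  fix j show "j < i --> xs ! j = ys ! j" using u[of j] i by force
 qed (use i len in auto)
 moreover have "drop (Suc i) xs = drop (Suc i) ys"
 proof (rule nth_equalityI)
  fix j assume "j < length (drop (Suc i) xs)"
  then have "Suc i + j < length xs" by simp
  then show "drop (Suc i) xs ! j = drop (Suc i) ys ! j" using len u[of "Suc i + j"] by auto
 qed (simp add: len)
 ultimately show "\<exists>u x y w. xs = u @ x # w \<and> ys = u @ y # w \<and> x ~= y" using i len id_take_nth_drop[of i xs] id_take_nth_drop[of i ys] by auto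
next
 assume "\<exists>u x y w. xs = u @ x # w \<and> ys = u @ y # w \<and> x ~= y"
 then obtain u x y w where eq: "xs = u @ x # w" "ys = u @ y # w" "x ~= y" by auto
 have "j = length u" if "xs ! j ~= ys ! j" for j using that unfolding eq nth_append nth_Cons by (auto split: if_splits nat.splits)
 moreover have "xs ! length u ~= ys ! length u" using eq by simp
 ultimately have "\<exists>!i. i < length xs \<and> xs ! i ~= ys ! i" by (intro ex1I[of _ "length u"]) (auto simp: eq)
 then show "differ_in_one xs ys" by (simp add: differ_in_one_def eq)
qed

lemma differ_in_one_Cons: "differ_in_one (x # xs) (y # ys) \<longleftrightarrow> (x = y \<and> differ_in_one xs ys) \<or> (x ~= y \<and> xs = ys)"
proof
 assume "differ_in_one (x # xs) (y # ys)"
 then show "(x = y \<and> differ_in_one xs ys) \<or> (x ~= y \<and> xs = ys)" by (auto simp: differ_in_one_iff Cons_eq_append_conv)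
next
 assume "(x = y \<and> differ_in_one xs ys) \<or> (x ~= y \<and> xs = ys)"
 then consider u a b w where "x = y" "xs = u @ a # w" "ys = u @ b # w" "a ~= b" | "x ~= y" "xs = ys" by (auto simp: differ_in_one_iff)
 then show "differ_in_one (x # xs) (y # ys)"
 proof cases
  case 1
  then have "x # xs = (x # u) @ a # w" "y # ys = (x # u) @ b # w" by auto
  then show ?thesis using 1(4) unfolding differ_in_one_iff by blast
 next
  case 2
  then show ?thesis using 2(1) unfolding differ_in_one_iff by blast
 qed
qed

lemma differ_in_one_append: "length xs = length ys ==> differ_in_one (xs @ us) (ys @ vs) \<longleftrightarrow>
  (xs = ys \<and> differ_in_one us vs) \<or> (differ_in_one xs ys \<and> us = vs)" by (induction xs ys rule: list_induct2) (auto simp: differ_in_one_Cons)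

lemma differ_in_one_rev: "differ_in_one (rev xs) (rev ys) \<longleftrightarrow> differ_in_one xs ys"
proof -
 have "differ_in_one (rev xs) (rev ys)" if d: "differ_in_one xs ys" for xs ys :: "'b list" using d by (fastforce simp: differ_in_one_iff)
 from this[of xs ys] this[of "rev xs" "rev ys"] show ?thesis by auto
qed

abbreviation verts :: "'a tagged => 'a set" where "verts T \<equiv> set (fst T)"

text \<open>Facets as vertex sets, so that adjacency becomes combinatorics of lists;
  \<open>facet_of_hull\<close> returns to convex hulls.\<close>

definition vfacets :: "'a set => 'a set set" where "vfacets V = {V - {v} | v. v \<in> V}"

definition fst_v :: "'a tagged => 'a" where "fst_v T = hd (fst T)"
definition last_v :: "'a tagged => 'a" where "last_v T = last (fst T)"

definition new_v :: "'a::euclidean_space tagged => 'a" where "new_v T = midpoint (fst_v T) (last_v T)"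

text \<open>Only the child at the first vertex. The other one is the child of the reflected simplex,
  see \<open>children_eq\<close>, so statements are proved for one child and then reflected.\<close>

definition child :: "'a::euclidean_space tagged => 'a tagged" where "child T = (fst_v T # new_v T # inner_vertices (fst T), (snd T + 1) mod DIM('a))"

lemma tagged_full_simplex: "tagged_simplex T ==> full_simplex (verts T)" by (simp add: tagged_simplex_def full_simplex_def distinct_card)

text \<open>With the inner vertices cut after position \<gamma> the type is the length of
  \<open>A\<close>, and children and reflections become list equations.\<close>

lemma tagged_cases:
 fixes T :: "'a::euclidean_space tagged"
 assumes T: "tagged_simplex T"
 obtains a A B b where "T = (a # A @ B @ [b], length A)" "length A + length B + 1 = DIM('a)"
proof -
 obtain xs \<gamma> where xs: "T = (xs, \<gamma>)" by force
 have len: "length xs = DIM('a) + 1" and g: "\<gamma> < DIM('a)" using T xs by (auto simp: tagged_simplex_def)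
 then obtain a ys where ys: "xs = a # ys" by (cases xs) auto
 then have "length ys = DIM('a)" "ys ~= []" using len by auto
 then obtain zs b where zs: "ys = zs @ [b]" by (metis append_butlast_last_id)
 show thesis using \<open>length ys = DIM('a)\<close> using that[of a "take \<gamma> zs" "drop \<gamma> zs" b] g by (simp add: xs ys zs)
qed

lemma split_simps [simp]: "fst_v (a # A @ B @ [b], n) = a" "last_v (a # A @ B @ [b], n) = b" "inner_vertices (a # A @ B @ [b]) = A @ B" "new_v (a # A @ B @ [b], n) = midpoint a b"
 "reflect (a # A @ B @ [b], length A) = (b # A @ rev B @ [a], length A)" by (auto simp: fst_v_def last_v_def inner_vertices_def new_v_def reflect_def butlast_append)

lemma child_split: "child ((a :: 'a::euclidean_space) # A @ B @ [b], length A) = (a # midpoint a b # A @ B, (length A + 1) mod DIM('a))" by (simp add: child_def)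

lemma children_eq:
 assumes "tagged_simplex T"
 shows "children T = {child T, child (reflect T)}"
proof (rule tagged_cases[OF assms])
 fix a A B b assume T: "T = (a # A @ B @ [b], length A)"
 then show ?thesis using child_split[of a A B b] child_split[of b A "rev B" a] by (simp add: T children_def Let_def midpoint_sym[of b a])
qed

context
 fixes T :: "'a::euclidean_space tagged"
 assumes T: "tagged_simplex T"
begin

lemma reflect_simps: "tagged_simplex (reflect T)" "verts (reflect T) = verts T" "snd (reflect T) = snd T"
 "fst_v (reflect T) = last_v T" "last_v (reflect T) = fst_v T" "new_v (reflect T) = new_v T" "reflect (reflect T) = T" "hull_of (reflect T) = hull_of T"
proof -
 obtain a A B b where s: "T = (a # A @ B @ [b], length A)" using tagged_cases[OF T] by metis
 let ?A = "(reflect T)"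
 show v: "verts ?A = verts T" by (auto simp: s)
 then show "hull_of ?A = hull_of T" by (simp add: hull_of_def)
 show "tagged_simplex ?A" using T v by (auto simp: s tagged_simplex_def)
 show "snd ?A = snd T" by (simp add: s)
 show "fst_v ?A = last_v T" "last_v ?A = fst_v T" "new_v ?A = new_v T" by (auto simp: s midpoint_sym)
 show "reflect ?A = T" by (simp add: s)
qed

lemma ref_edge: "fst_v T \<in> verts T" "last_v T \<in> verts T" "fst_v T ~= last_v T"
proof -
 obtain a A B b where s: "T = (a # A @ B @ [b], length A)" using tagged_cases[OF T] by metis
 show "fst_v T \<in> verts T" "last_v T \<in> verts T" "fst_v T ~= last_v T" using T by (auto simp: s tagged_simplex_def)
qed

lemma new_v_notin: "new_v T \<notin> verts T" unfolding new_v_def using ref_edge tagged_full_simplex[OF T] by (intro bisected_full_simplex(2))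

lemma verts_child: "verts (child T) = insert (new_v T) (verts T - {last_v T})"
proof -
 obtain a A B b where s: "T = (a # A @ B @ [b], length A)" using tagged_cases[OF T] by metis
 show ?thesis using T by (auto simp: s tagged_simplex_def child_split)
qed

lemma child_full_simplex: "full_simplex (verts (child T))" unfolding verts_child new_v_def using ref_edge tagged_full_simplex[OF T] by (intro bisected_full_simplex(1))

lemma child_tagged: "tagged_simplex (child T)"
proof -
 obtain a A B b where s: "T = (a # A @ B @ [b], length A)" "length A + length B + 1 = DIM('a)" using tagged_cases[OF T] by metis
 have "length (fst (child T)) = DIM('a) + 1" using s by (simp add: child_split)
 moreover have "card (verts (child T)) = DIM('a) + 1" "\<not> affine_dependent (verts (child T))" using child_full_simplex by (auto simp: full_simplex_def)
 ultimately show ?thesis by (simp add: tagged_simplex_def card_distinct) (simp add: child_def)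
qed

lemma hull_child: "hull_of (child T) = {x \<in> hull_of T. bary (verts T) (last_v T) x \<le> bary (verts T) (fst_v T) x}" unfolding hull_of_def verts_child new_v_def
 using ref_edge tagged_full_simplex[OF T] by (intro hull_bisected)

lemma volume_child: "simplex_volume (verts T) = 2 * simplex_volume (verts (child T))" unfolding verts_child new_v_def
 using ref_edge tagged_full_simplex[OF T] by (intro simplex_volume_bisected)

end

lemma children_tagged: "tagged_simplex T ==> C \<in> children T ==> tagged_simplex C" by (auto simp: children_eq child_tagged reflect_simps(1))

lemma hull_children: "tagged_simplex T ==> C \<in> children T ==> hull_of C \<subseteq> hull_of T" by (auto simp: children_eq hull_child reflect_simps)

text \<open>Inside one child the coordinate of one end of the refinement edge exceeds that of the
  other end; in the sibling it does not.\<close>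

lemma children_interiors_disjoint:
 assumes T: "tagged_simplex T" and C: "C \<in> children T" "C' \<in> children T" "C ~= C'"
 shows "interior (hull_of C) \<inter> interior (hull_of C') = {}"
proof -
 let ?R = "reflect T"
 have *: "interior (hull_of (child T)) \<inter> interior (hull_of (child ?R)) = {}"
 proof (rule ccontr)
  assume "\<not> ?thesis"
  then obtain x where x: "x \<in> interior (hull_of (child T))" "x \<in> interior (hull_of (child ?R))" by auto
  note V = tagged_full_simplex[OF T] ref_edge(1,2,3)[OF T]
  let ?A = "bary (verts T)"
  have "?A (last_v T) x < ?A (fst_v T) x"
  proof -
   have "0 < bary (verts (child T)) (fst_v T) x" using x(1) ref_edge[OF T] interior_bary[OF child_full_simplex[OF T]] verts_child[OF T] by (simp add: hull_of_def)
   then show ?thesis using bary_bisected[OF V V(2), of x] bary_bisected[OF V V(3), of x] V(4) by (simp add: verts_child[OF T] new_v_def)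
  qed
  moreover have "?A (fst_v T) x \<le> ?A (last_v T) x" using x(2) interior_subset hull_child[OF reflect_simps(1)[OF T]] reflect_simps[OF T] by auto
  ultimately show False by simp
 qed
 then show ?thesis using C unfolding children_eq[OF T] by auto
qed

section \<open>Reflected neighbours\<close>

lemma vfacets_iff:
 assumes "full_simplex (V :: 'a::euclidean_space set)"
 shows "f \<in> vfacets V \<longleftrightarrow> f \<subseteq> V \<and> card f = DIM('a)"
proof
 assume "f \<in> vfacets V"
 then show "f \<subseteq> V \<and> card f = DIM('a)" using assms by (auto simp: vfacets_def full_simplex_def)
next
 assume f: "f \<subseteq> V \<and> card f = DIM('a)"
 have fin: "finite V" using assms by (rule full_simplex_finite)
 then have "card (V - f) = 1" using f assms finite_subset[of f V] by (simp add: card_Diff_subset full_simplex_def)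
 then obtain v where "V - f = {v}" by (auto simp: card_1_singleton_iff)
 then show "f \<in> vfacets V" using f by (auto simp: vfacets_def)
qed

lemma vfacet_insert:
 assumes "f \<in> vfacets V"
 obtains p where "V = insert p f" "p \<notin> f" using assms by (auto simp: vfacets_def)

text \<open>The list part of \<open>reflected_neighbors\<close>; the shared facet is carried
  separately, since the induction follows one facet at a time.\<close>

definition refl_nb :: "'a tagged => 'a tagged => bool" where "refl_nb T T' \<longleftrightarrow> snd T = snd T' \<and>
   (differ_in_one (fst T) (fst T') \<or> differ_in_one (fst (reflect T)) (fst T'))"

abbreviation has_edge :: "'a tagged => 'a set => bool" where "has_edge T f \<equiv> fst_v T \<in> f \<and> last_v T \<in> f"

text \<open>The matching neighbor condition at a single facet. The second alternative is met by
  initial neighbors and also by siblings, which in general match only after another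
  bisection.\<close>

definition matched :: "'a::euclidean_space tagged => 'a tagged => 'a set => bool" where "matched T T' f \<longleftrightarrow> refl_nb T T' \<or>
   (\<not> has_edge T f \<and> \<not> has_edge T' f \<and> (\<exists>C\<in>children T. \<exists>C'\<in>children T'.
     f \<in> vfacets (verts C) \<and> f \<in> vfacets (verts C') \<and> refl_nb C C'))"

text \<open>The vertex set \<open>e\<close> of a facet of a child of \<open>T\<close> spans a part of the facet of \<open>T\<close> with vertex
  set \<open>f\<close>.\<close>

definition under :: "'a::euclidean_space tagged => 'a set => 'a set => bool" where
 "under T f e \<longleftrightarrow> e \<subseteq> f \<union> (if has_edge T f then {new_v T} else {})"

text \<open>The vertex at the differing position belongs to one simplex only, hence not to a shared
  facet.\<close>

lemma common_vfacet:
 assumes "distinct (u @ x # w)" "x ~= y" "f \<in> vfacets (set (u @ y # w))"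
 shows "x \<notin> f" using assms by (auto simp: vfacets_def)

lemma exchange_vfacet:
 assumes "distinct (u @ x # w)" "distinct (u @ y # w)" "e \<in> vfacets (set (u @ x # w))" "x \<notin> e"
 shows "e \<in> vfacets (set (u @ y # w))"
using assms(3) assms(4) assms(1) assms(2) by (auto simp: vfacets_def)

lemma differ_reflect:
 assumes "tagged_simplex T" "tagged_simplex T'" "snd T = snd T'" "differ_in_one (fst T) (fst T')"
 shows "differ_in_one (fst (reflect T)) (fst (reflect T'))"
proof -
 obtain a A B b where s: "T = (a # A @ B @ [b], length A)" "length A + length B + 1 = DIM('a)" using tagged_cases[OF assms(1)] by metis
 obtain a' A' B' b' where s': "T' = (a' # A' @ B' @ [b'], length A')" "length A' + length B' + 1 = DIM('a)" using tagged_cases[OF assms(2)] by metis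
 have len: "length A = length A'" "length B = length B'" using assms(3) s s' by auto
 have "reflect T = (b # A @ rev B @ [a], length A)" "reflect T' = (b' # A' @ rev B' @ [a'], length A')" by (auto simp: s s')
 then show ?thesis using assms(4) len by (auto simp: s(1) s'(1) differ_in_one_Cons differ_in_one_append differ_in_one_rev)
qed

text \<open>The position of the differing vertex decides. A differing inner vertex is inherited,
  with the same midpoint; for different last vertices the children differ in their midpoints, which
  \<open>e\<close> avoids. Each time the children again differ in one position.\<close>

lemma child_match_direct:
 assumes T: "tagged_simplex (T :: 'a::euclidean_space tagged)" and T': "tagged_simplex T'" and d: "snd T = snd T'" "differ_in_one (fst T) (fst T')"
  and f: "f \<in> vfacets (verts T)" "f \<in> vfacets (verts T')" and e: "e \<in> vfacets (verts (child T))" "under T f e"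
 shows "e \<in> vfacets (verts (child T')) \<and> snd (child T) = snd (child T') \<and> differ_in_one (fst (child T)) (fst (child T'))"
proof -
 obtain a A B b where s: "T = (a # A @ B @ [b], length A)" "length A + length B + 1 = DIM('a)" using tagged_cases[OF T] by metis
 obtain a' A' B' b' where s': "T' = (a' # A' @ B' @ [b'], length A')" "length A' + length B' + 1 = DIM('a)" using tagged_cases[OF T'] by metis
 have len: "length A = length A'" "length B = length B'" using d(1) s s' by auto
 define m where "m = midpoint a b"
 define m' where "m' = midpoint a' b'"
 let ?A = "(child T')"
 have C: "fst (child T) = a # m # A @ B" "fst ?A = a' # m' # A' @ B'" by (auto simp: s s' child_split m_def m'_def)
 have sn: "snd (child T) = snd ?A" using d(1) by (simp add: child_def)
 have dist: "distinct (a # A @ B @ [b])" "distinct (a' # A' @ B' @ [b'])" "distinct (a # m # A @ B)" "distinct (a' # m' # A' @ B')"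
  using T T' child_tagged[OF T] child_tagged[OF T'] C by (auto simp: tagged_simplex_def s(1) s'(1))
 have mV: "m \<notin> verts T" "m' \<notin> verts T'" using new_v_notin[OF T] new_v_notin[OF T'] by (auto simp: s s' m_def m'_def)
 have um: "e \<subseteq> insert m f" using e(2) by (auto simp: under_def s m_def split: if_splits)
 have xs: "fst T = a # A @ B @ [b]" "fst T' = a' # A' @ B' @ [b']" by (auto simp: s s')
 from d(2) consider "a ~= a'" "A = A'" "B = B'" "b = b'" | "a = a'" "differ_in_one A A'" "B = B'" "b = b'"
  | "a = a'" "A = A'" "differ_in_one B B'" "b = b'" | "a = a'" "A = A'" "B = B'" "b ~= b'" using len by (auto simp: xs differ_in_one_Cons differ_in_one_append)
 then show ?thesis
 proof cases
  case 1
  \<comment> \<open>Here \<open>f\<close> misses the first vertex, hence the refinement edge, and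
    \<open>e\<close> would have to consist of the d - 1 inner vertices only.\<close>
  have "a \<notin> f" using common_vfacet[of "[]" a "A @ B @ [b]" a' f] f 1 dist by (simp add: xs)
  then have "e \<subseteq> f" using e(2) by (simp add: under_def s)
  moreover have "f \<subseteq> verts T" using f by (auto simp: vfacets_def)
  moreover have "e \<subseteq> insert m (verts T - {b})" using e(1) verts_child[OF T] by (auto simp: vfacets_def s m_def)
  ultimately have "e \<subseteq> verts T - {a, b}" using mV \<open>a \<notin> f\<close> by auto
  moreover have "card (verts T - {a, b}) + 1 = DIM('a)"
  proof -
   have "a \<in> verts T" "b \<in> verts T" "a ~= b" using ref_edge[OF T] by (auto simp: s(1))
   then show ?thesis using tagged_full_simplex[OF T] by (simp add: full_simplex_def)
  qed
  ultimately have False using card_mono[of "verts T - {a, b}" e] e(1) vfacets_iff[OF child_full_simplex[OF T]] by simp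
  then show ?thesis ..
 next
  case 2
  then obtain u x y w where A: "A = u @ x # w" "A' = u @ y # w" "x ~= y" by (auto simp: differ_in_one_iff)
  have "x \<notin> f" using common_vfacet[of "a # u" x "w @ B @ [b]" y f] f dist 2 A by (simp add: xs)
  moreover have "x ~= m" using mV A by (auto simp: xs)
  ultimately have "x \<notin> e" using um by auto
  moreover have mm: "m' = m" using 2 by (simp add: m_def m'_def)
  ultimately have "e \<in> vfacets (verts ?A)" using exchange_vfacet[of "a # m # u" x "w @ B" y e] e(1) dist 2 A by (simp add: C)
  then show ?thesis using sn 2 mm by (simp add: C differ_in_one_Cons differ_in_one_append len)
 next
  case 3
  then obtain u x y w where A: "B = u @ x # w" "B' = u @ y # w" "x ~= y" by (auto simp: differ_in_one_iff)
  have "x \<notin> f" using common_vfacet[of "a # A @ u" x "w @ [b]" y f] f dist 3 A by (simp add: xs)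
  moreover have "x ~= m" using mV A by (auto simp: xs)
  ultimately have "x \<notin> e" using um by auto
  moreover have mm: "m' = m" using 3 by (simp add: m_def m'_def)
  ultimately have "e \<in> vfacets (verts ?A)" using exchange_vfacet[of "a # m # A @ u" x "w" y e] e(1) dist 3 A by (simp add: C)
  then show ?thesis using sn 3 mm by (simp add: C differ_in_one_Cons differ_in_one_append)
 next
  case 4
  have "e \<subseteq> f" using e(2) common_vfacet[of "a # A @ B" b "[]" b' f] f dist 4 by (simp add: xs under_def s)
  then have "e \<in> vfacets (verts ?A)" using exchange_vfacet[of "[a]" m "A @ B" m' e] e(1) dist 4 f(1) mV by (auto simp: vfacets_def C)
  moreover have "m ~= m'" using 4 by (simp add: m_def m'_def midpoint_def)
  ultimately show ?thesis using sn 4 by (simp add: C differ_in_one_Cons)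
 qed
qed

lemma under_reflect: "tagged_simplex T ==> under (reflect T) f e = under T f e" by (simp add: under_def reflect_simps)

lemma children_reflect: "tagged_simplex T ==> children (reflect T) = children T" by (auto simp: children_eq reflect_simps)

text \<open>Reflecting \<open>T\<close> leaves its children alone, so one may assume that the lists
  themselves differ in one entry; for the other child both simplices are reflected.\<close>

lemma children_match_refl:
 assumes T: "tagged_simplex T" and T': "tagged_simplex T'" and r: "refl_nb T T'" and f: "f \<in> vfacets (verts T)" "f \<in> vfacets (verts T')"
  and C: "C \<in> children T" "e \<in> vfacets (verts C)" "under T f e"
 shows "\<exists>C'\<in>children T'. e \<in> vfacets (verts C') \<and> refl_nb C C'"
proof -
 have main: "\<exists>C'\<in>children T'. e \<in> vfacets (verts C') \<and> refl_nb C C'"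
  if R: "tagged_simplex R" "verts R = verts T" "snd R = snd T" "C \<in> children R" "under R f e" "differ_in_one (fst R) (fst T')" for R
 proof -
  have sn: "snd R = snd T'" using R(3) r by (simp add: refl_nb_def)
  consider "C = child R" | "C = child (reflect R)" using R(4) children_eq[OF R(1)] by auto
  then show ?thesis
  proof cases
   case 1
   then show ?thesis using child_match_direct[OF R(1) T' sn R(6), of f e] f C R children_eq[OF T'] by (simp add: refl_nb_def)
  next
   case 2
   have "differ_in_one (fst (reflect R)) (fst (reflect T'))" by (rule differ_reflect[OF R(1) T' sn R(6)])
   moreover have "snd (reflect R) = snd (reflect T')" using sn by (simp add: reflect_simps R(1) T')
   ultimately show ?thesis
    using child_match_direct[OF reflect_simps(1)[OF R(1)] reflect_simps(1)[OF T'], of f e] f C R 2 children_eq[OF T'] by (simp add: refl_nb_def reflect_simps(2) T' under_reflect)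
  qed
 qed
 from r consider "differ_in_one (fst T) (fst T')" | "differ_in_one (fst (reflect T)) (fst T')" by (auto simp: refl_nb_def)
 then show ?thesis using main[OF T] C main[OF reflect_simps(1)[OF T]] T by (metis reflect_simps under_reflect children_reflect)
qed

text \<open>The two children share only d - 1 vertices of their parent, too few for a facet of
  it.\<close>

lemma child_facet_unique:
 assumes T: "tagged_simplex (T :: 'a::euclidean_space tagged)" and C: "C \<in> children T" "C' \<in> children T"
  and f: "f \<in> vfacets (verts T)" "f \<in> vfacets (verts C)" "f \<in> vfacets (verts C')"
 shows "C = C'"
proof (rule ccontr)
 assume "C ~= C'"
 have "f \<subseteq> verts C" "f \<subseteq> verts C'" using f(2,3) by (auto simp: vfacets_def)
 moreover from \<open>C ~= C'\<close> have "C = child T \<and> C' = child (reflect T) \<or> C = child (reflect T) \<and> C' = child T" using C unfolding children_eq[OF T] by auto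
 ultimately have "f \<subseteq> verts (child T)" "f \<subseteq> verts (child (reflect T))" by auto
 then have "f \<subseteq> insert (new_v T) (verts T - {last_v T})" "f \<subseteq> insert (new_v T) (verts T - {fst_v T})"
  by (auto simp: verts_child[OF T] verts_child[OF reflect_simps(1)[OF T]] reflect_simps(5,6)[OF T])
 moreover have "new_v T \<notin> f" using f(1) new_v_notin[OF T] by (auto simp: vfacets_def)
 ultimately have "f \<subseteq> verts T - {fst_v T, last_v T}" by auto
 moreover have "card (verts T - {fst_v T, last_v T}) + 1 = DIM('a)" using tagged_full_simplex[OF T] ref_edge[OF T] by (simp add: full_simplex_def)
 ultimately show False using card_mono[of "verts T - {fst_v T, last_v T}" f] f(1) vfacets_iff[OF tagged_full_simplex[OF T]] by simp
qed

text \<open>In the second alternative of \<open>matched\<close> no refinement edge lies in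
  \<open>f\<close>, so \<open>e\<close> is all of \<open>f\<close> and only one child of
  \<open>T\<close> has this facet.\<close>

lemma children_match:
 assumes T: "tagged_simplex (T :: 'a::euclidean_space tagged)" and T': "tagged_simplex T'" and m: "matched T T' f" and f: "f \<in> vfacets (verts T)" "f \<in> vfacets (verts T')"
  and C: "C \<in> children T" "e \<in> vfacets (verts C)" "under T f e"
 shows "\<exists>C'\<in>children T'. e \<in> vfacets (verts C') \<and> refl_nb C C'"
proof (cases "refl_nb T T'")
 case True
 then show ?thesis using children_match_refl[OF T T' _ f C] by simp
next
 case False
 then obtain C0 C' where *: "\<not> has_edge T f" "C0 \<in> children T" "C' \<in> children T'" "f \<in> vfacets (verts C0)" "f \<in> vfacets (verts C')" "refl_nb C0 C'"
  using m by (auto simp: matched_def)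
 have "e \<subseteq> f" using C(3) *(1) by (simp add: under_def)
 moreover have "card e = DIM('a)" "card f = DIM('a)" using C(2) f(1) vfacets_iff tagged_full_simplex[OF T] tagged_full_simplex[OF children_tagged[OF T C(1)]] by auto
 moreover have "finite f" using f(1) by (auto simp: vfacets_def)
 ultimately have "e = f" by (simp add: card_subset_eq)
 then show ?thesis using child_facet_unique[OF T C(1) *(2) f(1)] C(2) * by auto
qed

lemma bary_midpoint: "bary V v (midpoint x y) = (bary V v x + bary V v y) / 2" by (simp add: bary_def midpoint_def inner_diff_right inner_add_right)

text \<open>The siblings are (a, m, A, B) and (b, m, A, rev B). If \<open>B\<close> has at most one
  entry they differ in the first vertex only. Otherwise both refinement edges leave the common
  facet, and the reversal of \<open>B\<close> makes the children on that facet, after a reflection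
  of one, differ only in their new vertices \<open>y\<close> and \<open>y'\<close>.\<close>

lemma siblings_matched:
 assumes T: "tagged_simplex (T :: 'a::euclidean_space tagged)" and e: "e \<in> vfacets (verts (child T))" "e \<in> vfacets (verts (child (reflect T)))"
 shows "matched (child T) (child (reflect T)) e"
proof -
 obtain a A B b where s: "T = (a # A @ B @ [b], length A)" "length A + length B + 1 = DIM('a)" using tagged_cases[OF T] by metis
 define m where "m = midpoint a b"
 have C: "child T = (a # m # A @ B, (length A + 1) mod DIM('a))" "child (reflect T) = (b # m # A @ rev B, (length A + 1) mod DIM('a))"
  by (auto simp: s(1) child_split m_def midpoint_sym[of b a])
 have dist: "distinct (a # A @ B @ [b])" using T by (simp add: s(1) tagged_simplex_def)
 have ab: "a ~= b" using dist by auto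
 show ?thesis
 proof (cases "length B \<le> 1")
  case True
  then have "rev B = B" by (cases B) auto
  then show ?thesis using ab by (simp add: matched_def refl_nb_def C differ_in_one_Cons)
 next
  case False
  then obtain c B1 where B1: "B = c # B1" "B1 ~= []" by (cases B) auto
  then obtain B' c' where B': "B = c # B' @ [c']" by (metis append_butlast_last_id)
  have len: "length A + length B' + 3 = DIM('a)" using s(2) B' by simp
  let ?C = "child T" and ?S = "child (reflect T)"
  have tC: "tagged_simplex ?C" "tagged_simplex ?S" by (intro child_tagged reflect_simps(1) T)+
  let ?D = "length (m # A)"
  have Cs: "?C = (a # (m # A) @ (c # B') @ [c'], ?D)" "?S = (b # (m # A) @ (c' # rev B') @ [c], ?D)" using len by (auto simp: C B')
  define y where "y = midpoint c' a"
  define y' where "y' = midpoint c b"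
  have rC: "reflect ?C = (c' # (m # A) @ rev (c # B') @ [a], ?D)" "reflect ?S = (c # (m # A) @ rev (c' # rev B') @ [b], ?D)" unfolding Cs by (simp_all only: split_simps)
  let ?A = "child (reflect ?C)"
  let ?B = "child (reflect ?S)"
  let ?E = "(y # m # A)"
  have C0: "?A = (c' # ?E @ rev B' @ [c], length ?E)" "?B = (c # (y' # m # A) @ B' @ [c'], length ?E)"
   unfolding rC using len by (simp_all add: child_def new_v_def fst_v_def last_v_def y_def y'_def inner_vertices_def butlast_append)
  have rC0: "reflect ?A = (c # ?E @ B' @ [c'], length ?E)" unfolding C0 by (simp only: split_simps rev_rev_ident)
  \<comment> \<open>The coordinate of \<open>a\<close> tells the new vertices apart:
    \<open>y\<close> is a midpoint with \<open>a\<close>, while \<open>y'\<close> lies on an edge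
    without \<open>a\<close>.\<close>
  have "bary (verts T) a y = 1/2" "bary (verts T) a y' = 0" using dist tagged_full_simplex[OF T] by (auto simp: s(1) B' y_def y'_def bary_midpoint bary_vertex)
  then have "y ~= y'" by auto
  then have r: "refl_nb ?A ?B" unfolding refl_nb_def rC0 unfolding C0 by (simp add: differ_in_one_Cons)
  have vC: "verts ?C = insert m (verts T - {b})" "verts ?S = insert m (verts T - {a})" using verts_child[OF T] verts_child[OF reflect_simps(1)[OF T]]
   unfolding reflect_simps(2)[OF T] reflect_simps(5,6)[OF T] by (simp_all add: s(1) m_def)
  have "e \<subseteq> insert m (verts T - {a, b})" using e vC by (auto simp: vfacets_def)
  moreover have "m \<notin> verts T" using new_v_notin[OF T] by (simp add: s(1) m_def)
  moreover have "e \<in> vfacets (verts ?A)" "e \<in> vfacets (verts ?B)"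
  proof -
   have card: "card e = DIM('a)" using e(1) vfacets_iff tagged_full_simplex[OF tC(1)] by auto
   have "insert m (verts T - {a, b}) = {m} \<union> set A \<union> set B" using dist by (simp add: s(1))
   then have "e \<subseteq> verts ?A" "e \<subseteq> verts ?B" using \<open>e \<subseteq> insert m (verts T - {a, b})\<close> by (auto simp: C0 B')
   then show "e \<in> vfacets (verts ?A)" "e \<in> vfacets (verts ?B)" using card vfacets_iff child_full_simplex[OF reflect_simps(1)] tC by blast+
  qed
  moreover have "fst_v ?C = a" "fst_v ?S = b" by (auto simp: C fst_v_def)
  ultimately have "\<not> has_edge ?C e" "\<not> has_edge ?S e" "e \<in> vfacets (verts ?A)" "e \<in> vfacets (verts ?B)" by (auto simp: s(1))
  then show ?thesis using r by (simp add: matched_def children_eq tC)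
 qed
qed

lemma matched_sym_siblings:
 assumes T: "tagged_simplex T" and C: "C \<in> children T" "C' \<in> children T" "C ~= C'" and e: "e \<in> vfacets (verts C)" "e \<in> vfacets (verts C')"
 shows "matched C C' e" using siblings_matched[OF T] siblings_matched[OF reflect_simps(1)[OF T]] C e unfolding children_eq[OF T] by (auto simp: reflect_simps T)

text \<open>Removing one vertex of a child leaves the cut between the siblings (the kept end of the
  refinement edge is removed), an old facet (the midpoint is removed), or one half of an old facet
  that contains the refinement edge.\<close>

lemma child_facet_cases:
 assumes T: "tagged_simplex (T :: 'a::euclidean_space tagged)" and C: "C \<in> children T" "e \<in> vfacets (verts C)"
 obtains "e = insert (new_v T) (verts T - {fst_v T, last_v T})"
 | f where "f \<in> vfacets (verts T)" "under T f e" "e = f \<or> (has_edge T f \<and> (\<exists>z. (z = fst_v T \<or> z = last_v T) \<and> e = insert (new_v T) (f - {z})))"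
proof -
 note case_rules = that
 have main: thesis if R: "tagged_simplex R" "verts R = verts T" "C = child R" "new_v R = new_v T"
  "(fst_v R = fst_v T \<and> last_v R = last_v T) \<or> (fst_v R = last_v T \<and> last_v R = fst_v T)" for R
 proof -
  define a b m where "a = fst_v R" and "b = last_v R" and "m = new_v T"
  have ab: "a \<in> verts T" "b \<in> verts T" "a ~= b" using ref_edge[OF R(1)] R(2) by (auto simp: a_def b_def)
  have m: "m \<notin> verts T" using new_v_notin[OF T] by (simp add: m_def)
  have vC: "verts C = insert m (verts T - {b})" using verts_child[OF R(1)] R by (simp add: b_def m_def)
  obtain z where z: "z \<in> verts C" "e = verts C - {z}" using C(2) by (auto simp: vfacets_def)
  have fl: "{fst_v T, last_v T} = {a, b}" using R(5) by (auto simp: a_def b_def)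
  then have he: "has_edge T f \<longleftrightarrow> a \<in> f \<and> b \<in> f" for f using R(5) by (auto simp: a_def b_def)
  consider "z = a" | "z = m" | "z \<in> verts T" "z ~= a" "z ~= b" using z vC by auto
  then show thesis
  proof cases
   case 1
   then show thesis using case_rules(1) z vC m ab by (auto simp: fl m_def)
  next
   case 2
   then have "e = verts T - {b}" using z vC m by auto
   moreover have "verts T - {b} \<in> vfacets (verts T)" using ab by (auto simp: vfacets_def)
   ultimately show thesis by (intro case_rules(2)[of e]) (simp_all add: under_def)
  next
   case 3
   let ?A = "verts T - {z}"
   have f: "?A \<in> vfacets (verts T)" using 3 by (auto simp: vfacets_def)
   have e: "e = insert m (?A - {b})" using z vC m 3 by auto
   have he': "has_edge T ?A" unfolding he using 3 ab by simp
   have u: "under T ?A e" unfolding under_def if_P[OF he'] e m_def by auto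
   have bz: "b = fst_v T \<or> b = last_v T" using R(5) by (auto simp: b_def)
   show thesis by (rule case_rules(2)[OF f u]) (use he' e[unfolded m_def] bz in blast)
  qed
 qed
 consider "C = child T" | "C = child (reflect T)" using C(1) children_eq[OF T] by auto
 then show thesis
 proof cases
  case 1
  then show thesis by (intro main[OF T]) auto
 next
  case 2
  then show thesis by (intro main[OF reflect_simps(1)[OF T]]) (simp_all add: reflect_simps T)
 qed
qed

section \<open>Uniform refinements\<close>

lemma hull_inj:
 assumes "full_simplex V" "full_simplex W" "e \<subseteq> V" "e' \<subseteq> W" "convex hull e = convex hull e'"
 shows "e = e'"
proof -
 have "\<not> affine_dependent e" "\<not> affine_dependent e'" using assms(1-4) affine_dependent_subset by (metis full_simplex_def)+
 from extreme_point_of_convex_hull_affine_independent[OF this(1)]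
  extreme_point_of_convex_hull_affine_independent[OF this(2)] assms(5)
 show ?thesis by auto
qed

lemma facet_of_hull:
 assumes V: "full_simplex (V :: 'a::euclidean_space set)"
 shows "f facet_of convex hull V \<longleftrightarrow> (\<exists>e\<in>vfacets V. f = convex hull e)"
proof -
 have ne: "e ~= {}" if "e \<in> vfacets V" for e using that vfacets_iff[OF V] by auto
 have "f facet_of convex hull V \<longleftrightarrow> f ~= {} \<and> (\<exists>e\<in>vfacets V. f = convex hull e)"
  using facet_of_convex_hull_affine_independent[of V f] V by (auto simp: vfacets_def full_simplex_def)
 then show ?thesis using ne by (metis convex_hull_eq_empty)
qed

lemma share_face_iff:
 assumes "tagged_simplex T" "tagged_simplex T'"
 shows "share_face T T' \<longleftrightarrow> T ~= T' \<and> vfacets (verts T) \<inter> vfacets (verts T') ~= {}"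
proof -
 note V = tagged_full_simplex[OF assms(1)] and V' = tagged_full_simplex[OF assms(2)]
 have "e = e'" if "e \<in> vfacets (verts T)" "e' \<in> vfacets (verts T')" "convex hull e = convex hull e'" for e e'
  using hull_inj[OF V V' _ _ that(3)] that(1,2) vfacets_iff[OF V] vfacets_iff[OF V'] by simp
 then show ?thesis by (auto simp: share_face_def hull_of_def facet_of_hull[OF V] facet_of_hull[OF V'])
qed

lemma full_simplex_interior_nonempty:
 assumes V: "full_simplex V"
 shows "interior (convex hull V) ~= {}"
proof
 assume "interior (convex hull V) = {}"
 then have "negligible (convex hull V)" by (metis convex_convex_hull negligible_convex_interior)
 then show False using simplex_volume_pos[OF V] V by (simp add: negligible_iff_null_sets simplex_volume_def null_sets_def measure_def)
qed

lemma conforming_full: "conforming M \<Omega> ==> T \<in> M ==> full_simplex (verts T)" unfolding conforming_def by (blast intro: tagged_full_simplex)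

lemma interior_hull_children: "tagged_simplex T ==> C \<in> children T ==> interior (hull_of C) \<subseteq> interior (hull_of T)" by (intro interior_mono hull_children)

lemma conforming_Int:
 assumes M: "conforming M \<Omega>" and T: "T \<in> M" "T' \<in> M"
 shows "hull_of T \<inter> hull_of T' = convex hull (verts T \<inter> verts T')"
proof -
 have tr: "triangulation (hull_of ` M)" using M by (simp add: conforming_def triangulates_def)
 have V: "full_simplex (verts T)" "full_simplex (verts T')" using M T conforming_full by blast+
 have "(hull_of T \<inter> hull_of T') face_of hull_of T" "(hull_of T' \<inter> hull_of T) face_of hull_of T'" using tr T by (auto simp: triangulation_def)
 then show ?thesis unfolding hull_of_def by (intro simplex_Int_face V) (simp_all add: Int_commute)
qed

lemma conforming_verts_inj:
 assumes M: "conforming M \<Omega>" and T: "T \<in> M" "T' \<in> M" "T ~= T'"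
 shows "verts T ~= verts T'" using M T by (auto simp: conforming_def inj_on_def hull_of_def)

lemma conforming_disjoint:
 assumes M: "conforming M \<Omega>" and T: "T \<in> M" "T' \<in> M" "T ~= T'"
 shows "interior (hull_of T) \<inter> interior (hull_of T') = {}" unfolding hull_of_def
proof (rule simplex_interiors_disjoint)
 show "full_simplex (verts T)" "full_simplex (verts T')" using M T conforming_full by blast+
 show "convex hull verts T \<inter> convex hull verts T' = convex hull (verts T \<inter> verts T')" using conforming_Int[OF M T(1,2)] by (simp add: hull_of_def)
 show "verts T ~= verts T'" by (rule conforming_verts_inj[OF M T])
qed

text \<open>The relative interior of the face meets \<Omega>. Any point may serve, since a witness
  on half a facet has to become a witness on the whole facet.\<close>

definition interior_face :: "'a::euclidean_space set => 'a set => bool" where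
 "interior_face \<Omega> f \<longleftrightarrow> (\<exists>c. (\<forall>v\<in>f. 0 < c v) \<and> sum c f = 1 \<and> (\<Sum>v\<in>f. c v *\<^sub>R v) \<in> \<Omega>)"

text \<open>A relative interior point \<open>x\<close> of \<open>f\<close> lies on the boundary of
  \<open>T\<close>, so \<open>T\<close> alone does not cover its neighborhoods in \<Omega>. A
  further element through \<open>x\<close> contains all vertices of \<open>f\<close>, because their
  coordinates at \<open>x\<close> are positive.\<close>

lemma conforming_face_neighbor:
 assumes M: "conforming M \<Omega>" and \<Omega>: "open \<Omega>" and T: "T \<in> M" and f: "f \<in> vfacets (verts T)" "interior_face \<Omega> f"
 shows "\<exists>T'\<in>M. T' ~= T \<and> f \<in> vfacets (verts T')"
proof -
 have V: "full_simplex (verts T)" if "T \<in> M" for T using conforming_full[OF M that] .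
 have fin: "finite (hull_of ` M)" and cov: "(\<Union>T\<in>M. hull_of T) = closure \<Omega>" using M by (auto simp: conforming_def triangulates_def triangulation_def)
 have finM: "finite M" using M fin by (auto simp: conforming_def intro: finite_imageD)
 obtain c where c: "!!v. v \<in> f ==> 0 < c v" "sum c f = 1" "(\<Sum>v\<in>f. c v *\<^sub>R v) \<in> \<Omega>" using f(2) by (auto simp: interior_face_def)
 define x where "x = (\<Sum>v\<in>f. c v *\<^sub>R v)"
 have fT: "f \<subseteq> verts T" "card f = DIM('a)" using f(1) vfacets_iff[OF V[OF T]] by auto
 obtain p where p: "verts T = insert p f" "p \<notin> f" using vfacet_insert[OF f(1)] .
 have "bary (verts T) p x = 0" unfolding x_def using bary_on_facet[OF V[OF T] fT(1) c(2), of p] p by auto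
 moreover have "p \<in> verts T" using p by simp
 ultimately have x: "x \<notin> interior (hull_of T)" unfolding hull_of_def interior_bary[OF V[OF T]] by force
 let ?R = "\<Union>T'\<in>M - {T}. hull_of T'"
 have closed: "closed ?R" using finM V by (intro closed_UN) (auto simp: hull_of_def intro!: compact_imp_closed compact_hull)
 have "x \<in> ?R"
 proof (rule ccontr)
  assume "x \<notin> ?R"
  then have "open (\<Omega> - ?R)" "x \<in> \<Omega> - ?R" using closed \<Omega> c(3) by (auto simp: x_def)
  moreover have "\<Omega> - ?R \<subseteq> hull_of T" using cov closure_subset[of \<Omega>] by auto
  ultimately have "x \<in> interior (hull_of T)" by (meson interior_maximal subsetD)
  with x show False ..
 qed
 then obtain T' where T': "T' \<in> M" "T' ~= T" "x \<in> hull_of T'" by auto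
 have "x \<in> hull_of T" unfolding hull_of_def x_def using c fT by (intro convex_sum[OF finite_subset[OF fT(1)]]) (auto intro: hull_inc less_imp_le)
 then have xI: "x \<in> convex hull (verts T \<inter> verts T')" using T' conforming_Int[OF M T T'(1)] by auto
 have "v \<in> verts T'" if "v \<in> f" for v
 proof (rule ccontr)
  assume "v \<notin> verts T'"
  then have "bary (verts T) v x = 0" using hull_subset_bary_zero[OF V[OF T] _ xI, of v] that fT by auto
  moreover have "bary (verts T) v x = c v" unfolding x_def using bary_on_facet[OF V[OF T] fT(1) c(2), of v] that fT by auto
  ultimately show False using c(1)[OF that] by simp
 qed
 then have "f \<in> vfacets (verts T')" using fT vfacets_iff[OF V[OF T'(1)]] by auto
 then show ?thesis using T' by auto
qed

lemma polyhedral_open: "polyhedral_domain \<Omega> ==> open \<Omega>" by (auto simp: polyhedral_domain_def)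

lemma polyhedral_interior_closure:
 assumes "polyhedral_domain \<Omega>"
 shows "interior (closure \<Omega>) = \<Omega>"
proof -
 obtain P where P: "finite P" "\<forall>S\<in>P. polytope S" "\<Omega> = interior (\<Union>P)" using assms by (auto simp: polyhedral_domain_def)
 have "closed (\<Union>P)" using P by (auto simp: polytope_imp_closed)
 then have "closure \<Omega> \<subseteq> \<Union>P" unfolding P(3) by (intro closure_minimal interior_subset)
 then have "interior (closure \<Omega>) \<subseteq> \<Omega>" unfolding P(3) by (rule interior_mono)
 moreover have "\<Omega> \<subseteq> interior (closure \<Omega>)" using polyhedral_open[OF assms] closure_subset by (rule interior_maximal[rotated])
 ultimately show ?thesis by auto
qed

text \<open>Uniform refinements serve as the reference in which elements of different levels of a
  mesh are compared.\<close>

primrec unif :: "'a::euclidean_space tagged set => nat => 'a tagged set" where "unif M 0 = M"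
| "unif M (Suc n) = (\<Union>T\<in>unif M n. children T)"

locale bisection_setting =
 fixes \<Omega> :: "'a::euclidean_space set" and M\<^sub>0 :: "'a tagged set"
 assumes dim: "2 \<le> DIM('a)" and poly: "polyhedral_domain \<Omega>" and match: "matching_neighbor_condition M\<^sub>0 \<Omega>"
begin

abbreviation U :: "nat => 'a tagged set" where "U \<equiv> unif M\<^sub>0"

lemma conforming_M0: "conforming M\<^sub>0 \<Omega>" using match by (simp add: matching_neighbor_condition_def)

lemma U_tagged: "T \<in> U n ==> tagged_simplex T"
proof (induction n arbitrary: T)
 case 0
 then show ?case using conforming_M0 by (simp add: conforming_def)
next
 case (Suc n)
 then show ?case using children_tagged by (simp, blast)
qed

lemma U_full: "T \<in> U n ==> full_simplex (verts T)" by (rule tagged_full_simplex[OF U_tagged])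

lemma U_SucE:
 assumes "C \<in> U (Suc n)" obtains T where "T \<in> U n" "C \<in> children T" using assms by auto

lemma U_disjoint: "T \<in> U n ==> T' \<in> U n ==> T ~= T' ==> interior (hull_of T) \<inter> interior (hull_of T') = {}"
proof (induction n arbitrary: T T')
 case 0
 then show ?case using conforming_disjoint[OF conforming_M0] by simp
next
 case (Suc n)
 obtain P where P: "P \<in> U n" "T \<in> children P" using U_SucE[OF Suc.prems(1)] .
 obtain P' where P': "P' \<in> U n" "T' \<in> children P'" using U_SucE[OF Suc.prems(2)] .
 show ?case using children_interiors_disjoint[OF U_tagged[OF P(1)]] P P' Suc.prems Suc.IH interior_hull_children U_tagged by blast
qed

lemma U_overlap_eq: "T \<in> U n ==> T' \<in> U n ==> interior (hull_of T) \<inter> interior (hull_of T') ~= {} ==> T = T'" using U_disjoint by blast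

lemma U_interior: "T \<in> U n ==> interior (hull_of T) ~= {}" using full_simplex_interior_nonempty[OF U_full] by (simp add: hull_of_def)

lemma U_parent_unique:
 assumes "T \<in> U n" "T' \<in> U n" "C \<in> children T" "C \<in> children T'"
 shows "T = T'"
proof (rule U_overlap_eq[OF assms(1,2)])
 have "C \<in> U (Suc n)" using assms by auto
 then have "interior (hull_of C) ~= {}" by (rule U_interior)
 moreover have "interior (hull_of C) \<subseteq> interior (hull_of T)" "interior (hull_of C) \<subseteq> interior (hull_of T')"
  using interior_hull_children U_tagged assms by blast+
 ultimately show "interior (hull_of T) \<inter> interior (hull_of T') ~= {}" by auto
qed

lemma U_three:
 assumes T: "T1 \<in> U n" "T2 \<in> U n" "T3 \<in> U n" and f: "f \<in> vfacets (verts T1)" "f \<in> vfacets (verts T2)" "f \<in> vfacets (verts T3)"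
 shows "T1 = T2 \<or> T1 = T3 \<or> T2 = T3"
proof -
 obtain p where p: "verts T1 = insert p f" "p \<notin> f" using vfacet_insert[OF f(1)] .
 obtain q where q: "verts T2 = insert q f" "q \<notin> f" using vfacet_insert[OF f(2)] .
 obtain r where r: "verts T3 = insert r f" "r \<notin> f" using vfacet_insert[OF f(3)] .
 show ?thesis using U_overlap_eq T three_simplices_overlap[of p f q r] U_full[OF T(1)] U_full[OF T(2)] U_full[OF T(3)] p q r by (metis hull_of_def)
qed

lemma hull_subset_closure: "T \<in> U n ==> hull_of T \<subseteq> closure \<Omega>"
proof (induction n arbitrary: T)
 case 0
 then show ?case using conforming_M0 by (auto simp: conforming_def triangulates_def)
next
 case (Suc n)
 then show ?case using hull_children[OF U_tagged] by (meson U_SucE order_trans)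
qed

text \<open>The two simplices cover a neighborhood of the barycenter of \<open>f\<close>, and
  \<Omega> is the interior of its closure; a slit along \<open>f\<close> is thus excluded.\<close>

lemma shared_face_interior:
 assumes f: "f \<in> vfacets (verts T)" "f \<in> vfacets (verts T')" and V: "full_simplex (verts T)" "full_simplex (verts T')"
  and disj: "interior (hull_of T) \<inter> interior (hull_of T') = {}" and sub: "hull_of T \<subseteq> closure \<Omega>" "hull_of T' \<subseteq> closure \<Omega>"
 shows "interior_face \<Omega> f"
proof -
 obtain p where p: "verts T = insert p f" "p \<notin> f" using vfacet_insert[OF f(1)] .
 obtain q where q: "verts T' = insert q f" "q \<notin> f" using vfacet_insert[OF f(2)] .
 interpret facet_pair f p q by unfold_locales (use p q V in auto)
 have neg: "bary (insert p f) p q < 0" using same_side_overlap bary_apex_nonzero disj p q by (auto simp: hull_of_def)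
 have card: "card f = DIM('a)" using f(1) vfacets_iff[OF V(1)] by simp
 have "(\<Sum>v\<in>f. (1 / real (card f)) *\<^sub>R v) \<in> interior (convex hull insert p f \<union> convex hull insert q f)"
  by (intro facet_point_interior[OF neg]) (use card in auto)
 also have "... \<subseteq> interior (closure \<Omega>)" using sub p q by (intro interior_mono) (auto simp: hull_of_def)
 also have "... = \<Omega>" by (rule polyhedral_interior_closure[OF poly])
 finally show ?thesis unfolding interior_face_def using card by (intro exI[of _ "%_. 1 / real (card f)"]) auto
qed

lemma U_shared_face_interior: "T \<in> U n ==> T' \<in> U n ==> T ~= T' ==> f \<in> vfacets (verts T) ==> f \<in> vfacets (verts T') ==> interior_face \<Omega> f"
 using U_full U_disjoint hull_subset_closure by (intro shared_face_interior[of f T T']) auto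

lemma new_v_facet:
 assumes T: "tagged_simplex T" and f: "f \<in> vfacets (verts T)" "new_v T \<in> convex hull f"
 shows "has_edge T f"
proof -
 note V = tagged_full_simplex[OF T]
 obtain p where p: "p \<in> verts T" "f = verts T - {p}" using f(1) by (auto simp: vfacets_def)
 show ?thesis using hull_subset_bary_zero[OF V _ f(2) p(1)] using bary_vertex[OF V p(1) ref_edge(1)[OF T]] bary_vertex[OF V p(1) ref_edge(2)[OF T]] p ref_edge[OF T] by (auto simp: new_v_def bary_midpoint)
qed

lemma cut_in_children:
 assumes T: "tagged_simplex T" and C: "C \<in> children T"
 shows "insert (new_v T) (verts T - {fst_v T, last_v T}) \<in> vfacets (verts C)"
proof -
 let ?A = "insert (new_v T)"
 have "verts C = ?A (verts T - {last_v T}) \<or> verts C = ?A (verts T - {fst_v T})"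
  using C children_eq[OF T] verts_child[OF T] verts_child[OF reflect_simps(1)[OF T]] unfolding reflect_simps(2)[OF T] reflect_simps(5,6)[OF T] by auto
 then have "\<exists>z\<in>verts C. ?A (verts T - {fst_v T, last_v T}) = verts C - {z}"
 proof
  assume "verts C = ?A (verts T - {last_v T})"
  then show ?thesis using ref_edge[OF T] new_v_notin[OF T] by (intro bexI[of _ "fst_v T"]) auto
 next
  assume "verts C = ?A (verts T - {fst_v T})"
  then show ?thesis using ref_edge[OF T] new_v_notin[OF T] by (intro bexI[of _ "last_v T"]) auto
 qed
 then show ?thesis by (auto simp: vfacets_def)
qed

lemma sibling_exists:
 assumes T: "tagged_simplex T"
 shows "\<exists>S\<in>children T. S ~= C"
using reflect_simps(4)[OF T] ref_edge(3)[OF T] children_eq[OF T] by (fastforce simp: child_def)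

lemma interior_face_under:
 assumes T: "tagged_simplex T" and f: "f \<in> vfacets (verts T)"
  and e: "e = f \<or> (has_edge T f \<and> (\<exists>z. (z = fst_v T \<or> z = last_v T) \<and> e = insert (new_v T) (f - {z})))" and i: "interior_face \<Omega> e"
 shows "interior_face \<Omega> f"
proof (cases "e = f")
 case False
 then obtain z where z: "has_edge T f" "z = fst_v T \<or> z = last_v T" "e = insert (new_v T) (f - {z})" using e by auto
 define y where "y = (if z = fst_v T then last_v T else fst_v T)"
 have yz: "y \<in> f" "z \<in> f" "y ~= z" using z ref_edge[OF T] by (auto simp: y_def)
 have m: "new_v T = midpoint y z" using z(2) by (auto simp: y_def new_v_def midpoint_sym)
 have mf: "new_v T \<notin> f" using new_v_notin[OF T] f by (auto simp: vfacets_def)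
 have fin: "finite f" using f by (auto simp: vfacets_def)
 obtain c where c: "!!v. v \<in> e ==> 0 < c v" "sum c e = 1" "(\<Sum>v\<in>e. c v *\<^sub>R v) \<in> \<Omega>" using i by (auto simp: interior_face_def)
 let ?m = "new_v T"
 \<comment> \<open>The weight of the midpoint is shared equally by the two ends of the edge; the
   point stays the same and all weights on \<open>f\<close> are positive.\<close>
 define k where "k v = (if v = z then c ?m / 2 else if v = y then c y + c ?m / 2 else c v)" for v
 have pos: "0 < k v" if "v \<in> f" for v using that c(1)[of v] c(1)[of ?m] c(1)[of y] yz z(3) by (simp add: k_def)
 define R where "R = f - {z, y}"
 have R: "f = insert z (insert y R)" "e = insert ?m (insert y R)" "finite R" "z \<notin> insert y R" "y \<notin> R" "?m \<notin> insert y R"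
  using yz fin mf z(3) by (auto simp: R_def)
 have sf: "sum g f = g z + (g y + sum g R)" for g :: "'a => 'b::comm_monoid_add" using R by simp
 have se: "sum g e = g ?m + (g y + sum g R)" for g :: "'a => 'b::comm_monoid_add" using R by simp
 have kR: "k v = c v" if "v \<in> R" for v using that by (simp add: k_def R_def)
 have ky: "k y = c y + c ?m / 2" "k z = c ?m / 2" using yz by (auto simp: k_def)
 have "sum k f = sum c e" by (simp add: sf se ky kR)
 moreover have "(\<Sum>v\<in>f. k v *\<^sub>R v) = (\<Sum>v\<in>e. c v *\<^sub>R v)" by (auto simp:m midpoint_def scaleR_add_right sf se ky kR scaleR_add_left)
 ultimately show ?thesis unfolding interior_face_def using c pos by (intro exI[of _ k]) auto
qed (use i in simp)

text \<open>The neighbor condition only provides children with some common facet \<open>e\<close>.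
  It lies in the hull of \<open>f\<close> and cannot contain the midpoint of the refinement edge, so
  it consists of vertices of \<open>f\<close> and equals \<open>f\<close>.\<close>

lemma U_base_matched:
 assumes T: "T \<in> M\<^sub>0" "T' \<in> M\<^sub>0" "T ~= T'" and f: "f \<in> vfacets (verts T)" "f \<in> vfacets (verts T')"
 shows "matched T T' f"
proof -
 have tg: "tagged_simplex T" "tagged_simplex T'" using U_tagged[of _ 0] T by auto
 note V = tagged_full_simplex[OF tg(1)] and V' = tagged_full_simplex[OF tg(2)]
 have cV: "f \<subseteq> verts T" "f \<subseteq> verts T'" "card f = DIM('a)" using f vfacets_iff[OF V] vfacets_iff[OF V'] by auto
 have "verts T \<inter> verts T' = f"
 proof -
  obtain p where p: "verts T = insert p f" "p \<notin> f" using vfacet_insert[OF f(1)] .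
  obtain q where q: "verts T' = insert q f" "q \<notin> f" using vfacet_insert[OF f(2)] .
  show ?thesis using conforming_verts_inj[OF conforming_M0 T] using p q by auto
 qed
 then have I: "hull_of T \<inter> hull_of T' = convex hull f" using conforming_Int[OF conforming_M0 T(1,2)] by simp
 have sf: "share_face T T'" using share_face_iff[OF tg] T f by auto
 let ?E = "refinement_edge T \<subseteq> hull_of T \<inter> hull_of T' \<or> refinement_edge T' \<subseteq> hull_of T \<inter> hull_of T'"
 have m: "if ?E then reflected_neighbors T T' else \<exists>C\<in>children T. \<exists>C'\<in>children T'. reflected_neighbors C C'"
  using match T sf unfolding matching_neighbor_condition_def by simp
 show ?thesis
 proof (cases ?E)
  case True
  then show ?thesis using m by (simp add: reflected_neighbors_def matched_def refl_nb_def)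
 next
  case False
  obtain C C' where C: "C \<in> children T" "C' \<in> children T'" "reflected_neighbors C C'" using m unfolding if_not_P[OF False] by auto
  have seg: "has_edge S f ==> refinement_edge S \<subseteq> convex hull f" for S unfolding refinement_edge_def fst_v_def last_v_def
   by (intro closed_segment_subset) (auto intro: hull_inc)
  have ne: "\<not> has_edge T f" "\<not> has_edge T' f" using False seg unfolding I by blast+
  have tC: "tagged_simplex C" "tagged_simplex C'" using children_tagged tg C by blast+
  obtain e where e: "e \<in> vfacets (verts C)" "e \<in> vfacets (verts C')" using C(3) share_face_iff[OF tC] by (auto simp: reflected_neighbors_def)
  have eh: "e \<subseteq> convex hull f"
  proof -
   have "e \<subseteq> hull_of C" "e \<subseteq> hull_of C'" using e by (auto simp: vfacets_def hull_of_def intro!: hull_inc)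
   then show ?thesis using hull_children[OF tg(1) C(1)] hull_children[OF tg(2) C(2)] I by blast
  qed
  have nn: "new_v T \<notin> e" using new_v_facet[OF tg(1) f(1)] eh ne by auto
  have "e = f"
  proof (rule child_facet_cases[OF tg(1) C(1) e(1)])
   assume "e = insert (new_v T) (verts T - {fst_v T, last_v T})"
   then show "e = f" using nn by simp
  next
   fix g assume g: "g \<in> vfacets (verts T)" "e = g \<or> (has_edge T g \<and> (\<exists>z. (z = fst_v T \<or> z = last_v T) \<and> e = insert (new_v T) (g - {z})))"
   then have "e \<subseteq> verts T" "card e = DIM('a)" using nn using vfacets_iff[OF V] by auto
   then have "e \<subseteq> f" using eh hull_subset_iff[OF V cV(1)] by auto
   then show "e = f" using cV \<open>card e = DIM('a)\<close> full_simplex_finite[OF V] finite_subset card_subset_eq by metis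
  qed
  then show ?thesis unfolding matched_def using ne C e by (auto simp: reflected_neighbors_def refl_nb_def)
 qed
qed

text \<open>The induction invariant for uniform levels: conformity across facets together with the
  matching condition that reproduces it.\<close>

definition conf_facets :: "nat => bool" where "conf_facets n \<longleftrightarrow>
  (\<forall>T\<in>U n. \<forall>T'\<in>U n. \<forall>f. T ~= T' --> f \<in> vfacets (verts T) --> f \<in> vfacets (verts T') --> matched T T' f) \<and>
  (\<forall>T\<in>U n. \<forall>f\<in>vfacets (verts T). interior_face \<Omega> f --> (\<exists>T'\<in>U n. T' ~= T \<and> f \<in> vfacets (verts T')))"

lemma conf_facets_matched: "conf_facets n ==> T \<in> U n ==> T' \<in> U n ==> T' ~= T ==> f \<in> vfacets (verts T) ==> f \<in> vfacets (verts T') ==>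
  matched T T' f" by (simp add: conf_facets_def)

lemma conf_facets_neighbor:
 assumes "conf_facets n" "T \<in> U n" "f \<in> vfacets (verts T)" "interior_face \<Omega> f"
 obtains T' where "T' \<in> U n" "T' ~= T" "f \<in> vfacets (verts T')"
using assms(1)[unfolded conf_facets_def, THEN conjunct2] assms(2-4) by blast

text \<open>If \<open>e\<close> were the cut facet of \<open>T\<close>, the sibling of
  \<open>C\<close> would be a third element there. Hence \<open>e\<close> lies under a facet
  \<open>f\<close> of \<open>T\<close>; the neighbor of \<open>T\<close> across \<open>f\<close> has
  a child at \<open>e\<close>, and since at most two elements meet there, that child is
  \<open>C'\<close>.\<close>

lemma parents_share_aux:
 assumes cf: "conf_facets n" and T: "T \<in> U n" "T' \<in> U n" "T ~= T'" and C: "C \<in> children T" "C' \<in> children T'"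
  and e: "e \<in> vfacets (verts C)" "e \<in> vfacets (verts C')"
 shows "refl_nb C C' \<and> (\<exists>f. f \<in> vfacets (verts T) \<and> f \<in> vfacets (verts T') \<and>
  (e = f \<or> (has_edge T f \<and> (\<exists>z. (z = fst_v T \<or> z = last_v T) \<and> e = insert (new_v T) (f - {z})))))"
proof -
 note tg = U_tagged[OF T(1)] U_tagged[OF T(2)]
 have CU: "C \<in> U (Suc n)" "C' \<in> U (Suc n)" using T C by auto
 have CC: "C ~= C'" using U_parent_unique[OF T(1,2) C(1)] C(2) T(3) by auto
 have ie: "interior_face \<Omega> e" by (rule U_shared_face_interior[OF CU CC e])
 show ?thesis
 proof (rule child_facet_cases[OF tg(1) C(1) e(1)])
  assume cut: "e = insert (new_v T) (verts T - {fst_v T, last_v T})"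
  obtain S where S: "S \<in> children T" "S ~= C" using sibling_exists[OF tg(1)] by blast
  have "e \<in> vfacets (verts S)" using cut_in_children[OF tg(1) S(1)] cut by simp
  moreover have "S \<in> U (Suc n)" using S T by auto
  ultimately have "S = C'" using U_three[OF CU, of S e] e CC S(2) by blast
  then show ?thesis using U_parent_unique[OF T(1,2) S(1)] C(2) T(3) by auto
 next
  fix f assume f: "f \<in> vfacets (verts T)" "under T f e" "e = f \<or> (has_edge T f \<and> (\<exists>z. (z = fst_v T \<or> z = last_v T) \<and> e = insert (new_v T) (f - {z})))"
  have "interior_face \<Omega> f" by (rule interior_face_under[OF tg(1) f(1,3) ie])
  then obtain T'' where T'': "T'' \<in> U n" "T'' ~= T" "f \<in> vfacets (verts T'')" using conf_facets_neighbor[OF cf T(1) f(1)] by auto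
  have "matched T T'' f" by (rule conf_facets_matched[OF cf T(1) T''(1,2) f(1) T''(3)])
  then obtain C'' where C'': "C'' \<in> children T''" "e \<in> vfacets (verts C'')" "refl_nb C C''"
   using children_match[OF tg(1) U_tagged[OF T''(1)] _ f(1) T''(3) C(1) e(1) f(2)] by auto
  have CU'': "C'' \<in> U (Suc n)" using C'' T'' by auto
  have "C'' = C'" using U_three[OF CU CU'' e C''(2)] CC U_parent_unique[OF T(1) T''(1) C(1)] C''(1) T''(2) by auto
  moreover from this have "T'' = T'" using U_parent_unique[OF T(2) T''(1) C(2)] C''(1) by simp
  ultimately show ?thesis using f T'' C'' by auto
 qed
qed

lemma conf_facets: "conf_facets n"
proof (induction n)
 case 0
 show ?case unfolding conf_facets_def using U_base_matched conforming_face_neighbor[OF conforming_M0 polyhedral_open[OF poly]] by simp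
next
 case (Suc n)
 show ?case unfolding conf_facets_def
 proof (intro conjI ballI allI impI)
  fix C C' e
  assume C: "C \<in> U (Suc n)" "C' \<in> U (Suc n)" "C ~= C'" and e: "e \<in> vfacets (verts C)" "e \<in> vfacets (verts C')"
  obtain T where T: "T \<in> U n" "C \<in> children T" using U_SucE[OF C(1)] .
  obtain T' where T': "T' \<in> U n" "C' \<in> children T'" using U_SucE[OF C(2)] .
  show "matched C C' e"
  proof (cases "T = T'")
   case True
   then show ?thesis using matched_sym_siblings[OF U_tagged[OF T(1)]] T T' C e by simp
  next
   case False
   then show ?thesis using parents_share_aux[OF Suc T(1) T'(1) False T(2) T'(2) e] by (simp add: matched_def)
  qed
 next
  fix C e assume C: "C \<in> U (Suc n)" and e: "e \<in> vfacets (verts C)" "interior_face \<Omega> e"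
  obtain T where T: "T \<in> U n" "C \<in> children T" using U_SucE[OF C(1)] .
  note tg = U_tagged[OF T(1)]
  show "\<exists>C'\<in>U (Suc n). C' ~= C \<and> e \<in> vfacets (verts C')"
  proof (rule child_facet_cases[OF tg T(2) e(1)])
   assume cut: "e = insert (new_v T) (verts T - {fst_v T, last_v T})"
   obtain S where S: "S \<in> children T" "S ~= C" using sibling_exists[OF tg] by blast
   show ?thesis using cut_in_children[OF tg S(1)] cut using S T by auto
  next
   fix f assume f: "f \<in> vfacets (verts T)" "under T f e"
    "e = f \<or> (has_edge T f \<and> (\<exists>z. (z = fst_v T \<or> z = last_v T) \<and> e = insert (new_v T) (f - {z})))"
   have "interior_face \<Omega> f" by (rule interior_face_under[OF tg f(1,3) e(2)])
   then obtain T' where T': "T' \<in> U n" "T' ~= T" "f \<in> vfacets (verts T')" using conf_facets_neighbor[OF Suc T(1) f(1)] by auto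
   have "matched T T' f" by (rule conf_facets_matched[OF Suc T(1) T'(1,2) f(1) T'(3)])
   then obtain C' where C': "C' \<in> children T'" "e \<in> vfacets (verts C')" using children_match[OF tg U_tagged[OF T'(1)] _ f(1) T'(3) T(2) e(1) f(2)] by auto
   have "C' ~= C" using U_parent_unique[OF T(1) T'(1) T(2)] C'(1) T'(2) by auto
   then show ?thesis using C' T' by auto
  qed
 qed
qed

end

section \<open>Levels of neighbouring simplices\<close>

context bisection_setting
begin

lemma refinement_sub: "refinement M N ==> M \<subseteq> (\<Union>n. U n) ==> N \<subseteq> (\<Union>n. U n)" unfolding refinement_def
proof (induction rule: rtranclp_induct)
 case (step N N')
 then obtain T where T: "T \<in> N" "N' = bisect N {T}" by auto
 then obtain n where "T \<in> U n" using step by auto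
 then have "children T \<subseteq> U (Suc n)" by auto
 then have "children T \<subseteq> (\<Union>n. U n)" by blast
 moreover have "N \<subseteq> (\<Union>n. U n)" using step by simp
 ultimately show ?case by (auto simp: T(2) bisect_def)
qed simp

lemma bisect_sub:
 assumes "M \<subseteq> (\<Union>n. U n)" "S \<subseteq> M"
 shows "bisect M S \<subseteq> (\<Union>n. U n)"
proof -
 have "children T \<subseteq> (\<Union>n. U n)" if T: "T \<in> S" for T
 proof -
  obtain n where "T \<in> U n" using assms T by auto
  then have "children T \<subseteq> U (Suc n)" by auto
  then show ?thesis by blast
 qed
 then show ?thesis using assms unfolding bisect_def by auto
qed

lemma mesh_sub: "BiSec_mesh \<Omega> M\<^sub>0 M ==> M \<subseteq> (\<Union>n. U n)"
proof (induction rule: BiSec_mesh.induct)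
 case initial
 show ?case by (rule UN_upper[of 0 UNIV U, simplified])
next
 case (refine M S M')
 then have "refinement (bisect M S) M'" by (simp add: smallest_conforming_refinement_def)
 then show ?case by (rule refinement_sub) (rule bisect_sub[OF refine.IH refine.hyps(2)])
qed

lemma mesh_conforming: "BiSec_mesh \<Omega> M\<^sub>0 M ==> conforming M \<Omega>"
 by (induction rule: BiSec_mesh.induct) (simp_all add: conforming_M0 smallest_conforming_refinement_def)

lemma U_ancestor: "T \<in> U (n + k) ==> \<exists>A\<in>U n. hull_of T \<subseteq> hull_of A"
proof (induction k arbitrary: T)
 case (Suc k)
 then obtain P where P: "P \<in> U (n + k)" "T \<in> children P" by auto
 then have "hull_of T \<subseteq> hull_of P" using hull_children U_tagged by blast
 then show ?case using Suc.IH[OF P(1)] by auto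
qed auto

lemma child_misses_vertex:
 assumes T: "tagged_simplex T" and C: "C \<in> children T"
 shows "\<not> (fst_v T \<in> hull_of C \<and> last_v T \<in> hull_of C)"
proof
 assume *: "fst_v T \<in> hull_of C \<and> last_v T \<in> hull_of C"
 note V = tagged_full_simplex[OF T]
 let ?A = "bary (verts T)"
 have b: "?A (last_v T) (last_v T) = 1" "?A (fst_v T) (last_v T) = 0" "?A (fst_v T) (fst_v T) = 1" "?A (last_v T) (fst_v T) = 0"
  using ref_edge[OF T] by (auto simp: bary_vertex[OF V])
 consider "C = child T" | "C = child (reflect T)" using C children_eq[OF T] by auto
 then show False
 proof cases
  case 1
  then show False using * b unfolding 1 hull_child[OF T] by auto
 next
  case 2
  show False using * b reflect_simps[OF T] by (simp add: 2 hull_child[OF reflect_simps(1)[OF T]])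
 qed
qed

text \<open>The old inner vertices end the list of the child; there is at least one because d \<ge>
  2.\<close>

lemma last_v_child:
 assumes T: "tagged_simplex (T :: 'a tagged)"
 shows "last_v (child T) \<in> verts T - {last_v T}"
proof -
 obtain a A B b where s: "T = (a # A @ B @ [b], length A)" "length A + length B + 1 = DIM('a)" using tagged_cases[OF T] by metis
 define L where "L = A @ B"
 have L: "L ~= []" using s(2) dim by (auto simp: L_def)
 have "last_v (child T) = last L" using L unfolding s(1) child_split last_v_def L_def[symmetric] by simp
 then have "last_v (child T) \<in> set (A @ B)" using last_in_set[OF L] by (simp add: L_def)
 moreover have "distinct (a # A @ B @ [b])" using T by (simp add: s tagged_simplex_def)
 ultimately show ?thesis by (auto simp: s(1))
qed

text \<open>A child keeps only one end of the refinement edge, so a facet inside it consists of all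
  vertices but the other end. It then contains both ends of the refinement edge of the child, which
  no grandchild does.\<close>

lemma facet_not_in_grandchild:
 assumes A: "tagged_simplex (A :: 'a tagged)" and C: "C \<in> children A" and D: "D \<in> children C" and f: "f \<in> vfacets (verts A)"
 shows "\<not> f \<subseteq> hull_of D"
proof
 assume fD: "f \<subseteq> hull_of D"
 have tC: "tagged_simplex C" by (rule children_tagged[OF A C])
 have fC: "f \<subseteq> hull_of C" using fD hull_children[OF tC D] by simp
 have main: False if R: "tagged_simplex R" "C = child R" "f \<in> vfacets (verts R)" for R
 proof -
  have "\<not> (fst_v R \<in> f \<and> last_v R \<in> f)" using child_misses_vertex[OF R(1), of C] fC R(2) children_eq[OF R(1)] by auto
  moreover have "last_v R \<notin> f" using fC R(2) ref_edge[OF R(1)] bary_vertex[OF tagged_full_simplex[OF R(1)]] by (auto simp: hull_child[OF R(1)])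
  ultimately have "fst_v C \<in> f" "last_v C \<in> f" using ref_edge[OF R(1)] last_v_child[OF R(1)] R(3) by (auto simp: vfacets_def R(2) child_def fst_v_def)
  then show False using child_misses_vertex[OF tC D] fD by auto
 qed
 show False using C children_eq[OF A] using main[OF A _ f] main[OF reflect_simps(1)[OF A]] f reflect_simps(2)[OF A] by auto
qed

text \<open>On the level of \<open>T'\<close> there are two elements at \<open>f\<close>. Together
  with \<open>T\<close> these are three simplices on one facet, and neither \<open>T\<close> nor the
  second one overlaps \<open>T'\<close>.\<close>

lemma overlapping_neighbor:
 assumes M: "conforming M \<Omega>" and T: "T \<in> M" "T' \<in> M" "T ~= T'" "T \<in> U l" "T' \<in> U l'" and f: "f \<in> vfacets (verts T)" "f \<in> vfacets (verts T')"
 obtains T'' where "T'' \<in> U l'" "T'' ~= T'" "f \<in> vfacets (verts T'')" "interior (hull_of T) \<inter> interior (hull_of T'') ~= {}"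
proof -
 note V = U_full[OF T(4)] and V' = U_full[OF T(5)]
 have disj: "interior (hull_of T) \<inter> interior (hull_of T') = {}" by (rule conforming_disjoint[OF M T(1-3)])
 have "interior_face \<Omega> f" by (rule shared_face_interior[OF f V V' disj hull_subset_closure[OF T(4)] hull_subset_closure[OF T(5)]])
 then obtain T'' where T'': "T'' \<in> U l'" "T'' ~= T'" "f \<in> vfacets (verts T'')" using conf_facets_neighbor[OF conf_facets T(5) f(2)] by auto
 have disj': "interior (hull_of T') \<inter> interior (hull_of T'') = {}" using U_disjoint[OF T(5) T''(1)] T''(2) by simp
 obtain p where p: "verts T = insert p f" "p \<notin> f" using vfacet_insert[OF f(1)] .
 obtain q where q: "verts T' = insert q f" "q \<notin> f" using vfacet_insert[OF f(2)] .
 obtain r where r: "verts T'' = insert r f" "r \<notin> f" using vfacet_insert[OF T''(3)] .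
 show thesis using that T'' three_simplices_overlap[of p f q r] V V' U_full[OF T''(1)] p q r disj disj' by (simp add: hull_of_def)
qed

text \<open>Otherwise the overlapping element found on level \<open>l'\<close> lies in a grandchild
  of \<open>T\<close> and still has \<open>f\<close> as a facet.\<close>

lemma neighbor_levels:
 assumes M: "conforming M \<Omega>" and T: "T \<in> M" "T' \<in> M" "T ~= T'" "T \<in> U l" "T' \<in> U l'" and f: "f \<in> vfacets (verts T)" "f \<in> vfacets (verts T')"
 shows "l' \<le> l + 1"
proof (rule ccontr)
 assume "\<not> ?thesis"
 then obtain k where k: "l' = Suc (Suc l) + k" using le_Suc_ex[of "l + 2" l'] by auto
 obtain T'' where T'': "T'' \<in> U l'" "T'' ~= T'" "f \<in> vfacets (verts T'')" "interior (hull_of T) \<inter> interior (hull_of T'') ~= {}"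
  by (rule overlapping_neighbor[OF M T f])
 obtain D where D: "D \<in> U (Suc (Suc l))" "hull_of T'' \<subseteq> hull_of D" using U_ancestor T''(1) k by blast
 obtain C where C: "C \<in> U (Suc l)" "D \<in> children C" by (rule U_SucE[OF D(1)])
 obtain A where A: "A \<in> U l" "C \<in> children A" by (rule U_SucE[OF C(1)])
 have "interior (hull_of T'') \<subseteq> interior (hull_of A)" using hull_children[OF U_tagged[OF A(1)] A(2)] hull_children[OF U_tagged[OF C(1)] C(2)] using D(2) by (intro interior_mono) blast
 then have "A = T" using U_overlap_eq[OF A(1) T(4)] T''(4) by auto
 moreover have "f \<subseteq> hull_of D"
 proof -
  have "f \<subseteq> hull_of T''" using T''(3) by (auto simp: vfacets_def hull_of_def intro!: hull_inc)
  then show ?thesis using D(2) by simp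
 qed
 ultimately show False using facet_not_in_grandchild[OF U_tagged[OF A(1)] A(2) C(2)] f(1) by simp
qed

definition newest :: "'a tagged => 'a" where "newest T = fst T ! 1"

text \<open>The facet of \<open>T'\<close> shared with a coarser neighbour \<open>T\<close> does not contain the newest vertex of
  \<open>T'\<close>, which is the midpoint of an edge on the level of \<open>T\<close>.\<close>

lemma coarser_neighbor_facet:
 assumes M: "conforming M \<Omega>" and T: "T \<in> M" "T' \<in> M" "T ~= T'" "T \<in> U l" "T' \<in> U (Suc l)" and f: "f \<in> vfacets (verts T)" "f \<in> vfacets (verts T')"
 shows "f = verts T' - {newest T'}"
proof -
 obtain T'' where T'': "T'' \<in> U (Suc l)" "T'' ~= T'" "f \<in> vfacets (verts T'')" "interior (hull_of T) \<inter> interior (hull_of T'') ~= {}"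
  by (rule overlapping_neighbor[OF M T f])
 obtain A where A: "A \<in> U l" "T'' \<in> children A" by (rule U_SucE[OF T''(1)])
 have AT: "A = T" using interior_hull_children[OF U_tagged[OF A(1)] A(2)] using U_overlap_eq[OF A(1) T(4)] T''(4) by auto
 obtain P where P: "P \<in> U l" "T' \<in> children P" by (rule U_SucE[OF T(5)])
 note tP = U_tagged[OF P(1)] and tT = U_tagged[OF T(4)]
 have PT: "P ~= T" using interior_hull_children[OF tP P(2)] conforming_disjoint[OF M T(1-3)] U_interior[OF T(5)] by auto
 obtain g where g: "g \<in> vfacets (verts P)" "g \<in> vfacets (verts T)"
  "f = g \<or> (has_edge P g \<and> (\<exists>z. (z = fst_v P \<or> z = last_v P) \<and> f = insert (new_v P) (g - {z})))"
  using parents_share_aux[OF conf_facets P(1) T(4) PT P(2) A(2)[unfolded AT] f(2) T''(3)] by auto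
 \<comment> \<open>A half facet would contain the midpoint of an edge of \<open>T\<close>, which is
   no vertex of \<open>T\<close>.\<close>
 have "f = g" using g(3) g(2) f(1) bisected_full_simplex(2)[OF tagged_full_simplex[OF tT]] ref_edge(3)[OF tP] by (auto simp: vfacets_def new_v_def)
 then have nf: "new_v P \<notin> f" using g(1) new_v_notin[OF tP] by (auto simp: vfacets_def)
 have "T' = child P \<or> T' = child (reflect P)" using P(2) children_eq[OF tP] by simp
 then have "newest T' = new_v P" using reflect_simps(6)[OF tP] by (auto simp: newest_def child_def)
 moreover have "newest T' \<in> verts T'" using U_tagged[OF T(5)] by (simp add: newest_def tagged_simplex_def)
 ultimately show ?thesis using nf f(2) by (auto simp: vfacets_def)
qed

end

section \<open>Shape regularity\<close>

text \<open>The d-th power is 2^-n, the factor by which \<open>n\<close> bisections reduce the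
  volume.\<close>

definition mesh_size :: "nat => nat => real" where "mesh_size d n = 2 powr (- real n / real d)"

lemma mesh_size_pos [simp]: "0 < mesh_size d n" by (simp add: mesh_size_def)

text \<open>For a tagged simplex $(x_0,\dots,x_d)_\gamma$ the increments of the path
  $x_0,x_{\gamma+1},\dots,x_d,2x_1-x_0,\dots,2x_\gamma-x_0$ are, up to signs and order, unchanged by
  bisection, except that they are halved when the type returns to zero.\<close>

definition tag_path :: "'a::real_vector list => nat => 'a list" where "tag_path xs g = hd xs # drop (Suc g) xs @ map (%x. 2 *\<^sub>R x - hd xs) (take g (tl xs))"

definition steps_in :: "'a::real_vector set => 'a list => bool" where "steps_in E ps \<longleftrightarrow> (\<forall>i. Suc i < length ps --> ps ! Suc i - ps ! i \<in> E)"

lemma steps_in_Nil [simp]: "steps_in E []" "steps_in E [x]" by (auto simp: steps_in_def)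

lemma steps_in_Cons2 [simp]: "steps_in E (x # y # ps) \<longleftrightarrow> y - x \<in> E \<and> steps_in E (y # ps)" by (auto simp: steps_in_def nth_Cons split: nat.splits)

lemma steps_in_append: "xs ~= [] ==> ys ~= [] ==> steps_in E (xs @ ys) \<longleftrightarrow> steps_in E xs \<and> hd ys - last xs \<in> E \<and> steps_in E ys"
proof (induction xs rule: induct_list012)
 case (2 x)
 then show ?case by (cases ys) auto
qed auto

lemma steps_in_translate: "steps_in E (map (%x. x + t) xs) \<longleftrightarrow> steps_in E xs" by (simp add: steps_in_def)

lemma steps_in_rev:
 assumes "!!e. e \<in> E ==> - e \<in> E"
 shows "steps_in E (rev xs) \<longleftrightarrow> steps_in E xs"
proof -
 have neg: "x - y \<in> E \<longleftrightarrow> y - x \<in> E" for x y using assms[of "x - y"] assms[of "y - x"] by auto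
 show ?thesis
 proof (induction xs rule: induct_list012)
  case (3 x y zs)
  have "steps_in E (rev (x # y # zs)) \<longleftrightarrow> steps_in E (rev (y # zs) @ [x])" by simp
  also have "... \<longleftrightarrow> steps_in E (rev (y # zs)) \<and> x - y \<in> E" by (subst steps_in_append) auto
  finally show ?case using 3 neg by auto
 qed auto
qed

lemma steps_in_scale:
 assumes "steps_in E xs"
 shows "steps_in ((%e. t *\<^sub>R e) ` E) (map (%x. a + t *\<^sub>R x) xs)" using assms by (auto simp: steps_in_def scaleR_diff_right[symmetric])

lemma path_split: "tag_path (a # A @ B @ [b]) (length A) = a # B @ b # map (%x. 2 *\<^sub>R x - a) A" by (simp add: tag_path_def)

context
 fixes E :: "'a::real_vector set"
 assumes sym: "!!e. e \<in> E ==> - e \<in> E"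
begin

text \<open>Reflection reverses the part from \<open>a\<close> to \<open>b\<close> and translates
  the remaining points by a - b; for a symmetric set of steps neither matters.\<close>

lemma path_reflect:
 assumes "steps_in E (tag_path (a # A @ B @ [b]) (length A))"
 shows "steps_in E (tag_path (b # A @ rev B @ [a]) (length A))"
proof -
 let ?A = "map (%x. 2 *\<^sub>R x - a) A"
 let ?C = "steps_in E"
 have 1: "?C (a # B @ b # ?A)" using assms by (simp only: path_split)
 have "?C (a # B @ [b])" using 1 steps_in_append[of "a # B @ [b]" "?A" E] by force
 then have "?C (rev (a # B @ [b]))" using steps_in_rev[OF sym] by blast
 then have 2: "?C (b # rev B @ [a])" by simp
 show ?thesis
 proof (cases A)
  case Nil
  then show ?thesis using 2 by (simp add: tag_path_def)
 next
  case (Cons x A')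
  have "?C ((a # B @ [b]) @ ?A)" using 1 by simp
  then have 3: "hd ?A - b \<in> E" "?C ?A" using Cons by (subst (asm) steps_in_append; simp)+
  let ?B = "map (%x. 2 *\<^sub>R x - b) A"
  have m: "?B = map (%x. x + (a - b)) ?A" by simp
  have "?C ?B" unfolding m using 3(2) steps_in_translate by blast
  moreover have "hd ?B - a \<in> E" using 3(1) Cons by (simp add: algebra_simps)
  ultimately have "?C ((b # rev B @ [a]) @ ?B)" using 2 Cons by (subst steps_in_append) auto
  then show ?thesis by (simp add: path_split)
 qed
qed

end

text \<open>As long as \<open>B\<close> is nonempty the midpoint m enters the path as 2m - a = b, so
  the path of the child is literally that of the parent.\<close>

lemma path_child:
 assumes "B ~= []"
 shows "tag_path (a # midpoint a b # A @ B) (Suc (length A)) = tag_path (a # A @ B @ [b]) (length A)"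
by (auto simp:midpoint_def tag_path_def)

text \<open>The type returns to zero and the path contracts by one half towards
  \<open>a\<close>.\<close>

lemma path_child_last: "tag_path (a # midpoint a b # A) 0 = map (%x. (1/2) *\<^sub>R a + (1/2) *\<^sub>R x) (tag_path (a # A @ [b]) (length A))"
proof -
 have "(1/2) *\<^sub>R a + (1/2) *\<^sub>R a = a" by (simp add: scaleR_left_distrib[symmetric])
 moreover have "map (%x. (1/2) *\<^sub>R a + (1/2) *\<^sub>R x) (map (%x. 2 *\<^sub>R x - a) A) = A" unfolding map_map by (rule map_idI) (simp add: scaleR_diff_right)
 ultimately show ?thesis by (simp add: tag_path_def midpoint_def scaleR_add_right)
qed

primrec sums_of :: "'a::real_vector set => nat => 'a set" where "sums_of E 0 = {0}"
| "sums_of E (Suc n) = {s + e | s e. s \<in> sums_of E n \<and> e \<in> E}"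

lemma finite_sums_of: "finite E ==> finite (sums_of E n)" by (induction n) (auto intro: finite_image_set2)

lemma steps_in_sums:
 assumes "steps_in ((%e. t *\<^sub>R e) ` E) ps" "i < length ps"
 shows "ps ! i - ps ! 0 \<in> (%e. t *\<^sub>R e) ` sums_of E i" using assms(2)
proof (induction i)
 case (Suc i)
 then obtain s where s: "s \<in> sums_of E i" "ps ! i - ps ! 0 = t *\<^sub>R s" by auto
 obtain e where e: "e \<in> E" "ps ! Suc i - ps ! i = t *\<^sub>R e" using assms(1) Suc.prems by (auto simp: steps_in_def)
 have "ps ! Suc i - ps ! 0 = (ps ! Suc i - ps ! i) + (ps ! i - ps ! 0)" by simp
 also have "... = t *\<^sub>R (s + e)" by (simp add: s e scaleR_add_right)
 finally show ?case using s e by auto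
qed simp

lemma tag_path_entries:
 assumes "x \<in> set (a # A @ B @ [b])"
 shows "x \<in> set (tag_path (a # A @ B @ [b]) (length A)) \<or> 2 *\<^sub>R x - a \<in> set (tag_path (a # A @ B @ [b]) (length A))" using assms by (auto simp: path_split)

context bisection_setting
begin

definition type0 :: nat where "type0 = (SOME g. \<forall>T\<in>M\<^sub>0. snd T = g)"

definition halvings :: "nat => nat" where "halvings n = (type0 + n) div DIM('a)"

lemma finite_M0: "finite M\<^sub>0"
proof -
 have "finite (hull_of ` M\<^sub>0)" "inj_on hull_of M\<^sub>0" using conforming_M0 by (auto simp: conforming_def triangulates_def triangulation_def)
 then show ?thesis by (rule finite_imageD)
qed

lemma M0_nonempty: "M\<^sub>0 ~= {}"
proof
 assume "M\<^sub>0 = {}"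
 then have "closure \<Omega> = {}" using conforming_M0 by (simp add: conforming_def triangulates_def)
 then show False using poly by (simp add: polyhedral_domain_def)
qed

lemma type0: "T \<in> M\<^sub>0 ==> snd T = type0"
proof -
 have "\<exists>g. \<forall>T\<in>M\<^sub>0. snd T = g" using match by (simp add: matching_neighbor_condition_def)
 then have "\<forall>T\<in>M\<^sub>0. snd T = type0" unfolding type0_def by (rule someI_ex)
 then show "T \<in> M\<^sub>0 ==> snd T = type0" by simp
qed

lemma type0_less: "type0 < DIM('a)"
proof -
 obtain T where "T \<in> M\<^sub>0" using M0_nonempty by auto
 then show ?thesis using type0 U_tagged[of T 0] by (simp add: tagged_simplex_def)
qed

lemma U_type: "T \<in> U n ==> snd T = (type0 + n) mod DIM('a)"
proof (induction n arbitrary: T)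
 case 0
 then show ?case using type0 type0_less by simp
next
 case (Suc n)
 obtain P where P: "P \<in> U n" "T \<in> children P" by (rule U_SucE[OF Suc.prems])
 have "T = child P \<or> T = child (reflect P)" using P(2) children_eq[OF U_tagged[OF P(1)]] by simp
 then show ?case using Suc.IH[OF P(1)] reflect_simps(3)[OF U_tagged[OF P(1)]] by (auto simp: child_def mod_simps)
qed

text \<open>All ordered differences on initial paths, not only consecutive ones, which makes the set
  symmetric.\<close>

definition steps0 :: "'a set" where "steps0 = (\<Union>T\<in>M\<^sub>0. \<Union>x\<in>set (tag_path (fst T) (snd T)). \<Union>y\<in>set (tag_path (fst T) (snd T)). {x - y})"

lemma finite_steps0: "finite steps0" unfolding steps0_def using finite_M0 by simp

lemma steps0I: "T \<in> M\<^sub>0 ==> x \<in> set (tag_path (fst T) (snd T)) ==> y \<in> set (tag_path (fst T) (snd T)) ==>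
  x - y \<in> steps0" by (auto simp: steps0_def)

lemma steps0_sym:
 assumes "e \<in> steps0"
 shows "- e \<in> steps0"
proof -
 obtain T x y where "T \<in> M\<^sub>0" "x \<in> set (tag_path (fst T) (snd T))" "y \<in> set (tag_path (fst T) (snd T))" "e = x - y" using assms unfolding steps0_def by auto
 then show ?thesis using steps0I[of T y x] by simp
qed

lemma path_child_steps:
 assumes T: "tagged_simplex (T :: 'a tagged)" and s: "steps_in ((%e. (1/2^k) *\<^sub>R e) ` steps0) (tag_path (fst T) (snd T))"
 shows "steps_in ((%e. (1/2^(if snd T + 1 = DIM('a) then Suc k else k)) *\<^sub>R e) ` steps0) (tag_path (fst (child T)) (snd (child T)))"
proof -
 obtain a A B b where sp: "T = (a # A @ B @ [b], length A)" "length A + length B + 1 = DIM('a)" using tagged_cases[OF T] by metis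
 show ?thesis
 proof (cases "B = []")
  case False
  then have l: "length A + 1 < DIM('a)" using sp(2) by (cases B) auto
  show ?thesis using s l path_child[OF False, of a b A] by (simp add: sp(1) child_split)
 next
  case True
  then have l: "length A + 1 = DIM('a)" using sp(2) by simp
  have "tag_path (fst (child T)) (snd (child T)) =
    map (%x. (1/2) *\<^sub>R a + (1/2) *\<^sub>R x) (tag_path (fst T) (snd T))" using path_child_last[of a b A] l True child_split[of a A "[]" b] by (simp add: sp(1))
  moreover have "(%e. (1/2) *\<^sub>R e) ` (%e. (1/2^k) *\<^sub>R e) ` steps0 = (%e. (1/2^Suc k) *\<^sub>R e) ` steps0" by force
  ultimately show ?thesis using steps_in_scale[OF s, of "1/2" "(1/2) *\<^sub>R a"] l by (simp add: sp(1))
 qed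
qed

lemma path_reflect_steps:
 assumes T: "tagged_simplex (T :: 'a tagged)" and s: "steps_in ((%e. t *\<^sub>R e) ` steps0) (tag_path (fst T) (snd T))"
 shows "steps_in ((%e. t *\<^sub>R e) ` steps0) (tag_path (fst (reflect T)) (snd (reflect T)))"
proof -
 obtain a A B b where sp: "T = (a # A @ B @ [b], length A)" using tagged_cases[OF T] by metis
 let ?A = "(%e. t *\<^sub>R e)"
 have sym: "- e \<in> ?A ` steps0" if "e \<in> ?A ` steps0" for e using that steps0_sym by force
 show ?thesis using path_reflect[of "?A ` steps0" a A B b, OF sym] s by (simp add: sp)
qed

lemma U_steps: "T \<in> U n ==> steps_in ((%e. (1/2^halvings n) *\<^sub>R e) ` steps0) (tag_path (fst T) (snd T))"
proof (induction n arbitrary: T)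
 case 0
 have "halvings 0 = 0" using type0_less by (simp add: halvings_def)
 moreover have "tag_path (fst T) (snd T) ! Suc i - tag_path (fst T) (snd T) ! i \<in> steps0"
  if "Suc i < length (tag_path (fst T) (snd T))" for i using 0 that by (intro steps0I[of T] nth_mem) auto
 ultimately show ?case by (simp add: steps_in_def)
next
 case (Suc n)
 obtain P where P: "P \<in> U n" "T \<in> children P" by (rule U_SucE[OF Suc.prems])
 note tP = U_tagged[OF P(1)]
 show ?case using P(2) children_eq[OF tP] path_child_steps[OF tP Suc.IH[OF P(1)]] path_child_steps[OF reflect_simps(1)[OF tP] path_reflect_steps[OF tP Suc.IH[OF P(1)]]] by (auto simp: halvings_def U_type[OF P(1)] div_Suc mod_Suc reflect_simps(3)[OF tP])
qed

text \<open>Half sums occur because a vertex \<open>x\<close> enters the path either itself or as 2x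
  - a.\<close>

definition shape_points :: "'a set" where "shape_points = (\<Union>i\<le>DIM('a). sums_of steps0 i \<union> (%z. (1/2) *\<^sub>R z) ` sums_of steps0 i)"

lemma finite_shape_points: "finite shape_points" unfolding shape_points_def using finite_sums_of[OF finite_steps0] by simp

text \<open>Path increments come from one finite set, up to the scale 2^-halvings, so only finitely
  many vertex sets occur up to translation and scale.\<close>

lemma U_shape:
 assumes T: "T \<in> U n"
 obtains a Y where "Y \<subseteq> shape_points" "full_simplex Y" "verts T = (%z. a + (1/2^halvings n) *\<^sub>R z) ` Y"
proof -
 obtain a A B b where sp: "T = (a # A @ B @ [b], length A)" "length A + length B + 1 = DIM('a)" using tagged_cases[OF U_tagged[OF T]] by metis
 define t :: real where "t = 1/2^halvings n"
 have t: "t > 0" by (simp add: t_def)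
 define ps where "ps = tag_path (fst T) (snd T)"
 have st: "steps_in ((%e. t *\<^sub>R e) ` steps0) ps" using U_steps[OF T] by (simp add: ps_def t_def)
 have ps0: "ps ! 0 = a" and len: "length ps = Suc DIM('a)" using sp(2) by (auto simp: ps_def sp(1) path_split)
 have ent: "\<exists>i\<le>DIM('a). \<exists>z\<in>sums_of steps0 i. y - a = t *\<^sub>R z" if "y \<in> set ps" for y
 proof -
  obtain i where i: "i < length ps" "y = ps ! i" using \<open>y \<in> set ps\<close> unfolding in_set_conv_nth by auto
  from steps_in_sums[OF st i(1)] show ?thesis using i len ps0 by (intro exI[of _ i]) auto
 qed
 have sub: "(1/t) *\<^sub>R (x - a) \<in> shape_points" if x: "x \<in> verts T" for x
 proof -
  have "x \<in> set ps \<or> 2 *\<^sub>R x - a \<in> set ps" using tag_path_entries[of x a A B b] x by (simp add: ps_def sp(1))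
  then show ?thesis
  proof
   assume "x \<in> set ps"
   then obtain i z where "i \<le> DIM('a)" "z \<in> sums_of steps0 i" "x - a = t *\<^sub>R z" using ent by blast
   then show ?thesis using t by (auto simp: shape_points_def)
  next
   assume "2 *\<^sub>R x - a \<in> set ps"
   then obtain i z where iz: "i \<le> DIM('a)" "z \<in> sums_of steps0 i" "2 *\<^sub>R x - a - a = t *\<^sub>R z" using ent by blast
   have "2 *\<^sub>R x - a - a = 2 *\<^sub>R (x - a)" by (simp add: scaleR_2)
   then have "x - a = (1/2) *\<^sub>R (2 *\<^sub>R x - a - a)" by simp
   then show ?thesis using t using iz by (auto simp: shape_points_def)
  qed
 qed
 define Y where "Y = (%x. (1/t) *\<^sub>R (x - a)) ` verts T"
 have "Y \<subseteq> shape_points" using sub by (auto simp: Y_def)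
 moreover have "full_simplex Y"
 proof -
  let ?A = "(%x. (- (1/t) *\<^sub>R a) + (1/t) *\<^sub>R x) ` verts T"
  have "Y = ?A" by (simp add: Y_def scaleR_diff_right)
  moreover have "full_simplex ?A" using t by (intro full_simplex_image U_full[OF T]) simp
  ultimately show ?thesis by simp
 qed
 moreover have "verts T = (%z. a + t *\<^sub>R z) ` Y" unfolding Y_def image_image using t by simp
 ultimately show thesis using that unfolding t_def by simp
qed

text \<open>\<open>halvings n\<close> is the integer part of (type0 + n)/d with type0 < d, hence
  within one of n/d.\<close>

lemma halvings_bounds: "1/2^halvings n \<le> 2 * mesh_size DIM('a) n" "mesh_size DIM('a) n \<le> 2 * (1/2^halvings n)"
proof -
 let ?A = "halvings n"
 let ?d = "real DIM('a)" and ?k = "real ?A"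
 have "?A * DIM('a) \<le> type0 + n" by (simp add: halvings_def)
 then have 1: "?k * ?d \<le> real type0 + n" by (metis of_nat_add of_nat_le_iff of_nat_mult)
 have "type0 + n < ?A * DIM('a) + DIM('a)" unfolding halvings_def using dividend_less_div_times[of "DIM('a)" "type0 + n"] by simp
 then have 2: "real type0 + n < ?k * ?d + ?d" by (metis of_nat_add of_nat_less_iff of_nat_mult)
 have k1: "?k < 1 + n / ?d" using 1 type0_less by (simp add: field_simps)
 have k2: "n / ?d < ?k + 1" using 2 by (simp add: field_simps)
 have p: "1/2^?A = 2 powr (- ?k)" by (simp add: powr_minus powr_realpow divide_inverse)
 have e: "2 * (2::real) powr z = 2 powr (1 + z)" for z by (simp add: powr_add)
 show "1/2^?A \<le> 2 * mesh_size DIM('a) n" unfolding p mesh_size_def e using k2 by simp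
 show "mesh_size DIM('a) n \<le> 2 * (1/2^?A)" unfolding p mesh_size_def e using k1 by simp
qed

lemma mesh_size_power: "mesh_size DIM('a) n ^ DIM('a) = 1 / 2 ^ n"
proof -
 have "mesh_size DIM('a) n ^ DIM('a) = mesh_size DIM('a) n powr (real DIM('a))" by (simp add: powr_realpow)
 also have "... = 2 powr (- real n)" by (simp add: mesh_size_def powr_powr)
 finally show ?thesis by (simp add: powr_minus powr_realpow divide_inverse)
qed

lemma U_volume: "T \<in> U n ==> \<exists>T\<^sub>0\<in>M\<^sub>0. simplex_volume (verts T\<^sub>0) = 2 ^ n * simplex_volume (verts T)"
proof (induction n arbitrary: T)
 case (Suc n)
 obtain P where P: "P \<in> U n" "T \<in> children P" by (rule U_SucE[OF Suc.prems])
 note tP = U_tagged[OF P(1)]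
 have "T = child P \<or> T = child (reflect P)" using P(2) children_eq[OF tP] by simp
 then have "simplex_volume (verts P) = 2 * simplex_volume (verts T)" using volume_child[OF tP] volume_child[OF reflect_simps(1)[OF tP]] reflect_simps(2)[OF tP] by auto
 moreover obtain T0 where "T0 \<in> M\<^sub>0" "simplex_volume (verts T0) = 2 ^ n * simplex_volume (verts P)" using Suc.IH[OF P(1)] by auto
 ultimately show ?case by force
qed auto

theorem shape_regular:
 obtains C where "1 \<le> C" "!!n T x y. T \<in> U n ==> x \<in> hull_of T ==> y \<in> hull_of T ==> norm (x - y) \<le> C * mesh_size DIM('a) n"
  "!!n T. T \<in> U n ==> 1 / 2 ^ n \<le> C * simplex_volume (verts T)" "!!n T. T \<in> U n ==> simplex_volume (verts T) \<le> C * (1 / 2 ^ n)"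
  "!!n T v. T \<in> U n ==> v \<in> verts T ==> norm (bary_grad (verts T) v) * mesh_size DIM('a) n \<le> C"
proof -
 have fin: "finite M\<^sub>0" "finite shape_points" by (rule finite_M0 finite_shape_points)+
 \<comment> \<open>Each constant is a sum of nonnegative terms over a finite set, hence an upper
   bound for every single term.\<close>
 define C1 where "C1 = (\<Sum>y\<in>shape_points. \<Sum>z\<in>shape_points. norm (y - z))"
 define C2 where "C2 = (\<Sum>T\<in>M\<^sub>0. 1 / simplex_volume (verts T))"
 define C3 where "C3 = (\<Sum>T\<in>M\<^sub>0. simplex_volume (verts T))"
 define C4 where "C4 = (\<Sum>Y\<in>Pow shape_points. \<Sum>y\<in>shape_points. norm (bary_grad Y y))"
 have V0: "0 < simplex_volume (verts T)" if "T \<in> M\<^sub>0" for T using simplex_volume_pos U_full[of T 0] that by simp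
 have nn: "0 \<le> C1" "0 \<le> C2" "0 \<le> C3" "0 \<le> C4" unfolding C1_def C2_def C3_def C4_def using less_imp_le[OF V0] by (simp_all add: sum_nonneg)
 define C where "C = 1 + 2 * C1 + C2 + C3 + 2 * C4"
 show thesis
 proof (rule that)
  show "1 \<le> C" using nn by (simp add: C_def)
  fix n T assume T: "T \<in> U n"
  let ?C = "halvings n"
  obtain a Y where Y: "Y \<subseteq> shape_points" "full_simplex Y" "verts T = (%z. a + (1/2^?C) *\<^sub>R z) ` Y" by (rule U_shape[OF T])
  let ?t = "1/2^?C :: real"
  have vd: "norm (x - y) \<le> ?t * C1" if "x \<in> verts T" "y \<in> verts T" for x y
  proof -
   obtain u v where uv: "u \<in> Y" "v \<in> Y" "x = a + ?t *\<^sub>R u" "y = a + ?t *\<^sub>R v" using \<open>x \<in> verts T\<close> \<open>y \<in> verts T\<close> Y by auto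
   have "norm (u - v) \<le> (\<Sum>z\<in>shape_points. norm (u - z))" using uv Y(1) fin by (intro member_le_sum[of v _ "%z. norm (u - z)"]) auto
   also have "... \<le> C1" unfolding C1_def using uv Y(1) fin by (intro member_le_sum[of u _ "%y. \<Sum>z\<in>shape_points. norm (y - z)"]) (auto intro: sum_nonneg)
   moreover have "x - y = ?t *\<^sub>R (u - v)" by (simp add: uv scaleR_diff_right)
   ultimately show ?thesis by (simp add: divide_right_mono)
  qed
  show "norm (x - y) \<le> C * mesh_size DIM('a) n" if xy: "x \<in> hull_of T" "y \<in> hull_of T" for x y
  proof -
   have "norm (x - y) \<le> ?t * C1"
   proof -
    have c1: "norm (y - v) \<le> ?t * C1" if v: "v \<in> verts T" "y \<in> hull_of T" for v y
    proof -
     have "verts T \<subseteq> cball v (?t * C1)" using vd[OF v(1)] by (auto simp: dist_norm)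
     then have "hull_of T \<subseteq> cball v (?t * C1)" unfolding hull_of_def by (intro hull_minimal convex_cball)
     then show ?thesis using v(2) by (auto simp: dist_norm norm_minus_commute)
    qed
    have "verts T \<subseteq> cball x (?t * C1)" using c1[OF _ xy(1)] by (auto simp: dist_norm)
    then have "hull_of T \<subseteq> cball x (?t * C1)" unfolding hull_of_def by (intro hull_minimal convex_cball)
    then show ?thesis using xy(2) by (auto simp: dist_norm)
   qed
   also have "... \<le> (2 * mesh_size DIM('a) n) * C1" using halvings_bounds nn by (intro mult_right_mono) auto
   also have "... = (2 * C1) * mesh_size DIM('a) n" by simp
   also have "... \<le> C * mesh_size DIM('a) n" by (rule mult_right_mono) (use nn in \<open>simp_all add: C_def less_imp_le\<close>)
   finally show ?thesis .
  qed
  let ?D = "2 ^ n * simplex_volume (verts T)"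
  obtain T0 where T0: "T0 \<in> M\<^sub>0" "simplex_volume (verts T0) = ?D" using U_volume[OF T] by auto
  have pos: "0 < simplex_volume (verts T)" using simplex_volume_pos[OF U_full[OF T]] .
  have "1 / simplex_volume (verts T0) \<le> C2" unfolding C2_def using T0(1) fin V0 by (intro member_le_sum[of T0 _ "%T. 1 / simplex_volume (verts T)"]) (auto intro: less_imp_le)
  also have "C2 \<le> C" using nn by (simp add: C_def)
  finally have "1 / ?D \<le> C" by (simp add: T0(2))
  then show "1 / 2 ^ n \<le> C * simplex_volume (verts T)" using pos by (simp add: field_simps)
  have "simplex_volume (verts T0) \<le> C3" unfolding C3_def using T0(1) fin V0 by (intro member_le_sum[of T0 _ "%T. simplex_volume (verts T)"]) (auto intro: less_imp_le)
  also have "C3 \<le> C" using nn by (simp add: C_def)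
  finally show "simplex_volume (verts T) \<le> C * (1 / 2 ^ n)" by (simp add: T0(2) field_simps)
  let ?A = "bary_grad (verts T)"
  show "norm (?A v) * mesh_size DIM('a) n \<le> C" if v: "v \<in> verts T" for v
  proof -
   obtain u where u: "u \<in> Y" "v = a + ?t *\<^sub>R u" using v Y(3) by auto
   let ?B = "bary_grad Y u"
   have "?A v = ?B /\<^sub>R ?t" unfolding Y(3) u(2) by (intro bary_grad_image Y(2) u(1)) simp
   then have e: "norm (?A v) = norm ?B * 2^?C" by simp
   have "norm ?B \<le> (\<Sum>y\<in>shape_points. norm (bary_grad Y y))" using u(1) Y(1) fin by (intro member_le_sum[of u _ "%y. norm (bary_grad Y y)"]) auto
   also have "... \<le> C4" unfolding C4_def using Y(1) fin by (intro member_le_sum[of Y _ "%Y. \<Sum>y\<in>shape_points. norm (bary_grad Y y)"]) (auto intro: sum_nonneg)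
   moreover have "2^?C * mesh_size DIM('a) n \<le> 2" using halvings_bounds(2)[of n] by (simp add: field_simps)
   ultimately have "norm ?B * (2^?C * mesh_size DIM('a) n) \<le> C4 * 2" using nn by (intro mult_mono) (auto intro!: less_imp_le)
   also have "... \<le> C" using nn by (simp add: C_def)
   finally show ?thesis by (simp add: e)
  qed
 qed
qed

end

section \<open>Weighted estimates for the discrete system\<close>

text \<open>AM-GM turns the product of two sums into the square of one sum, to which Cauchy-Schwarz
  applies. The bound is sharp enough to produce the exact threshold.\<close>

lemma product_form_bound:
 fixes p y :: "'f => real"
 assumes "!!f. f \<in> I ==> 0 < p f"
 shows "(\<Sum>f\<in>I. p f * y f) * (\<Sum>f\<in>I. y f / p f) \<le> (\<Sum>f\<in>I. (p f + 1 / p f)^2) * (\<Sum>f\<in>I. (y f)^2) / 4"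
proof -
 let ?P = "\<Sum>f\<in>I. p f * y f" and ?Q = "\<Sum>f\<in>I. y f / p f"
 have "4 * (?P * ?Q) \<le> (?P + ?Q)^2" using zero_le_power2[of "?P - ?Q"] by (simp add: power2_eq_square algebra_simps)
 also have "?P + ?Q = (\<Sum>f\<in>I. (p f + 1 / p f) * y f)" by (simp add: sum.distrib[symmetric] algebra_simps)
 also have "...\<^sup>2 \<le> (\<Sum>f\<in>I. (p f + 1 / p f)^2) * (\<Sum>f\<in>I. (y f)^2)" by (rule Cauchy_Schwarz_ineq_sum)
 finally show ?thesis by simp
qed

text \<open>t + 1/t is largest at the ends of the interval, as (\<tau> - t)(\<tau> - 1/t) \<ge> 0
  shows.\<close>

lemma plus_inverse_square_mono:
 fixes t \<tau> :: real
 assumes "1 / \<tau> \<le> t" "t \<le> \<tau>" "0 < t" "0 < \<tau>"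
 shows "(t + 1 / t)^2 \<le> \<tau>^2 + 1 / \<tau>^2 + 2"
proof -
 have "0 \<le> (\<tau> - t) * (\<tau> - 1 / t)" using assms by (intro mult_nonneg_nonneg) (auto simp: field_simps)
 also have "(\<tau> - t) * (\<tau> - 1 / t) = \<tau> * \<tau> + 1 - \<tau> * (t + 1/t)" using assms by (simp add: field_simps)
 finally have "\<tau> * (t + 1/t) \<le> \<tau> * \<tau> + 1" by simp
 then have "t + 1/t \<le> \<tau> + 1/\<tau>" using assms by (simp add: field_simps)
 then have "(t + 1/t)^2 \<le> (\<tau> + 1/\<tau>)^2" using assms by simp
 also have "... = \<tau>^2 + 1 / \<tau>^2 + 2" using assms by (simp add: power2_eq_square field_simps)
 finally show ?thesis .
qed

text \<open>Young's inequality after both sums are normalized to one.\<close>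

lemma weighted_Hoelder_sum:
 fixes a b m :: "'t => real"
 assumes fin: "finite I" and nn: "!!i. i \<in> I ==> 0 \<le> m i" "!!i. i \<in> I ==> 0 \<le> a i" "!!i. i \<in> I ==> 0 \<le> b i" and \<theta>: "0 < \<theta>" "\<theta> < 1"
 shows "(\<Sum>i\<in>I. m i * (a i powr \<theta> * b i powr (1 - \<theta>))) \<le> (\<Sum>i\<in>I. m i * a i) powr \<theta> * (\<Sum>i\<in>I. m i * b i) powr (1 - \<theta>)"
proof -
 let ?A = "\<Sum>i\<in>I. m i * a i" and ?B = "\<Sum>i\<in>I. m i * b i"
 have A0: "0 \<le> ?A" "0 \<le> ?B" using nn by (auto intro!: sum_nonneg)
 show ?thesis
 proof (cases "?A = 0 \<or> ?B = 0")
  case True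
  then have "(\<Sum>i\<in>I. m i * (a i powr \<theta> * b i powr (1 - \<theta>))) = 0" using sum_nonneg_eq_0_iff[OF fin, of "%i. m i * a i"] sum_nonneg_eq_0_iff[OF fin, of "%i. m i * b i"] nn by (intro sum.neutral) auto
  then show ?thesis by simp
 next
  case False
  then have A: "0 < ?A" "0 < ?B" using A0 by auto
  have "(\<Sum>i\<in>I. m i * (a i powr \<theta> * b i powr (1 - \<theta>))) / (?A powr \<theta> * ?B powr (1 - \<theta>)) =
    (\<Sum>i\<in>I. m i * ((a i / ?A) powr \<theta> * (b i / ?B) powr (1 - \<theta>)))" by (simp add: sum_divide_distrib powr_divide)
  also have "... \<le> (\<Sum>i\<in>I. m i * (\<theta> * (a i / ?A) + (1 - \<theta>) * (b i / ?B)))"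
  proof (intro sum_mono mult_left_mono nn)
   fix i assume i: "i \<in> I"
   show "(a i / ?A) powr \<theta> * (b i / ?B) powr (1 - \<theta>) \<le> \<theta> * (a i / ?A) + (1 - \<theta>) * (b i / ?B)"
   proof (cases "a i = 0 \<or> b i = 0")
    case True
    moreover have "0 \<le> \<theta> * (a i / ?A) + (1 - \<theta>) * (b i / ?B)" using nn i A \<theta> by simp
    ultimately show ?thesis by auto
   next
    case False
    then show ?thesis using nn i A \<theta> by (intro Youngs_inequality_0) (auto simp: less_le)
   qed
  qed
  also have "... = (\<Sum>i\<in>I. \<theta> / ?A * (m i * a i) + (1 - \<theta>) / ?B * (m i * b i))" by (simp add: distrib_left mult.left_commute)
  also have "... = \<theta> / ?A * ?A + (1 - \<theta>) / ?B * ?B" by (simp only: sum.distrib sum_distrib_left[symmetric])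
  finally show ?thesis using A by simp
 qed
qed

text \<open>The combinatorial data of the linear system: elements, their faces, volumes
  \<open>m\<close> and levels. By \<open>low\<close>, all coarser neighbors of an element share one
  and the same face with it.\<close>

locale discrete_mesh =
 fixes El :: "'t set" and F :: "'t => 'f set" and m :: "'t => real" and lev :: "'t => nat" and d :: nat
 assumes fin: "finite El" and finF: "!!T. T \<in> El ==> finite (F T)" and cardF: "!!T. T \<in> El ==> card (F T) = d + 1" and d2: "2 \<le> d"
  and m_pos: "!!T. T \<in> El ==> 0 < m T"
  and low: "!!T. T \<in> El ==> \<exists>f\<^sub>0. \<forall>f\<in>F T. \<forall>T'\<in>El. f \<in> F T' --> lev T' < lev T --> f = f\<^sub>0"
begin

definition nbr :: "'t => 't => bool" where "nbr T T' \<longleftrightarrow> T \<in> El \<and> T' \<in> El \<and> T ~= T' \<and> F T \<inter> F T' ~= {}"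

lemma nbr_sym: "nbr T T' ==> nbr T' T" by (auto simp: nbr_def)

abbreviation "Fa \<equiv> \<Union>T\<in>El. F T"

text \<open>The Crouzeix-Raviart normal equations scaled by (d+1)(d+2): \<open>x\<close> are the
  coefficients, \<beta> is the right-hand side split into element contributions, \<open>Ub\<close>
  its size per volume.\<close>

definition solves :: "('f => real) => ('t => real) => bool" where
 "solves x Ub \<longleftrightarrow> (\<exists>\<beta>. (\<forall>T\<in>El. \<forall>f\<in>F T. \<bar>\<beta> T f\<bar> \<le> m T * Ub T) \<and>
  (\<forall>f\<in>Fa. (\<Sum>T | T \<in> El \<and> f \<in> F T. m T * ((real d)^2 * x f - (real d - 2) * (\<Sum>g\<in>F T. x g))) =
   (\<Sum>T | T \<in> El \<and> f \<in> F T. \<beta> T f)))"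

text \<open>Smallness of the oscillation of the weight within an element: \<open>b1\<close> bounds the ratio towards
  neighbours of the same or a higher level, \<open>b\<close> the ratio towards the at most one coarser neighbour.\<close>

definition admissible :: "real => real => real => bool" where "admissible b1 b \<delta> \<longleftrightarrow> 1 \<le> b1 \<and> b1 \<le> b \<and> 0 < \<delta> \<and>
  (real d - 2) * (real d * (b1 + 1 / b1 + 2) + (b^2 / b1 + b1 / b^2 + 2)) \<le> 4 * ((real d)^2 - \<delta>)"

text \<open>Equation \<open>f\<close> is tested with w_f^2 x_f, where w_f is the minimum of the
  weight around \<open>f\<close>. By \<open>product_form_bound\<close> the element forms keep a
  share \<delta> of sum (w_f x_f)^2.\<close>

lemma weighted_L2:
 assumes x: "solves x Ub" and U: "!!T. T \<in> El ==> 0 \<le> Ub T" and \<omega>: "!!T. T \<in> El ==> 0 < \<omega> T" and adm: "admissible b1 b \<delta>"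
  and w1: "!!T T'. nbr T T' ==> lev T \<le> lev T' ==> \<omega> T \<le> b1 * \<omega> T'" and w2: "!!T T'. nbr T T' ==> lev T' < lev T ==> \<omega> T \<le> b * \<omega> T'"
 shows "(\<Sum>T\<in>El. m T * ((\<omega> T)^2 * (\<Sum>f\<in>F T. (x f)^2))) \<le>
  b^2 * (real d + 1) / \<delta>^2 * (\<Sum>T\<in>El. m T * ((\<omega> T)^2 * (Ub T)^2))"
proof -
 have b: "1 \<le> b1" "b1 \<le> b" "0 < \<delta>" using adm by (auto simp: admissible_def)
 then have b0: "0 < b1" "0 < b" by auto
 \<comment> \<open>The minimum over the elements at \<open>f\<close> never exceeds \<omega>, so the
   right-hand side is bounded by \<omega> without a further factor; the price is a lower bound of
   \<open>w\<close> in terms of \<open>b\<close>.\<close>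
 define w where "w f = Min (\<omega> ` {T \<in> El. f \<in> F T})" for f
 have wle: "w f \<le> \<omega> T" if "T \<in> El" "f \<in> F T" for T f unfolding w_def using that fin by simp
 have wat: "\<exists>T'\<in>El. f \<in> F T' \<and> w f = \<omega> T'" if "T \<in> El" "f \<in> F T" for T f
 proof -
  have "w f \<in> \<omega> ` {T \<in> El. f \<in> F T}" unfolding w_def using that fin by (intro Min_in) auto
  then show ?thesis by auto
 qed
 have w0: "0 < w f" if "T \<in> El" "f \<in> F T" for T f using wat[OF that] \<omega> by auto
 have wb: "\<omega> T \<le> b * w f" if Tf: "T \<in> El" "f \<in> F T" for T f
 proof -
  obtain T' where T': "T' \<in> El" "f \<in> F T'" "w f = \<omega> T'" using wat[OF Tf] by auto
  show ?thesis
  proof (cases "T' = T")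
   case True
   then show ?thesis using T' b \<omega>[OF Tf(1)] by simp
  next
   case False
   then have nb: "nbr T T'" using T' Tf by (auto simp: nbr_def)
   show ?thesis
   proof (cases "lev T \<le> lev T'")
    case True
    have "b1 * \<omega> T' \<le> b * \<omega> T'" using b \<omega>[OF T'(1)] by simp
    then show ?thesis using w1[OF nb True] T' by simp
   next
    case False
    then show ?thesis using w2[OF nb] T' by simp
   qed
  qed
 qed
 have wb1: "\<exists>f\<^sub>0. \<forall>f\<in>F T. f ~= f\<^sub>0 --> \<omega> T \<le> b1 * w f" if T: "T \<in> El" for T
 proof -
  obtain f0 where f0: "!!f T'. f \<in> F T ==> T' \<in> El ==> f \<in> F T' ==> lev T' < lev T ==> f = f0" using low[OF T] by auto
  have "\<omega> T \<le> b1 * w f" if f: "f \<in> F T" "f ~= f0" for f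
  proof -
   obtain T' where T': "T' \<in> El" "f \<in> F T'" "w f = \<omega> T'" using wat[OF T f(1)] by auto
   show ?thesis using T' b \<omega>[OF T] T f w1 f0[OF f(1) T'(1,2)] by (fastforce simp: nbr_def)
  qed
  then show ?thesis by auto
 qed
 define y where "y f = w f * x f" for f
 let ?A = "(real d - 2)"
 let ?G = "(real d)"
 let ?E = "(?G^2 - \<delta>)"
 have form: "?A * ((\<Sum>f\<in>F T. w f * y f) * (\<Sum>f\<in>F T. y f / w f)) \<le> ?E * (\<Sum>f\<in>F T. (y f)^2)"
  if T: "T \<in> El" for T
 proof -
  obtain f0 where f0: "!!f. f \<in> F T ==> f ~= f0 ==> \<omega> T \<le> b1 * w f" using wb1[OF T] by auto
  \<comment> \<open>The scaling centers the face weights: s w_f lies between 1 / sqrt b1 and sqrt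
    b1, except on the face to coarser neighbors, where the lower end is sqrt b1 / b. The product of
    the two sums is invariant under it.\<close>
  define s where "s = sqrt b1 / \<omega> T"
  have s: "0 < s" using b0 \<omega>[OF T] by (simp add: s_def)
  let ?C = "b1 + 1 / b1 + 2"
  let ?D = "b^2 / b1 + b1 / b^2 + 2"
  define K where "K f = (if f = f0 then ?D else ?C)" for f
  let ?H = "b / sqrt b1"
  have K: "(s * w f + 1 / (s * w f))^2 \<le> K f" if f: "f \<in> F T" for f
  proof -
   have up: "s * w f \<le> sqrt b1" using wle[OF T f] \<omega>[OF T] b0 by (simp add: s_def field_simps)
   have pos: "0 < s * w f" using s w0[OF T f] by simp
   show ?thesis
   proof (cases "f = f0")
    case True
    have "sqrt b1 / b \<le> s * w f" using wb[OF T f] \<omega>[OF T] b0 by (simp add: s_def field_simps)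
    moreover have "sqrt b1 \<le> ?H" using b by (simp add: field_simps)
    ultimately have "(s * w f + 1 / (s * w f))^2 \<le> ?H^2 + 1 / ?H^2 + 2" using up pos by (intro plus_inverse_square_mono) auto
    then show ?thesis using b0 True by (simp add: K_def power_divide)
   next
    case False
    have "1 / sqrt b1 = sqrt b1 / b1" using b0 by (simp add: field_simps)
    also have "... \<le> s * w f" using f0[OF f False] \<omega>[OF T] b0 by (simp add: s_def field_simps)
    finally have "(s * w f + 1 / (s * w f))^2 \<le> (sqrt b1)^2 + 1 / (sqrt b1)^2 + 2" using up pos b0 by (intro plus_inverse_square_mono) auto
    then show ?thesis using b0 False by (simp add: K_def)
   qed
  qed
  have Kd: "?C \<le> ?D"
  proof -
   have "(sqrt b1 + 1 / sqrt b1)^2 \<le> ?H^2 + 1 / ?H^2 + 2" using b by (intro plus_inverse_square_mono) (auto simp: field_simps)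
   moreover have "(sqrt b1 + 1 / sqrt b1)^2 = ?C" using b0 by (simp add: power2_sum power_divide)
   ultimately show ?thesis using b0 by (simp add: power_divide)
  qed
  let ?F = "sum K (F T)"
  have sK: "?F \<le> real d * ?C + ?D"
  proof (cases "f0 \<in> F T")
   case True
   have "?F = K f0 + sum K (F T - {f0})" using True finF[OF T] by (simp add: sum.remove)
   also have "sum K (F T - {f0}) = (\<Sum>f\<in>F T - {f0}. ?C)" by (simp add: K_def)
   finally show ?thesis using True cardF[OF T] by (simp add: K_def)
  next
   case False
   have "?F = (\<Sum>f\<in>F T. ?C)" using False by (intro sum.cong) (auto simp: K_def)
   also have "... = real d * ?C + ?C" using cardF[OF T] by (simp add: algebra_simps)
   finally show ?thesis using Kd by simp
  qed
  have "(\<Sum>f\<in>F T. w f * y f) * (\<Sum>f\<in>F T. y f / w f) = (\<Sum>f\<in>F T. (s * w f) * y f) * (\<Sum>f\<in>F T. y f / (s * w f))"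
  using s by (simp add: sum_distrib_left mult.commute)
  also have "... \<le> (\<Sum>f\<in>F T. (s * w f + 1 / (s * w f))^2) * (\<Sum>f\<in>F T. (y f)^2) / 4" using s w0[OF T] by (intro product_form_bound) auto
  also have "... \<le> ?F * (\<Sum>f\<in>F T. (y f)^2) / 4" using K by (intro divide_right_mono mult_right_mono sum_mono sum_nonneg) auto
  finally have "?A * ((\<Sum>f\<in>F T. w f * y f) * (\<Sum>f\<in>F T. y f / w f)) \<le>
    ?A * (?F * (\<Sum>f\<in>F T. (y f)^2) / 4)" using d2 by (intro mult_left_mono) auto
  also have "... = (?A * ?F) * ((\<Sum>f\<in>F T. (y f)^2) / 4)" by simp
  also have "... \<le> (4 * ?E) * ((\<Sum>f\<in>F T. (y f)^2) / 4)"
  proof (rule mult_right_mono)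
   have "?A * ?F \<le> ?A * (real d * ?C + ?D)" using d2 sK by (intro mult_left_mono) auto
   then show "?A * ?F \<le> 4 * ?E" using adm by (simp add: admissible_def)
  qed (simp add: sum_nonneg)
  also have "... = ?E * (\<Sum>f\<in>F T. (y f)^2)" by simp
  finally show ?thesis .
 qed
 obtain \<beta> where \<beta>: "!!T f. T \<in> El ==> f \<in> F T ==> \<bar>\<beta> T f\<bar> \<le> m T * Ub T"
  "!!f. f \<in> Fa ==> (\<Sum>T | T \<in> El \<and> f \<in> F T. m T * (?G^2 * x f - ?A * (\<Sum>g\<in>F T. x g))) = (\<Sum>T | T \<in> El \<and> f \<in> F T. \<beta> T f)"
  using x unfolding solves_def by blast
 have finFa: "finite Fa" using fin finF by simp
 have swap: "(\<Sum>f\<in>Fa. \<Sum>T | T \<in> El \<and> f \<in> F T. G T f) = (\<Sum>T\<in>El. \<Sum>f\<in>F T. G T f)" for G :: "'t => 'f => real"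
 proof -
  have "(\<Sum>f\<in>Fa. \<Sum>T | T \<in> El \<and> f \<in> F T. G T f) = (\<Sum>T\<in>El. \<Sum>f | f \<in> Fa \<and> f \<in> F T. G T f)"
   by (rule sum.swap_restrict[OF finFa fin])
  also have "... = (\<Sum>T\<in>El. \<Sum>f\<in>F T. G T f)" by (intro sum.cong) auto
  finally show ?thesis .
 qed
 define S where "S = (\<Sum>T\<in>El. m T * (\<Sum>f\<in>F T. (y f)^2))"
 define R where "R = (\<Sum>T\<in>El. m T * ((\<omega> T)^2 * (Ub T)^2))"
 have loc: "\<delta> * (\<Sum>f\<in>F T. (y f)^2) \<le> (\<Sum>f\<in>F T. (w f)^2 * x f * (?G^2 * x f - ?A * (\<Sum>g\<in>F T. x g)))"
  if T: "T \<in> El" for T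
 proof -
  have wx: "(\<Sum>f\<in>F T. y f / w f) = (\<Sum>f\<in>F T. x f)" using w0[OF T] by (intro sum.cong) (force simp: y_def)+
  have "(\<Sum>f\<in>F T. (w f)^2 * x f * (?G^2 * x f - ?A * (\<Sum>g\<in>F T. x g))) = (\<Sum>f\<in>F T. ?G^2 * (y f)^2 - ?A * (\<Sum>g\<in>F T. x g) * (w f * y f))"
   by (simp add: y_def power2_eq_square algebra_simps)
  also have "... = ?G^2 * (\<Sum>f\<in>F T. (y f)^2) - ?A * ((\<Sum>f\<in>F T. w f * y f) * (\<Sum>f\<in>F T. y f / w f))"
   by (simp add: wx sum_subtractf sum_distrib_left[symmetric])
  finally show ?thesis using form[OF T] by argo
 qed
 have "\<delta> * S = (\<Sum>T\<in>El. m T * (\<delta> * (\<Sum>f\<in>F T. (y f)^2)))" by (simp add: S_def sum_distrib_left mult.left_commute)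
 also have "... \<le> (\<Sum>T\<in>El. m T * (\<Sum>f\<in>F T. (w f)^2 * x f * (?G^2 * x f - ?A * (\<Sum>g\<in>F T. x g))))"
  using loc m_pos by (intro sum_mono mult_left_mono) (auto simp: less_imp_le)
 also have "... = (\<Sum>f\<in>Fa. (w f)^2 * x f * (\<Sum>T | T \<in> El \<and> f \<in> F T. m T * (?G^2 * x f - ?A * (\<Sum>g\<in>F T. x g))))" by (simp add: sum_distrib_left mult.left_commute swap[symmetric])
 also have "... = (\<Sum>T\<in>El. \<Sum>f\<in>F T. (w f)^2 * x f * \<beta> T f)" using \<beta>(2) by (simp add: swap[symmetric] sum_distrib_left)
 also have "... \<le> (\<Sum>T\<in>El. \<Sum>f\<in>F T. m T * (1 / (2 * \<delta>) * ((\<omega> T)^2 * (Ub T)^2) + \<delta> / 2 * (y f)^2))"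
 proof (intro sum_mono)
  fix T f assume T: "T \<in> El" and f: "f \<in> F T"
  have m: "0 < m T" using m_pos[OF T] .
  have "(w f)^2 * x f * \<beta> T f \<le> \<bar>(w f)\<^sup>2 * x f * \<beta> T f\<bar>" by simp
  also have "... \<le> \<omega> T * \<bar>y f\<bar> * (m T * Ub T)" using wle[OF T f] \<beta>(1)[OF T f] w0[OF T f] by (auto simp: y_def abs_mult power2_eq_square intro!: mult_mono)
  also have "... = m T * ((\<omega> T * Ub T) * \<bar>y f\<bar>)" by simp
  \<comment> \<open>Young's inequality with parameter \<delta>; half of the coercive term absorbs
    the last summand.\<close>
  also have "(\<omega> T * Ub T) * \<bar>y f\<bar> \<le> 1 / (2 * \<delta>) * ((\<omega> T)^2 * (Ub T)^2) + \<delta> / 2 * (y f)^2"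
  proof -
   have "0 \<le> (\<omega> T * Ub T - \<delta> * \<bar>y f\<bar>)^2" by simp
   then show ?thesis using b by (simp add: field_simps power2_eq_square)
  qed
  finally show "(w f)^2 * x f * \<beta> T f \<le> m T * (1 / (2 * \<delta>) * ((\<omega> T)^2 * (Ub T)^2) + \<delta> / 2 * (y f)^2)" using m by auto
 qed
 also have "... = (\<Sum>T\<in>El. (real d + 1) / (2 * \<delta>) * (m T * ((\<omega> T)^2 * (Ub T)^2)) + \<delta> / 2 * (m T * (\<Sum>f\<in>F T. (y f)^2)))"
 proof (intro sum.cong refl)
  fix T assume T: "T \<in> El"
  let ?B = "(\<Sum>f\<in>F T. m T * (1 / (2 * \<delta>) * ((\<omega> T)^2 * (Ub T)^2) + \<delta> / 2 * (y f)^2))"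
  have "?B =
   m T * ((\<Sum>f\<in>F T. 1 / (2 * \<delta>) * ((\<omega> T)^2 * (Ub T)^2)) + (\<Sum>f\<in>F T. \<delta> / 2 * (y f)^2))" by (simp only: sum_distrib_left[symmetric] sum.distrib)
  also have "... = m T * ((real d + 1) * (1 / (2 * \<delta>) * ((\<omega> T)^2 * (Ub T)^2)) + \<delta> / 2 * (\<Sum>f\<in>F T. (y f)^2))"
   using cardF[OF T] by (simp add: sum_distrib_left)
  finally show "?B = (real d + 1) / (2 * \<delta>) * (m T * ((\<omega> T)^2 * (Ub T)^2)) + \<delta> / 2 * (m T * (\<Sum>f\<in>F T. (y f)^2))" by argo
 qed
 also have "... = (real d + 1) / (2 * \<delta>) * R + \<delta> / 2 * S" by (simp add: R_def S_def sum.distrib sum_distrib_left)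
 finally have "S \<le> (real d + 1) / \<delta>^2 * R" using b by (simp add: field_simps power2_eq_square)
 moreover have "(\<Sum>T\<in>El. m T * ((\<omega> T)^2 * (\<Sum>f\<in>F T. (x f)^2))) \<le> b^2 * S"
 proof -
  have "(\<Sum>T\<in>El. m T * ((\<omega> T)^2 * (\<Sum>f\<in>F T. (x f)^2))) \<le> (\<Sum>T\<in>El. m T * (b^2 * (\<Sum>f\<in>F T. (y f)^2)))"
  proof (intro sum_mono mult_left_mono)
   fix T assume T: "T \<in> El"
   have "(\<omega> T)^2 * (\<Sum>f\<in>F T. (x f)^2) = (\<Sum>f\<in>F T. (\<omega> T)^2 * (x f)^2)" by (simp add: sum_distrib_left)
   also have "... \<le> (\<Sum>f\<in>F T. (b * w f)^2 * (x f)^2)" using wb[OF T] \<omega>[OF T] by (intro sum_mono mult_right_mono power_mono) auto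
   finally show "(\<omega> T)^2 * (\<Sum>f\<in>F T. (x f)^2) \<le> b^2 * (\<Sum>f\<in>F T. (y f)^2)" by (simp add: sum_distrib_left y_def power_mult_distrib mult.assoc)
  qed (use m_pos in \<open>auto simp: less_imp_le\<close>)
  then show ?thesis by (simp add: S_def sum_distrib_left mult.left_commute)
 qed
 ultimately show ?thesis using mult_left_mono[of S "(real d + 1) / \<delta>^2 * R" "b^2"] unfolding R_def by simp
qed

section \<open>Paths through the mesh and slowly varying majorants\<close>

inductive reach :: "nat => nat => 't => 't => bool" where
 start: "T \<in> El ==> reach 0 0 T T"
| drop: "reach i j S T ==> nbr T T' ==> lev T' < lev T ==> reach (Suc i) j S T'"
| stay: "reach i j S T ==> nbr T T' ==> lev T \<le> lev T' ==> reach i (Suc j) S T'"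

lemma reach_El: "reach i j S T ==> S \<in> El \<and> T \<in> El" by (induction rule: reach.induct) (auto simp: nbr_def)

text \<open>A drop in level costs an additional 1/2, the reciprocal of the volume it may gain, so
  that the factor \<open>2 ^ i\<close> in \<open>growth\<close> cancels.\<close>

definition cost :: "real => nat => nat => real" where "cost \<epsilon> i j = (1 / (2 * (1 + \<epsilon>))) ^ i * (1 / (1 + \<epsilon>)) ^ j"

text \<open>A supremal convolution of \<open>h\<close> along paths: passing to a neighbor lowers it
  at most by the factor 1 + \<epsilon>, or 2(1 + \<epsilon>) towards a coarser element, while its
  integral stays comparable to that of \<open>h\<close>.\<close>

definition majorant :: "real => ('t => real) => 't => real" where "majorant \<epsilon> h T = Sup {cost \<epsilon> i j * h S | i j S. reach i j S T}"

definition growth :: "real => bool" where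
 "growth A \<longleftrightarrow> (\<forall>S\<in>El. \<forall>i j. (\<Sum>T | T \<in> El \<and> reach i j S T. m T) \<le> A * (real (i + j + 1) ^ d * (2 ^ i * m S)))"

context
 fixes \<epsilon> :: real and h :: "'t => real"
 assumes \<epsilon>: "0 < \<epsilon>" and h: "!!T. T \<in> El ==> 0 \<le> h T"
begin

lemma cost_pos: "0 < cost \<epsilon> i j" using \<epsilon> by (simp add: cost_def)

lemma cost_le_one: "cost \<epsilon> i j \<le> 1"
proof -
 have "(1 / (2 * (1 + \<epsilon>))) ^ i \<le> 1" "(1 / (1 + \<epsilon>)) ^ j \<le> 1" using \<epsilon> by (intro power_le_one; simp)+
 then show ?thesis unfolding cost_def using \<epsilon> by (intro mult_le_one) auto
qed

lemma majorant_bdd: "bdd_above {cost \<epsilon> i j * h S | i j S. reach i j S T}"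
proof (rule bdd_aboveI)
 fix z assume "z \<in> {cost \<epsilon> i j * h S | i j S. reach i j S T}"
 then obtain i j S where z: "z = cost \<epsilon> i j * h S" "reach i j S T" by auto
 have S: "S \<in> El" using reach_El[OF z(2)] by simp
 have "z \<le> 1 * h S" unfolding z(1) using cost_le_one h[OF S] by (intro mult_right_mono)
 also have "1 * h S \<le> sum h El" using member_le_sum[of S El h] S fin h by simp
 finally show "z \<le> sum h El" .
qed

lemma majorant_upper: "reach i j S T ==> cost \<epsilon> i j * h S \<le> majorant \<epsilon> h T" unfolding majorant_def by (rule cSup_upper[OF _ majorant_bdd]) blast

lemma majorant_ge: "T \<in> El ==> h T \<le> majorant \<epsilon> h T" using majorant_upper[OF reach.start, of T] by (simp add: cost_def)

lemma majorant_step: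
 assumes "nbr T T'"
 shows "lev T' < lev T ==> majorant \<epsilon> h T \<le> 2 * (1 + \<epsilon>) * majorant \<epsilon> h T'"
  "lev T \<le> lev T' ==> majorant \<epsilon> h T \<le> (1 + \<epsilon>) * majorant \<epsilon> h T'"
proof -
 have T: "T \<in> El" using assms by (simp add: nbr_def)
 then have ne: "{cost \<epsilon> i j * h S | i j S. reach i j S T} ~= {}" using reach.start by auto
 let ?A = "majorant \<epsilon> h"
 let ?B = "(1 + \<epsilon>)"
 show "?A T \<le> 2 * ?B * ?A T'" if "lev T' < lev T" unfolding majorant_def[of _ _ T]
 proof (rule cSup_least[OF ne])
  fix z assume "z \<in> {cost \<epsilon> i j * h S | i j S. reach i j S T}"
  then obtain i j S where z: "z = cost \<epsilon> i j * h S" "reach i j S T" by auto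
  have "z = 2 * ?B * (cost \<epsilon> (Suc i) j * h S)" unfolding z(1) using \<epsilon> by (simp add: cost_def)
  also have "... \<le> 2 * ?B * ?A T'" using reach.drop[OF z(2) assms that] \<epsilon> by (intro mult_left_mono majorant_upper) auto
  finally show "z \<le> 2 * ?B * ?A T'" .
 qed
 show "?A T \<le> ?B * ?A T'" if "lev T \<le> lev T'" unfolding majorant_def[of _ _ T]
 proof (rule cSup_least[OF ne])
  fix z assume "z \<in> {cost \<epsilon> i j * h S | i j S. reach i j S T}"
  then obtain i j S where z: "z = cost \<epsilon> i j * h S" "reach i j S T" by auto
  have "z = ?B * (cost \<epsilon> i (Suc j) * h S)" unfolding z(1) using \<epsilon> by (simp add: cost_def)
  also have "... \<le> ?B * ?A T'" using reach.stay[OF z(2) assms that] \<epsilon> by (intro mult_left_mono majorant_upper) auto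
  finally show "z \<le> ?B * ?A T'" .
 qed
qed

lemma majorant_powr_step:
 assumes n: "nbr T T'" and s: "0 \<le> s" "s \<le> 1"
 shows "lev T' < lev T ==> majorant \<epsilon> h T powr s \<le> 2 powr s * (1 + \<epsilon>) * majorant \<epsilon> h T' powr s"
  "lev T \<le> lev T' ==> majorant \<epsilon> h T powr s \<le> (1 + \<epsilon>) * majorant \<epsilon> h T' powr s"
proof -
 let ?G = "majorant \<epsilon> h" and ?B = "1 + \<epsilon>"
 have "T \<in> El" using n by (simp add: nbr_def)
 then have g: "0 \<le> ?G T" using h majorant_ge order_trans by blast
 have e: "?B powr s \<le> ?B" using powr_mono[of s 1 ?B] s \<epsilon> by simp
 show "?G T powr s \<le> 2 powr s * ?B * ?G T' powr s" if l: "lev T' < lev T"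
 proof -
  have "?G T powr s \<le> (2 * ?B * ?G T') powr s" using majorant_step(1)[OF n l] g s by (intro powr_mono2)
  also have "... = 2 powr s * ?B powr s * ?G T' powr s" by (simp only: powr_mult)
  also have "... \<le> 2 powr s * ?B * ?G T' powr s" using e by (intro mult_right_mono mult_left_mono) auto
  finally show ?thesis .
 qed
 show "?G T powr s \<le> ?B * ?G T' powr s" if l: "lev T \<le> lev T'"
 proof -
  have "?G T powr s \<le> (?B * ?G T') powr s" using majorant_step(2)[OF n l] g s by (intro powr_mono2)
  also have "... \<le> ?B * ?G T' powr s" using e by (simp add: powr_mult mult_right_mono)
  finally show ?thesis .
 qed
qed

text \<open>The supremum may run over infinitely many pairs (i, j); giving away a factor 2 avoids
  showing that it is attained.\<close>

lemma majorant_attained: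
 assumes T: "T \<in> El"
 shows "\<exists>i j S. reach i j S T \<and> majorant \<epsilon> h T \<le> 2 * (cost \<epsilon> i j * h S)"
proof (cases "majorant \<epsilon> h T \<le> 0")
 case True
 then show ?thesis using reach.start[OF T] h[OF T] cost_pos[of 0 0] by (intro exI[of _ 0] exI[of _ T]) (auto intro: order_trans)
next
 case False
 have ne: "{cost \<epsilon> i j * h S | i j S. reach i j S T} ~= {}" using reach.start[OF T] by auto
 let ?A = "majorant \<epsilon> h T"
 have "?A / 2 < ?A" using False by simp
 then obtain z where "z \<in> {cost \<epsilon> i j * h S | i j S. reach i j S T}" "?A / 2 < z" unfolding majorant_def using less_cSupE[OF _ ne] by blast
 then show ?thesis by force
qed

text \<open>Each value of the majorant is charged to the start \<open>S\<close> of one path. Over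
  the elements reachable from \<open>S\<close> the factor 2^-i of the cost meets the volume growth
  2^i, and a polynomial times geometric decay remains.\<close>

lemma majorant_sum:
 assumes A: "growth A" "0 \<le> A" and K: "!!N. (\<Sum>i<N. (1 / (1 + \<epsilon>)) ^ i * real (i + 1) ^ d) \<le> K"
 shows "(\<Sum>T\<in>El. m T * majorant \<epsilon> h T) \<le> 2 * A * K^2 * (\<Sum>T\<in>El. m T * h T)"
proof -
 define a where "a = 1 / (1 + \<epsilon>)"
 have a: "0 < a" using \<epsilon> by (simp add: a_def)
 let ?A = "cost \<epsilon>"
 let ?C = "majorant \<epsilon> h"
 obtain ci cj cS where c: "!!T. T \<in> El ==> reach (ci T) (cj T) (cS T) T" "!!T. T \<in> El ==> ?C T \<le> 2 * (?A (ci T) (cj T) * h (cS T))" using majorant_attained by metis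
 \<comment> \<open>Exceeds the indices of all selected paths, so that the sums over \<open>i\<close>
   and \<open>j\<close> are finite.\<close>
 define N where "N = Suc (\<Sum>T\<in>El. ci T + cj T)"
 have N: "ci T < N" "cj T < N" if "T \<in> El" for T using member_le_sum[of T El "%T. ci T + cj T"] that fin by (auto simp: N_def)
 define I where "I = El \<times> {..<N} \<times> {..<N}"
 have finI: "finite I" using fin by (simp add: I_def)
 define t where "t k T = (case k of (S, i, j) => if reach i j S T then 2 * (?A i j * h S) * m T else 0)" for k T
 have t0: "0 \<le> t k T" if T: "T \<in> El" for k T
 proof -
  obtain S i j where k: "k = (S, i, j)" by (cases k) auto
  have "0 \<le> 2 * (?A i j * h S) * m T" if "reach i j S T" using less_imp_le[OF cost_pos] h reach_El[OF that] less_imp_le[OF m_pos[OF T]] by simp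
  then show ?thesis by (simp add: t_def k)
 qed
 have "(\<Sum>T\<in>El. m T * ?C T) \<le> (\<Sum>T\<in>El. \<Sum>k\<in>I. t k T)"
 proof (rule sum_mono)
  fix T assume T: "T \<in> El"
  have "m T * ?C T \<le> m T * (2 * (?A (ci T) (cj T) * h (cS T)))" using c(2)[OF T] m_pos[OF T] by simp
  also have "... = t (cS T, ci T, cj T) T" using c(1)[OF T] by (simp add: t_def)
  also have "... \<le> (\<Sum>k\<in>I. t k T)" using N[OF T] reach_El[OF c(1)[OF T]] finI t0[OF T] by (intro member_le_sum) (auto simp: I_def)
  finally show "m T * ?C T \<le> (\<Sum>k\<in>I. t k T)" .
 qed
 also have "... = (\<Sum>k\<in>I. \<Sum>T\<in>El. t k T)" by (rule sum.swap)
 also have "... \<le> (\<Sum>(S, i, j)\<in>I. 2 * A * (m S * h S) * ((a ^ i * real (i + 1) ^ d) * (a ^ j * real (j + 1) ^ d)))"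
 proof (rule sum_mono)
  fix k assume "k \<in> I"
  then obtain S i j where k: "k = (S, i, j)" "S \<in> El" by (auto simp: I_def)
  have "(\<Sum>T\<in>El. t k T) = (\<Sum>T\<in>El. if reach i j S T then 2 * (?A i j * h S) * m T else 0)" by (simp add: t_def k)
  also have "... = 2 * (?A i j * h S) * (\<Sum>T | T \<in> El \<and> reach i j S T. m T)" using fin by (simp add: sum.inter_filter[symmetric] sum_distrib_left)
  also have "... \<le> 2 * (?A i j * h S) * (A * (real (i + j + 1) ^ d * (2 ^ i * m S)))"
   using A(1) k(2) cost_pos[of i j] h[OF k(2)] by (intro mult_left_mono) (auto simp: growth_def)
  \<comment> \<open>Uses i + j + 1 \<le> (i + 1)(j + 1), which separates the two sums.\<close>
  also have "... \<le> 2 * (?A i j * h S) * (A * ((real (i + 1) * real (j + 1)) ^ d * (2 ^ i * m S)))" using A(2) m_pos[OF k(2)] cost_pos[of i j] h[OF k(2)]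
   by (intro mult_left_mono mult_right_mono power_mono) (auto simp: algebra_simps)
  also have "?A i j = (a / 2) ^ i * a ^ j" unfolding cost_def a_def by argo
  also have "... = a ^ i * a ^ j / 2 ^ i" by (simp add: power_divide)
  also have "2 * (a ^ i * a ^ j / 2 ^ i * h S) * (A * ((real (i + 1) * real (j + 1)) ^ d * (2 ^ i * m S))) =
    2 * A * (m S * h S) * ((a ^ i * real (i + 1) ^ d) * (a ^ j * real (j + 1) ^ d))" by (simp add: power_mult_distrib)
  finally show "(\<Sum>T\<in>El. t k T) \<le> (case k of (S, i, j) => 2 * A * (m S * h S) * ((a ^ i * real (i + 1) ^ d) * (a ^ j * real (j + 1) ^ d)))" by (simp add: k)
 qed
 also have "... = (\<Sum>S\<in>El. \<Sum>i<N. \<Sum>j<N. 2 * A * (m S * h S) * ((a ^ i * real (i + 1) ^ d) * (a ^ j * real (j + 1) ^ d)))"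
  by (simp add: I_def sum.cartesian_product)
 also have "... = 2 * A * ((\<Sum>i<N. a ^ i * real (i + 1) ^ d) * (\<Sum>j<N. a ^ j * real (j + 1) ^ d)) * (\<Sum>S\<in>El. m S * h S)"
 proof -
  define P where "P i = a ^ i * real (i + 1) ^ d" for i
  let ?B = "(sum P {..<N} * sum P {..<N})"
  have "(\<Sum>i<N. \<Sum>j<N. k * (P i * P j)) = k * ?B" for k by (simp only: sum_product sum_distrib_left[symmetric])
  then have "(\<Sum>S\<in>El. \<Sum>i<N. \<Sum>j<N. 2 * A * (m S * h S) * (P i * P j)) = (\<Sum>S\<in>El. 2 * A * (m S * h S) * ?B)" by simp
  also have "... = (\<Sum>S\<in>El. (2 * A * ?B) * (m S * h S))" by (simp add: field_simps)
  finally have "(\<Sum>S\<in>El. \<Sum>i<N. \<Sum>j<N. 2 * A * (m S * h S) * (P i * P j)) = (\<Sum>S\<in>El. (2 * A * ?B) * (m S * h S))" .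
  then show ?thesis by (simp only: P_def[symmetric] sum_distrib_left[symmetric])
 qed
 also have "... \<le> 2 * A * (K * K) * (\<Sum>S\<in>El. m S * h S)"
 proof -
  have "0 \<le> (\<Sum>i<N. a ^ i * real (i + 1) ^ d)" using a by (intro sum_nonneg) auto
  then have "(\<Sum>i<N. a ^ i * real (i + 1) ^ d) * (\<Sum>j<N. a ^ j * real (j + 1) ^ d) \<le> K * K" using K[of N] unfolding a_def by (intro mult_mono) auto
  moreover have "0 \<le> (\<Sum>S\<in>El. m S * h S)" using m_pos h by (intro sum_nonneg mult_nonneg_nonneg) (auto simp: less_imp_le)
  ultimately show ?thesis using A(2) by (intro mult_right_mono mult_left_mono) auto
 qed
 finally show ?thesis by (simp add: power2_eq_square)
qed

end

definition local_size :: "('f => real) => 't => real" where "local_size x T = sqrt (\<Sum>f\<in>F T. (x f)^2)"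

lemma local_size_nonneg: "0 \<le> local_size x T" by (simp add: local_size_def sum_nonneg)

lemma local_size_square: "(local_size x T)^2 = (\<Sum>f\<in>F T. (x f)^2)" by (simp add: local_size_def sum_nonneg)

text \<open>Extrapolation from the weighted $L^2$ estimate: the weight is multiplied by a power of a
  majorant of $|\rho x|^p$ for \<open>p \<ge> 2\<close> and of the $p$-th power of the right-hand side for
  \<open>p < 2\<close>.\<close>

context
 fixes \<rho> :: "'t => real" and x :: "'f => real" and Ub :: "'t => real" and \<gamma> \<epsilon> b1 b \<delta> A K C\<^sub>2 C\<^sub>3 :: real
 assumes x: "solves x Ub" and U: "!!T. T \<in> El ==> 0 \<le> Ub T"
  and \<rho>: "!!T. T \<in> El ==> 0 < \<rho> T" and graded: "!!T T'. nbr T T' ==> \<rho> T \<le> \<gamma> * \<rho> T'" and levd: "!!T T'. nbr T T' ==> lev T \<le> lev T' + 1"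
  and adm: "admissible b1 b \<delta>" and \<epsilon>: "0 < \<epsilon>" and growth: "growth A" "0 \<le> A"
  and K: "!!N. (\<Sum>i<N. (1 / (1 + \<epsilon>)) ^ i * real (i + 1) ^ d) \<le> K" and \<gamma>: "1 \<le> \<gamma>"
 defines "C\<^sub>2 \<equiv> 1 + b^2 * (real d + 1) / \<delta>^2" and "C\<^sub>3 \<equiv> 1 + 2 * A * K^2"
begin

definition rt :: "'t => real" where "rt T = \<rho> T * 2 powr (real (lev T) / real d)"

abbreviation "\<kappa> \<equiv> 2 powr (1 / real d)"

lemma rt_pos: "T \<in> El ==> 0 < rt T" using \<rho> by (simp add: rt_def)

lemma rt_step:
 assumes "nbr T T'"
 shows "lev T' < lev T ==> rt T \<le> \<gamma> * \<kappa> * rt T'" "lev T = lev T' ==> rt T \<le> \<gamma> * rt T'" "lev T < lev T' ==> rt T \<le> \<gamma> / \<kappa> * rt T'"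
proof -
 let ?A = "2 powr (real (lev T) / real d)"
 have *: "rt T \<le> \<gamma> * k * rt T'" if "?A = k * 2 powr (real (lev T') / real d)" for k
 proof -
  have "rt T \<le> (\<gamma> * \<rho> T') * ?A" unfolding rt_def using graded[OF assms] by simp
  then show ?thesis by (simp add: that rt_def algebra_simps)
 qed
 show "lev T' < lev T ==> rt T \<le> \<gamma> * \<kappa> * rt T'"
 proof -
  assume "lev T' < lev T"
  then have "lev T = lev T' + 1" using levd[OF assms] by simp
  then show ?thesis by (intro *) (simp add: powr_add[symmetric] add_divide_distrib)
 qed
 show "lev T = lev T' ==> rt T \<le> \<gamma> * rt T'" using *[of 1] by simp
 show "lev T < lev T' ==> rt T \<le> \<gamma> / \<kappa> * rt T'"
 proof -
  assume "lev T < lev T'"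
  then have "lev T' = lev T + 1" using levd[OF nbr_sym[OF assms]] by simp
  then have "?A = (1 / \<kappa>) * 2 powr (real (lev T') / real d)" by (simp add: powr_add add_divide_distrib)
  from *[OF this] show ?thesis by simp
 qed
qed

lemma C23: "1 \<le> C\<^sub>2" "1 \<le> C\<^sub>3" using growth(2) by (auto simp: C\<^sub>2_def C\<^sub>3_def)

lemma L2_bound:
 assumes "!!T. T \<in> El ==> 0 < \<omega> T" and "!!T T'. nbr T T' ==> lev T \<le> lev T' ==> \<omega> T \<le> b1 * \<omega> T'"
  and "!!T T'. nbr T T' ==> lev T' < lev T ==> \<omega> T \<le> b * \<omega> T'"
 shows "(\<Sum>T\<in>El. m T * (\<omega> T * local_size x T)^2) \<le> C\<^sub>2 * (\<Sum>T\<in>El. m T * (\<omega> T * Ub T)^2)"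
proof -
 let ?R = "\<Sum>T\<in>El. m T * ((\<omega> T)^2 * (Ub T)^2)"
 have R: "0 \<le> ?R" using m_pos by (intro sum_nonneg mult_nonneg_nonneg) (auto simp: less_imp_le)
 have "(\<Sum>T\<in>El. m T * ((\<omega> T)^2 * (local_size x T)^2)) \<le> b^2 * (real d + 1) / \<delta>^2 * ?R"
  unfolding local_size_square using weighted_L2[where \<omega> = \<omega>, OF x U assms(1) adm assms(2) assms(3)] by simp
 also have "... \<le> C\<^sub>2 * ?R" using R by (intro mult_right_mono) (simp_all add: C\<^sub>2_def)
 finally show ?thesis by (simp add: power_mult_distrib)
qed

text \<open>With s = 1/2 - 1/p and \<open>G\<close> above V^p, the weight rt * G^s dominates: V^p
  \<le> (\<omega> * local size)^2 on each element. Hoelder bounds the weighted right-hand side by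
  R^(2/p) times a power of the left-hand side, which is then divided out.\<close>

lemma Lp_ge_2:
 assumes p: "2 \<le> p" and b: "\<gamma> * (1 + \<epsilon>) \<le> b1" "\<gamma> * \<kappa> * 2 powr (1/2 - 1/p) * (1 + \<epsilon>) \<le> b"
 shows "(\<Sum>T\<in>El. m T * (rt T * local_size x T) powr p) \<le> (2 * C\<^sub>2 * C\<^sub>3) powr (p/2) * (\<Sum>T\<in>El. m T * (rt T * Ub T) powr p)"
proof -
 let ?E = "local_size x"
 define V where "V T = rt T * ?E T" for T
 have V0: "0 \<le> V T" if "T \<in> El" for T using rt_pos[OF that] local_size_nonneg by (simp add: V_def)
 define AV where "AV = (\<Sum>T\<in>El. m T * V T powr p)"
 define R where "R = (\<Sum>T\<in>El. m T * (rt T * Ub T) powr p)"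
 have AV0: "0 \<le> AV" unfolding AV_def using m_pos by (intro sum_nonneg) (simp add: less_imp_le)
 have R0: "0 \<le> R" unfolding R_def using m_pos by (intro sum_nonneg) (simp add: less_imp_le)
 show ?thesis
 proof (cases "AV = 0")
  case True
  then show ?thesis using R0 unfolding AV_def V_def R_def by simp
 next
  case False
  then have AVp: "0 < AV" using AV0 by simp
  define s where "s = 1/2 - 1/p"
  have s: "0 \<le> s" "s \<le> 1" "s * 2 = 1 - 2/p" using p by (auto simp: s_def field_simps)
  have El: "El ~= {}" using False by (auto simp: AV_def)
  then have mtot: "0 < sum m El" using fin m_pos by (intro sum_pos) auto
  \<comment> \<open>Adding the mean of V^p makes \<open>h\<close> positive everywhere but only
    doubles its integral.\<close>
  define e where "e = AV / sum m El"
  have e: "0 < e" using AVp mtot by (simp add: e_def)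
  define h where "h T = V T powr p + e" for T
  have h: "0 < h T" for T using e by (simp add: h_def add_nonneg_pos)
  define G where "G = majorant \<epsilon> h"
  have hG: "h T \<le> G T" if "T \<in> El" for T unfolding G_def using h that by (intro majorant_ge \<epsilon>) (auto simp: less_imp_le)
  have G: "0 < G T" if "T \<in> El" for T using hG[OF that] h[of T] by simp
  let ?D = "(\<Sum>T\<in>El. m T * G T)"
  have Gs: "?D \<le> C\<^sub>3 * (2 * AV)"
  proof -
   have "?D \<le> 2 * A * K^2 * (\<Sum>T\<in>El. m T * h T)" unfolding G_def using h by (intro majorant_sum \<epsilon> growth K) (auto simp: less_imp_le)
   also have "(\<Sum>T\<in>El. m T * h T) = AV + sum m El * e" by (simp add: h_def AV_def distrib_left sum.distrib sum_distrib_right)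
   finally show ?thesis using AV0 mtot by (simp add: e_def C\<^sub>3_def algebra_simps)
  qed
  define \<omega> where "\<omega> T = rt T * G T powr s" for T
  let ?B = "1 + \<epsilon>"
  note G2 = majorant_powr_step(1)[where h = h, OF \<epsilon> less_imp_le[OF h] _ s(1,2), folded G_def]
  note G1 = majorant_powr_step(2)[where h = h, OF \<epsilon> less_imp_le[OF h] _ s(1,2), folded G_def]
  have k1: "1 \<le> \<kappa>" by (simp add: ge_one_powr_ge_zero)
  let ?A = "(\<Sum>T\<in>El. m T * (\<omega> T * Ub T)^2)"
  let ?C = "(\<Sum>T\<in>El. m T * (\<omega> T * ?E T)^2)"
  have "?C \<le> C\<^sub>2 * ?A"
  proof (rule L2_bound)
   show "0 < \<omega> T" if "T \<in> El" for T using rt_pos[OF that] G[OF that] by (simp add: \<omega>_def)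
   show "\<omega> T \<le> b1 * \<omega> T'" if n: "nbr T T'" "lev T \<le> lev T'" for T T'
   proof -
    have El: "T \<in> El" "T' \<in> El" using n(1) by (auto simp: nbr_def)
    have "rt T \<le> \<gamma> * rt T'"
    proof (cases "lev T = lev T'")
     case False
     then have "rt T \<le> \<gamma> / \<kappa> * rt T'" using rt_step(3)[OF n(1)] n(2) by simp
     also have "... \<le> \<gamma> * rt T'" using k1 \<gamma> rt_pos[OF El(2)] by (simp add: divide_le_eq)
     finally show ?thesis .
    qed (use rt_step(2)[OF n(1)] in simp)
    then have "\<omega> T \<le> (\<gamma> * rt T') * (?B * G T' powr s)" unfolding \<omega>_def using G1[OF n] rt_pos[OF El(1)] by (intro mult_mono) auto
    also have "... = (\<gamma> * ?B) * \<omega> T'" by (simp add: \<omega>_def)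
    also have "... \<le> b1 * \<omega> T'" using b(1) rt_pos[OF El(2)] by (intro mult_right_mono) (auto simp: \<omega>_def)
    finally show ?thesis .
   qed
   show "\<omega> T \<le> b * \<omega> T'" if n: "nbr T T'" "lev T' < lev T" for T T'
   proof -
    have El: "T \<in> El" "T' \<in> El" using n(1) by (auto simp: nbr_def)
    have "\<omega> T \<le> (\<gamma> * \<kappa> * rt T') * (2 powr s * ?B * G T' powr s)"
     unfolding \<omega>_def using G2[OF n] rt_step(1)[OF n] rt_pos[OF El(1)] by (intro mult_mono) auto
    also have "... = (\<gamma> * \<kappa> * 2 powr s * ?B) * \<omega> T'" by (simp add: \<omega>_def)
    also have "... \<le> b * \<omega> T'" using b(2) rt_pos[OF El(2)] by (intro mult_right_mono) (auto simp: \<omega>_def s_def)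
    finally show ?thesis .
   qed
  qed
  moreover have "AV \<le> ?C" unfolding AV_def
  proof (intro sum_mono mult_left_mono)
   fix T assume T: "T \<in> El"
   show "V T powr p \<le> (\<omega> T * ?E T)^2"
   proof (cases "V T = 0")
    case False
    then have Vp: "0 < V T" using V0[OF T] by simp
    \<comment> \<open>The exponents add up, 2 + p (1 - 2/p) = p, so the majorant of V^p supplies the
      missing powers.\<close>
    have "V T powr p = V T powr 2 * (V T powr p) powr (s * 2)" unfolding powr_powr powr_add[symmetric] s(3) using p by (simp add: field_simps)
    also have "... \<le> V T powr 2 * G T powr (s * 2)" using hG[OF T] e s unfolding h_def by (intro mult_left_mono powr_mono2) auto
    also have "... = (V T * G T powr s)^2" using Vp by (simp add: power_mult_distrib powr_powr[symmetric])
    also have "V T * G T powr s = \<omega> T * ?E T" by (simp add: V_def \<omega>_def)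
    finally show ?thesis .
   qed simp
  qed (use m_pos in \<open>auto simp: less_imp_le\<close>)
  moreover have "?A \<le> R powr (2/p) * (2 * C\<^sub>3 * AV) powr (1 - 2/p)"
  proof (cases "p = 2")
   case True
   have "?A = R" unfolding R_def
   proof (intro sum.cong refl)
    fix T assume T: "T \<in> El"
    show "m T * (\<omega> T * Ub T)^2 = m T * (rt T * Ub T) powr p" using rt_pos[OF T] U[OF T] using True G[OF T] by (simp add: \<omega>_def s_def)
   qed
   then show ?thesis using True AVp C23 by simp
  next
   case False
   then have p2: "2 < p" using p by simp
   have "?A = (\<Sum>T\<in>El. m T * (((rt T * Ub T) powr p) powr (2/p) * G T powr (1 - 2/p)))"
   proof (intro sum.cong refl)
    fix T assume T: "T \<in> El"
    have "((rt T * Ub T) powr p) powr (2/p) = (rt T * Ub T) powr 2" using p by (simp add: powr_powr)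
    also have "... = (rt T * Ub T)^2" using rt_pos[OF T] U[OF T] by simp
    ultimately show "m T * (\<omega> T * Ub T)^2 = m T * (((rt T * Ub T) powr p) powr (2/p) * G T powr (1 - 2/p))" by (simp add: s(3)[symmetric] powr_powr[symmetric] \<omega>_def power_mult_distrib)
   qed
   also have "... \<le> R powr (2/p) * ?D powr (1 - 2/p)" unfolding R_def using p2 m_pos G by (intro weighted_Hoelder_sum fin) (auto simp: less_imp_le)
   also have "... \<le> R powr (2/p) * (2 * C\<^sub>3 * AV) powr (1 - 2/p)"
    using Gs p G m_pos by (intro mult_left_mono powr_mono2 sum_nonneg mult_nonneg_nonneg) (auto simp: less_imp_le)
   finally show ?thesis .
  qed
  ultimately have "AV \<le> C\<^sub>2 * (R powr (2/p) * (2 * C\<^sub>3 * AV) powr (1 - 2/p))" using C23 by (meson order_trans mult_left_mono order.trans zero_le_one)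
  also have "(2 * C\<^sub>3 * AV) powr (1 - 2/p) = (2 * C\<^sub>3) powr (1 - 2/p) * AV powr (1 - 2/p)" by (simp add: powr_mult)
  also have "C\<^sub>2 * (R powr (2/p) * ((2 * C\<^sub>3) powr (1 - 2/p) * AV powr (1 - 2/p))) \<le>
    C\<^sub>2 * (R powr (2/p) * ((2 * C\<^sub>3) powr 1 * AV powr (1 - 2/p)))" using C23 p by (intro mult_left_mono mult_right_mono powr_mono) auto
  finally have "AV \<le> (2 * C\<^sub>2 * C\<^sub>3) * R powr (2/p) * AV powr (1 - 2/p)" using C23 by (simp add: mult_ac)
  moreover have "AV = AV powr (2/p) * AV powr (1 - 2/p)" using AVp by (simp add: powr_add[symmetric])
  ultimately have "AV powr (2/p) * AV powr (1 - 2/p) \<le> (2 * C\<^sub>2 * C\<^sub>3) * R powr (2/p) * AV powr (1 - 2/p)" by simp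
  then have "(AV powr (2/p)) powr (p/2) \<le> ((2 * C\<^sub>2 * C\<^sub>3) * R powr (2/p)) powr (p/2)" using AVp using p by (intro powr_mono2) auto
  then show ?thesis using p R0 by (simp add: powr_powr powr_mult AV_def R_def V_def)
 qed
qed

text \<open>Here the majorant belongs to the right-hand side and enters with the negative power -s,
  so its steep direction is reversed: the factor 2^s appears towards finer neighbors, where the
  bound for \<open>rt\<close> has 1/\<kappa>. The left-hand side is recovered by Hoelder.\<close>

lemma Lp_less_2:
 assumes p: "1 \<le> p" "p < 2" and b: "\<gamma> * (1 + \<epsilon>) \<le> b1" "\<gamma> / \<kappa> * 2 powr (1/p - 1/2) * (1 + \<epsilon>) \<le> b1"
   "\<gamma> * \<kappa> * (1 + \<epsilon>) \<le> b"
 shows "(\<Sum>T\<in>El. m T * (rt T * local_size x T) powr p) \<le> (2 * C\<^sub>2 * C\<^sub>3) powr (p/2) * (\<Sum>T\<in>El. m T * (rt T * Ub T) powr p)"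
proof -
 let ?C = "local_size x"
 define V where "V T = rt T * ?C T" for T
 have V0: "0 \<le> V T" if "T \<in> El" for T using rt_pos[OF that] local_size_nonneg by (simp add: V_def)
 define AV where "AV = (\<Sum>T\<in>El. m T * V T powr p)"
 define R where "R = (\<Sum>T\<in>El. m T * (rt T * Ub T) powr p)"
 define C where "C = (2 * C\<^sub>2 * C\<^sub>3) powr (p/2)"
 have C: "0 < C" using C23 by (simp add: C_def)
 let ?G = "sum m El"
 have main: "AV \<le> C * (R + e * ?G)" if e: "0 < e" for e
 proof -
  define s where "s = 1/p - 1/2"
  have s: "0 < s" "s \<le> 1" "s * 2 = 2/p - 1" using p by (auto simp: s_def field_simps)
  define h where "h T = (rt T * Ub T) powr p + e" for T
  have h: "0 < h T" for T using e by (simp add: h_def add_nonneg_pos)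
  define H where "H = (\<Sum>T\<in>El. m T * h T)"
  have H: "H = R + e * ?G" by (simp add: H_def h_def R_def distrib_left sum.distrib sum_distrib_left mult.commute)
  have H0: "0 \<le> H" unfolding H_def using m_pos h by (intro sum_nonneg mult_nonneg_nonneg) (auto simp: less_imp_le)
  define G where "G = majorant \<epsilon> h"
  have hG: "h T \<le> G T" if "T \<in> El" for T unfolding G_def using h that by (intro majorant_ge \<epsilon>) (auto simp: less_imp_le)
  have G: "0 < G T" if "T \<in> El" for T using hG[OF that] h[of T] by simp
  let ?D = "(\<Sum>T\<in>El. m T * G T)"
  have Gs: "?D \<le> C\<^sub>3 * H"
  proof -
   have "?D \<le> 2 * A * K^2 * H" unfolding G_def H_def using h by (intro majorant_sum \<epsilon> growth K) (auto simp: less_imp_le)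
   then show ?thesis using H0 by (simp add: C\<^sub>3_def algebra_simps)
  qed
  define \<omega> where "\<omega> T = rt T * G T powr (- s)" for T
  have inv: "G T powr (- s) \<le> k * G T' powr (- s)" if "G T' powr s \<le> k * G T powr s" "T \<in> El" "T' \<in> El" for T T' k
   using that G[OF that(2)] G[OF that(3)] by (simp add: powr_minus field_simps)
  let ?A = "1 + \<epsilon>"
  note G2 = majorant_powr_step(1)[where h = h, OF \<epsilon> less_imp_le[OF h] _ less_imp_le[OF s(1)] s(2), folded G_def]
  note G1 = majorant_powr_step(2)[where h = h, OF \<epsilon> less_imp_le[OF h] _ less_imp_le[OF s(1)] s(2), folded G_def]
  have prod: "\<omega> T \<le> k * l * \<omega> T'" if "rt T \<le> k * rt T'" "G T' powr s \<le> l * G T powr s" "T \<in> El" "T' \<in> El" "0 \<le> k"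
   for T T' k l
  proof -
   have "\<omega> T \<le> (k * rt T') * (l * G T' powr (- s))" unfolding \<omega>_def using that inv[OF that(2-4)] rt_pos[OF that(4)] by (intro mult_mono) auto
   then show ?thesis by (simp add: \<omega>_def mult_ac)
  qed
  have \<omega>0: "0 < \<omega> T" if "T \<in> El" for T using rt_pos[OF that] G[OF that] by (simp add: \<omega>_def)
  let ?B = "(\<Sum>T\<in>El. m T * (\<omega> T * ?C T)^2)"
  let ?E = "(\<Sum>T\<in>El. m T * (\<omega> T * Ub T)^2)"
  have L2: "?B \<le> C\<^sub>2 * ?E"
  proof (rule L2_bound[OF \<omega>0])
   show "\<omega> T \<le> b1 * \<omega> T'" if n: "nbr T T'" "lev T \<le> lev T'" for T T'
   proof -
    have El: "T \<in> El" "T' \<in> El" using n(1) by (auto simp: nbr_def)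
    note n' = nbr_sym[OF n(1)]
    show ?thesis
    proof (cases "lev T = lev T'")
     case True
     then have "\<omega> T \<le> \<gamma> * ?A * \<omega> T'" using rt_step(2)[OF n(1)] G1[OF n'] El \<gamma> by (intro prod) auto
     also have "... \<le> b1 * \<omega> T'" using b(1) \<omega>0[OF El(2)] by simp
     finally show ?thesis .
    next
     case False
     then have "\<omega> T \<le> \<gamma> / \<kappa> * (2 powr s * ?A) * \<omega> T'" using rt_step(3)[OF n(1)] G2[OF n'] El \<gamma> n(2) by (intro prod) auto
     also have "... \<le> b1 * \<omega> T'" using b(2) \<omega>0[OF El(2)] by (intro mult_right_mono) (auto simp: s_def)
     finally show ?thesis .
    qed
   qed
   show "\<omega> T \<le> b * \<omega> T'" if n: "nbr T T'" "lev T' < lev T" for T T'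
   proof -
    have El: "T \<in> El" "T' \<in> El" using n(1) by (auto simp: nbr_def)
    have "\<omega> T \<le> \<gamma> * \<kappa> * ?A * \<omega> T'" using rt_step(1)[OF n] G1[OF nbr_sym[OF n(1)]] El \<gamma> n(2) by (intro prod) auto
    also have "... \<le> b * \<omega> T'" using b(3) \<omega>0[OF El(2)] by simp
    finally show ?thesis .
   qed
  qed
  have Ule: "?E \<le> H" unfolding H_def
  proof (intro sum_mono mult_left_mono)
   fix T assume T: "T \<in> El"
   have ru: "0 \<le> rt T * Ub T" using rt_pos[OF T] U[OF T] by simp
   have "(\<omega> T * Ub T)^2 = (rt T * Ub T)^2 * G T powr (- (s * 2))" using powr_powr[of "G T" "- s" 2] by (simp add: \<omega>_def power_mult_distrib)
   also have "(rt T * Ub T)^2 = ((rt T * Ub T) powr p) powr (2/p)" using ru p by (simp add: powr_powr)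
   also have "... * G T powr (- (s * 2)) \<le> h T powr (2/p) * h T powr (- (s * 2))" using e p hG[OF T] h[of T] s by (intro mult_mono powr_mono2 powr_mono2') (auto simp: h_def)
   finally show "(\<omega> T * Ub T)^2 \<le> h T" using h[of T] by (simp add: powr_add[symmetric] s(3))
  qed (use m_pos in \<open>auto simp: less_imp_le\<close>)
  let ?F = "(1 - p/2)"
  have "AV = (\<Sum>T\<in>El. m T * (((\<omega> T * ?C T)^2) powr (p/2) * G T powr ?F))" unfolding AV_def
  proof (intro sum.cong refl)
   fix T assume T: "T \<in> El"
   have ol: "0 \<le> \<omega> T * ?C T" using \<omega>0[OF T] local_size_nonneg by simp
   have "V T = (\<omega> T * ?C T) * G T powr s" using G[OF T] by (simp add: V_def \<omega>_def powr_minus)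
   then have "V T powr p = (\<omega> T * ?C T) powr p * G T powr (s * p)" by (simp add: powr_mult powr_powr)
   also have "s * p = 1 - p/2" using p by (simp add: s_def field_simps)
   finally show "m T * V T powr p = m T * (((\<omega> T * ?C T)^2) powr (p/2) * G T powr ?F)" using ol powr_powr[of "\<omega> T * ?C T" 2 "p/2"] by simp
  qed
  also have "... \<le> ?B powr (p/2) * ?D powr ?F" using p m_pos G by (intro weighted_Hoelder_sum fin) (auto simp: less_imp_le)
  also have "... \<le> (C\<^sub>2 * H) powr (p/2) * (C\<^sub>3 * H) powr ?F"
  proof (intro mult_mono powr_mono2)
   show "?B \<le> C\<^sub>2 * H" using order_trans[OF L2 mult_left_mono[OF Ule]] C23 by simp
  qed (use p Gs m_pos G in \<open>auto intro!: sum_nonneg mult_nonneg_nonneg simp: less_imp_le\<close>)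
  also have "... = C\<^sub>2 powr (p/2) * C\<^sub>3 powr ?F * H" using H0 powr_add[of H "p/2" "1 - p/2"] by (simp add: powr_mult)
  also have "... \<le> C * H"
  proof -
   have "C\<^sub>2 powr (p/2) * C\<^sub>3 powr ?F \<le> C\<^sub>2 powr (p/2) * C\<^sub>3 powr (p/2)" using C23 p by (intro mult_left_mono powr_mono) auto
   also have "... = (C\<^sub>2 * C\<^sub>3) powr (p/2)" by (simp add: powr_mult)
   also have "... \<le> C" unfolding C_def using C23 p by (intro powr_mono2) auto
   finally show ?thesis using H0 by (rule mult_right_mono)
  qed
  finally show ?thesis by (simp add: H)
 qed
 have "AV \<le> C * R"
 \<comment> \<open>The shift that makes \<open>h\<close> positive is removed in the limit.\<close>
 proof (rule field_le_epsilon)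
  fix e :: real assume e: "0 < e"
  define k where "k = C * (?G + 1)"
  have sm: "0 \<le> ?G" using m_pos by (intro sum_nonneg) (auto simp: less_imp_le)
  then have k: "0 < k" using C by (simp add: k_def)
  have "AV \<le> C * (R + e / k * ?G)" using k e by (intro main) simp
  also have "... = C * R + e * (C * ?G / k)" by argo
  also have "... \<le> C * R + e * 1" using e sm by (simp add: k_def)
  finally show "AV \<le> C * R + e" by simp
 qed
 then show ?thesis by (simp add: AV_def R_def V_def C_def)
qed

lemma discrete_Lp:
 assumes p: "1 \<le> p" and b: "\<gamma> * (1 + \<epsilon>) \<le> b1" "\<gamma> / \<kappa> * 2 powr \<bar>1/2 - 1/p\<bar> * (1 + \<epsilon>) \<le> b1"
   "\<gamma> * \<kappa> * 2 powr \<bar>1/2 - 1/p\<bar> * (1 + \<epsilon>) \<le> b"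
 shows "(\<Sum>T\<in>El. m T * (rt T * local_size x T) powr p) \<le> (2 * C\<^sub>2 * C\<^sub>3) powr (p/2) * (\<Sum>T\<in>El. m T * (rt T * Ub T) powr p)"
proof (cases "p < 2")
 case True
 moreover have "\<gamma> * \<kappa> * 1 * (1 + \<epsilon>) \<le> \<gamma> * \<kappa> * 2 powr \<bar>1/2 - 1/p\<bar> * (1 + \<epsilon>)"
  using \<gamma> \<epsilon> by (simp add: ge_one_powr_ge_zero)
 ultimately show ?thesis using True p b by (intro Lp_less_2) auto
next
 case False
 then show ?thesis using False b by (intro Lp_ge_2) auto
qed

end

end

text \<open>The strict inequality in the threshold condition leaves room for an \<open>\<epsilon>\<close> that depends on \<open>d\<close> only, because
  an element has at most one coarser neighbour.  Hence the estimate is uniform up to the threshold.\<close>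

lemma CR_threshold_square:
 fixes d :: nat
 assumes d: "3 \<le> d"
 defines "B \<equiv> (real d + sqrt (real d + 2)) / (real d - sqrt (real d + 2))"
 shows "1 + 2 / sqrt (real d + 2) \<le> B" "(real d - 2) * ((real d + 1) * (B + 1 / B + 2)) = 4 * (real d)^2"
proof -
 let ?A = "real d + 2"
 define r where "r = sqrt ?A"
 have r2: "r * r = ?A" by (simp add: r_def)
 have r0: "0 < r" by (simp add: r_def)
 have "sqrt ?A < real d"
 proof (rule real_less_lsqrt)
  have "3 * real d \<le> real d * real d" using d by simp
  moreover have "3 \<le> real d" using d by simp
  ultimately show "?A < (real d)^2" unfolding power2_eq_square by argo
 qed auto
 then have rd: "0 < real d - r" by (simp add: r_def)
 let ?B = "(real d - r)"
 let ?C = "(real d + r)"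
 have B: "B = ?C / ?B" by (simp add: B_def r_def)
 have "real d - r \<le> r * r" unfolding r2 using r0 by simp
 then have "(r + 2) * ?B \<le> r * ?C" by argo
 then have "(r + 2) / r \<le> B" unfolding B using r0 rd by (simp add: divide_le_eq pos_le_divide_eq mult.commute)
 then show "1 + 2 / sqrt ?A \<le> B" by (simp add: add_divide_distrib r_def)
 \<comment> \<open>Applied with d + r and d - r: their sum is 2d and their product d^2 - d - 2 = (d
   - 2)(d + 1).\<close>
 have pq: "p / q + 1 / (p / q) + 2 = (p + q)^2 / (p * q)" if "0 < p" "0 < q" for p q :: real using that by (simp add: field_simps power2_eq_square)
 have "B + 1 / B + 2 = (?C + ?B)^2 / (?C * ?B)" unfolding B using rd r0 by (intro pq) auto
 also have "... = 4 * (real d)^2 / ((real d)^2 - r * r)" by (simp add: algebra_simps power2_eq_square)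
 also have "(real d)^2 - r * r = (real d - 2) * (real d + 1)" by (simp add: r2 algebra_simps power2_eq_square)
 finally show "(real d - 2) * ((real d + 1) * (B + 1 / B + 2)) = 4 * (real d)^2" using d by simp
qed

text \<open>Bernoulli's inequality gives 2 \<le> (1 + 1/d)^d.\<close>

lemma two_powr_inverse_le: "1 \<le> d ==> 2 powr (1 / real d) \<le> 1 + 1 / real d"
proof -
 assume d: "1 \<le> d"
 have "1 + real d * (1 / real d) \<le> (1 + 1 / real d) ^ d" by (rule Bernoulli_inequality) (simp add: order_trans[of "-1" 0])
 then have "2 powr (1 / real d) \<le> ((1 + 1 / real d) powr (real d)) powr (1 / real d)" using d by (auto simp: powr_realpow add_pos_nonneg intro!: powr_mono2)
 also have "... = 1 + 1 / real d" by (simp add: powr_powr)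
 finally show ?thesis .
qed

text \<open>Compared with d + 1 equal ratios \<open>B\<close>, now d faces carry B / \<kappa> and
  one carries \<kappa> B. The gain outweighs the loss because \<kappa> \<le> 1 + 1/d while B \<ge> 1
  + 2 / sqrt(d + 2).\<close>

lemma threshold_room:
 fixes d :: nat
 assumes d: "3 \<le> d"
 defines "B \<equiv> (real d + sqrt (real d + 2)) / (real d - sqrt (real d + 2))" and "\<kappa> \<equiv> 2 powr (1 / real d)"
 shows "\<kappa> \<le> B" "(real d - 2) * (real d * (B / \<kappa> + \<kappa> / B + 2) + (\<kappa> * B + 1 / (\<kappa> * B) + 2)) < 4 * (real d)^2"
proof -
 note B = CR_threshold_square[OF d, folded B_def]
 define r where "r = sqrt (real d + 2)"
 have d0: "3 \<le> real d" using d by simp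
 have k: "1 < \<kappa>" "\<kappa> \<le> 1 + 1 / real d" using d two_powr_inverse_le[of d] by (auto simp: \<kappa>_def)
 have r0: "0 < r" by (simp add: r_def)
 have rd: "r \<le> real d" unfolding r_def
 proof (rule real_le_lsqrt)
  have "3 * real d \<le> real d * real d" using d by simp
  moreover have "3 \<le> real d" using d by simp
  ultimately show "real d + 2 \<le> (real d)^2" unfolding power2_eq_square by argo
 qed auto
 have "1 / real d \<le> 2 / r" using rd r0 by (simp add: field_simps)
 then show kB: "\<kappa> \<le> B" using k B(1) by (simp add: r_def)
 then have B0: "1 < B" using k by simp
 let ?B = "real d - 1 - 1 / real d"
 have e: "5 * real d / 9 \<le> ?B"
 proof -
  have "1 / real d \<le> 1 / 3" using d0 by simp
  then show ?thesis using d0 by argo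
 qed
 have "real d < (1 + 4 / r) * ?B"
 proof -
  have "4 / real d \<le> 4 / r" using rd r0 by (intro divide_left_mono) auto
  then have "(4 / real d) * (5 * real d / 9) \<le> (4 / r) * ?B" using e r0 by (intro mult_mono) auto
  then have "20 / 9 \<le> (4 / r) * ?B" using d0 by simp
  moreover have "1 / real d \<le> 1 / 3" using d0 by simp
  ultimately show ?thesis by argo
 qed
 also have "... \<le> B^2 * ?B"
 proof (rule mult_right_mono)
  have "(1 + 2 / r)^2 \<le> B^2" using B(1) by (intro power_mono) (auto simp: r_def)
  moreover have "1 + 4 / r \<le> (1 + 2 / r)^2" by (simp add: power2_eq_square algebra_simps)
  ultimately show "1 + 4 / r \<le> B^2" by simp
  show "0 \<le> ?B" using e by simp
 qed
 also have "... \<le> B^2 * (real d - \<kappa>)" using k by (intro mult_left_mono) auto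
 moreover have "real d * \<kappa> - 1 \<le> real d" using k d0 by (simp add: field_simps)
 ultimately have main: "real d * \<kappa> - 1 < B * B * (real d - \<kappa>)" by (simp add: power2_eq_square)
 let ?A = "real d * (B / \<kappa> + \<kappa> / B + 2) + (\<kappa> * B + 1 / (\<kappa> * B) + 2)"
 let ?C = "(real d + 1) * (B + 1 / B + 2)"
 \<comment> \<open>Multiplied out, the difference factors; \<open>main\<close> gives the sign of the
   second factor.\<close>
 have "?C - ?A = (\<kappa> - 1) * (B * B * (real d - \<kappa>) - (real d * \<kappa> - 1)) / (\<kappa> * B)" using B0 k by (simp add: field_simps)
 also have "... > 0" using main B0 k by simp
 finally have "?A < ?C" by simp
 then have "(real d - 2) * ?A < (real d - 2) * ?C" using d0 by simp
 then show "(real d - 2) * ?A < 4 * (real d)^2" unfolding B(2) .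
qed

text \<open>At the threshold the choice is b1 = B / \<kappa> and b = B, so that b^2 / b1 = \<kappa>
  B as in \<open>threshold_room\<close>; a small \<epsilon> fits by continuity and \<delta> is the
  remaining slack. For d \<ge> 3 these numbers depend on d alone.\<close>

lemma uniform_constants:
 fixes d :: nat and \<gamma> :: real
 assumes d: "2 \<le> d"
 obtains \<epsilon> b1 b \<delta> where "0 < \<epsilon>" "1 \<le> b1" "b1 \<le> b" "0 < \<delta>"
  "(real d - 2) * (real d * (b1 + 1 / b1 + 2) + (b^2 / b1 + b1 / b^2 + 2)) \<le> 4 * ((real d)^2 - \<delta>)"
  "!!s. 0 \<le> s ==> s \<le> 1/2 ==> 1 \<le> \<gamma> ==> ereal (\<gamma> * 2 powr (1 / real d + s)) < CR_threshold d ==>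
   \<gamma> * (1 + \<epsilon>) \<le> b1 \<and> \<gamma> / 2 powr (1 / real d) * 2 powr s * (1 + \<epsilon>) \<le> b1 \<and>
   \<gamma> * 2 powr (1 / real d) * 2 powr s * (1 + \<epsilon>) \<le> b"
proof (cases "d = 2")
 case True
 \<comment> \<open>For d = 2 the factor d - 2 removes the restriction on \<open>b\<close>. With
   \<epsilon> = 1 and 2^(1/2 + s) \<le> 2 the number 4 \<gamma> is large enough.\<close>
 define b where "b = max 1 (4 * \<gamma>)"
 show thesis
 proof (rule that[of 1 b b 4])
  fix s :: real assume s: "0 \<le> s" "s \<le> 1/2" and g: "1 \<le> \<gamma>"
  define k where "k = (2::real) powr (1 / real d)"
  have 1: "2 powr s \<le> 2 powr (1/2::real)" using s by simp
  have k: "k = 2 powr (1/2)" using True by (simp add: k_def)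
  have kk: "k * k = 2" by (simp add: k powr_add[symmetric])
  have k1: "1 \<le> k" by (simp add: k ge_one_powr_ge_zero)
  have "k * 2 powr s \<le> k * k" using 1 k by simp
  then have k2: "k * 2 powr s \<le> 2" using kk by simp
  have 3: "\<gamma> * k * 2 powr s * (1 + 1) \<le> b" using k2 g by (simp add: b_def)
  have "\<gamma> / k * 2 powr s * 2 \<le> \<gamma> * k * 2 powr s * 2" using k1 g mult_mono[OF k1 k1] by (simp add: divide_le_eq)
  with 3 show "\<gamma> * (1 + 1) \<le> b \<and> \<gamma> / 2 powr (1 / real d) * 2 powr s * (1 + 1) \<le> b \<and>
   \<gamma> * 2 powr (1 / real d) * 2 powr s * (1 + 1) \<le> b" by (simp add: b_def k_def[symmetric])
 qed (use True in \<open>simp_all add: b_def\<close>)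
next
 case False
 then have d3: "3 \<le> d" using d by simp
 define B where "B = (real d + sqrt (real d + 2)) / (real d - sqrt (real d + 2))"
 define \<kappa> where "\<kappa> = (2::real) powr (1 / real d)"
 note R = threshold_room[OF d3, folded B_def \<kappa>_def]
 have k: "1 \<le> \<kappa>" by (simp add: \<kappa>_def ge_one_powr_ge_zero)
 have B0: "1 \<le> B" using R(1) k by simp
 let ?C = "(real d - 2)"
 define f where "f \<epsilon> = ?C * (real d * ((1 + \<epsilon>) * B / \<kappa> + 1 / ((1 + \<epsilon>) * B / \<kappa>) + 2) +
   (((1 + \<epsilon>)^2 * B)^2 / ((1 + \<epsilon>) * B / \<kappa>) + ((1 + \<epsilon>) * B / \<kappa>) / ((1 + \<epsilon>)^2 * B)^2 + 2))" for \<epsilon>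
 have "f 0 = ?C * (real d * (B / \<kappa> + \<kappa> / B + 2) + (\<kappa> * B + 1 / (\<kappa> * B) + 2))" by (simp add: f_def power2_eq_square)
 then have f0: "f 0 < 4 * (real d)^2" using R(2) by simp
 have "isCont f 0" unfolding f_def using k B0 by simp
 then have "(f \<longlongrightarrow> f 0) (at_right 0)" by (simp add: isCont_def filterlim_at_split)
 then have "\<forall>\<^sub>F \<epsilon> in at_right 0. f \<epsilon> < 4 * (real d)^2" using f0 by (rule order_tendstoD)
 moreover have "\<forall>\<^sub>F \<epsilon> in at_right (0::real). 0 < \<epsilon>" by (simp add: eventually_at_right_less)
 ultimately have "\<forall>\<^sub>F \<epsilon> in at_right 0. f \<epsilon> < 4 * (real d)^2 \<and> 0 < \<epsilon>" by eventually_elim auto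
 then obtain \<epsilon> where \<epsilon>: "f \<epsilon> < 4 * (real d)^2" "0 < \<epsilon>" using eventually_happens'[OF trivial_limit_at_right_real] by auto
 define b1 where "b1 = (1 + \<epsilon>) * B / \<kappa>"
 define b where "b = (1 + \<epsilon>)^2 * B"
 have e1: "1 \<le> 1 + \<epsilon>" using \<epsilon> by simp
 have Bk: "1 \<le> B / \<kappa>" "B / \<kappa> \<le> B" using R(1) k by (auto simp: divide_le_eq)
 have e2: "1 + \<epsilon> \<le> (1 + \<epsilon>)^2" using \<epsilon> by (simp add: power2_eq_square)
 let ?A = "(4 * (real d)^2 - f \<epsilon>)"
 show thesis
 proof (rule that[of \<epsilon> b1 b "?A / 4"])
  show "0 < \<epsilon>" by (rule \<epsilon>)
  show "1 \<le> b1" unfolding b1_def using mult_mono[OF e1 Bk(1)] \<epsilon> by simp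
  show "b1 \<le> b" unfolding b1_def b_def using mult_mono[OF e2 Bk(2)] k B0 by simp
  show "0 < ?A / 4" using \<epsilon> by simp
  let ?B = "(real d * (b1 + 1 / b1 + 2) + (b^2 / b1 + b1 / b^2 + 2))"
  show "?C * ?B \<le> 4 * ((real d)^2 - ?A / 4)"
  proof -
   have "?C * ?B = f \<epsilon>" by (simp only: f_def b1_def b_def)
   moreover have "z \<le> 4 * (w - (4 * w - z) / 4)" for z w :: real by argo
   ultimately show ?thesis by simp
  qed
  fix s :: real assume s: "0 \<le> s" and g: "1 \<le> \<gamma>" and less: "ereal (\<gamma> * 2 powr (1 / real d + s)) < CR_threshold d"
  have le: "\<gamma> * \<kappa> * 2 powr s \<le> B" using less False by (simp add: CR_threshold_def B_def \<kappa>_def powr_add)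
  have "\<gamma> * \<kappa> * 1 \<le> \<gamma> * \<kappa> * 2 powr s" using g k s by (simp add: ge_one_powr_ge_zero)
  then have g1: "\<gamma> \<le> B / \<kappa>" using le k by (simp add: pos_le_divide_eq)
  have g2: "\<gamma> * 2 powr s \<le> B / \<kappa>" using le k by (simp add: pos_le_divide_eq mult_ac)
  have "\<gamma> / \<kappa> * 2 powr s \<le> \<gamma> * 2 powr s" using k g by (simp add: divide_le_eq)
  then have g3: "\<gamma> / \<kappa> * 2 powr s \<le> B / \<kappa>" using g2 by simp
  have "\<gamma> * (1 + \<epsilon>) \<le> b1" "\<gamma> / \<kappa> * 2 powr s * (1 + \<epsilon>) \<le> b1"
   using mult_right_mono[OF g1, of "1 + \<epsilon>"] mult_right_mono[OF g3, of "1 + \<epsilon>"] e1 by (auto simp: b1_def mult.commute)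
  moreover have "\<gamma> * \<kappa> * 2 powr s * (1 + \<epsilon>) \<le> b" unfolding b_def using mult_mono[OF le e2] B0 e1 by argo
  ultimately show "\<gamma> * (1 + \<epsilon>) \<le> b1 \<and> \<gamma> / 2 powr (1 / real d) * 2 powr s * (1 + \<epsilon>) \<le> b1 \<and>
   \<gamma> * 2 powr (1 / real d) * 2 powr s * (1 + \<epsilon>) \<le> b" by (simp add: \<kappa>_def)
 qed
qed

text \<open>Half of the decay, r = sqrt a, bounds the polynomial factor, and the other half sums
  up.\<close>

lemma geometric_moment_bounded:
 fixes \<epsilon> :: real
 assumes "0 < \<epsilon>"
 obtains K where "!!N. (\<Sum>i<N. (1 / (1 + \<epsilon>)) ^ i * real (i + 1) ^ d) \<le> K"
proof -
 define a where "a = 1 / (1 + \<epsilon>)"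
 have a: "0 < a" "a < 1" using assms by (auto simp: a_def)
 define r where "r = sqrt a"
 have r: "0 < r" "r < 1" using a by (auto simp: r_def)
 \<comment> \<open>(i + 1) t^i is bounded, and r^i \<le> (t^i)^d supplies one such factor for each
   power of i + 1.\<close>
 define t where "t = r powr (1 / real (d + 1))"
 have t: "0 < t" "t < 1" using r powr_less_mono2[of "1 / real (d + 1)" r 1] by (auto simp: t_def)
 have "(%n. real n * t ^ n) \<longlonglongrightarrow> 0" using t by (intro powser_times_n_limit_0) simp
 then have "Bseq (%n. real n * t ^ n)" by (intro convergent_imp_Bseq) (auto simp: convergent_def)
 then obtain M where M: "0 < M" "!!n. norm (real n * t ^ n) \<le> M" by (auto elim: BseqE)
 have rt: "r = t ^ (d + 1)" using r by (simp add: t_def powr_realpow[symmetric] powr_powr del: power_Suc)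
 have bd: "r ^ i * real (i + 1) ^ d \<le> ((M + 1)) ^ d" for i
 proof -
  have "r ^ i = (t ^ i) ^ (d + 1)" unfolding rt by (simp add: power_mult[symmetric] mult.commute del: power_Suc)
  also have "... \<le> (t ^ i) ^ d" using t by (simp add: power_le_one)
  finally have "r ^ i * real (i + 1) ^ d \<le> (t ^ i) ^ d * real (i + 1) ^ d" by simp
  also have "... \<le> (M + 1) ^ d" using M(2)[of i] t power_le_one[of t i] by (auto simp: power_mult_distrib[symmetric] algebra_simps intro!: power_mono)
  finally show ?thesis .
 qed
 show thesis
 proof (rule that[of "(M + 1) ^ d * (1 / (1 - r))"])
  fix N
  have "(\<Sum>i<N. a ^ i * real (i + 1) ^ d) \<le> (\<Sum>i<N. (M + 1) ^ d * r ^ i)"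
  proof (rule sum_mono)
   fix i
   have "a ^ i * real (i + 1) ^ d = (r ^ i * real (i + 1) ^ d) * r ^ i" using a by (simp add: r_def power_mult_distrib[symmetric])
   also have "... \<le> (M + 1) ^ d * r ^ i" using bd r by (intro mult_right_mono) auto
   finally show "a ^ i * real (i + 1) ^ d \<le> (M + 1) ^ d * r ^ i" .
  qed
  also have "... = (M + 1) ^ d * (\<Sum>i<N. r ^ i)" by (simp add: sum_distrib_left)
  also have "... \<le> (M + 1) ^ d * (1 / (1 - r))"
  proof (rule mult_left_mono)
   have "(\<Sum>i<N. r ^ i) \<le> (\<Sum>i. r ^ i)" using r by (intro sum_le_suminf summable_geometric) auto
   then show "(\<Sum>i<N. r ^ i) \<le> 1 / (1 - r)" using r by (simp add: suminf_geometric)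
  qed (use M in simp)
  finally show "(\<Sum>i<N. (1 / (1 + \<epsilon>)) ^ i * real (i + 1) ^ d) \<le> (M + 1) ^ d * (1 / (1 - r))" by (simp add: a_def)
 qed
qed

section \<open>The Poincare inequality on convex sets\<close>

definition flat_exp :: "real => nat => real => real" where "flat_exp c k t = (if 0 < t then exp (- c / t) / t ^ k else 0)"

text \<open>The term of order k + 2 of the exponential series leaves a factor t^2, which makes the
  derivative at 0 vanish.\<close>

lemma flat_exp_quadratic:
 assumes c: "0 < c"
 shows "\<bar>flat_exp c k t\<bar> \<le> fact (k + 2) / c ^ (k + 2) * t^2"
proof (cases "0 < t")
 case True
 let ?A = "fact (k + 2)"
 have le: "(c / t) ^ (k + 2) / ?A \<le> exp (c / t)"
 proof -
  have "(\<Sum>n\<in>{k + 2}. inverse (fact n) * (c / t) ^ n) \<le> (\<Sum>n. inverse (fact n) * (c / t) ^ n)"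
   using c True summable_exp_generic[of "c / t"] by (intro sum_le_suminf) auto
  then show ?thesis by (simp add: exp_def field_simps)
 qed
 have "exp (- z) \<le> w / y" if "y / w \<le> exp z" "0 < y" "0 < w" for y w z :: real using that by (simp add: exp_minus field_simps)
 from this[OF le] have "exp (- (c / t)) \<le> ?A / (c / t) ^ (k + 2)" using c True by simp
 then have "exp (- (c / t)) / t ^ k \<le> ?A / (c / t) ^ (k + 2) / t ^ k" using True by (intro divide_right_mono) auto
 also have "... = ?A / c ^ (k + 2) * t^2" using True c by (simp add: field_simps power2_eq_square)
 finally show ?thesis using True by (simp add: flat_exp_def)
qed (use c in \<open>simp add: flat_exp_def\<close>)

text \<open>The family is closed under differentiation up to linear combinations, which gives all
  derivatives of \<open>bump\<close> by induction.\<close>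

lemma flat_exp_deriv:
 assumes c: "0 < c"
 shows "(flat_exp c k has_real_derivative c * flat_exp c (k + 2) t - real k * flat_exp c (k + 1) t) (at t)"
proof -
 consider "0 < t" | "t < 0" | "t = 0" by argo
 then show ?thesis
 proof cases
  case 1
  let ?A = "(exp (- c / t) * (c / t^2) * t ^ k - exp (- c / t) * (real k * t ^ (k - 1)))"
  have "((%t. exp (- c / t) / t ^ k) has_real_derivative
    ?A / (t ^ k * t ^ k)) (at t)" using 1 by (auto intro!: derivative_eq_intros simp: power2_eq_square)
  also have "?A / (t ^ k * t ^ k) =
    c * flat_exp c (k + 2) t - real k * flat_exp c (k + 1) t" using 1 by (cases k) (simp_all add: flat_exp_def field_simps power2_eq_square)
  finally show ?thesis by (rule DERIV_cong_ev[THEN iffD2, rotated -1])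
    (use 1 in \<open>auto simp: flat_exp_def intro!: eventually_nhds_in_open[of "{0<..}", THEN eventually_mono]\<close>)
 next
  case 2
  have "((%t. 0) has_real_derivative 0) (at t)" by simp
  then have "(flat_exp c k has_real_derivative 0) (at t)" by (rule DERIV_cong_ev[THEN iffD2, rotated -1])
    (use 2 in \<open>auto simp: flat_exp_def intro!: eventually_nhds_in_open[of "{..<0}", THEN eventually_mono]\<close>)
  then show ?thesis using 2 by (simp add: flat_exp_def)
 next
  case 3
  have "((%h. (flat_exp c k (0 + h) - flat_exp c k 0) / h) \<longlongrightarrow> 0) (at 0)"
  proof (rule Lim_null_comparison)
   let ?B = "fact (k + 2)"
   show "\<forall>\<^sub>F h in at 0. norm ((flat_exp c k (0 + h) - flat_exp c k 0) / h) \<le> ?B / c ^ (k + 2) * \<bar>h\<bar>"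
   proof (rule eventually_at_ball'[of 1 0, THEN eventually_mono])
    fix h :: real assume h: "h \<in> ball 0 1 \<and> h ~= 0 \<and> h \<in> UNIV"
    have "\<bar>flat_exp c k h\<bar> / \<bar>h\<bar> \<le> ?B / c ^ (k + 2) * h^2 / \<bar>h\<bar>" by (intro divide_right_mono flat_exp_quadratic c) auto
    also have "... = ?B / c ^ (k + 2) * \<bar>h\<bar>" by (simp add: power2_eq_square abs_if)
    finally show "norm ((flat_exp c k (0 + h) - flat_exp c k 0) / h) \<le> ?B / c ^ (k + 2) * \<bar>h\<bar>" by (simp add: flat_exp_def[of c k 0])
   qed simp
   let ?C = "(%h. ?B / c ^ (k + 2) * \<bar>h\<bar>)"
   have "(?C \<longlongrightarrow> ?B / c ^ (k + 2) * \<bar>0\<bar>) (at (0::real))" by (intro tendsto_intros)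
   then show "(?C \<longlongrightarrow> 0) (at (0::real))" by simp
  qed
  then show ?thesis using 3 by (simp add: DERIV_def flat_exp_def)
 qed
qed

lemma flat_exp_bounds: "0 < c ==> 0 \<le> flat_exp c 0 t \<and> flat_exp c 0 t \<le> 1" by (simp add: flat_exp_def)

lemma flat_exp_pos_iff: "flat_exp c 0 t ~= 0 \<longleftrightarrow> 0 < t" by (simp add: flat_exp_def)

lemma flat_exp_tendsto: "(%n. flat_exp (1 / real (Suc n)) 0 t) \<longlonglongrightarrow> (if 0 < t then 1 else 0)"
proof (cases "0 < t")
 case True
 have "(%n. exp (- (1 / real (Suc n)) / t)) \<longlonglongrightarrow> exp (- 0 / t)" by (intro tendsto_intros LIMSEQ_Suc lim_1_over_n) (use True in auto)
 then show ?thesis by (simp add: flat_exp_def)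
qed (simp add: flat_exp_def)

lemma partial_deriv_eq: "(f has_derivative f') (at x) ==> partial_deriv b f x = f' b" by (simp add: partial_deriv_def frechet_derivative_at[symmetric])

lemma Ck_SucD: "Ck (Suc k) f ==> Ck k f"
proof (induction k arbitrary: f)
 case 0
 then show ?case by (auto intro!: differentiable_imp_continuous_on simp: differentiable_on_def)
next
 case (Suc k)
 then show ?case by simp
qed

lemma Ck_const: "Ck k (%x. c)"
proof (induction k arbitrary: c)
 case (Suc k)
 have "partial_deriv b (%x. c) = (%x. 0)" for b :: 'a by (auto intro!: partial_deriv_eq)
 then show ?case using Suc by simp
qed simp

lemma Ck_add: "Ck k f ==> Ck k g ==> Ck k (%x. f x + g x)"
proof (induction k arbitrary: f g)
 case (Suc k)
 have "partial_deriv b (%x. f x + g x) = (%x. partial_deriv b f x + partial_deriv b g x)" for b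
 proof
  fix x
  have "(f has_derivative frechet_derivative f (at x)) (at x)" "(g has_derivative frechet_derivative g (at x)) (at x)"
   using Suc.prems by (auto simp: frechet_derivative_works[symmetric])
  from has_derivative_add[OF this]
  show "partial_deriv b (%x. f x + g x) x = partial_deriv b f x + partial_deriv b g x" by (subst partial_deriv_eq) (auto simp: partial_deriv_def)
 qed
 then show ?case using Suc by auto
qed (simp add: continuous_on_add)

lemma Ck_mult: "Ck k f ==> Ck k g ==> Ck k (%x. f x * g x)"
proof (induction k arbitrary: f g)
 case (Suc k)
 have "partial_deriv b (%x. f x * g x) = (%x. f x * partial_deriv b g x + partial_deriv b f x * g x)" for b
 proof
  fix x
  have "(f has_derivative frechet_derivative f (at x)) (at x)" "(g has_derivative frechet_derivative g (at x)) (at x)"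
   using Suc.prems by (auto simp: frechet_derivative_works[symmetric])
  from has_derivative_mult[OF this]
  show "partial_deriv b (%x. f x * g x) x = f x * partial_deriv b g x + partial_deriv b f x * g x" by (subst partial_deriv_eq) (auto simp: partial_deriv_def)
 qed
 moreover have "Ck k (%x. f x * partial_deriv b g x + partial_deriv b f x * g x)" if "b \<in> Basis" for b
  using Ck_SucD[OF Suc.prems(1)] Ck_SucD[OF Suc.prems(2)] Suc.prems that by (intro Ck_add Suc.IH) auto
 ultimately show ?case using Suc.prems by auto
qed (simp add: continuous_on_mult)

lemma Ck_prod: "finite A ==> (!!i. i \<in> A ==> Ck k (f i)) ==> Ck k (%x. \<Prod>i\<in>A. f i x)" by (induction A rule: finite_induct) (auto intro: Ck_const Ck_mult)

lemma Ck_flat_exp: "0 < c ==> Ck k (%x. flat_exp c j (x \<bullet> v + s))"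
proof -
 assume c: "0 < c"
 let ?A = "flat_exp c"
 have deriv: "((%x. ?A j (x \<bullet> v + s)) has_derivative (%h. (c * ?A (j + 2) (x \<bullet> v + s) - real j * ?A (j + 1) (x \<bullet> v + s)) * (h \<bullet> v))) (at x)" for j x
 by (intro derivative_eq_intros has_derivative_compose[OF _ flat_exp_deriv[OF c, unfolded has_field_derivative_def]]) auto
 show "Ck k (%x. ?A j (x \<bullet> v + s))"
 proof (induction k arbitrary: j)
  case 0
  show ?case using deriv[of j] by (auto intro!: has_derivative_continuous_on[OF has_derivative_at_withinI])
 next
  case (Suc k)
  have "partial_deriv b (%x. ?A j (x \<bullet> v + s)) =
    (%x. (c * (b \<bullet> v)) * ?A (j + 2) (x \<bullet> v + s) + (- real j * (b \<bullet> v)) * ?A (j + 1) (x \<bullet> v + s))" for b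
   by (rule ext, subst partial_deriv_eq[OF deriv]) (simp add: algebra_simps)
  moreover have "Ck k (%x. (c * (b \<bullet> v)) * ?A (j + 2) (x \<bullet> v + s) + (- real j * (b \<bullet> v)) * ?A (j + 1) (x \<bullet> v + s))" for b
   by (intro Ck_add Ck_mult[OF Ck_const] Suc.IH)
  moreover have "(%x. ?A j (x \<bullet> v + s)) differentiable (at x)" for x using deriv[of j x] unfolding differentiable_def by auto
  ultimately show ?case by simp
 qed
qed

text \<open>An explicit test function in place of a mollifier: nonzero exactly on the open box, and
  convergent to its indicator as \<open>c\<close> tends to 0.\<close>

definition bump :: "real => 'a::euclidean_space => 'a => 'a => real" where
 "bump c a b x = (\<Prod>i\<in>Basis. flat_exp c 0 (x \<bullet> i + (- (a \<bullet> i))) * flat_exp c 0 (x \<bullet> (- i) + b \<bullet> i))"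

lemma Ck_bump: "0 < c ==> Ck k (bump c a b)" unfolding bump_def by (intro Ck_prod Ck_mult Ck_flat_exp) auto

lemma bump_support: "bump c a b x ~= 0 \<longleftrightarrow> x \<in> box a b" by (simp add: bump_def flat_exp_pos_iff box_def)

lemma bump_bounds: "0 < c ==> 0 \<le> bump c a b x \<and> bump c a b x \<le> 1" unfolding bump_def using flat_exp_bounds[of c] by (auto intro!: prod_nonneg prod_le_1 mult_le_one)

lemma bump_tendsto: "(%n. bump (1 / real (Suc n)) a b x) \<longlonglongrightarrow> indicator (box a b) x"
proof -
 let ?A = "(\<Prod>i\<in>Basis. (if 0 < x \<bullet> i + (- (a \<bullet> i)) then 1 else 0) * (if 0 < x \<bullet> (- i) + b \<bullet> i then 1 else 0))"
 have "(%n. bump (1 / real (Suc n)) a b x) \<longlonglongrightarrow>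
   ?A" unfolding bump_def by (intro tendsto_prod tendsto_mult flat_exp_tendsto)
 also have "?A = (indicator (box a b) x :: real)" by (cases "x \<in> box a b") (auto simp: box_def)
 finally show ?thesis .
qed

lemma bump_translate: "bump c a b (x - v) = bump c (a + v) (b + v) x" by (simp add: bump_def algebra_simps)

lemma test_function_bump:
 assumes "0 < c" "cbox a b \<subseteq> \<Omega>"
 shows "test_function \<Omega> (bump c a b)"
proof -
 have "closure {x. bump c a b x ~= 0} \<subseteq> cbox a b" by (rule closure_minimal) (auto simp: bump_support box_subset_cbox[THEN subsetD])
 then show ?thesis using assms unfolding test_function_def by (metis Ck_bump bounded_cbox bounded_subset closed_closure compact_eq_bounded_closed order_trans)
qed

text \<open>The positive and the negative part of \<open>w\<close> are densities of two measures
  that agree on boxes, an intersection-stable generator.\<close>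

lemma box_integrals_zero_imp_AE:
 fixes w :: "'a::euclidean_space => real"
 assumes w: "integrable lborel w" and zero: "!!a b. (IL x. indicator (box a b) x * w x) = 0"
 shows "AE x in lborel. w x = 0"
proof -
 let ?C = "borel_measurable borel"
 have [measurable]: "w \<in> ?C" using w by simp
 define p where "p x = ennreal (w x)" for x
 define q where "q x = ennreal (- w x)" for x
 have [measurable]: "p \<in> ?C" "q \<in> ?C" unfolding p_def q_def by auto
 let ?A = "integrable lborel"
 have pq: "(NN x. p x * indicator A x) = ennreal (IL x. indicator A x * max 0 (w x))" "(NN x. q x * indicator A x) = ennreal (IL x. indicator A x * max 0 (- w x))"
  "?A (%x. indicator A x * max 0 (w x))" "?A (%x. indicator A x * max 0 (- w x))"
  if [measurable]: "A \<in> sets borel" for A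
 proof -
  have "?A (%x. max 0 (w x))" "?A (%x. max 0 (- w x))" using w by auto
  from integrable_mult_indicator[OF _ this(1), of A] integrable_mult_indicator[OF _ this(2), of A]
  show i: "?A (%x. indicator A x * max 0 (w x))" "?A (%x. indicator A x * max 0 (- w x))" by auto
  show "(NN x. p x * indicator A x) = ennreal (IL x. indicator A x * max 0 (w x))" "(NN x. q x * indicator A x) = ennreal (IL x. indicator A x * max 0 (- w x))"
   by (auto simp: p_def q_def nn_integral_eq_integral[OF i(1), symmetric] nn_integral_eq_integral[OF i(2), symmetric], auto intro!: nn_integral_cong simp: split: split_indicator)
 qed
 let ?E = "range (%(a::'a, b). box a b)"
 let ?B = "density lborel"
 have eq: "?B p = ?B q"
 proof (rule measure_eqI_generator_eq[where E = ?E and \<Omega> = UNIV and A = "%i::nat. box (- (real i *\<^sub>R One)) (real i *\<^sub>R One)"])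
  show "Int_stable ?E" by (auto simp: Int_stable_def box_Int_box)
  show "sets (?B p) = sigma_sets UNIV ?E" "sets (?B q) = sigma_sets UNIV ?E" by (auto simp: borel_eq_box)
  show "(\<Union>i::nat. box (- (real i *\<^sub>R One)) (real i *\<^sub>R One)) = (UNIV :: 'a set)" by (rule UN_box_eq_UNIV)
  fix X assume "X \<in> ?E"
  then obtain a b :: 'a where X: "X = box a b" by auto
  have "0 = (IL x. indicator (box a b) x * max 0 (w x)) - (IL x. indicator (box a b) x * max 0 (- w x))"
   by (subst Bochner_Integration.integral_diff[OF pq(3,4), symmetric], simp, simp, subst zero[of a b, symmetric]) (auto intro!: Bochner_Integration.integral_cong split: split_max)
  then show "emeasure (?B p) X = emeasure (?B q) X" using pq(1,2)[of X] by (simp add: X emeasure_density)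
 next
  fix i show "emeasure (?B p) (box (- (real i *\<^sub>R One)) (real i *\<^sub>R One)) ~= \<infinity>"
   using pq(1)[of "box (- (real i *\<^sub>R One)) (real i *\<^sub>R One)"] by (simp add: emeasure_density)
 qed auto
 then have "AE x in lborel. p x = q x" by (intro sigma_finite_measure.density_unique[OF sigma_finite_lborel]) auto
 then show ?thesis
 proof eventually_elim
  case (elim x)
  then show ?case using ennreal_eq_0_iff[of "w x"] ennreal_eq_0_iff[of "- w x"] unfolding p_def q_def by auto
 qed
qed

section \<open>Differences along segments and the Poincare inequality\<close>

lemma lborel_integral_translate:
 fixes f :: "'a::euclidean_space => real"
 assumes [measurable]: "f \<in> borel_measurable borel"
 shows "(IL x. f (x + v)) = (IL x. f x)" "integrable lborel (%x. f (x + v)) \<longleftrightarrow> integrable lborel f"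
proof -
 have "(IL x. f x) = (LINT x|distr lborel borel ((+) v). f x)" by (simp add: lborel_distr_plus)
 also have "... = (IL x. f (v + x))" by (intro integral_distr) auto
 finally show "(IL x. f (x + v)) = (IL x. f x)" by (simp add: add.commute)
 let ?A = "integrable lborel"
 have "?A f \<longleftrightarrow> integrable (distr lborel borel ((+) v)) f" by (simp add: lborel_distr_plus)
 also have "... \<longleftrightarrow> ?A (%x. f (v + x))" by (intro integrable_distr_eq) auto
 finally show "?A (%x. f (x + v)) \<longleftrightarrow> ?A f" by (simp add: add.commute)
qed

text \<open>Weak differentiability in a form fit for Fubini: Borel measurable functions, tested only
  with the functions \<open>bump\<close>.\<close>

definition borel_weak :: "'a::euclidean_space set => ('a => real) => ('a => 'a) => bool" where
 "borel_weak \<Omega> u g \<longleftrightarrow> u \<in> borel_measurable borel \<and> g \<in> borel_measurable borel \<and> (\<forall>S. compact S \<and> S \<subseteq> \<Omega> -->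
   integrable lborel (%x. indicator S x * u x) \<and> integrable lborel (%x. indicator S x *\<^sub>R g x)) \<and>
  (\<forall>c a b i. 0 < c \<and> cbox a b \<subseteq> \<Omega> \<and> i \<in> Basis --> (IL x. u x * partial_deriv i (bump c a b) x) = - (IL x. (g x \<bullet> i) * bump c a b x))"

lemma integrable_bounded_times:
 fixes w k :: "'b => real"
 assumes "integrable M w" "k \<in> borel_measurable M" "!!x. x \<in> space M ==> \<bar>k x\<bar> \<le> B"
 shows "integrable M (%x. w x * k x)"
proof (rule Bochner_Integration.integrable_bound[of M "%x. B * w x"])
 show "AE x in M. norm (w x * k x) \<le> norm (B * w x)"
 proof (rule AE_I2)
  fix x assume "x \<in> space M"
  from assms(3)[OF this] have "\<bar>w x\<bar> * \<bar>k x\<bar> \<le> \<bar>w x\<bar> * \<bar>B\<bar>" by (intro mult_left_mono) auto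
  then show "norm (w x * k x) \<le> norm (B * w x)" by (simp add: abs_mult mult.commute)
 qed
qed (use assms in auto)

lemma bump_deriv_continuous: "0 < c ==> i \<in> Basis ==> continuous_on UNIV (partial_deriv i (bump c a b))" using Ck_bump[of c "Suc 0" a b] by simp

lemma bump_has_derivative: "0 < c ==> (bump c a b has_derivative frechet_derivative (bump c a b) (at x)) (at x)"
 using Ck_bump[of c "Suc 0" a b] by (simp add: frechet_derivative_works[symmetric])

lemma bump_deriv:
 assumes c: "0 < c"
 shows "(bump c a b has_derivative (%h. \<Sum>i\<in>Basis. (h \<bullet> i) * partial_deriv i (bump c a b) x)) (at x)"
proof -
 note d = bump_has_derivative[OF c, of a b x]
 let ?B = "(bump c a b)"
 let ?A = "frechet_derivative ?B (at x)"
 interpret linear "?A" using d by (rule has_derivative_linear)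
 have "?A h = (\<Sum>i\<in>Basis. (h \<bullet> i) * partial_deriv i ?B x)" for h
 proof -
  have "?A (\<Sum>i\<in>Basis. (h \<bullet> i) *\<^sub>R i) = (\<Sum>i\<in>Basis. (h \<bullet> i) * partial_deriv i ?B x)" by (simp add: sum scaleR partial_deriv_def)
  then show ?thesis by (simp add: euclidean_representation)
 qed
 then have "?A = (%h. \<Sum>i\<in>Basis. (h \<bullet> i) * partial_deriv i ?B x)" by auto
 then show ?thesis using d by simp
qed

lemma bump_deriv_outside:
 assumes c: "0 < c" and x: "x \<notin> cbox a b"
 shows "partial_deriv i (bump c a b) x = 0"
proof -
 have "(bump c a b has_derivative (%h. 0)) (at x)"
 proof (rule has_derivative_transform_within_open[of _ _ _ _ "- cbox a b"])
  fix y assume "y \<in> - cbox a b"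
  then show "0 = bump c a b y" using box_subset_cbox[of a b] using bump_support[of c a b y] by auto
 qed (use x in auto)
 then show ?thesis by (simp add: partial_deriv_eq)
qed

lemma bump_deriv_bounded:
 assumes c: "0 < c" and i: "i \<in> Basis"
 obtains B where "0 \<le> B" "!!x. \<bar>partial_deriv i (bump c a b) x\<bar> \<le> B"
proof -
 let ?A = "partial_deriv i (bump c a b)"
 have "compact (?A ` cbox a b)" by (intro compact_continuous_image compact_cbox continuous_on_subset[OF bump_deriv_continuous[OF c i]]) auto
 then obtain B where B: "0 < B" "!!x. x \<in> cbox a b ==> norm (?A x) \<le> B" by (metis bounded_pos compact_imp_bounded imageI)
 have "\<bar>?A x\<bar> \<le> B" for x using B bump_deriv_outside[OF c, of x a b] by force
 then show thesis using that B(1) by (meson less_imp_le)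
qed

lemma bump_deriv_translate: "0 < c ==> partial_deriv i (bump c a b) (x - v) = partial_deriv i (bump c (a + v) (b + v)) x"
proof -
 assume c: "0 < c"
 have "((%x. bump c a b (x - v)) has_derivative frechet_derivative (bump c a b) (at (x - v))) (at x)"
  by (rule has_derivative_compose[OF _ bump_has_derivative[OF c]]) (auto intro!: derivative_eq_intros)
 then have "(bump c (a + v) (b + v) has_derivative frechet_derivative (bump c a b) (at (x - v))) (at x)" unfolding bump_translate .
 then show ?thesis by (simp add: partial_deriv_eq) (simp add: partial_deriv_def)
qed

lemma unit_interval_Fubini:
 fixes f :: "real => 'a::euclidean_space => real"
 assumes [measurable]: "(%(t, x). f t x) \<in> borel_measurable (borel \<Otimes>\<^sub>M borel)" and i: "!!t. t \<in> {0..1} ==> integrable lborel (f t)"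
  and B: "!!t. t \<in> {0..1} ==> (IL x. \<bar>f t x\<bar>) \<le> B"
 shows "integrable (lborel \<Otimes>\<^sub>M lborel) (%(t, x). indicator {0..1} t * f t x)"
proof (rule lborel_pair.Fubini_integrable)
 show "(%(t, x). indicator {0..1} t * f t x) \<in> borel_measurable (lborel \<Otimes>\<^sub>M lborel)" by simp
 let ?B = "integrable lborel"
 show "AE t in lborel. ?B (%x. case (t, x) of (t, x) => indicator {0..1} t * f t x)" using i by (simp add: indicator_def)
 let ?A = "(%t. IL x. norm (case (t, x) of (t, x) => indicator {0..1} t * f t x))"
 show "?B ?A"
 proof (rule Bochner_Integration.integrable_bound)
  show "?B (%t. B * indicator {0..1::real} t)" by simp
  show "?A \<in> borel_measurable lborel" by simp
  show "AE t in lborel. norm (IL x. norm (case (t, x) of (t, x) => indicator {0..1} t * f t x)) \<le> norm (B * indicator {0..1} t)"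
  proof (rule AE_I2)
   fix t :: real
   have "(IL x. \<bar>f t x\<bar>) \<le> \<bar>B\<bar>" if "t \<in> {0..1}" using B[OF that] by simp
   then show "norm (IL x. norm (case (t, x) of (t, x) => indicator {0..1} t * f t x)) \<le> norm (B * indicator {0..1} t)" by (simp add: indicator_def)
  qed
 qed
qed

text \<open>The fundamental theorem of calculus in weak form. Tested with a bump, the difference of
  \<open>u\<close> moves onto the bump and becomes an integral of its derivative along the segment;
  the weak derivative moves this onto \<open>g\<close>, and the bumps then tend to the
  indicator.\<close>

lemma difference_formula:
 fixes u :: "'a::euclidean_space => real" and g :: "'a => 'a" and h :: 'a
 assumes W: "borel_weak \<Omega> u g" and K: "convex K" "K \<subseteq> \<Omega>" and ab: "cbox a b \<subseteq> K" "cbox (a + h) (b + h) \<subseteq> K"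
 defines "G \<equiv> %x. IL t. indicator {0..1} t * (g (x + t *\<^sub>R h) \<bullet> h)"
 shows "integrable lborel (%x. indicator (cbox a b) x * (u (x + h) - u x - G x))" (is ?int) and "(IL x. indicator (box a b) x * (u (x + h) - u x - G x)) = 0" (is ?zero)
proof -
 let ?B = "borel_measurable borel"
 have [measurable]: "u \<in> ?B" "g \<in> ?B" using W by (auto simp: borel_weak_def)
 let ?J = "cbox a b"
 \<comment> \<open>Contains every segment from the box to its translate, and is compact inside
   \<Omega> because \<open>K\<close> is convex. Cut off to \<open>S\<close>, \<open>u\<close> and
   \<open>g\<close> are integrable on the whole space.\<close>
 define S where "S = convex hull (?J \<union> cbox (a + h) (b + h))"
 have S: "compact S" unfolding S_def by (intro compact_convex_hull compact_Un compact_cbox)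
 have S\<Omega>: "S \<subseteq> \<Omega>" unfolding S_def using K ab by (metis Un_least hull_minimal order_trans)
 have [measurable]: "S \<in> sets borel" using S by (simp add: borel_compact)
 have mem: "x + t *\<^sub>R h \<in> S" if "x \<in> ?J" "t \<in> {0..1}" for x t
 proof -
  have "x + h \<in> cbox (a + h) (b + h)" using that(1) by (simp add: mem_box inner_add_left)
  then have "(1 - t) *\<^sub>R x + t *\<^sub>R (x + h) \<in> S" using that unfolding S_def by (intro convexD[OF convex_convex_hull]) (auto intro: hull_inc)
  then show ?thesis by (simp add: algebra_simps)
 qed
 have boxt: "cbox (a + t *\<^sub>R h) (b + t *\<^sub>R h) \<subseteq> S" if t: "t \<in> {0..1}" for t
 proof
  fix y assume "y \<in> cbox (a + t *\<^sub>R h) (b + t *\<^sub>R h)"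
  then have "y - t *\<^sub>R h \<in> ?J" by (simp add: mem_box algebra_simps)
  from mem[OF this t] show "y \<in> S" by simp
 qed
 define ub where "ub x = indicator S x * u x" for x
 define gi where "gi i x = indicator S x * (g x \<bullet> i)" for i x
 have [measurable]: "ub \<in> ?B" "gi i \<in> ?B" for i unfolding ub_def gi_def by auto
 let ?A = "integrable lborel"
 have ub: "?A ub" and "?A (%x. indicator S x *\<^sub>R g x)" using W S S\<Omega> unfolding borel_weak_def ub_def by auto
 from integrable_inner_left[OF this(2)] have gi: "?A (gi i)" for i by (simp add: gi_def[abs_def])
 define Gb where "Gb x = (IL t. indicator {0..1} t * gi h (x + t *\<^sub>R h))" for x
 have Gb: "Gb x = G x" if "x \<in> ?J" for x unfolding Gb_def G_def using mem[OF that] by (intro Bochner_Integration.integral_cong) (auto simp: gi_def indicator_def)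
 have ux: "ub x = u x" "ub (x + h) = u (x + h)" if "x \<in> ?J" for x using mem[OF that, of 0] mem[OF that, of 1] by (auto simp: ub_def)
 let ?C = "integrable (lborel \<Otimes>\<^sub>M lborel)"
 have F2: "?C (%(t, x). indicator {0..1} t * gi h (x + t *\<^sub>R h))"
 proof (rule unit_interval_Fubini)
  show "?A (%x. gi h (x + t *\<^sub>R h))" for t using gi by (simp add: lborel_integral_translate)
  show "(IL x. \<bar>gi h (x + t *\<^sub>R h)\<bar>) \<le> (IL x. \<bar>gi h x\<bar>)" for t using lborel_integral_translate(1)[of "%x. \<bar>gi h x\<bar>" "t *\<^sub>R h"] by simp
 qed measurable
 have Gbi: "?A Gb" unfolding Gb_def using lborel_pair.integrable_snd[OF F2] by simp
 define w where "w x = ub (x + h) - ub x - Gb x" for x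
 have wi: "?A w" unfolding w_def using ub Gbi by (simp add: lborel_integral_translate)
 have [measurable]: "w \<in> ?B" using wi by auto
 have weq: "w x = u (x + h) - u x - G x" if "x \<in> ?J" for x using ux[OF that] Gb[OF that] by (simp add: w_def)
 have "?A (%x. indicator ?J x *\<^sub>R w x)" using wi by (intro integrable_mult_indicator) auto
 then show ?int by (rule Bochner_Integration.integrable_cong[THEN iffD1, rotated -1]) (auto simp: weq indicator_def)
 have test: "(IL x. bump c a b x * w x) = 0" if c: "0 < c" for c
 proof -
  define \<phi> where "\<phi> = bump c a b"
  define D where "D y = (\<Sum>i\<in>Basis. (h \<bullet> i) * partial_deriv i \<phi> y)" for y
  have contD: "continuous_on UNIV D" unfolding D_def \<phi>_def using bump_deriv_continuous[OF c] by (intro continuous_intros) auto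
  have cont\<phi>: "continuous_on UNIV \<phi>" using Ck_bump[OF c, of 0 a b] by (simp add: \<phi>_def)
  have pm: "partial_deriv i (bump c a' b') \<in> ?B" if "i \<in> Basis" for i a' b' using bump_deriv_continuous[OF c that] by (rule borel_measurable_continuous_onI)
  have bm: "bump c a' b' \<in> ?B" for a' b' :: 'a using Ck_bump[OF c, of 0 a' b'] by (intro borel_measurable_continuous_onI) simp
  have [measurable]: "D \<in> ?B" "\<phi> \<in> ?B" using contD cont\<phi> by (auto intro: borel_measurable_continuous_onI)
  have \<phi>1: "\<bar>\<phi> x\<bar> \<le> 1" for x using bump_bounds[OF c, of a b x] by (simp add: \<phi>_def)
  have "\<forall>i\<in>Basis. \<exists>B. \<forall>x. \<bar>partial_deriv i \<phi> x\<bar> \<le> B" using bump_deriv_bounded[OF c, of _ a b] unfolding \<phi>_def by metis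
  then obtain B where B: "!!i x. i \<in> Basis ==> \<bar>partial_deriv i \<phi> x\<bar> \<le> B i" by metis
  let ?D = "(\<Sum>i\<in>Basis. \<bar>h \<bullet> i\<bar> * B i)"
  have DB: "\<bar>D y\<bar> \<le> ?D" for y unfolding D_def by (rule order_trans[OF sum_abs]) (auto simp: abs_mult intro!: sum_mono mult_left_mono B)
  have FTC: "\<phi> (x - h) - \<phi> x = - (IL t. indicator {0..1} t * D (x - t *\<^sub>R h))" for x
  proof -
   have "(IL t. indicator {0..1} t *\<^sub>R (- D (x - t *\<^sub>R h))) = \<phi> (x - 1 *\<^sub>R h) - \<phi> (x - 0 *\<^sub>R h)"
   proof (rule integral_FTC_Icc)
    show "continuous_on {0..1} (%t. - D (x - t *\<^sub>R h))" by (intro continuous_intros continuous_on_compose2[OF contD]) auto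
    fix t :: real
    let ?I = "(%t. \<phi> (x - t *\<^sub>R h))"
    have "(?I has_derivative (%s. \<Sum>i\<in>Basis. ((- (s *\<^sub>R h)) \<bullet> i) * partial_deriv i \<phi> (x - t *\<^sub>R h))) (at t within {0..1})"
     unfolding \<phi>_def by (rule has_derivative_compose[OF _ bump_deriv[OF c]]) (auto intro!: derivative_eq_intros)
    then show "(?I has_vector_derivative - D (x - t *\<^sub>R h)) (at t within {0..1})" by (simp add: has_vector_derivative_def D_def sum_distrib_left sum_negf mult.assoc)
   qed auto
   then show ?thesis by simp
  qed
  have F1: "?C (%(t, x). indicator {0..1} t * (ub x * D (x - t *\<^sub>R h)))"
  proof (rule unit_interval_Fubini)
   show i: "?A (%x. ub x * D (x - t *\<^sub>R h))" for t by (rule integrable_bounded_times[OF ub _ DB]) simp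
   show "(IL x. \<bar>ub x * D (x - t *\<^sub>R h)\<bar>) \<le> (IL x. \<bar>ub x\<bar> * ?D)" for t
   proof (rule integral_mono)
    show "?A (%x. \<bar>ub x * D (x - t *\<^sub>R h)\<bar>)" using i[of t] by simp
    show "\<bar>ub x * D (x - t *\<^sub>R h)\<bar> \<le> \<bar>ub x\<bar> * ?D" for x using DB by (auto simp: abs_mult intro!: mult_left_mono)
   qed (use ub in simp)
  qed measurable
  have inner: "(IL x. ub x * D (x - t *\<^sub>R h)) = - (IL x. gi h (x + t *\<^sub>R h) * \<phi> x)" if t: "t \<in> {0..1}" for t
  proof -
   define \<psi> where "\<psi> = bump c (a + t *\<^sub>R h) (b + t *\<^sub>R h)"
   have \<psi>: "partial_deriv i \<phi> (x - t *\<^sub>R h) = partial_deriv i \<psi> x" "\<phi> (x - t *\<^sub>R h) = \<psi> x" for i x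
    by (auto simp: \<phi>_def \<psi>_def bump_deriv_translate[OF c] bump_translate)
   have out: "partial_deriv i \<psi> x = 0" "\<psi> x = 0" if "x \<notin> S" for i x
   proof -
    show "partial_deriv i \<psi> x = 0" "\<psi> x = 0" using boxt[OF t] that using bump_deriv_outside[OF c] bump_support[of c "a + t *\<^sub>R h" "b + t *\<^sub>R h" x] box_subset_cbox
     unfolding \<psi>_def by blast+
   qed
   have wk: "(IL x. ub x * partial_deriv i \<psi> x) = - (IL x. gi i x * \<psi> x)" if "i \<in> Basis" for i
   proof -
    let ?G = "(IL x. u x * partial_deriv i \<psi> x)"
    have "?G = - (IL x. (g x \<bullet> i) * \<psi> x)" using W c that boxt[OF t] S\<Omega> unfolding borel_weak_def \<psi>_def by simp
    moreover have "?G = (IL x. ub x * partial_deriv i \<psi> x)" using out by (intro Bochner_Integration.integral_cong) (auto simp: ub_def indicator_def)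
    ultimately show ?thesis using out by (auto simp: gi_def indicator_def intro!: Bochner_Integration.integral_cong)
   qed
   have i1: "?A (%x. ub x * partial_deriv i \<psi> x)" if "i \<in> Basis" for i
    by (rule integrable_bounded_times[OF ub _ B[OF that, of "_ - t *\<^sub>R h", unfolded \<psi>]]) (use pm[OF that] in \<open>simp add: \<psi>_def\<close>)
   have i2: "?A (%x. gi i x * \<psi> x)" for i
    by (rule integrable_bounded_times[OF gi _ \<phi>1[of "_ - t *\<^sub>R h", unfolded \<psi>]]) (use bm in \<open>simp add: \<psi>_def\<close>)
   have "(IL x. ub x * D (x - t *\<^sub>R h)) = (IL x. (\<Sum>i\<in>Basis. (h \<bullet> i) * (ub x * partial_deriv i \<psi> x)))"
    by (simp add: D_def \<psi> sum_distrib_left mult_ac)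
   also have "... = - (\<Sum>i\<in>Basis. (h \<bullet> i) * (IL x. gi i x * \<psi> x))" using i1 by (simp add: wk sum_negf)
   also have "(\<Sum>i\<in>Basis. (h \<bullet> i) * (IL x. gi i x * \<psi> x)) = (IL x. (\<Sum>i\<in>Basis. (h \<bullet> i) * (gi i x * \<psi> x)))" using i2 by simp
   also have "(%x. \<Sum>i\<in>Basis. (h \<bullet> i) * (gi i x * \<psi> x)) = (%x. gi h x * \<psi> x)"
   proof
    fix x
    have "g x \<bullet> h = (\<Sum>i\<in>Basis. (h \<bullet> i) * (g x \<bullet> i))" by (subst euclidean_inner) (simp add: mult.commute)
    then show "(\<Sum>i\<in>Basis. (h \<bullet> i) * (gi i x * \<psi> x)) = gi h x * \<psi> x"
     by (cases "x \<in> S") (simp_all add: gi_def sum_distrib_left sum_distrib_right mult_ac)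
   qed
   also have "(IL x. gi h x * \<psi> x) = (IL x. gi h (x + t *\<^sub>R h) * \<psi> (x + t *\<^sub>R h))"
    by (rule lborel_integral_translate(1)[symmetric]) (use bm in \<open>simp add: \<psi>_def\<close>)
   finally show ?thesis by (simp add: \<psi>(2)[symmetric])
  qed
  let ?F = "(IL x. \<phi> x * ub (x + h))"
  have "?F = (IL x. (%y. \<phi> (y - h) * ub y) (x + h))" by simp
  also have "... = (IL x. \<phi> (x - h) * ub x)" by (rule lborel_integral_translate) simp
  finally have 1: "?F = (IL x. \<phi> (x - h) * ub x)" .
  have ubh: "?A (%x. ub (x + h))" using ub by (simp add: lborel_integral_translate)
  have int\<phi>: "?A (%x. \<phi> x * f x)" "?A (%x. \<phi> (x - h) * f x)" if "?A f" for f
   using integrable_bounded_times[OF that _ \<phi>1, of "%x. x"] integrable_bounded_times[OF that _ \<phi>1, of "%x. x - h"] by (auto simp: mult.commute)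
  let ?H = "(IL x. \<phi> x * (ub (x + h) - ub x))"
  have "?H = ?F - (IL x. \<phi> x * ub x)" unfolding right_diff_distrib by (rule Bochner_Integration.integral_diff[OF int\<phi>(1)[OF ubh] int\<phi>(1)[OF ub]])
  also have "... = (IL x. \<phi> (x - h) * ub x - \<phi> x * ub x)" unfolding 1 by (rule Bochner_Integration.integral_diff[OF int\<phi>(2)[OF ub] int\<phi>(1)[OF ub], symmetric])
  also have "... = (IL x. - (IL t. indicator {0..1} t * (ub x * D (x - t *\<^sub>R h))))"
  proof (rule Bochner_Integration.integral_cong[OF refl])
   fix x
   have "\<phi> (x - h) * ub x - \<phi> x * ub x = ub x * (\<phi> (x - h) - \<phi> x)" by argo
   also have "... = - (IL t. ub x * (indicator {0..1} t * D (x - t *\<^sub>R h)))" by (simp add: FTC)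
   finally show "\<phi> (x - h) * ub x - \<phi> x * ub x = - (IL t. indicator {0..1} t * (ub x * D (x - t *\<^sub>R h)))" by (simp add: mult_ac)
  qed
  also have "... = - (IL x. (IL t. indicator {0..1} t * (ub x * D (x - t *\<^sub>R h))))" by simp
  also have "(IL x. (IL t. indicator {0..1} t * (ub x * D (x - t *\<^sub>R h)))) = (IL t. (IL x. indicator {0..1} t * (ub x * D (x - t *\<^sub>R h))))"
   using lborel_pair.Fubini_integral[OF F1] .
  also have "... = (IL t. - (IL x. indicator {0..1} t * gi h (x + t *\<^sub>R h) * \<phi> x))"
   using inner by (intro Bochner_Integration.integral_cong[OF refl]) (simp add: indicator_def)
  also have "... = - (IL t. (IL x. indicator {0..1} t * gi h (x + t *\<^sub>R h) * \<phi> x))" by simp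
  also have "(IL t. (IL x. indicator {0..1} t * gi h (x + t *\<^sub>R h) * \<phi> x)) = (IL x. (IL t. indicator {0..1} t * gi h (x + t *\<^sub>R h) * \<phi> x))"
  proof (rule lborel_pair.Fubini_integral[symmetric])
   have "?C (%p. (case p of (t, x) => indicator {0..1} t * gi h (x + t *\<^sub>R h)) * \<phi> (snd p))" by (rule integrable_bounded_times[OF F2 _ \<phi>1]) simp
   then show "?C (%(t, x). indicator {0..1} t * gi h (x + t *\<^sub>R h) * \<phi> x)" by (simp add: case_prod_unfold)
  qed
  also have "... = (IL x. \<phi> x * Gb x)" by (simp add: Gb_def mult.commute)
  moreover have "?A (%x. \<phi> x * (ub (x + h) - ub x))" "?A (%x. \<phi> x * Gb x)" using ub ubh Gbi by (intro int\<phi>(1); simp)+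
  from Bochner_Integration.integral_diff[OF this]
  have "(IL x. \<phi> x * w x) = ?H - (IL x. \<phi> x * Gb x)" by (simp add: w_def right_diff_distrib)
  ultimately show ?thesis by (simp add: \<phi>_def)
 qed
 let ?K = "indicator (box a b)"
 let ?E = "(IL x. ?K x * w x)"
 have "(%n. IL x. bump (1 / real (Suc n)) a b x * w x) \<longlonglongrightarrow> ?E"
 proof (rule integral_dominated_convergence)
  show "?A (%x. \<bar>w x\<bar>)" using wi by simp
  show "AE x in lborel. (%n. bump (1 / real (Suc n)) a b x * w x) \<longlonglongrightarrow> ?K x * w x" by (intro AE_I2 tendsto_mult bump_tendsto tendsto_const)
  fix n
  have n: "0 < 1 / real (Suc n)" by simp
  have "bump (1 / real (Suc n)) a b \<in> ?B" using Ck_bump[OF n, of 0 a b] by (intro borel_measurable_continuous_onI) simp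
  then show "(%x. bump (1 / real (Suc n)) a b x * w x) \<in> borel_measurable lborel" by simp
  show "AE x in lborel. norm (bump (1 / real (Suc n)) a b x * w x) \<le> \<bar>w x\<bar>" using bump_bounds[OF n, of a b] by (simp add: abs_mult mult_left_le_one_le)
 qed simp
 then have "?E = 0" by (simp add: test LIMSEQ_const_iff)
 moreover have "?E = (IL x. ?K x * (u (x + h) - u x - G x))" using weq box_subset_cbox[of a b] by (intro Bochner_Integration.integral_cong) (auto simp: indicator_def)
 ultimately show ?zero by simp
qed

text \<open>The formula holds on every subbox, integrals over boxes determine a function almost
  everywhere, and the boundary of the box is null.\<close>

lemma AE_box_difference:
 fixes u :: "'a::euclidean_space => real"
 assumes W: "borel_weak \<Omega> u g" and K: "convex K" "K \<subseteq> \<Omega>" and ab: "cbox a b \<subseteq> K" "cbox (a + h) (b + h) \<subseteq> K"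
 shows "AE x in lborel. x \<in> cbox a b --> u (x + h) - u x = (IL t. indicator {0..1} t * (g (x + t *\<^sub>R h) \<bullet> h))"
proof -
 define w where "w x = u (x + h) - u x - (IL t. indicator {0..1} t * (g (x + t *\<^sub>R h) \<bullet> h))" for x
 note D = difference_formula[OF W K, of _ _ h, folded w_def]
 let ?A = "indicator (box a b)"
 let ?B = "cbox a b"
 have "integrable lborel (%x. ?A x *\<^sub>R (indicator ?B x * w x))" using D(1)[OF ab] by (intro integrable_mult_indicator) auto
 then have i: "integrable lborel (%x. ?A x * w x)" by (rule Bochner_Integration.integrable_cong[THEN iffD1, rotated -1])
   (use box_subset_cbox[of a b] in \<open>auto simp: indicator_def\<close>)
 have "AE x in lborel. ?A x * w x = 0"
 proof (rule box_integrals_zero_imp_AE[OF i])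
  fix c d :: 'a
  obtain e f where ef: "box c d \<inter> box a b = box e f" using box_Int_box[of c d a b] by simp
  have "(IL x. indicator (box e f) x * w x) = 0"
  proof (cases "box e f = {}")
   case False
   have sub: "cbox e f \<subseteq> ?B"
   proof -
    have s: "box e f \<subseteq> box a b" using ef by auto
    then have "box a b ~= {}" using False by auto
    then show ?thesis using closure_mono[OF s] by (simp only: closure_box False not_False_eq_True)
   qed
   have "cbox (e + h) (f + h) \<subseteq> cbox (a + h) (b + h)"
   proof
    fix y assume "y \<in> cbox (e + h) (f + h)"
    then have "y - h \<in> cbox e f" by (simp add: mem_box algebra_simps)
    then have "y - h \<in> ?B" using sub by auto
    then show "y \<in> cbox (a + h) (b + h)" by (simp add: mem_box algebra_simps)
   qed
   then show ?thesis using sub ab by (intro D(2)) auto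
  qed simp
  moreover have "(%x. indicator (box c d) x * (?A x * w x)) = (%x. indicator (box e f) x * w x)" by (auto simp: ef[symmetric] indicator_def)
  ultimately show "(IL x. indicator (box c d) x * (?A x * w x)) = 0" by simp
 qed
 moreover have "AE x in lborel. x \<notin> ?B - box a b"
 proof -
  have "?B - box a b \<in> null_sets lebesgue" using negligible_frontier_interval[of a b] by (simp add: negligible_iff_null_sets)
  then have "?B - box a b \<in> null_sets lborel" by force
  then show ?thesis by (rule AE_not_in)
 qed
 ultimately show ?thesis by (auto simp: w_def)
qed

text \<open>The points with \<open>x\<close> and \<open>x + h\<close> in \<open>K\<close> form an
  open set, a countable union of boxes. The null set depends on \<open>h\<close>, which is harmless
  because later the integration over \<open>x\<close> precedes that over \<open>h\<close>.\<close>

lemma AE_difference_le: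
 fixes u :: "'a::euclidean_space => real"
 assumes W: "borel_weak \<Omega> u g" and K: "open K" "convex K" "K \<subseteq> \<Omega>"
 shows "AE x in lborel. x \<in> K \<and> x + h \<in> K -->
  ennreal \<bar>u (x + h) - u x\<bar> \<le> (NN t. indicator {0..1} t * ennreal (norm (g (x + t *\<^sub>R h)) * norm h))"
proof -
 define V where "V = K \<inter> (%x. x + h) -` K"
 have "open V" unfolding V_def using K(1) by (intro open_Int open_vimage continuous_intros)
 then obtain \<D> where \<D>: "countable \<D>" "\<D> \<subseteq> Pow V" "!!X. X \<in> \<D> ==> \<exists>a b. X = cbox a b" "\<Union>\<D> = V"
  by (rule open_countable_Union_open_cbox) blast
 have "AE x in lborel. \<forall>X\<in>\<D>. x \<in> X --> u (x + h) - u x = (IL t. indicator {0..1} t * (g (x + t *\<^sub>R h) \<bullet> h))"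
 proof (subst AE_ball_countable[OF \<D>(1)], intro ballI)
  fix X assume X: "X \<in> \<D>"
  then obtain a b where ab: "X = cbox a b" using \<D>(3) by blast
  have sub: "cbox a b \<subseteq> V" using X \<D>(2) ab by auto
  have "cbox (a + h) (b + h) \<subseteq> K"
  proof
   fix y assume "y \<in> cbox (a + h) (b + h)"
   then have "y - h \<in> cbox a b" by (simp add: mem_box algebra_simps)
   then show "y \<in> K" using sub by (auto simp: V_def)
  qed
  then show "AE x in lborel. x \<in> X --> u (x + h) - u x = (IL t. indicator {0..1} t * (g (x + t *\<^sub>R h) \<bullet> h))"
   unfolding ab using sub by (intro AE_box_difference[OF W K(2,3)]) (auto simp: V_def)
 qed
 then show ?thesis
 proof eventually_elim
  case (elim x)
  let ?A = "(NN t. indicator {0..1} t * ennreal (norm (g (x + t *\<^sub>R h)) * norm h))"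
  have "ennreal \<bar>u (x + h) - u x\<bar> \<le> ?A"
   if x: "x \<in> V"
  proof -
   let ?f = "%t. indicator {0..1} t * (g (x + t *\<^sub>R h) \<bullet> h)"
   have "u (x + h) - u x = (IL t. ?f t)" using elim x \<D>(4) by auto
   moreover have "ennreal (norm (IL t. ?f t)) \<le> (NN t. ennreal (norm (?f t)))"
    using integral_norm_bound_ennreal[of lborel ?f] by (cases "integrable lborel ?f") (auto simp: not_integrable_integral_eq)
   moreover have "(NN t. ennreal (norm (?f t))) \<le> ?A" by (intro nn_integral_mono) (auto simp: indicator_def Cauchy_Schwarz_ineq2)
   ultimately show ?thesis by simp
  qed
  then show ?case by (simp add: V_def)
 qed
qed

lemma emeasure_scaled:
 fixes K :: "'a::euclidean_space set"
 assumes [measurable]: "K \<in> sets borel" and c: "c ~= 0"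
 shows "emeasure lborel K = ennreal (\<bar>c\<bar> ^ DIM('a)) * (NN h. indicator K (z + c *\<^sub>R h))"
proof -
 have "emeasure lborel K = (NN x. indicator K x)" by simp
 also have "... = (\<integral>\<^sup>+x. indicator K x \<partial>density (distr lborel borel (%x. z + c *\<^sub>R x)) (%_. ennreal (\<bar>c\<bar> ^ DIM('a))))"
  by (subst lborel_affine[OF c, of z]) simp
 also have "... = ennreal (\<bar>c\<bar> ^ DIM('a)) * (NN h. indicator K (z + c *\<^sub>R h))"
  by (simp add: nn_integral_density nn_integral_distr nn_integral_cmult del: nn_integral_indicator)
 finally show ?thesis .
qed

lemma nn_integral_scaled_indicator:
 fixes K :: "'a::euclidean_space set"
 assumes K: "K \<in> sets borel" and c: "1/2 \<le> \<bar>c\<bar>"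
 shows "(NN h. indicator K (z + c *\<^sub>R h)) \<le> 2 ^ DIM('a) * emeasure lborel K"
proof -
 have "c ~= 0" using c by auto
 note eq = emeasure_scaled[OF K this, of z]
 have "1 \<le> (2 * \<bar>c\<bar>) ^ DIM('a)" using c by (intro one_le_power) simp
 then have "ennreal 1 \<le> ennreal (2 ^ DIM('a) * \<bar>c\<bar> ^ DIM('a))" by simp
 then have "1 \<le> 2 ^ DIM('a) * ennreal (\<bar>c\<bar> ^ DIM('a))" by (simp add: ennreal_mult ennreal_power[symmetric])
 then have "1 * (NN h. indicator K (z + c *\<^sub>R h)) \<le> (2 ^ DIM('a) * ennreal (\<bar>c\<bar> ^ DIM('a))) * (NN h. indicator K (z + c *\<^sub>R h))"
  by (rule mult_right_mono) simp
 then show ?thesis by (simp add: eq mult.assoc)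
qed

text \<open>After substituting z = x + t h one needs the measure of the steps \<open>h\<close> with
  both z - t h and z + (1 - t) h in \<open>K\<close>. One of t and 1 - t is at least 1/2, so it is
  at most 2^d times the volume of \<open>K\<close>.\<close>

lemma poincare_borel:
 fixes u :: "'a::euclidean_space => real"
 assumes W: "borel_weak \<Omega> u g" and K: "open K" "convex K" "bounded K" "K \<subseteq> \<Omega>"
 shows "(NN x. NN y. indicator K x * indicator K y * ennreal \<bar>u y - u x\<bar>) \<le>
  2 ^ DIM('a) * ennreal (diameter K) * emeasure lborel K * (NN x. indicator K x * ennreal (norm (g x)))"
proof -
 have [measurable]: "u \<in> borel_measurable borel" "g \<in> borel_measurable borel" using W by (auto simp: borel_weak_def)
 have [measurable]: "K \<in> sets borel" using K by simp
 define D where "D = diameter K"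
 let ?A = "indicator K"
 define I where "I = (NN x. ?A x * ennreal (norm (g x)))"
 have "(NN x. NN y. ?A x * ?A y * ennreal \<bar>u y - u x\<bar>) = (NN x. NN h. ?A x * ?A (h + x) * ennreal \<bar>u (h + x) - u x\<bar>)"
 proof (rule nn_integral_cong)
  fix x
  show "(NN y. ?A x * ?A y * ennreal \<bar>u y - u x\<bar>) = (NN h. ?A x * ?A (h + x) * ennreal \<bar>u (h + x) - u x\<bar>)"
   by (simp add: add.commute nn_integral_lborel_translate[of "%y. ?A x * ?A y * ennreal \<bar>u y - u x\<bar>" x, symmetric])
 qed
 also have "... = (NN h. NN x. ?A x * ?A (h + x) * ennreal \<bar>u (h + x) - u x\<bar>)" by (rule lborel_pair.Fubini') measurable
 also have "... \<le> (NN h. NN x. NN t. indicator {0..1} t * (?A x * ?A (h + x) * (ennreal D * ennreal (norm (g (x + t *\<^sub>R h))))))"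
 proof (rule nn_integral_mono)
  fix h
  show "(NN x. ?A x * ?A (h + x) * ennreal \<bar>u (h + x) - u x\<bar>) \<le>
   (NN x. NN t. indicator {0..1} t * (?A x * ?A (h + x) * (ennreal D * ennreal (norm (g (x + t *\<^sub>R h))))))"
  proof (rule nn_integral_mono_AE, use AE_difference_le[OF W K(1,2,4), of h] in eventually_elim)
   case (elim x)
   let ?E = "(NN t. indicator {0..1} t * (ennreal D * ennreal (norm (g (x + t *\<^sub>R h)))))"
   have "ennreal \<bar>u (x + h) - u x\<bar> \<le> ?E"
    if x: "x \<in> K" "x + h \<in> K"
   proof -
    have "norm h \<le> D" using diameter_bounded_bound[OF K(3) x(2,1)] by (simp add: D_def dist_norm)
    moreover have "0 \<le> D" using \<open>norm h \<le> D\<close> norm_ge_zero order_trans by blast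
    ultimately have "ennreal (norm (g (x + t *\<^sub>R h)) * norm h) \<le> ennreal D * ennreal (norm (g (x + t *\<^sub>R h)))" for t
     by (subst ennreal_mult'[symmetric]) (auto intro!: mult_right_mono simp: mult.commute)
    then have "(NN t. indicator {0..1} t * ennreal (norm (g (x + t *\<^sub>R h)) * norm h)) \<le>
     ?E" by (intro nn_integral_mono mult_left_mono) auto
    then show ?thesis using elim x by simp
   qed
   then show ?case by (simp add: indicator_def add.commute)
  qed
 qed
 also have "... = (NN h. NN t. NN x. indicator {0..1} t * (?A x * ?A (h + x) * (ennreal D * ennreal (norm (g (x + t *\<^sub>R h))))))"
  by (intro nn_integral_cong lborel_pair.Fubini') measurable
 also have "... = (NN t. NN h. NN x. indicator {0..1} t * (?A x * ?A (h + x) * (ennreal D * ennreal (norm (g (x + t *\<^sub>R h))))))" by (intro lborel_pair.Fubini') measurable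
 also have "... \<le> (NN t. indicator {0..1::real} t * (2 ^ DIM('a) * ennreal D * emeasure lborel K * I))"
 proof (rule nn_integral_mono)
  fix t :: real
  define J where "J = 2 ^ DIM('a) * emeasure lborel K"
  let ?C = "(NN h. NN x. ?A x * ?A (h + x) * (ennreal D * ennreal (norm (g (x + t *\<^sub>R h)))))"
  have "?C
    \<le> ennreal D * (J * I)" if t: "t \<in> {0..1}"
  proof -
   have "?C = (NN h. NN z. ?A (z - t *\<^sub>R h) * ?A (h + (z - t *\<^sub>R h)) * (ennreal D * ennreal (norm (g z))))"
   proof (rule nn_integral_cong)
    fix h
    show "(NN x. ?A x * ?A (h + x) * (ennreal D * ennreal (norm (g (x + t *\<^sub>R h))))) =
     (NN z. ?A (z - t *\<^sub>R h) * ?A (h + (z - t *\<^sub>R h)) * (ennreal D * ennreal (norm (g z))))"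
     using nn_integral_lborel_translate[of "%z. ?A (z - t *\<^sub>R h) * ?A (h + (z - t *\<^sub>R h)) * (ennreal D * ennreal (norm (g z)))" "t *\<^sub>R h"] by (simp add: add.commute)
   qed
   also have "... = (NN z. NN h. ?A (z - t *\<^sub>R h) * ?A (h + (z - t *\<^sub>R h)) * (ennreal D * ennreal (norm (g z))))" by (intro lborel_pair.Fubini') measurable
   also have "... \<le> (NN z. ennreal D * J * (?A z * ennreal (norm (g z))))"
   proof (rule nn_integral_mono)
    fix z
    have zK: "z \<in> K" if "z - t *\<^sub>R h \<in> K" "h + (z - t *\<^sub>R h) \<in> K" for h
    proof -
     have "(1 - t) *\<^sub>R (z - t *\<^sub>R h) + t *\<^sub>R (h + (z - t *\<^sub>R h)) \<in> K" using that t K(2) by (intro convexD) auto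
     then show ?thesis by (simp add: algebra_simps)
    qed
    let ?B = "(NN h. ?A (z - t *\<^sub>R h) * ?A (h + (z - t *\<^sub>R h)))"
    have J: "?B \<le> J"
    proof (cases "1/2 \<le> t")
     case True
     have "?B \<le> (NN h. ?A (z + (- t) *\<^sub>R h))" by (intro nn_integral_mono) (auto simp: indicator_def)
     also have "... \<le> J" unfolding J_def using True by (intro nn_integral_scaled_indicator) auto
     finally show ?thesis .
    next
     case False
     have "?B \<le> (NN h. ?A (z + (1 - t) *\<^sub>R h))" by (intro nn_integral_mono) (auto simp: indicator_def algebra_simps)
     also have "... \<le> J" unfolding J_def using False by (intro nn_integral_scaled_indicator) auto
     finally show ?thesis .
    qed
    let ?D = "(NN h. ?A (z - t *\<^sub>R h) * ?A (h + (z - t *\<^sub>R h)) * (ennreal D * ennreal (norm (g z))))"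
    let ?F = "(?A z * (ennreal D * ennreal (norm (g z))))"
    have "?D \<le> (NN h. ?A (z - t *\<^sub>R h) * ?A (h + (z - t *\<^sub>R h)) * ?F)" using zK by (intro nn_integral_mono) (auto simp: indicator_def)
    also have "... = ?B * ?F" by (rule nn_integral_multc) measurable
    also have "... \<le> J * ?F" by (rule mult_right_mono[OF J]) simp
    finally show "?D \<le>
     ennreal D * J * (?A z * ennreal (norm (g z)))" by (simp add: mult_ac)
   qed
   finally show ?thesis by (simp add: I_def mult_ac nn_integral_cmult)
  qed
  then show "(NN h. NN x. indicator {0..1} t * (?A x * ?A (h + x) * (ennreal D * ennreal (norm (g (x + t *\<^sub>R h))))))
    \<le> indicator {0..1} t * (2 ^ DIM('a) * ennreal D * emeasure lborel K * I)" by (simp add: indicator_def J_def mult_ac)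
 qed
 finally show ?thesis by (simp add: nn_integral_multc D_def I_def)
qed

section \<open>Borel representatives of weakly differentiable functions\<close>

lemma locally_integrable_representative:
 fixes f :: "'a::euclidean_space => real"
 assumes \<Omega>: "open \<Omega>" and f: "locally_integrable \<Omega> f"
 obtains f' where "f' \<in> borel_measurable borel" "AE x in lborel. x \<in> \<Omega> --> f' x = f x" "(%x. indicator \<Omega> x * f x) \<in> borel_measurable lebesgue"
proof -
 obtain C :: "nat => 'a set" where C: "!!n. compact (C n)" "!!n. C n \<subseteq> \<Omega>" "!!n. C n \<subseteq> interior (C (Suc n))" "\<Union>(range C) = \<Omega>"
  using open_Union_compact_subsets[OF \<Omega>] by metis
 have inc: "incseq C" using C(3) interior_subset by (intro incseq_SucI) blast
 let ?A = "indicator \<Omega>"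
 have m: "(%x. ?A x * f x) \<in> borel_measurable lebesgue"
 proof (rule borel_measurable_LIMSEQ_real)
  show "(%x. indicator (C n) x * f x) \<in> borel_measurable lebesgue" for n
  using f C(1,2) by (auto simp: locally_integrable_def lmeasurable_compact fmeasurableD integrable_restrict_space)
  fix x
  have "(%n. indicator (C n) x :: real) \<longlonglongrightarrow> indicator (\<Union>n. C n) x" using inc by (rule LIMSEQ_indicator_incseq)
  then show "(%n. indicator (C n) x * f x) \<longlonglongrightarrow> ?A x * f x" using C(4) by (intro tendsto_mult tendsto_const) simp
 qed
 then obtain f' where "f' \<in> borel_measurable lborel" "AE x in lborel. ?A x * f x = f' x" using completion_ex_borel_measurable_real[of _ lborel] by auto
 with m show thesis by (intro that[of f']) (auto elim!: eventually_mono)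
qed

text \<open>The components of the gradient are represented separately; changes on a null set affect
  none of the integrals in \<open>borel_weak\<close>.\<close>

lemma borel_representative:
 fixes u :: "'a::euclidean_space => real"
 assumes \<Omega>: "open \<Omega>" and w: "has_weak_gradient \<Omega> u g"
 obtains u' g' where "borel_weak \<Omega> u' g'" "AE x in lborel. x \<in> \<Omega> --> u' x = u x \<and> g' x = g x"
proof -
 let ?E = "locally_integrable \<Omega>"
 have li: "?E u" "?E g" using w by (auto simp: has_weak_gradient_def)
 let ?A = "borel_measurable borel"
 let ?B = "borel_measurable lebesgue"
 let ?D = "indicator \<Omega>"
 obtain u' where u': "u' \<in> ?A" "AE x in lborel. x \<in> \<Omega> --> u' x = u x" "(%x. ?D x * u x) \<in> ?B" using locally_integrable_representative[OF \<Omega> li(1)] .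
 have "?E (%x. g x \<bullet> i)" for i using li(2) by (simp add: locally_integrable_def)
 then have "\<exists>f'. f' \<in> ?A \<and> (AE x in lborel. x \<in> \<Omega> --> f' x = g x \<bullet> i) \<and> (%x. ?D x * (g x \<bullet> i)) \<in> ?B" for i
  by (rule locally_integrable_representative[OF \<Omega>, of "%x. g x \<bullet> i"]) blast+
 then obtain gi where gi: "!!i. gi i \<in> ?A" "!!i. AE x in lborel. x \<in> \<Omega> --> gi i x = g x \<bullet> i" "!!i. (%x. ?D x * (g x \<bullet> i)) \<in> ?B" by metis
 define g' where "g' x = (\<Sum>i\<in>Basis. gi i x *\<^sub>R i)" for x
 have g'm: "g' \<in> ?A" unfolding g'_def using gi(1) by simp
 have "AE x in lborel. \<forall>i\<in>Basis. x \<in> \<Omega> --> gi i x = g x \<bullet> i" using gi(2) by (subst AE_ball_countable) (auto intro: countable_finite)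
 with u'(2) have eq: "AE x in lborel. x \<in> \<Omega> --> u' x = u x \<and> g' x = g x" by (auto simp: g'_def euclidean_representation)
 have eqc: "AE x in lebesgue. x \<in> \<Omega> --> u' x = u x \<and> g' x = g x" using eq by (rule AE_completion)
 note [measurable] = u'(1) g'm
 have \<Omega>s: "\<Omega> \<in> sets lebesgue" using \<Omega> by simp
 have int: "integrable lborel (%x. indicator S x * u' x) \<and> integrable lborel (%x. indicator S x *\<^sub>R g' x)"
  if S: "compact S" "S \<subseteq> \<Omega>" for S
 proof -
  have Sm: "S \<in> sets borel" "S \<in> sets lebesgue" using S(1) by (auto simp: borel_compact)
  have "integrable (lebesgue_on S) u" "integrable (lebesgue_on S) g" using li S by (auto simp: locally_integrable_def)
  then have i: "integrable lebesgue (%x. indicator S x *\<^sub>R u x)" "integrable lebesgue (%x. indicator S x *\<^sub>R g x)" using Sm by (auto simp: integrable_restrict_space)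
  let ?G = "(%x. indicator S x *\<^sub>R u' x)"
  have m: "?G \<in> ?A" "(%x. indicator S x *\<^sub>R g' x) \<in> ?A" using Sm by auto
  have "integrable lebesgue ?G" using i(1) by (rule Bochner_Integration.integrable_cong_AE_imp)
    (use eqc m S in \<open>auto elim!: eventually_mono simp: indicator_def intro!: measurable_completion\<close>)
  moreover have "integrable lebesgue (%x. indicator S x *\<^sub>R g' x)" using i(2) by (rule Bochner_Integration.integrable_cong_AE_imp)
    (use eqc m S in \<open>auto elim!: eventually_mono simp: indicator_def intro!: measurable_completion\<close>)
  ultimately show ?thesis using m by (simp add: integrable_completion)
 qed
 have "(IL x. u' x * partial_deriv i (bump c a b) x) = - (IL x. (g' x \<bullet> i) * bump c a b x)"
  if c: "0 < c" and ab: "cbox a b \<subseteq> \<Omega>" and i: "i \<in> Basis" for c a b i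
 proof -
  let ?C = "L2_pairing \<Omega>"
  let ?F = "?C (%x. g x \<bullet> i) (bump c a b)"
  let ?H = "?C u (partial_deriv i (bump c a b))"
  have "?H = - ?F" using w test_function_bump[OF c ab] i by (simp add: has_weak_gradient_def)
  moreover have "?C f k = (IL x. f' x * k x)"
   if [measurable]: "f' \<in> ?A" "k \<in> ?A" and f: "(%x. ?D x * f x) \<in> ?B"
    and e: "AE x in lebesgue. x \<in> \<Omega> --> f' x = f x" and 0: "!!x. x \<notin> cbox a b ==> k x = 0" for f f' k
  proof -
   have "k \<in> ?B" by (intro measurable_completion) measurable
   from borel_measurable_times[OF f this]
   have m: "(%x. ?D x * f x * k x) \<in> ?B" .
   have "?C f k = (LINT x|lebesgue. ?D x * f x * k x)" unfolding L2_pairing_def using \<Omega>s by (subst integral_restrict_space) (auto simp: mult.assoc)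
   also have "... = (LINT x|lebesgue. f' x * k x)" using e ab 0 by (intro integral_cong_AE m measurable_completion) (auto elim!: eventually_mono simp: indicator_def)
   finally show ?thesis by (simp add: integral_completion)
  qed
  note P = this
  have k: "partial_deriv i (bump c a b) \<in> ?A" "bump c a b \<in> ?A" using bump_deriv_continuous[OF c i] Ck_bump[OF c, of 0 a b] by (auto intro: borel_measurable_continuous_onI)
  have z: "partial_deriv i (bump c a b) x = 0" "bump c a b x = 0" if "x \<notin> cbox a b" for x
   using bump_deriv_outside[OF c that] bump_support[of c a b x] box_subset_cbox[of a b] that by auto
  have "?H = (IL x. u' x * partial_deriv i (bump c a b) x)" by (rule P[OF _ k(1) u'(3) _ z(1)]) (use eqc in \<open>auto elim!: eventually_mono\<close>)
  moreover have "?F = (IL x. (g' x \<bullet> i) * bump c a b x)" by (rule P[OF _ k(2) gi(3) _ z(2)]) (use eqc in \<open>auto elim!: eventually_mono\<close>)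
  ultimately show ?thesis by simp
 qed
 then show thesis using that[OF _ eq] int by (simp add: borel_weak_def)
qed

section \<open>The Crouzeix--Raviart space\<close>

definition opp :: "'a set => 'a set => 'a" where "opp V f = the_elem (V - f)"

definition cr_basis :: "'a::euclidean_space set => 'a set => 'a => real" where "cr_basis V f x = 1 - DIM('a) * bary V (opp V f) x"

definition mid :: "'a::euclidean_space set => 'a" where "mid f = (\<Sum>v\<in>f. v) /\<^sub>R DIM('a)"

lemma opp_vfacet: "v \<in> V ==> opp V (V - {v}) = v"
proof -
 assume "v \<in> V"
 then have "V - (V - {v}) = {v}" by auto
 then show ?thesis by (simp add: opp_def)
qed

lemma opp_in: "f \<in> vfacets V ==> opp V f \<in> V \<and> f = V - {opp V f}" by (auto simp: vfacets_def opp_vfacet)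

context
 fixes V :: "'a::euclidean_space set"
 assumes V: "full_simplex V"
begin

lemma vfacets_inj: "inj_on (%v. V - {v}) V" by (rule inj_onI) blast

lemma vfacets_image: "vfacets V = (%v. V - {v}) ` V" by (auto simp: vfacets_def)

lemma card_vfacets: "finite (vfacets V)" "card (vfacets V) = DIM('a) + 1"
 using V full_simplex_finite[OF V] unfolding vfacets_image by (auto simp: card_image vfacets_inj full_simplex_def)

lemma sum_vfacets: "(\<Sum>f\<in>vfacets V. h f) = (\<Sum>v\<in>V. h (V - {v}))" by (simp add: vfacets_image sum.reindex[OF vfacets_inj])

lemma cr_basis_vertex: "v \<in> V ==> cr_basis V (V - {v}) x = 1 - DIM('a) * bary V v x" by (simp add: cr_basis_def opp_vfacet)

lemma cr_basis_sum: "(\<Sum>f\<in>vfacets V. cr_basis V f x) = 1" using V bary_sum[OF V, of x] unfolding sum_vfacets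
 by (simp add: cr_basis_vertex sum_subtractf sum_distrib_left[symmetric] full_simplex_def)

lemma bary_mid: "f \<in> vfacets V ==> v \<in> V ==> bary V v (mid f) = (if v \<in> f then 1 / DIM('a) else 0)"
proof -
 assume f: "f \<in> vfacets V" and v: "v \<in> V"
 have c: "f \<subseteq> V" "card f = DIM('a)" using f vfacets_iff[OF V] by auto
 show ?thesis using bary_on_facet[OF V c(1) _ v, of "%_. 1 / DIM('a)"] c by (simp add: mid_def scaleR_sum_right divide_inverse)
qed

lemma cr_basis_mid: "f \<in> vfacets V ==> g \<in> vfacets V ==> cr_basis V f (mid g) = (if f = g then 1 else 0)"
proof -
 assume f: "f \<in> vfacets V" and g: "g \<in> vfacets V"
 then obtain v w where vw: "v \<in> V" "f = V - {v}" "w \<in> V" "g = V - {w}" by (auto simp: vfacets_def)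
 then have "f = g \<longleftrightarrow> v = w" by auto
 then show ?thesis using bary_mid[OF g vw(1)] vw by (simp add: cr_basis_vertex)
qed

lemma mid_in_hull: "f \<in> vfacets V ==> mid f \<in> convex hull V" by (simp add: convex_hull_bary[OF V] bary_mid)

text \<open>The barycenters of the facets form a simplex whose barycentric coordinates are the
  functions \<open>cr_basis\<close>.\<close>

lemma cr_basis_repr: "(\<Sum>f\<in>vfacets V. cr_basis V f x *\<^sub>R mid f) = x"
proof -
 define s where "s = (\<Sum>v\<in>V. v)"
 have fin: "finite V" and card: "card V = DIM('a) + 1" using V full_simplex_finite by (auto simp: full_simplex_def)
 have "(\<Sum>f\<in>vfacets V. cr_basis V f x *\<^sub>R mid f) = (\<Sum>v\<in>V. (1 - DIM('a) * bary V v x) *\<^sub>R ((s - v) /\<^sub>R DIM('a)))"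
  using fin by (simp add: sum_vfacets cr_basis_vertex mid_def s_def sum_diff1)
 also have "... = (\<Sum>v\<in>V. (s - v) /\<^sub>R DIM('a) - (bary V v x *\<^sub>R s - bary V v x *\<^sub>R v))" by (simp add: field_simps scaleR_diff_left)
 also have "... = ((real DIM('a) + 1) *\<^sub>R s - s) /\<^sub>R DIM('a) - (s - x)"
 proof -
  have "(\<Sum>v\<in>V. s - v) = (real DIM('a) + 1) *\<^sub>R s - s" by (simp add: sum_subtractf sum_constant_scaleR card s_def[symmetric])
  moreover have "(\<Sum>v\<in>V. bary V v x *\<^sub>R s) = s" by (simp add: scaleR_sum_left[symmetric] bary_sum[OF V])
  ultimately show ?thesis by (simp only: sum_subtractf[of "%v. (s - v) /\<^sub>R DIM('a)"] sum_subtractf[of "%v. bary V v x *\<^sub>R s"]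
   scaleR_sum_right[symmetric] bary_repr[OF V])
 qed
 finally show ?thesis by (simp add: scaleR_left.add)
qed

lemma cr_basis_affine: "a \<bullet> x + b = (\<Sum>f\<in>vfacets V. (a \<bullet> mid f + b) * cr_basis V f x)"
proof -
 have "a \<bullet> x + b = a \<bullet> (\<Sum>f\<in>vfacets V. cr_basis V f x *\<^sub>R mid f) + b * (\<Sum>f\<in>vfacets V. cr_basis V f x)"
  by (simp add: cr_basis_repr cr_basis_sum)
 then show ?thesis by (simp add: inner_sum_right sum_distrib_left sum.distrib algebra_simps)
qed

lemma cr_basis_bound: "f \<in> vfacets V ==> x \<in> convex hull V ==> \<bar>cr_basis V f x\<bar> \<le> DIM('a)"
proof -
 assume "f \<in> vfacets V" "x \<in> convex hull V"
 then have b: "0 \<le> bary V (opp V f) x" "bary V (opp V f) x \<le> 1" using bary_bounds[OF V] opp_in by blast+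
 have "DIM('a) * bary V (opp V f) x \<le> real DIM('a) * 1" using b by simp
 moreover have "0 \<le> DIM('a) * bary V (opp V f) x" using b by simp
 moreover have "1 \<le> real DIM('a)" by simp
 ultimately show ?thesis unfolding cr_basis_def by argo
qed

lemma cr_mass_matrix: "f \<in> vfacets V ==> g \<in> vfacets V ==> (real DIM('a) + 1) * (real DIM('a) + 2) * simplex_integral V (%x. cr_basis V f x * cr_basis V g x) =
  ((if f = g then (real DIM('a))^2 else 0) - (real DIM('a) - 2)) * simplex_volume V"
 using mass_matrix[OF V, of "opp V f" "opp V g"] opp_in[of f V] opp_in[of g V] unfolding cr_basis_def by force

end

lemma continuous_cr_basis [continuous_intros]: "continuous_on S (cr_basis V f)" unfolding cr_basis_def by (intro continuous_intros)

lemma cr_basis_has_derivative: "(cr_basis V f has_derivative (%h. (- DIM('a) *\<^sub>R bary_grad V (opp V f)) \<bullet> h)) (at (x :: 'a::euclidean_space))"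
 unfolding cr_basis_def bary_def by (auto intro!: derivative_eq_intros)

text \<open>Induction on the index set, by Gram--Schmidt elimination of one index.\<close>

lemma positive_definite_solvable:
 fixes A :: "'f => 'f => real"
 assumes "finite S" and sym: "!!f g. A f g = A g f"
  and pd: "!!x. (!!f. f \<notin> S ==> x f = 0) ==> (\<exists>f. x f ~= 0) ==> 0 < (\<Sum>f\<in>S. \<Sum>g\<in>S. x f * A f g * x g)"
 shows "\<exists>x. (\<forall>f. f \<notin> S --> x f = 0) \<and> (\<forall>f\<in>S. (\<Sum>g\<in>S. A f g * x g) = b f)" using assms(1) pd
proof (induction S arbitrary: b rule: finite_induct)
 case (insert e S)
 let ?A = "insert e S"
 have restrict: "(\<Sum>g\<in>?A. A f g * x g) = (\<Sum>g\<in>S. A f g * x g) + A f e * x e" for f x using insert.hyps by simp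
 have pdS: "0 < (\<Sum>f\<in>S. \<Sum>g\<in>S. x f * A f g * x g)" if "!!f. f \<notin> S ==> x f = 0" "\<exists>f. x f ~= 0" for x using insert.prems[of x] that insert.hyps by auto
 obtain z where z: "!!f. f \<notin> S ==> z f = 0" "!!f. f \<in> S ==> (\<Sum>g\<in>S. A f g * z g) = - A f e" using insert.IH[OF pdS, of "%f. - A f e"] by auto
 obtain y where y: "!!f. f \<notin> S ==> y f = 0" "!!f. f \<in> S ==> (\<Sum>g\<in>S. A f g * y g) = b f" using insert.IH[OF pdS, of b] by auto
 \<comment> \<open>\<open>w\<close> is conjugate to all old directions, so adding a multiple of it
   changes only equation \<open>e\<close>. Its energy \<open>r\<close> is positive by
   definiteness.\<close>
 define w where "w = z(e := 1)"
 have w: "(\<Sum>g\<in>?A. A f g * w g) = 0" if "f \<in> S" for f using z(2)[OF that] insert.hyps by (simp add: w_def) (smt (verit, best) sum.cong fun_upd_other)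
 define r where "r = (\<Sum>g\<in>?A. A e g * w g)"
 have "0 < (\<Sum>f\<in>?A. \<Sum>g\<in>?A. w f * A f g * w g)" by (rule insert.prems) (use z(1) in \<open>auto simp: w_def\<close>)
 also have "... = (\<Sum>f\<in>?A. w f * (\<Sum>g\<in>?A. A f g * w g))" by (simp only: sum_distrib_left mult.assoc)
 also have "... = w e * r + (\<Sum>f\<in>S. w f * (\<Sum>g\<in>?A. A f g * w g))" using insert.hyps unfolding r_def by simp
 also have "... = r" using w by (simp add: w_def)
 define s where "s = (b e - (\<Sum>g\<in>?A. A e g * y g)) / r"
 have "(\<Sum>g\<in>?A. A f g * (y g + s * w g)) = (\<Sum>g\<in>?A. A f g * y g) + s * (\<Sum>g\<in>?A. A f g * w g)" for f
  by (simp add: sum_distrib_left sum.distrib[symmetric] algebra_simps)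
 moreover have "(\<Sum>g\<in>?A. A f g * y g) = b f" if "f \<in> S" for f using y(1)[OF insert.hyps(2)] y(2)[OF that] unfolding restrict by simp
 ultimately have "(\<Sum>g\<in>?A. A f g * (y g + s * w g)) = b f" if "f \<in> ?A" for f using that w by (auto simp: r_def[symmetric] s_def)
 moreover have "y f + s * w f = 0" if "f \<notin> ?A" for f using that z(1) y(1) by (simp add: w_def)
 ultimately show ?case by (intro exI[of _ "%f. y f + s * w f"]) blast
qed (auto intro: exI[of _ "%_. 0"])

lemma hull_interior_AE:
 assumes V: "full_simplex V"
 shows "AE x in lborel. x \<in> convex hull V \<longleftrightarrow> x \<in> interior (convex hull V)"
proof -
 have "frontier (convex hull V) \<in> null_sets lborel" using negligible_convex_frontier[of "convex hull V"] by (simp add: negligible_iff_null_sets null_sets_completion_iff)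
 then have "AE x in lborel. x \<notin> frontier (convex hull V)" by (rule AE_not_in)
 then show ?thesis using closure_subset[of "convex hull V"] interior_subset[of "convex hull V"] by (auto simp: frontier_def)
qed

lemma interior_hull_volume:
 assumes V: "full_simplex V"
 shows "emeasure lborel (interior (convex hull V)) = ennreal (simplex_volume V)"
proof -
 have "emeasure lborel (interior (convex hull V)) = emeasure lborel (convex hull V)" by (rule emeasure_eq_AE) (use hull_interior_AE[OF V] borel_hull[OF V] in \<open>auto\<close>)
 moreover have "emeasure lborel (convex hull V) < \<infinity>" using compact_hull[OF V] by (rule emeasure_compact_finite)
 ultimately show ?thesis by (simp add: simplex_volume_def emeasure_eq_ennreal_measure)
qed

context bisection_setting
begin

definition shape_bound :: "real => bool" where "shape_bound C \<longleftrightarrow> 1 \<le> C \<and>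
  (\<forall>n T. T \<in> U n --> (\<forall>x\<in>hull_of T. \<forall>y\<in>hull_of T. norm (x - y) \<le> C * mesh_size DIM('a) n) \<and>
   1 / 2 ^ n \<le> C * simplex_volume (verts T) \<and> simplex_volume (verts T) \<le> C * (1 / 2 ^ n) \<and>
   (\<forall>v\<in>verts T. norm (bary_grad (verts T) v) * mesh_size DIM('a) n \<le> C))"

text \<open>Fixed once for the initial mesh. All later geometric constants are built from it, which
  is how they depend on the initial triangulation alone.\<close>

definition shape_const :: real where "shape_const = (SOME C. shape_bound C)"

lemma shape_const: "1 \<le> shape_const" "T \<in> U n ==> x \<in> hull_of T ==> y \<in> hull_of T ==> norm (x - y) \<le> shape_const * mesh_size DIM('a) n"
  "T \<in> U n ==> 1 / 2 ^ n \<le> shape_const * simplex_volume (verts T)" "T \<in> U n ==> simplex_volume (verts T) \<le> shape_const * (1 / 2 ^ n)"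
  "T \<in> U n ==> v \<in> verts T ==> norm (bary_grad (verts T) v) * mesh_size DIM('a) n \<le> shape_const"
proof (atomize (full), goal_cases)
 case 1
 have "\<exists>C. shape_bound C" by (rule shape_regular) (auto simp: shape_bound_def)
 then have "shape_bound shape_const" unfolding shape_const_def by (rule someI_ex)
 then show ?case unfolding shape_bound_def by blast
qed

end

locale bisection_mesh = bisection_setting +
 fixes M :: "'a tagged set"
 assumes mesh: "BiSec_mesh \<Omega> M\<^sub>0 M"
begin

definition lev :: "'a tagged => nat" where "lev T = (SOME n. T \<in> U n)"

lemma conf: "conforming M \<Omega>" using mesh_conforming[OF mesh] .

lemma lev: "T \<in> M ==> T \<in> U (lev T)" using mesh_sub[OF mesh] unfolding lev_def by (intro someI_ex[of "%n. T \<in> U n"]) auto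

lemma M_full: "T \<in> M ==> full_simplex (verts T)" using conforming_full[OF conf] .

lemma finite_M: "finite M" using conf finite_imageD by (auto simp: conforming_def triangulates_def triangulation_def)

abbreviation fc :: "'a tagged => 'a set set" where "fc T \<equiv> vfacets (verts T)"
abbreviation vol :: "'a tagged => real" where "vol T \<equiv> simplex_volume (verts T)"

lemma neighbor_lev: "T \<in> M ==> T' \<in> M ==> f \<in> fc T ==> f \<in> fc T' ==> lev T' \<le> lev T + 1" using neighbor_levels[OF conf _ _ _ lev lev] by fastforce

sublocale dm: discrete_mesh M fc vol lev "DIM('a)"
proof
 fix T assume T: "T \<in> M"
 show "finite (fc T)" "card (fc T) = DIM('a) + 1" using card_vfacets[OF M_full[OF T]] by auto
 show "0 < vol T" by (rule simplex_volume_pos[OF M_full[OF T]])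
 show "\<exists>f\<^sub>0. \<forall>f\<in>fc T. \<forall>T'\<in>M. f \<in> fc T' --> lev T' < lev T --> f = f\<^sub>0"
 proof (intro exI[of _ "verts T - {newest T}"] ballI impI)
  fix f T' assume f: "f \<in> fc T" "T' \<in> M" "f \<in> fc T'" "lev T' < lev T"
  then have "lev T = Suc (lev T')" using neighbor_lev[of T' T f] T by simp
  moreover from f(4) have "T' ~= T" by auto
  ultimately show "f = verts T - {newest T}" using coarser_neighbor_facet[OF conf f(2) T _ lev[OF f(2)] _ f(3,1)] lev[OF T] by simp
 qed
qed (use finite_M dim in auto)

lemma nbr_lev: "dm.nbr T T' ==> lev T \<le> lev T' + 1" unfolding dm.nbr_def using neighbor_lev[of T' T] by auto

text \<open>After \<open>i\<close> drops the level is at most \<open>i\<close> below that of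
  \<open>S\<close>, so each of the i + j + 1 elements on the path has diameter at most 2^(i/d) times
  the mesh size of \<open>S\<close>, up to \<open>shape_const\<close>.\<close>

lemma reach_cball:
 assumes "dm.reach i j S T" "z \<in> hull_of S"
 shows "hull_of T \<subseteq> cball z (shape_const * real (i + j + 1) * (2 powr (i / DIM('a)) * mesh_size DIM('a) (lev S))) \<and> lev S \<le> lev T + i" using assms
proof (induction rule: dm.reach.induct)
 case (start T)
 then show ?case using shape_const(2)[OF lev[OF start(1)]] by (auto simp: dist_norm)
next
 have step: "hull_of T' \<subseteq> cball z (shape_const * real (i' + j' + 1) * (2 powr (i' / DIM('a)) * mesh_size DIM('a) (lev S)))"
  if IH: "hull_of T \<subseteq> cball z (shape_const * real (i + j + 1) * (2 powr (i / DIM('a)) * mesh_size DIM('a) (lev S)))"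
   and n: "dm.nbr T T'" and l: "lev S \<le> lev T' + i'" and i: "i' + j' = Suc (i + j)" "i \<le> i'" for i j i' j' T T' S
 proof
  fix y assume y: "y \<in> hull_of T'"
  obtain f where f: "T \<in> M" "T' \<in> M" "f \<in> fc T" "f \<in> fc T'" using n by (auto simp: dm.nbr_def)
  have "f ~= {}" using f(1,3) vfacets_iff[OF M_full] by auto
  then obtain x where "x \<in> f" by auto
  then have x: "x \<in> hull_of T" "x \<in> hull_of T'" using f by (auto simp: vfacets_def hull_of_def intro: hull_inc)
  define H where "H = 2 powr (i' / DIM('a)) * mesh_size DIM('a) (lev S)"
  have "mesh_size DIM('a) (lev T') \<le> H"
  proof -
   have "- real (lev T') / DIM('a) \<le> (real i' - real (lev S)) / DIM('a)" using l by (intro divide_right_mono) auto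
   then show ?thesis by (simp add: H_def mesh_size_def powr_add[symmetric] diff_divide_distrib)
  qed
  moreover have "dist x y \<le> shape_const * mesh_size DIM('a) (lev T')" using shape_const(2)[OF lev[OF f(2)] x(2) y] by (simp add: dist_norm)
  ultimately have 1: "dist x y \<le> shape_const * H" using shape_const(1) by (meson mult_left_mono order_trans zero_le_one)
  have "shape_const * real (i + j + 1) * (2 powr (i / DIM('a)) * mesh_size DIM('a) (lev S)) \<le> shape_const * real (i + j + 1) * H" using shape_const(1) i by (auto simp: H_def intro!: divide_right_mono)
  moreover have "dist z x \<le> shape_const * real (i + j + 1) * (2 powr (i / DIM('a)) * mesh_size DIM('a) (lev S))" using IH x(1) by auto
  ultimately have "dist z y \<le> shape_const * real (i + j + 1) * H + shape_const * H" using 1 dist_triangle[of z y x] by simp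
  also have "... = shape_const * real (i' + j' + 1) * H" by (simp add: i(1) algebra_simps)
  finally show "y \<in> cball z (shape_const * real (i' + j' + 1) * (2 powr (i' / DIM('a)) * mesh_size DIM('a) (lev S)))" by (simp add: H_def)
 qed
 {
  case (drop i j S T T')
  have "lev T \<le> lev T' + 1" using drop(2) by (rule nbr_lev)
  then have l: "lev S \<le> lev T' + Suc i" using drop by simp
  show ?case using step[OF conjunct1[OF drop.IH[OF drop.prems]] drop(2) l] l by simp
 next
  case (stay i j S T T')
  then have l: "lev S \<le> lev T' + i" by simp
  show ?case using step[OF conjunct1[OF stay.IH[OF stay.prems]] stay(2) l, of "Suc j"] l by simp
 }
qed

abbreviation ih :: "'a tagged => 'a set" where "ih T \<equiv> interior (hull_of T)"

lemma ih_volume: "T \<in> M ==> emeasure lborel (ih T) = ennreal (vol T)" unfolding hull_of_def by (rule interior_hull_volume[OF M_full])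

lemma ih_disjoint: "T \<in> M ==> T' \<in> M ==> T ~= T' ==> ih T \<inter> hull_of T' = {}"
proof -
 assume T: "T \<in> M" "T' \<in> M" "T ~= T'"
 have "hull_of T' \<subseteq> closure (ih T')"
  using convex_closure_interior[of "hull_of T'"] full_simplex_interior_nonempty[OF M_full[OF T(2)]] closure_subset by (simp add: hull_of_def)
 moreover have "ih T \<inter> closure (ih T') = {}" using conforming_disjoint[OF conf T] open_Int_closure_eq_empty[OF open_interior] by auto
 ultimately show ?thesis by auto
qed

lemma sum_ih_volume:
 assumes "N \<subseteq> M"
 shows "ennreal (\<Sum>T\<in>N. vol T) = emeasure lborel (\<Union>T\<in>N. ih T)"
proof -
 have "emeasure lborel (\<Union>T\<in>N. ih T) = (\<Sum>T\<in>N. emeasure lborel (ih T))"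
 proof (rule sum_emeasure[symmetric])
  show "disjoint_family_on ih N" using assms ih_disjoint interior_subset unfolding disjoint_family_on_def by blast
 qed (use assms finite_M finite_subset in auto)
 also have "... = (\<Sum>T\<in>N. ennreal (vol T))" using assms ih_volume by (intro sum.cong) auto
 finally show ?thesis by (simp add: simplex_volume_def)
qed

text \<open>The reachable elements have disjoint interiors inside one ball, and the d-th power of
  its radius is (i + j + 1)^d 2^i 2^-lev up to constants.\<close>

lemma growth: "dm.growth (unit_ball_vol DIM('a) * shape_const ^ (DIM('a) + 1))" unfolding dm.growth_def
proof (intro ballI allI)
 fix S i j assume S: "S \<in> M"
 let ?C = "real (i + j + 1)"
 define r where "r = shape_const * ?C * (2 powr (i / DIM('a)) * mesh_size DIM('a) (lev S))"
 have r0: "0 \<le> r" using shape_const(1) by (simp add: r_def less_imp_le)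
 have "ih S ~= {}" using full_simplex_interior_nonempty[OF M_full[OF S]] by (simp add: hull_of_def)
 then obtain z where z: "z \<in> hull_of S" by force
 let ?A = "(\<Union>T\<in>{T \<in> M. dm.reach i j S T}. ih T)"
 have sub: "?A \<subseteq> cball z r" using reach_cball[OF _ z] interior_subset by (fastforce simp: r_def)
 let ?B = "(\<Sum>T\<in>{T \<in> M. dm.reach i j S T}. vol T)"
 have "ennreal ?B = emeasure lborel ?A" by (rule sum_ih_volume) auto
 also have "... \<le> emeasure lborel (cball z r)" by (rule emeasure_mono[OF sub]) simp
 also have "... = ennreal (unit_ball_vol DIM('a) * r ^ DIM('a))" using r0 by (rule emeasure_cball)
 finally have "?B \<le> unit_ball_vol DIM('a) * r ^ DIM('a)" using r0 by simp
 also have "r ^ DIM('a) = shape_const ^ DIM('a) * ?C ^ DIM('a) * (2 ^ i * (1 / 2 ^ lev S))" unfolding r_def power_mult_distrib mesh_size_power[symmetric]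
  by (simp add: powr_realpow[symmetric] powr_powr)
 also have "... \<le> shape_const ^ DIM('a) * ?C ^ DIM('a) * (2 ^ i * (shape_const * vol S))" using shape_const(1) shape_const(3)[OF lev[OF S]] by (intro mult_left_mono) auto
 finally show "(\<Sum>T | T \<in> M \<and> dm.reach i j S T. vol T) \<le>
   unit_ball_vol DIM('a) * shape_const ^ (DIM('a) + 1) * (?C ^ DIM('a) * (2 ^ i * vol S))" by (simp add: mult_ac)
qed

definition pf :: "'a tagged => ('a set => real) => 'a => real" where "pf T x y = (\<Sum>f\<in>fc T. x f * cr_basis (verts T) f y)"

text \<open>Averaging over the elements that contain \<open>y\<close> makes the function Borel measurable.\<close>

definition crf :: "('a set => real) => 'a => real" where "crf x y = (\<Sum>T\<in>M. indicator (hull_of T) y * pf T x y) / (\<Sum>T\<in>M. indicator (hull_of T) y)"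

lemma continuous_pf [continuous_intros]: "continuous_on S (pf T x)" unfolding pf_def by (intro continuous_intros)

lemma pf_mid: "T \<in> M ==> f \<in> fc T ==> pf T x (mid f) = x f" unfolding pf_def using card_vfacets[OF M_full]
 by (simp add: cr_basis_mid[OF M_full] if_distrib cong: if_cong sum.cong)

lemma crf_interior:
 assumes T: "T \<in> M" "y \<in> ih T"
 shows "crf x y = pf T x y"
proof -
 have i: "indicator (hull_of T') y = (if T' = T then 1 else 0 :: real)" if "T' \<in> M" for T' using ih_disjoint[OF T(1) that] T(2) interior_subset by (auto simp: indicator_def)
 have "(\<Sum>T'\<in>M. indicator (hull_of T') y * pf T' x y) = (\<Sum>T'\<in>M. if T' = T then pf T x y else 0)" by (intro sum.cong refl) (simp add: i)
 moreover have "(\<Sum>T'\<in>M. indicator (hull_of T') y) = (\<Sum>T'\<in>M. if T' = T then 1 else 0 :: real)" by (simp add: i)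
 ultimately show ?thesis using T(1) finite_M by (simp add: crf_def)
qed

lemma hull_compact: "T \<in> M ==> compact (hull_of T)" unfolding hull_of_def by (rule compact_hull[OF M_full])

lemma cover: "(\<Union>T\<in>M. hull_of T) = closure \<Omega>" using conf by (simp add: conforming_def triangulates_def)

lemma closure_element: "y \<in> closure \<Omega> ==> \<exists>T\<in>M. y \<in> hull_of T" by (simp flip: cover)

lemma open_\<Omega>: "open \<Omega>" by (rule polyhedral_open[OF poly])

lemma ih_sub: "T \<in> M ==> ih T \<subseteq> \<Omega>" using interior_mono[of "hull_of T" "closure \<Omega>"] cover polyhedral_interior_closure[OF poly] by auto

lemma bounded_\<Omega>: "bounded \<Omega>"
proof -
 have "compact (closure \<Omega>)" unfolding cover[symmetric] using finite_M hull_compact by auto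
 then have "bounded (closure \<Omega>)" by auto
 then show ?thesis by (rule bounded_subset) (rule closure_subset)
qed

lemma \<Omega>_AE: "AE x in lborel. x \<in> \<Omega> \<longleftrightarrow> (\<exists>T\<in>M. x \<in> ih T)"
proof -
 have "AE x in lborel. \<forall>T\<in>M. x \<in> hull_of T \<longleftrightarrow> x \<in> ih T" using hull_interior_AE[OF M_full] finite_M
  by (subst AE_ball_countable) (auto simp: hull_of_def intro: countable_finite)
 then show ?thesis using ih_sub cover closure_subset[of \<Omega>] by fastforce
qed

text \<open>The barycenter has positive coordinates for all vertices of \<open>f\<close>, so the
  common face of the two elements contains all of them.\<close>

lemma mid_member:
 assumes T: "T \<in> M" "T' \<in> M" and f: "f \<in> fc T" "mid f \<in> hull_of T'"
 shows "f \<in> fc T'"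
proof -
 note V = M_full[OF T(1)]
 have m: "mid f \<in> convex hull (verts T \<inter> verts T')" using conforming_Int[OF conf T] mid_in_hull[OF V f(1)] f(2) by (auto simp: hull_of_def)
 have "f \<subseteq> verts T" "card f = DIM('a)" using vfacets_iff[OF V] f(1) by auto
 moreover have "f \<subseteq> verts T'"
 proof
  fix v assume v: "v \<in> f"
  then show "v \<in> verts T'" using \<open>f \<subseteq> verts T\<close> using hull_subset_bary_zero[OF V _ m, of v] bary_mid[OF V f(1), of v] by auto
 qed
 ultimately show ?thesis using vfacets_iff[OF M_full[OF T(2)]] by simp
qed

lemma faces_eq: "faces (hull_of ` M) = {convex hull f | f T. T \<in> M \<and> f \<in> fc T}" unfolding faces_def hull_of_def using facet_of_hull[OF M_full] by blast

lemma barycenter_mid: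
 assumes T: "T \<in> M" "f \<in> fc T"
 shows "barycenter (convex hull f) = mid f"
proof -
 have f: "f \<subseteq> verts T" "card f = DIM('a)" using vfacets_iff[OF M_full[OF T(1)]] T(2) by auto
 have "\<not> affine_dependent f" using M_full[OF T(1)] f(1) affine_dependent_subset by (auto simp: full_simplex_def)
 then have "{x. x extreme_point_of convex hull f} = f" using extreme_point_of_convex_hull_affine_independent by auto
 then show ?thesis by (simp add: barycenter_def mid_def f(2))
qed

text \<open>Elements through \<open>mid f\<close> have \<open>f\<close> as a facet, and their local
  functions all take the value \<open>x f\<close> there, so any average of them tends to it.\<close>

lemma crf_continuous:
 assumes T: "T \<in> M" "f \<in> fc T"
 shows "continuous (at (mid f) within closure \<Omega>) (crf x)" "crf x (mid f) = x f"
proof -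
 \<comment> \<open>The deviation from \<open>x f\<close>, cut off outside the element; it tends to 0
   by continuity or because the element stays away from \<open>mid f\<close>.\<close>
 define k where "k T y = indicator (hull_of T) y * (pf T x y - x f)" for T y
 define N where "N y = (\<Sum>T\<in>M. indicator (hull_of T) y :: real)" for y
 let ?B = "closure \<Omega>"
 have N: "1 \<le> N y" if y: "y \<in> ?B" for y
 proof -
  obtain T where T: "T \<in> M" "y \<in> hull_of T" using closure_element[OF y] by auto
  have "indicator (hull_of T) y \<le> N y" unfolding N_def using finite_M T(1) by (intro member_le_sum) auto
  then show ?thesis using T(2) by simp
 qed
 have eq: "crf x y - x f = (\<Sum>T\<in>M. k T y) / N y" if "y \<in> ?B" for y
  using N[OF that] by (simp add: crf_def k_def N_def[symmetric] right_diff_distrib sum_subtractf sum_distrib_right[symmetric] diff_divide_distrib)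
 have "mid f \<in> hull_of T" using mid_in_hull[OF M_full] T by (simp add: hull_of_def)
 then have m: "mid f \<in> ?B" using cover T by auto
 have k0: "k T' (mid f) = 0" if "T' \<in> M" for T' using pf_mid[OF that mid_member[OF T(1) that T(2)]] by (simp add: k_def indicator_def)
 then show v: "crf x (mid f) = x f" using eq[OF m] by simp
 let ?A = "at (mid f) within ?B"
 have lim: "(k T' \<longlongrightarrow> 0) ?A" if T': "T' \<in> M" for T'
 proof (cases "mid f \<in> hull_of T'")
  case True
  let ?D = "(%y. \<bar>pf T' x y - x f\<bar>)"
  have "(?D \<longlongrightarrow> \<bar>pf T' x (mid f) - x f\<bar>) ?A"
   using continuous_pf[of UNIV T' x] by (intro tendsto_intros) (auto simp: continuous_on_def intro: tendsto_within_subset)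
  then have "(?D \<longlongrightarrow> 0) ?A" using pf_mid[OF T' mid_member[OF T(1) T' T(2) True]] by simp
  then show ?thesis by (rule Lim_null_comparison[rotated]) (auto simp: k_def indicator_def)
 next
  case False
  have "\<forall>\<^sub>F y in ?A. y \<in> - hull_of T'" using hull_compact[OF T'] False by (intro topological_tendstoD[OF tendsto_ident_at]) (auto simp: compact_imp_closed)
  then show ?thesis by (rule tendsto_eventually[OF eventually_mono]) (simp add: k_def)
 qed
 let ?C = "(%y. \<Sum>T\<in>M. \<bar>k T y\<bar>)"
 have "(?C \<longlongrightarrow> (\<Sum>T\<in>M. \<bar>0\<bar>)) ?A" using lim by (intro tendsto_sum tendsto_rabs) auto
 then have "(?C \<longlongrightarrow> 0) ?A" by simp
 moreover have "\<forall>\<^sub>F y in ?A. norm (crf x y - x f) \<le> (\<Sum>T\<in>M. \<bar>k T y\<bar>)"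
 proof (rule eventually_at_topological[THEN iffD2], intro exI[of _ UNIV] conjI ballI impI)
  fix y assume y: "y \<in> ?B"
  have "norm (crf x y - x f) = \<bar>\<Sum>T\<in>M. k T y\<bar> / N y" using eq[OF y] N[OF y] by simp
  also have "... \<le> \<bar>\<Sum>T\<in>M. k T y\<bar> / 1" using N[OF y] by (intro divide_left_mono) auto
  also have "... \<le> (\<Sum>T\<in>M. \<bar>k T y\<bar>)" by simp
  finally show "norm (crf x y - x f) \<le> (\<Sum>T\<in>M. \<bar>k T y\<bar>)" .
 qed auto
 ultimately have "((%y. crf x y - x f) \<longlongrightarrow> 0) ?A" by (rule Lim_null_comparison[rotated])
 then show "continuous ?A (crf x)" by (simp add: continuous_within v LIM_zero_iff)
qed

end

section \<open>The projection as a linear system\<close>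

context bisection_mesh
begin

lemma crf_borel [measurable]: "crf x \<in> borel_measurable borel"
proof -
 have [measurable]: "hull_of T \<in> sets borel" if "T \<in> M" for T using hull_compact[OF that] by (rule borel_compact)
 have [measurable]: "pf T x \<in> borel_measurable borel" for T by (intro borel_measurable_continuous_onI continuous_pf)
 show ?thesis unfolding crf_def by simp
qed

lemma pf_bound: "T \<in> M ==> y \<in> hull_of T ==> \<bar>pf T x y\<bar> \<le> real DIM('a) * (\<Sum>f\<in>fc T. \<bar>x f\<bar>)" unfolding pf_def sum_distrib_left
 by (rule order_trans[OF sum_abs], intro sum_mono) (auto simp: abs_mult mult.commute[of "real _"] intro!: mult_left_mono cr_basis_bound[OF M_full] simp: hull_of_def)

lemma crf_bound: "\<bar>crf x y\<bar> \<le> (\<Sum>T\<in>M. real DIM('a) * (\<Sum>f\<in>fc T. \<bar>x f\<bar>))"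
proof -
 define N where "N = (\<Sum>T\<in>M. indicator (hull_of T) y :: real)"
 let ?A = "(\<Sum>T\<in>M. real DIM('a) * (\<Sum>f\<in>fc T. \<bar>x f\<bar>))"
 have "\<bar>\<Sum>T\<in>M. indicator (hull_of T) y * pf T x y\<bar> \<le> ?A" by (rule order_trans[OF sum_abs], intro sum_mono) (simp add: indicator_def pf_bound)
 moreover have "N = 0 \<or> 1 \<le> N"
 proof -
  have "N = real (card {T \<in> M. y \<in> hull_of T})" unfolding N_def using finite_M by (simp add: indicator_def Int_def)
  then show ?thesis by auto
 qed
 ultimately show ?thesis
 proof (elim disjE)
  assume N: "1 \<le> N" and le: "\<bar>\<Sum>T\<in>M. indicator (hull_of T) y * pf T x y\<bar> \<le> ?A"
  have "\<bar>crf x y\<bar> = \<bar>\<Sum>T\<in>M. indicator (hull_of T) y * pf T x y\<bar> / N" using N by (simp add: crf_def N_def[symmetric])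
  also have "... \<le> \<bar>\<Sum>T\<in>M. indicator (hull_of T) y * pf T x y\<bar> / 1" using N by (intro divide_left_mono) auto
  finally show ?thesis using le by simp
 qed (simp add: crf_def N_def[symmetric] sum_nonneg)
qed

lemma \<Omega>_sets: "\<Omega> \<in> sets borel" "\<Omega> \<in> sets lebesgue" using open_\<Omega> by auto

lemma crf_CR1: "crf x \<in> CR1 \<Omega> (hull_of ` M)"
proof -
 define B where "B = (\<Sum>T\<in>M. real DIM('a) * (\<Sum>f\<in>fc T. \<bar>x f\<bar>))"
 have m: "crf x \<in> borel_measurable (lebesgue_on \<Omega>)" by (intro measurable_restrict_space1 measurable_completion) simp
 have "esssup (lebesgue_on \<Omega>) (%y. ennreal (norm (crf x y))) \<le> ennreal B" using m crf_bound[of x] by (intro esssup_I) (auto simp: B_def intro!: ennreal_leI)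
 then have "crf x \<in> Lp \<Omega> \<infinity>" using m by (simp add: Lp_def Lp_norm_def less_top[symmetric]) (metis ennreal_neq_top top.extremum_uniqueI)
 moreover have "\<exists>a b. \<forall>y\<in>interior S. crf x y = a \<bullet> y + b" if S: "S \<in> hull_of ` M" for S
 proof -
  obtain T where T: "T \<in> M" "S = hull_of T" using S by auto
  define a where "a = (\<Sum>f\<in>fc T. x f *\<^sub>R (- (DIM('a) *\<^sub>R bary_grad (verts T) (opp (verts T) f))))"
  have "pf T x y = a \<bullet> y + pf T x 0" for y by (simp add: pf_def a_def inner_sum_left sum.distrib[symmetric] cr_basis_def bary_def algebra_simps)
  then show ?thesis using crf_interior[OF T(1)] T(2) by metis
 qed
 moreover have "continuous (at (barycenter f) within closure \<Omega>) (crf x)" if "f \<in> faces (hull_of ` M)" for f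
  using that crf_continuous(1) barycenter_mid unfolding faces_eq by auto
 ultimately show ?thesis by (simp add: CR1_def)
qed

text \<open>On the open element \<open>v\<close> is affine; continuity at the barycenter of a facet,
  approached from inside \<open>T\<close>, equates the value there with that of the affine
  function.\<close>

lemma CR1_coef:
 assumes v: "v \<in> CR1 \<Omega> (hull_of ` M)" and T: "T \<in> M" "y \<in> ih T"
 shows "v y = pf T (%f. v (mid f)) y"
proof -
 note V = M_full[OF T(1)]
 obtain a b where ab: "!!y. y \<in> ih T ==> v y = a \<bullet> y + b" using v T(1) unfolding CR1_def by auto
 have "v (mid f) = a \<bullet> mid f + b" if f: "f \<in> fc T" for f
 proof -
  have "convex hull f \<in> faces (hull_of ` M)" unfolding faces_eq using f T(1) by blast
  then have "continuous (at (mid f) within closure \<Omega>) v" using v barycenter_mid[OF T(1) f] unfolding CR1_def by auto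
  then have 1: "(v \<longlongrightarrow> v (mid f)) (at (mid f) within ih T)"
   unfolding continuous_within using ih_sub[OF T(1)] closure_subset[of \<Omega>] by (auto intro: tendsto_within_subset)
  have "((%y. a \<bullet> y + b) \<longlongrightarrow> a \<bullet> mid f + b) (at (mid f) within ih T)" by (intro tendsto_intros)
  then have 2: "(v \<longlongrightarrow> a \<bullet> mid f + b) (at (mid f) within ih T)" by (rule Lim_transform_eventually) (auto simp: eventually_at_filter ab)
  have "mid f \<notin> ih T" using opp_in[OF f] unfolding hull_of_def interior_bary[OF V] using bary_mid[OF V f] by auto
  moreover have "mid f \<in> closure (ih T)"
   using convex_closure_interior[of "hull_of T"] full_simplex_interior_nonempty[OF V] closure_subset mid_in_hull[OF V f] by (auto simp: hull_of_def)
  ultimately have "at (mid f) within ih T ~= bot" by (simp add: trivial_limit_within islimpt_in_closure)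
  then show ?thesis using 1 2 by (rule tendsto_unique)
 qed
 then show ?thesis unfolding pf_def using ab[OF T(2)] cr_basis_affine[OF V, of a y b] by simp
qed

definition SI :: "'a tagged => ('a => real) => real" where "SI T h = simplex_integral (verts T) h"

lemma hull_integrable:
 fixes f :: "'a => real"
 assumes i: "integrable lborel (%x. indicator \<Omega> x * f x)" and T: "T \<in> M" and [measurable]: "f \<in> borel_measurable borel"
 shows "integrable lborel (%x. indicator (hull_of T) x * f x)"
proof -
 have [measurable]: "hull_of T \<in> sets borel" using hull_compact[OF T] by (rule borel_compact)
 have "integrable lborel (%x. indicator (ih T) x *\<^sub>R (indicator \<Omega> x * f x))" using i by (intro integrable_mult_indicator) auto
 then show ?thesis
 proof (rule Bochner_Integration.integrable_cong_AE_imp)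
  show "AE x in lborel. indicator (ih T) x *\<^sub>R (indicator \<Omega> x * f x) = indicator (hull_of T) x * f x"
   using hull_interior_AE[OF M_full[OF T]] ih_sub[OF T] by (auto simp: indicator_def hull_of_def)
 qed measurable
qed

lemma hull_integrable_pf:
 fixes f k :: "'a => real"
 assumes i: "integrable lborel (%x. indicator \<Omega> x * f x)" and T: "T \<in> M" and f: "f \<in> borel_measurable borel" and k: "continuous_on UNIV k"
 shows "integrable lborel (%x. indicator (hull_of T) x * (f x * k x))"
proof -
 have [measurable]: "hull_of T \<in> sets borel" "k \<in> borel_measurable borel" using hull_compact[OF T] k by (auto simp: borel_compact intro: borel_measurable_continuous_onI)
 have "compact (k ` hull_of T)" using hull_compact[OF T] by (intro compact_continuous_image continuous_on_subset[OF k]) auto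
 then obtain B where B: "0 < B" "!!y. y \<in> hull_of T ==> norm (k y) \<le> B" by (metis bounded_pos compact_imp_bounded imageI)
 have "integrable lborel (%x. (indicator (hull_of T) x * f x) * (indicator (hull_of T) x * k x))"
  using B by (intro integrable_bounded_times[OF hull_integrable[OF i T f], of _ B]) (auto simp: indicator_def)
 then show ?thesis by (rule Bochner_Integration.integrable_cong[THEN iffD1, rotated -1]) (auto simp: indicator_def)
qed

text \<open>Almost every point of \<Omega> is in exactly one open element, where \<open>v\<close> is
  its local affine function. The Borel representative moves the integral from Lebesgue measure to
  \<open>lborel\<close>.\<close>

lemma pairing:
 assumes f: "f \<in> borel_measurable (lebesgue_on \<Omega>)" and f': "f' \<in> borel_measurable borel"
  and eq: "AE x in lborel. x \<in> \<Omega> --> f' x = f x" and i: "integrable lborel (%x. indicator \<Omega> x * f' x)" and v: "v \<in> CR1 \<Omega> (hull_of ` M)"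
 shows "L2_pairing \<Omega> f v = (\<Sum>T\<in>M. SI T (%x. f' x * pf T (%f. v (mid f)) x))"
proof -
 let ?c = "%f. v (mid f)"
 have [measurable]: "hull_of T \<in> sets borel" if "T \<in> M" for T using hull_compact[OF that] by (rule borel_compact)
 have [measurable]: "pf T ?c \<in> borel_measurable borel" for T by (intro borel_measurable_continuous_onI continuous_pf)
 have vm: "v \<in> borel_measurable (lebesgue_on \<Omega>)" using v by (simp add: CR1_def Lp_def)
 let ?A = "indicator \<Omega>"
 have m: "(%x. ?A x *\<^sub>R (f x * v x)) \<in> borel_measurable lebesgue" using borel_measurable_times[OF f vm] \<Omega>_sets by (simp add: borel_measurable_restrict_space_iff)
 define k where "k x = (\<Sum>T\<in>M. indicator (hull_of T) x * (f' x * pf T ?c x))" for x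
 have km: "k \<in> borel_measurable borel" unfolding k_def using f' by simp
 have "AE x in lborel. \<forall>T\<in>M. x \<in> hull_of T \<longleftrightarrow> x \<in> ih T" using hull_interior_AE[OF M_full] finite_M
  by (subst AE_ball_countable) (auto simp: hull_of_def intro: countable_finite)
 with eq \<Omega>_AE have "AE x in lborel. ?A x *\<^sub>R (f x * v x) = k x"
 proof eventually_elim
  case (elim x)
  show ?case
  proof (cases "x \<in> \<Omega>")
   case True
   then obtain T where T: "T \<in> M" "x \<in> ih T" using elim by auto
   have "k x = (\<Sum>T'\<in>M. if T' = T then f' x * pf T ?c x else 0)" unfolding k_def
   proof (intro sum.cong refl)
    fix T' assume "T' \<in> M"
    then show "indicator (hull_of T') x * (f' x * pf T' ?c x) = (if T' = T then f' x * pf T ?c x else 0)"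
     using ih_disjoint[OF T(1), of T'] T(2) interior_subset by (auto simp: indicator_def)
   qed
   then show ?thesis using True elim T finite_M CR1_coef[OF v T] by simp
  next
   case False
   have "indicator (hull_of T) x * (f' x * pf T ?c x) = 0" if "T \<in> M" for T using elim False that by simp
   then show ?thesis using False by (auto simp: k_def intro!: sum.neutral)
  qed
 qed
 then have ae: "AE x in lebesgue. ?A x *\<^sub>R (f x * v x) = k x" by (rule AE_completion)
 have "L2_pairing \<Omega> f v = (LINT x|lebesgue. ?A x *\<^sub>R (f x * v x))" unfolding L2_pairing_def using \<Omega>_sets by (subst integral_restrict_space) auto
 also have "... = (LINT x|lebesgue. k x)" using ae km by (intro integral_cong_AE m measurable_completion) auto
 also have "... = (IL x. k x)" using km by (simp add: integral_completion)
 finally show ?thesis by (auto simp: k_def SI_def simplex_integral_def hull_of_def[symmetric] intro!: Bochner_Integration.integral_sum hull_integrable_pf[OF i _ f'] continuous_pf)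
qed

lemma crf_integrable: "integrable lborel (%y. indicator \<Omega> y * crf x y)"
proof (rule integrable_bounded_times)
 have "emeasure lborel \<Omega> < \<infinity>" using bounded_\<Omega> by (rule emeasure_bounded_finite)
 then show "integrable lborel (indicator \<Omega> :: 'a => real)" using \<Omega>_sets by simp
qed (use crf_bound crf_borel in auto)

lemma CR1_AE:
 assumes v: "v \<in> CR1 \<Omega> (hull_of ` M)"
 shows "AE y in lborel. y \<in> \<Omega> --> crf (%f. v (mid f)) y = v y" using \<Omega>_AE by eventually_elim (use CR1_coef[OF v] crf_interior in auto)

lemma pairing_CR1:
 assumes w: "w \<in> CR1 \<Omega> (hull_of ` M)" and v: "v \<in> CR1 \<Omega> (hull_of ` M)"
 shows "L2_pairing \<Omega> w v = (\<Sum>T\<in>M. SI T (%x. pf T (%f. w (mid f)) x * pf T (%f. v (mid f)) x))"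
proof -
 have "w \<in> borel_measurable (lebesgue_on \<Omega>)" using w by (simp add: CR1_def Lp_def)
 then have "L2_pairing \<Omega> w v = (\<Sum>T\<in>M. SI T (%x. crf (%f. w (mid f)) x * pf T (%f. v (mid f)) x))" by (rule pairing[OF _ crf_borel CR1_AE[OF w] crf_integrable v])
 also have "... = (\<Sum>T\<in>M. SI T (%x. pf T (%f. w (mid f)) x * pf T (%f. v (mid f)) x))"
 proof (intro sum.cong refl)
  fix T assume T: "T \<in> M"
  have [measurable]: "hull_of T \<in> sets borel" using hull_compact[OF T] by (rule borel_compact)
  have [measurable]: "pf T c \<in> borel_measurable borel" for c by (intro borel_measurable_continuous_onI continuous_pf)
  show "SI T (%x. crf (%f. w (mid f)) x * pf T (%f. v (mid f)) x) = SI T (%x. pf T (%f. w (mid f)) x * pf T (%f. v (mid f)) x)"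
   unfolding SI_def simplex_integral_def hull_of_def[symmetric] by (rule integral_cong_AE; (measurable)?)
    (use hull_interior_AE[OF M_full[OF T]] crf_interior[OF T] in \<open>auto elim!: eventually_mono simp: hull_of_def\<close>)
 qed
 finally show ?thesis .
qed

lemma SI_pf_basis:
 assumes T: "T \<in> M" and f: "f \<in> fc T"
 shows "(real DIM('a) + 1) * (real DIM('a) + 2) * SI T (%x. pf T c x * cr_basis (verts T) f x) =
  vol T * ((real DIM('a))^2 * c f - (real DIM('a) - 2) * (\<Sum>g\<in>fc T. c g))"
proof -
 note V = M_full[OF T]
 note fin = card_vfacets(1)[OF V]
 let ?A = "cr_basis (verts T)"
 let ?B = "SI T (%x. pf T c x * ?A f x)"
 have "?B = (\<Sum>g\<in>fc T. c g * SI T (%x. ?A f x * ?A g x))" unfolding SI_def simplex_integral_cmult[symmetric] pf_def sum_distrib_right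
  by (subst simplex_integral_sum[OF V fin, symmetric]) (auto intro!: continuous_intros simp: mult_ac)
 then have "(real DIM('a) + 1) * (real DIM('a) + 2) * ?B = (\<Sum>g\<in>fc T. c g * ((real DIM('a) + 1) * (real DIM('a) + 2) * simplex_integral (verts T) (%x. ?A f x * ?A g x)))"
  by (simp add: sum_distrib_left SI_def mult_ac)
 also have "... = (\<Sum>g\<in>fc T. (if g = f then vol T * (real DIM('a))^2 * c f else 0) - vol T * (real DIM('a) - 2) * c g)"
 proof (intro sum.cong refl)
  fix g assume g: "g \<in> fc T"
  show "c g * ((real DIM('a) + 1) * (real DIM('a) + 2) * simplex_integral (verts T) (%x. ?A f x * ?A g x)) =
    (if g = f then vol T * (real DIM('a))^2 * c f else 0) - vol T * (real DIM('a) - 2) * c g"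
   unfolding cr_mass_matrix[OF V f g] by (cases "g = f") (simp_all add: left_diff_distrib right_diff_distrib mult_ac)
 qed
 also have "... = vol T * ((real DIM('a))^2 * c f - (real DIM('a) - 2) * (\<Sum>g\<in>fc T. c g))"
  unfolding sum_subtractf sum_distrib_left[symmetric] sum.delta[OF fin] using f by argo
 finally show ?thesis .
qed

lemma pf_delta: "T \<in> M ==> pf T (%g. if g = f then 1 else 0) x = (if f \<in> fc T then cr_basis (verts T) f x else 0)"
proof -
 assume T: "T \<in> M"
 have "pf T (%g. if g = f then 1 else 0) x = (\<Sum>g\<in>fc T. if g = f then cr_basis (verts T) g x else 0)" unfolding pf_def by (intro sum.cong) auto
 then show ?thesis by (simp add: sum.delta[OF card_vfacets(1)[OF M_full[OF T]]])
qed

lemma SI_diff: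
 assumes "integrable lborel (%x. indicator (hull_of T) x * h x)" "integrable lborel (%x. indicator (hull_of T) x * k x)"
 shows "SI T (%x. h x - k x) = SI T h - SI T k" using Bochner_Integration.integral_diff[OF assms] by (simp add: SI_def simplex_integral_def hull_of_def right_diff_distrib)

lemma SI_pf_right:
 assumes T: "T \<in> M" and i: "integrable lborel (%x. indicator \<Omega> x * h x)" and h: "h \<in> borel_measurable borel"
 shows "SI T (%x. h x * pf T c x) = (\<Sum>f\<in>fc T. c f * SI T (%x. h x * cr_basis (verts T) f x))"
using hull_integrable_pf[OF i T h continuous_cr_basis] by (simp add: SI_def simplex_integral_def pf_def hull_of_def sum_distrib_left mult_ac)

lemma fin_Fa: "finite dm.Fa" using finite_M card_vfacets(1)[OF M_full] by simp

lemma sum_Fa: "T \<in> M ==> (\<Sum>f\<in>dm.Fa. if f \<in> fc T then h f else 0) = (\<Sum>f\<in>fc T. h f)" by (rule sum.mono_neutral_cong_right[OF fin_Fa]) auto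

lemma sum_El_faces: "(\<Sum>T | T \<in> M \<and> f \<in> fc T. h T) = (\<Sum>T\<in>M. if f \<in> fc T then h T else 0)" by (rule sum.mono_neutral_cong_left) (use finite_M in auto)

text \<open>A lower eigenvalue bound of the element mass matrix: by Cauchy-Schwarz the rank-one part
  takes at most (d - 2)(d + 1) from d^2, and d + 2 remains.\<close>

lemma pf_square_pos:
 assumes T: "T \<in> M"
 shows "vol T / (real DIM('a) + 1) * (\<Sum>f\<in>fc T. (c f)^2) \<le> (\<Sum>f\<in>fc T. c f * SI T (%x. pf T c x * cr_basis (verts T) f x))"
proof -
 define d where "d = real DIM('a)"
 define s where "s = (\<Sum>f\<in>fc T. c f)"
 define q where "q = (\<Sum>f\<in>fc T. (c f)^2)"
 define Y where "Y = (\<Sum>f\<in>fc T. c f * SI T (%x. pf T c x * cr_basis (verts T) f x))"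
 have d: "2 \<le> d" using dim by (simp add: d_def)
 have v: "0 < vol T" using simplex_volume_pos[OF M_full[OF T]] .
 have sq: "s^2 \<le> (d + 1) * q" using card_vfacets[OF M_full[OF T]] Cauchy_Schwarz_ineq_sum[of "%_. 1" c "fc T"] by (simp add: s_def d_def q_def add.commute)
 have "(d + 1) * (d + 2) * Y = (\<Sum>f\<in>fc T. c f * (vol T * (d^2 * c f - (d - 2) * s)))" unfolding Y_def sum_distrib_left
 proof (intro sum.cong refl)
  fix f assume "f \<in> fc T"
  from SI_pf_basis[OF T this, of c, folded s_def]
  show "(d + 1) * (d + 2) * (c f * SI T (%x. pf T c x * cr_basis (verts T) f x)) = c f * (vol T * (d^2 * c f - (d - 2) * s))" by (simp only: d_def mult.left_commute[of _ "c f"])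
 qed
 also have "... = (\<Sum>f\<in>fc T. vol T * d^2 * (c f)^2 - vol T * (d - 2) * s * c f)" by (simp add: algebra_simps power2_eq_square)
 also have "... = vol T * (d^2 * q - (d - 2) * s^2)"
  unfolding sum_subtractf sum_distrib_left[symmetric] s_def[symmetric] q_def[symmetric] by (simp add: algebra_simps power2_eq_square)
 finally have eq: "(d + 1) * (d + 2) * Y = vol T * (d^2 * q - (d - 2) * s^2)" .
 have "(d - 2) * s^2 \<le> (d - 2) * ((d + 1) * q)" using sq d by (intro mult_left_mono) auto
 then have "(d + 2) * q \<le> d^2 * q - (d - 2) * s^2" by (simp add: algebra_simps power2_eq_square)
 then have "vol T * ((d + 2) * q) \<le> vol T * (d^2 * q - (d - 2) * s^2)" using v by simp
 then have "(d + 2) * (vol T * q) \<le> (d + 2) * ((d + 1) * Y)" unfolding eq[symmetric] by argo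
 then show ?thesis using d by (simp add: d_def[symmetric] q_def[symmetric] Y_def[symmetric] pos_divide_le_eq mult.commute)
qed

text \<open>\<open>A\<close> is the global mass matrix, positive definite by
  \<open>pf_square_pos\<close>. As \<open>u\<close> is merely integrable, solving the normal
  equations takes the place of a Hilbert space projection.\<close>

lemma projection_exists:
 assumes f: "u \<in> borel_measurable (lebesgue_on \<Omega>)" and f': "u' \<in> borel_measurable borel"
  and eq: "AE x in lborel. x \<in> \<Omega> --> u' x = u x" and i: "integrable lborel (%x. indicator \<Omega> x * u' x)"
 shows "\<exists>w. w \<in> CR1 \<Omega> (hull_of ` M) \<and> (\<forall>v\<in>CR1 \<Omega> (hull_of ` M). L2_pairing \<Omega> w v = L2_pairing \<Omega> u v)"
proof -
 define a where "a T f g = SI T (%x. cr_basis (verts T) f x * cr_basis (verts T) g x)" for T f g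
 define A where "A f g = (\<Sum>T\<in>M. if f \<in> fc T \<and> g \<in> fc T then a T f g else 0)" for f g
 define b where "b f = (\<Sum>T\<in>M. if f \<in> fc T then SI T (%x. u' x * cr_basis (verts T) f x) else 0)" for f
 have aT: "(\<Sum>g\<in>fc T. a T f g * c g) = SI T (%x. pf T c x * cr_basis (verts T) f x)" if T: "T \<in> M" for T f c unfolding SI_def pf_def a_def sum_distrib_right
  by (subst simplex_integral_sum[OF M_full[OF T] card_vfacets(1)[OF M_full[OF T]]]) (auto intro!: continuous_intros simp: simplex_integral_cmult[symmetric] mult_ac)
 have A: "(\<Sum>g\<in>dm.Fa. A f g * c g) = (\<Sum>T\<in>M. if f \<in> fc T then SI T (%x. pf T c x * cr_basis (verts T) f x) else 0)" for f c
 proof -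
  have "(\<Sum>g\<in>dm.Fa. A f g * c g) = (\<Sum>T\<in>M. \<Sum>g\<in>dm.Fa. (if f \<in> fc T \<and> g \<in> fc T then a T f g else 0) * c g)"
   unfolding A_def sum_distrib_right by (rule sum.swap)
  also have "... = (\<Sum>T\<in>M. if f \<in> fc T then SI T (%x. pf T c x * cr_basis (verts T) f x) else 0)"
  proof (intro sum.cong refl)
   fix T assume T: "T \<in> M"
   let ?B = "(\<Sum>g\<in>dm.Fa. (if f \<in> fc T \<and> g \<in> fc T then a T f g else 0) * c g)"
   have "?B = (if f \<in> fc T then (\<Sum>g\<in>dm.Fa. if g \<in> fc T then a T f g * c g else 0) else 0)" by (auto intro!: sum.cong)
   then show "?B = (if f \<in> fc T then SI T (%x. pf T c x * cr_basis (verts T) f x) else 0)" by (simp only: sum_Fa[OF T] aT[OF T])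
  qed
  finally show ?thesis .
 qed
 have test: "(\<Sum>f\<in>dm.Fa. x f * (\<Sum>T\<in>M. if f \<in> fc T then h T f else 0)) = (\<Sum>T\<in>M. \<Sum>f\<in>fc T. x f * h T f)" for x :: "'a set => real" and h
 proof -
  have "(\<Sum>f\<in>dm.Fa. x f * (\<Sum>T\<in>M. if f \<in> fc T then h T f else 0)) = (\<Sum>f\<in>dm.Fa. \<Sum>T\<in>M. if f \<in> fc T then x f * h T f else 0)"
   unfolding sum_distrib_left by (intro sum.cong refl) auto
  also have "... = (\<Sum>T\<in>M. \<Sum>f\<in>dm.Fa. if f \<in> fc T then x f * h T f else 0)" by (rule sum.swap)
  finally show ?thesis by (auto intro!: sum.cong sum_Fa)
 qed
 have "\<exists>c. (\<forall>f. f \<notin> dm.Fa --> c f = 0) \<and> (\<forall>f\<in>dm.Fa. (\<Sum>g\<in>dm.Fa. A f g * c g) = b f)"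
 proof (rule positive_definite_solvable[OF fin_Fa])
  show "A f g = A g f" for f g unfolding A_def a_def by (intro sum.cong refl) (simp add: mult.commute)
  fix x :: "'a set => real" assume x: "!!f. f \<notin> dm.Fa ==> x f = 0" "\<exists>f. x f ~= 0"
  let ?A = "(\<Sum>f\<in>dm.Fa. \<Sum>g\<in>dm.Fa. x f * A f g * x g)"
  have "?A = (\<Sum>T\<in>M. \<Sum>f\<in>fc T. x f * SI T (%y. pf T x y * cr_basis (verts T) f y))" unfolding mult.assoc sum_distrib_left[symmetric] A test ..
  also have "... \<ge> (\<Sum>T\<in>M. vol T / (real DIM('a) + 1) * (\<Sum>f\<in>fc T. (x f)^2))" by (intro sum_mono pf_square_pos)
  finally have le: "(\<Sum>T\<in>M. vol T / (real DIM('a) + 1) * (\<Sum>f\<in>fc T. (x f)^2)) \<le> ?A" .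
  obtain f where f: "x f ~= 0" using x(2) by auto
  then have "f \<in> dm.Fa" using x(1) by auto
  then obtain T where T: "T \<in> M" "f \<in> fc T" by auto
  have "0 < (\<Sum>f\<in>fc T. (x f)^2)" using f card_vfacets(1)[OF M_full[OF T(1)]] by (intro sum_pos2[OF _ T(2)]) auto
  moreover have v: "0 < vol T" if "T \<in> M" for T using simplex_volume_pos[OF M_full[OF that]] .
  ultimately have "0 < vol T / (real DIM('a) + 1) * (\<Sum>f\<in>fc T. (x f)^2)" using v[OF T(1)] by simp
  moreover have "0 \<le> vol T / (real DIM('a) + 1) * (\<Sum>f\<in>fc T. (x f)^2)" if "T \<in> M" for T using v[OF that] by (intro mult_nonneg_nonneg sum_nonneg) auto
  ultimately have "0 < (\<Sum>T\<in>M. vol T / (real DIM('a) + 1) * (\<Sum>f\<in>fc T. (x f)^2))" by (intro sum_pos2[OF finite_M T(1)])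
  then show "0 < ?A" using le by simp
 qed
 then obtain c where c: "!!f. f \<in> dm.Fa ==> (\<Sum>g\<in>dm.Fa. A f g * c g) = b f" by auto
 let ?C = "L2_pairing \<Omega>"
 have "?C (crf c) v = ?C u v" if v: "v \<in> CR1 \<Omega> (hull_of ` M)" for v
 proof -
  let ?v = "%f. v (mid f)"
  have pc: "pf T (%f. crf c (mid f)) = pf T c" if "T \<in> M" for T unfolding pf_def using crf_continuous(2)[OF that] by simp
  have "?C (crf c) v = (\<Sum>T\<in>M. SI T (%x. pf T c x * pf T ?v x))" by (simp add: pairing_CR1[OF crf_CR1 v] pc)
  also have "... = (\<Sum>T\<in>M. \<Sum>f\<in>fc T. ?v f * SI T (%x. pf T c x * cr_basis (verts T) f x))"
  proof (intro sum.cong refl)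
   fix T assume T: "T \<in> M"
   show "SI T (%x. pf T c x * pf T ?v x) = (\<Sum>f\<in>fc T. ?v f * SI T (%x. pf T c x * cr_basis (verts T) f x))"
    unfolding SI_def simplex_integral_cmult[symmetric] pf_def[of T ?v] by (subst simplex_integral_sum[OF M_full[OF T] card_vfacets(1)[OF M_full[OF T]], symmetric])
     (auto intro!: continuous_intros simp: sum_distrib_left mult_ac)
  qed
  also have "... = (\<Sum>f\<in>dm.Fa. ?v f * (\<Sum>g\<in>dm.Fa. A f g * c g))" unfolding A test ..
  also have "... = (\<Sum>T\<in>M. SI T (%x. u' x * pf T ?v x))" by (simp add: c b_def test SI_pf_right[OF _ i f'])
  also have "... = ?C u v" by (rule pairing[OF f f' eq i v, symmetric])
  finally show ?thesis .
 qed
 then show ?thesis using crf_CR1 by auto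
qed

text \<open>Subtracting face values \<open>y\<close> from the coefficients replaces the data
  \<open>u\<close> by its difference to the interpolant of \<open>y\<close>. The basis functions of
  an element sum to one, so this difference is a combination of the functions u - y f.\<close>

lemma projection_system:
 assumes f: "u \<in> borel_measurable (lebesgue_on \<Omega>)" and f': "u' \<in> borel_measurable borel"
  and eq: "AE x in lborel. x \<in> \<Omega> --> u' x = u x" and i: "integrable lborel (%x. indicator \<Omega> x * u' x)"
 defines "Q \<equiv> Q_CR \<Omega> (hull_of ` M) u"
 shows "T \<in> M ==> x \<in> ih T ==> Q x = pf T (%f. Q (mid f)) x" and "dm.solves (%f. Q (mid f) - y f) (%T. (real DIM('a) + 1) * (real DIM('a) + 2) * (real DIM('a))^2 / vol T *
   (\<Sum>f\<in>fc T. SI T (%x. \<bar>u' x - y f\<bar>)))"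
proof -
 have Q: "Q \<in> CR1 \<Omega> (hull_of ` M)" "!!v. v \<in> CR1 \<Omega> (hull_of ` M) ==> L2_pairing \<Omega> Q v = L2_pairing \<Omega> u v"
  using someI_ex[OF projection_exists[OF f f' eq i]] unfolding Q_def Q_CR_def by auto
 show "T \<in> M ==> x \<in> ih T ==> Q x = pf T (%f. Q (mid f)) x" by (rule CR1_coef[OF Q(1)])
 define W where "W f = Q (mid f)" for f
 let ?A = "real DIM('a)"
 \<comment> \<open>The normalization of the element mass matrix in
   \<open>SI_pf_basis\<close>.\<close>
 define k where "k = (?A + 1) * (?A + 2)"
 have k0: "0 \<le> k" by (simp add: k_def)
 let ?C = "integrable lborel"
 have \<Omega>i: "?C (indicator \<Omega> :: 'a => real)" using emeasure_bounded_finite[OF bounded_\<Omega>] \<Omega>_sets by simp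
 define r where "r T x = u' x - pf T y x" for T x
 have iu: "?C (%x. indicator \<Omega> x * (u' x - z))" for z unfolding right_diff_distrib using i \<Omega>i by simp
 define \<beta> where "\<beta> T f = k * SI T (%x. r T x * cr_basis (verts T) f x)" for T f
 \<comment> \<open>Orthogonality tested with the basis function of one face, whose coefficients are
   a Kronecker delta.\<close>
 have orth: "(\<Sum>T\<in>M. if f \<in> fc T then SI T (%x. pf T W x * cr_basis (verts T) f x) else 0) =
   (\<Sum>T\<in>M. if f \<in> fc T then SI T (%x. u' x * cr_basis (verts T) f x) else 0)" if F: "f \<in> dm.Fa" for f
 proof -
  let ?\<delta> = "%g. if g = f then 1 else 0 :: real"
  let ?D = "(%g. crf ?\<delta> (mid g))"
  have pc: "pf T ?D x = (if f \<in> fc T then cr_basis (verts T) f x else 0)" if "T \<in> M" for T x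
  proof -
   show ?thesis using pf_delta[OF that] crf_continuous(2)[OF that, of _ ?\<delta>] by (simp add: pf_def)
  qed
  have z: "SI T (%x. h x * (if P then k x else 0)) = (if P then SI T (%x. h x * k x) else 0)" for T P h k by (simp add: SI_def simplex_integral_def)
  have "(\<Sum>T\<in>M. SI T (%x. pf T W x * pf T ?D x)) = (\<Sum>T\<in>M. SI T (%x. u' x * pf T ?D x))"
   using Q(2)[OF crf_CR1, of ?\<delta>] unfolding pairing_CR1[OF Q(1) crf_CR1] pairing[OF f f' eq i crf_CR1] W_def .
  then show ?thesis by (simp add: pc z)
 qed
 have c: "continuous_on UNIV (%x. pf T z x * cr_basis (verts T) f x)" for T z f by (intro continuous_intros)
 have pi: "?C (%x. indicator (hull_of T) x * (pf T z x * cr_basis (verts T) f x))" if "T \<in> M" for T z f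
  using simplex_integrable_cont[OF M_full[OF that] c] by (simp add: hull_of_def)
 have ui: "?C (%x. indicator (hull_of T) x * (u' x * cr_basis (verts T) f x))" if "T \<in> M" for T f by (rule hull_integrable_pf[OF i that f' continuous_cr_basis])
 have ri: "?C (%x. indicator (hull_of T) x * (r T x * cr_basis (verts T) f x))" if "T \<in> M" for T f
  using Bochner_Integration.integrable_diff[OF ui[OF that] pi[OF that], of f y f] by (simp add: r_def right_diff_distrib left_diff_distrib)
 have "dm.solves (%f. W f - y f) (%T. k * ?A^2 / vol T * (\<Sum>f\<in>fc T. SI T (%x. \<bar>u' x - y f\<bar>)))" unfolding dm.solves_def
 proof (intro exI[of _ \<beta>] conjI ballI)
  fix T f assume T: "T \<in> M" and f: "f \<in> fc T"
  note V = M_full[OF T]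
  let ?I = "indicator (hull_of T) :: 'a => real"
  have int: "?C (%x. ?I x * \<bar>u' x - y g\<bar>)" for g using integrable_abs[OF hull_integrable[OF iu T, of "y g"]] f' by (simp add: abs_mult)
  have bd: "\<bar>?I x * (r T x * cr_basis (verts T) f x)\<bar> \<le> (\<Sum>g\<in>fc T. ?A^2 * (?I x * \<bar>u' x - y g\<bar>))" for x
  proof (cases "x \<in> hull_of T")
   case True
   then have b: "\<bar>cr_basis (verts T) g x\<bar> \<le> ?A" if "g \<in> fc T" for g using cr_basis_bound[OF V that] by (simp add: hull_of_def)
   have "r T x = (\<Sum>g\<in>fc T. (u' x - y g) * cr_basis (verts T) g x)"
    by (simp add: r_def pf_def left_diff_distrib sum_subtractf sum_distrib_left[symmetric] cr_basis_sum[OF V])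
   then have "\<bar>r T x\<bar> * \<bar>cr_basis (verts T) f x\<bar> \<le> (\<Sum>g\<in>fc T. \<bar>u' x - y g\<bar> * ?A) * ?A" using b[OF f] b by (auto simp: abs_mult intro!: order_trans[OF sum_abs] sum_mono mult_mono sum_nonneg)
   then show ?thesis using True by (simp add: abs_mult sum_distrib_left power2_eq_square mult_ac)
  qed simp
  have "\<bar>SI T (%x. r T x * cr_basis (verts T) f x)\<bar> \<le> (IL x. (\<Sum>g\<in>fc T. ?A^2 * (?I x * \<bar>u' x - y g\<bar>)))"
   unfolding SI_def simplex_integral_def hull_of_def[symmetric]
  proof (rule order_trans[OF integral_abs_bound integral_mono])
   show "?C (%x. \<bar>?I x * (r T x * cr_basis (verts T) f x)\<bar>)" by (rule integrable_abs[OF ri[OF T]])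
   show "?C (%x. \<Sum>g\<in>fc T. ?A^2 * (?I x * \<bar>u' x - y g\<bar>))" using int by auto
  qed (rule bd)
  also have "... = (\<Sum>g\<in>fc T. ?A^2 * SI T (%x. \<bar>u' x - y g\<bar>))" using int unfolding SI_def simplex_integral_def hull_of_def[symmetric] by simp
  finally have "k * \<bar>SI T (%x. r T x * cr_basis (verts T) f x)\<bar> \<le> k * (\<Sum>g\<in>fc T. ?A^2 * SI T (%x. \<bar>u' x - y g\<bar>))" using k0 by (rule mult_left_mono)
  then show "\<bar>\<beta> T f\<bar> \<le> vol T * (k * ?A^2 / vol T * (\<Sum>f\<in>fc T. SI T (%x. \<bar>u' x - y f\<bar>)))"
   using k0 simplex_volume_pos[OF V] by (simp add: \<beta>_def abs_mult sum_distrib_left[symmetric])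
 next
  fix f assume F: "f \<in> dm.Fa"
  let ?B = "(\<Sum>T | T \<in> M \<and> f \<in> fc T. vol T * (?A^2 * (W f - y f) - (?A - 2) * (\<Sum>g\<in>fc T. W g - y g)))"
  have "?B = (\<Sum>T | T \<in> M \<and> f \<in> fc T. k * (SI T (%x. pf T W x * cr_basis (verts T) f x) - SI T (%x. pf T y x * cr_basis (verts T) f x)))"
  proof (intro sum.cong refl)
   fix T assume "T \<in> {T. T \<in> M \<and> f \<in> fc T}"
   then have T: "T \<in> M" "f \<in> fc T" by auto
   have "SI T (%x. pf T (%g. W g - y g) x * cr_basis (verts T) f x) =
     SI T (%x. pf T W x * cr_basis (verts T) f x) - SI T (%x. pf T y x * cr_basis (verts T) f x)" using SI_diff[OF pi[OF T(1)] pi[OF T(1)], of W f y f] by (simp add: pf_def left_diff_distrib sum_subtractf)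
   then show "vol T * (?A^2 * (W f - y f) - (?A - 2) * (\<Sum>g\<in>fc T. W g - y g)) =
     k * (SI T (%x. pf T W x * cr_basis (verts T) f x) - SI T (%x. pf T y x * cr_basis (verts T) f x))" using SI_pf_basis[OF T, of "%g. W g - y g"] by (simp only: k_def)
  qed
  also have "... = k * ((\<Sum>T | T \<in> M \<and> f \<in> fc T. SI T (%x. u' x * cr_basis (verts T) f x)) -
    (\<Sum>T | T \<in> M \<and> f \<in> fc T. SI T (%x. pf T y x * cr_basis (verts T) f x)))"
   unfolding sum_distrib_left[symmetric] sum_subtractf using orth[OF F] by (simp add: sum_El_faces)
  also have "... = (\<Sum>T | T \<in> M \<and> f \<in> fc T. \<beta> T f)" unfolding sum_subtractf[symmetric] sum_distrib_left \<beta>_def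
  proof (intro sum.cong refl)
   fix T assume "T \<in> {T. T \<in> M \<and> f \<in> fc T}"
   then show "k * (SI T (%x. u' x * cr_basis (verts T) f x) - SI T (%x. pf T y x * cr_basis (verts T) f x)) =
     k * SI T (%x. r T x * cr_basis (verts T) f x)" using SI_diff[OF ui pi, of T f y f] by (simp add: r_def left_diff_distrib)
  qed
  finally show "?B = (\<Sum>T | T \<in> M \<and> f \<in> fc T. \<beta> T f)" .
 qed
 then show "dm.solves (%f. Q (mid f) - y f) (%T. (?A + 1) * (?A + 2) * ?A^2 / vol T * (\<Sum>f\<in>fc T. SI T (%x. \<bar>u' x - y f\<bar>)))" by (simp add: W_def k_def)
qed

end

section \<open>Local oscillation\<close>

definition osc :: "('a::euclidean_space => real) => 'a set => 'a set => ennreal" where "osc u A B = (NN x. NN y. indicator A x * indicator B y * ennreal \<bar>u y - u x\<bar>)"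

lemma osc_mono: "A \<subseteq> A' ==> B \<subseteq> B' ==> osc u A B \<le> osc u A' B'" unfolding osc_def by (intro nn_integral_mono mult_right_mono mult_mono) auto

text \<open>The pointwise triangle inequality, integrated over the product of the three
  sets.\<close>

lemma osc_triangle:
 fixes u :: "'a::euclidean_space => real"
 assumes [measurable]: "u \<in> borel_measurable borel" "A \<in> sets borel" "B \<in> sets borel" "C \<in> sets borel"
 shows "emeasure lborel B * osc u A C \<le> emeasure lborel C * osc u A B + emeasure lborel A * osc u B C"
proof -
 let ?B = "indicator A"
 let ?C = "indicator B"
 let ?F = "%a b c. ?B a * ?C b * indicator C c :: ennreal"
 let ?A = "emeasure lborel"
 have "?A B * osc u A C = (NN a. NN b. NN c. ?F a b c * ennreal \<bar>u c - u a\<bar>)"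
 proof -
  have "(NN b. NN c. ?F a b c * ennreal \<bar>u c - u a\<bar>) =
   ?A B * (NN c. ?B a * indicator C c * ennreal \<bar>u c - u a\<bar>)" for a
  proof -
   have "(NN c. ?F a b c * ennreal \<bar>u c - u a\<bar>) = ?C b * (NN c. ?B a * indicator C c * ennreal \<bar>u c - u a\<bar>)" for b
    by (simp add: mult_ac nn_integral_cmult[symmetric])
   then show ?thesis by (simp add: nn_integral_multc)
  qed
  then show ?thesis by (simp add: osc_def nn_integral_cmult)
 qed
 also have "... \<le> (NN a. NN b. NN c. (?F a b c * ennreal \<bar>u b - u a\<bar> + ?F a b c * ennreal \<bar>u c - u b\<bar>))"
 proof (intro nn_integral_mono)
  fix a b c
  have "ennreal \<bar>u c - u a\<bar> \<le> ennreal (\<bar>u b - u a\<bar> + \<bar>u c - u b\<bar>)" by (intro ennreal_leI) linarith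
  from mult_left_mono[OF this, of "?F a b c"]
  show "?F a b c * ennreal \<bar>u c - u a\<bar> \<le> ?F a b c * ennreal \<bar>u b - u a\<bar> + ?F a b c * ennreal \<bar>u c - u b\<bar>" by (simp add: distrib_left)
 qed
 also have "... = (NN a. NN b. NN c. ?F a b c * ennreal \<bar>u b - u a\<bar>) + (NN a. NN b. NN c. ?F a b c * ennreal \<bar>u c - u b\<bar>)" by (simp add: nn_integral_add)
 also have "(NN a. NN b. NN c. ?F a b c * ennreal \<bar>u b - u a\<bar>) = ?A C * osc u A B"
 proof -
  have "(NN c. ?F a b c * ennreal \<bar>u b - u a\<bar>) = ?A C * (?B a * ?C b * ennreal \<bar>u b - u a\<bar>)" for a b
  proof -
   have "(NN c. ?F a b c * ennreal \<bar>u b - u a\<bar>) = (NN c. (?B a * ?C b * ennreal \<bar>u b - u a\<bar>) * indicator C c)" by (simp add: mult_ac)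
   also have "... = (?B a * ?C b * ennreal \<bar>u b - u a\<bar>) * ?A C" by (simp add: nn_integral_cmult)
   finally show ?thesis by (simp only: mult.commute)
  qed
  then show ?thesis by (simp add: osc_def nn_integral_cmult)
 qed
 finally show ?thesis by (simp add: osc_def mult.assoc nn_integral_cmult nn_integral_multc)
qed

lemma ennreal_cancel:
 assumes "0 < a" "0 \<le> b" "ennreal a * X \<le> ennreal b * Y"
 shows "X \<le> ennreal (b / a) * Y"
proof -
 have "ennreal (1 / a) * (ennreal a * X) \<le> ennreal (1 / a) * (ennreal b * Y)" using assms(3) by (rule mult_left_mono) simp
 then show ?thesis using assms(1,2) by (simp add: mult.assoc[symmetric] ennreal_mult[symmetric])
qed

context bisection_setting
begin

text \<open>Levels of neighbors differ by at most one, which allows a factor 2, and each volume is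
  within \<open>shape_const\<close> of 2^-level.\<close>

definition vol_ratio :: real where "vol_ratio = 2 * shape_const^2"
text \<open>Share of an element in the ball around a facet barycenter used in
  \<open>osc_neighbor\<close>: the base of the power is the contraction factor in
  \<open>cap_volume\<close>, and \<open>vol_ratio\<close> compares the two neighbors.\<close>

definition cap_ratio :: real where "cap_ratio = (1 / (4 * DIM('a) * shape_const^2)) ^ DIM('a) / vol_ratio"
definition osc_const :: real where "osc_const = 3 * (vol_ratio^2 / cap_ratio^2) * (4 * 2 ^ DIM('a) * shape_const * vol_ratio)"
definition resid_const :: "real => real" where "resid_const \<gamma> = (real DIM('a) + 1) * (real DIM('a) + 2) * (real DIM('a))^2 * osc_const * vol_ratio^2 * \<gamma>"

lemma ratio_bounds: "1 \<le> vol_ratio" "0 < cap_ratio" "cap_ratio \<le> 1"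
proof -
 have s: "1 \<le> shape_const^2" using shape_const(1) by simp
 then show v: "1 \<le> vol_ratio" by (simp add: vol_ratio_def)
 let ?A = "4 * real DIM('a) * shape_const^2"
 have "1 * 1 \<le> ?A" using s dim by (intro mult_mono) auto
 then have q: "0 < 1 / ?A" "1 / ?A \<le> 1" by auto
 have "(1 / ?A) ^ DIM('a) \<le> 1" using q by (intro power_le_one) auto
 then show "cap_ratio \<le> 1" using v by (simp add: cap_ratio_def)
 show "0 < cap_ratio" unfolding cap_ratio_def using q v by simp
qed

end

context bisection_mesh
begin

abbreviation hs :: "'a tagged => real" where "hs T \<equiv> mesh_size DIM('a) (lev T)"

lemma vol_pos: "T \<in> M ==> 0 < vol T" using simplex_volume_pos[OF M_full] .

lemma neighbor_sizes:
 assumes T: "T \<in> M" "T' \<in> M" and f: "f \<in> fc T" "f \<in> fc T'"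
 shows "vol T' \<le> vol_ratio * vol T" "hs T' \<le> 2 * hs T"
proof -
 have l: "lev T \<le> lev T' + 1" using neighbor_lev[OF T(2,1) f(2,1)] .
 have "vol T' \<le> shape_const * (1 / 2 ^ lev T')" by (rule shape_const(4)[OF lev[OF T(2)]])
 also have "1 / 2 ^ lev T' \<le> 2 * (1 / 2 ^ lev T :: real)" using power_increasing[OF l, of "2::real"] by (simp add: field_simps)
 then have "shape_const * (1 / 2 ^ lev T') \<le> shape_const * (2 * (1 / 2 ^ lev T))" using shape_const(1) by (intro mult_left_mono) auto
 also have "... \<le> shape_const * (2 * (shape_const * vol T))" using shape_const(1) shape_const(3)[OF lev[OF T(1)]] by (intro mult_left_mono) auto
 finally show "vol T' \<le> vol_ratio * vol T" by (simp add: vol_ratio_def power2_eq_square)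
 have "- real (lev T') / real DIM('a) \<le> (1 - real (lev T)) / real DIM('a)" using l by (intro divide_right_mono) auto
 also have "... \<le> 1 + - real (lev T) / real DIM('a)" by (simp add: diff_divide_distrib)
 finally have "hs T' \<le> 2 powr (1 + - real (lev T) / real DIM('a))" by (simp add: mesh_size_def)
 also have "... = 2 * hs T" by (simp only: mesh_size_def powr_add) simp
 finally show "hs T' \<le> 2 * hs T" .
qed

text \<open>Contracting the element towards \<open>z\<close> by \<open>s\<close> keeps it inside by
  convexity, and the diameter bound puts the image into the ball.\<close>

lemma cap_volume:
 assumes T: "T \<in> M" and z: "z \<in> hull_of T" and r: "0 < s" "s \<le> 1" "s * (shape_const * hs T) < r"
 shows "ennreal (s ^ DIM('a) * vol T) \<le> emeasure lborel (ball z r \<inter> ih T)"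
proof -
 let ?D = "hull_of T"
 have [measurable]: "?D \<in> sets borel" using hull_compact[OF T] by (rule borel_compact)
 let ?B = "(z - (1 / s) *\<^sub>R z)"
 let ?A = "(NN y. indicator (ih T) (?B + (1 / s) *\<^sub>R y))"
 let ?C = "emeasure lborel"
 have "?C (ih T) = ennreal (\<bar>1 / s\<bar> ^ DIM('a)) * ?A" using r by (intro emeasure_scaled) auto
 also have "?A \<le> (NN y. indicator (ball z r \<inter> ?D) y)"
 proof (intro nn_integral_mono)
  fix y
  show "indicator (ih T) (?B + (1 / s) *\<^sub>R y) \<le> (indicator (ball z r \<inter> ?D) y :: ennreal)"
  proof (cases "?B + (1 / s) *\<^sub>R y \<in> ih T")
   case True
   define x where "x = ?B + (1 / s) *\<^sub>R y"
   have x: "x \<in> ?D" using True interior_subset unfolding x_def by auto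
   have y: "y = (1 - s) *\<^sub>R z + s *\<^sub>R x" using r by (simp add: x_def algebra_simps)
   have "y \<in> ?D" unfolding y using r x z by (intro convexD) (auto simp: hull_of_def)
   moreover have "dist z y = s * norm (z - x)"
   proof -
    have "z - y = s *\<^sub>R (z - x)" by (simp add: y algebra_simps)
    then show ?thesis using r by (simp add: dist_norm)
   qed
   moreover have "s * norm (z - x) \<le> s * (shape_const * hs T)" using shape_const(2)[OF lev[OF T] z x] r by simp
   ultimately have "dist z y < r" using r(3) by simp
   then show ?thesis using \<open>y \<in> hull_of T\<close> by (simp add: indicator_def)
  qed simp
 qed
 also have "... = ?C (ball z r \<inter> ?D)" by simp
 also have "... = ?C (ball z r \<inter> ih T)"
  by (rule emeasure_eq_AE) (use hull_interior_AE[OF M_full[OF T]] borel_hull[OF M_full[OF T]] in \<open>auto elim!: eventually_mono simp: hull_of_def\<close>)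
 finally have "ennreal (vol T) \<le> ennreal ((1 / s) ^ DIM('a)) * ?C (ball z r \<inter> ih T)" using r by (simp add: ih_volume[OF T] mult_left_mono)
 then have "ennreal (s ^ DIM('a)) * ennreal (vol T) \<le> ennreal (s ^ DIM('a)) * (ennreal ((1 / s) ^ DIM('a)) * ?C (ball z r \<inter> ih T))" by (rule mult_left_mono) simp
 then show ?thesis using r vol_pos[OF T] by (simp add: mult.assoc[symmetric] ennreal_mult[symmetric] power_divide)
qed

text \<open>At the barycenter the coordinates of the vertices of \<open>f\<close> are 1/d, and their
  gradients are at most shape_const / h; within the given radius they remain nonnegative, so
  \<open>opposite_cover\<close> applies.\<close>

lemma mid_ball:
 assumes T: "T \<in> M" "T' \<in> M" "T ~= T'" and f: "f \<in> fc T" "f \<in> fc T'" and r: "r \<le> hs T / (DIM('a) * shape_const)" "r \<le> hs T' / (DIM('a) * shape_const)"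
 shows "ball (mid f) r \<subseteq> hull_of T \<union> hull_of T'"
proof
 fix y assume y: "y \<in> ball (mid f) r"
 note V = M_full[OF T(1)] and W = M_full[OF T(2)]
 obtain p where p: "verts T = insert p f" "p \<notin> f" using vfacet_insert[OF f(1)] .
 obtain q where q: "verts T' = insert q f" "q \<notin> f" using vfacet_insert[OF f(2)] .
 interpret facet_pair f p q by unfold_locales (use V W p q in auto)
 have neg: "bary (insert p f) p q < 0" using same_side_overlap bary_apex_nonzero conforming_disjoint[OF conf T] by (auto simp: hull_of_def p q)
 let ?A = "(DIM('a) * shape_const)"
 have pos: "0 \<le> bary (verts S) v y" if S: "S \<in> M" "f \<in> fc S" "r \<le> hs S / ?A" "v \<in> f" for S v
 proof -
  have vS: "v \<in> verts S" using S(2,4) by (auto simp: vfacets_def)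
  let ?B = "norm (bary_grad (verts S) v)"
  have "\<bar>bary (verts S) v y - bary (verts S) v (mid f)\<bar> \<le> ?B * norm (y - mid f)" by (rule bary_lipschitz)
  also have "norm (y - mid f) \<le> hs S / ?A" using y S(3) by (simp add: dist_norm norm_minus_commute)
  then have "?B * norm (y - mid f) \<le> ?B * (hs S / ?A)" by (intro mult_left_mono) auto
  also have "... = ?B * hs S / ?A" by simp
  also have "... \<le> shape_const / ?A" using shape_const(1) shape_const(5)[OF lev[OF S(1)] vS] by (intro divide_right_mono) auto
  finally show ?thesis using bary_mid[OF M_full[OF S(1)] S(2) vS] S(4) shape_const(1) by simp
 qed
 show "y \<in> hull_of T \<union> hull_of T'" using opposite_cover[OF neg pos[OF T(1) f(1) r(1), unfolded p] pos[OF T(2) f(2) r(2), unfolded q]]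
  by (cases "0 \<le> bary (insert p f) p y") (auto simp: hull_of_def p q)
qed

context
 fixes u :: "'a => real" and g :: "'a => 'a"
 assumes W: "borel_weak \<Omega> u g"
begin

lemma ug_borel: "u \<in> borel_measurable borel" "g \<in> borel_measurable borel" using W by (auto simp: borel_weak_def)

definition grad_mass :: "'a set => ennreal" where "grad_mass A = (NN x. indicator A x * ennreal (norm (g x)))"

lemma osc_self:
 assumes K: "open K" "convex K" "K \<subseteq> \<Omega>" and d: "diameter K \<le> \<delta>" "0 \<le> \<delta>" and m: "emeasure lborel K \<le> ennreal m" "0 \<le> m"
 shows "osc u K K \<le> ennreal (2 ^ DIM('a) * \<delta> * m) * grad_mass K"
proof -
 have "osc u K K \<le> 2 ^ DIM('a) * ennreal (diameter K) * emeasure lborel K * grad_mass K"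
  unfolding osc_def grad_mass_def using K bounded_subset[OF bounded_\<Omega>] by (intro poincare_borel[OF W]) auto
 also have "... \<le> 2 ^ DIM('a) * ennreal \<delta> * ennreal m * grad_mass K" using d m by (intro mult_mono ennreal_leI) auto
 finally show ?thesis using d m by (simp add: ennreal_mult ennreal_power[symmetric])
qed

lemma osc_element:
 assumes T: "T \<in> M"
 shows "osc u (ih T) (ih T) \<le> ennreal (2 ^ DIM('a) * (shape_const * hs T) * vol T) * grad_mass (ih T)"
proof (rule osc_self)
 show "convex (ih T)" by (simp add: hull_of_def)
 have "norm (x - y) \<le> shape_const * hs T" if "x \<in> ih T" "y \<in> ih T" for x y using that interior_subset by (intro shape_const(2)[OF lev[OF T]]) blast+
 then show "diameter (ih T) \<le> shape_const * hs T" using shape_const(1) by (intro diameter_le) (auto simp: less_imp_le)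
qed (use T ih_sub ih_volume vol_pos shape_const(1) in \<open>auto simp: less_imp_le\<close>)

text \<open>The union of two neighbors need not be convex. The ball \<open>B\<close> around the
  facet barycenter is convex and meets them in caps \<open>A\<close> and \<open>A'\<close> of
  comparable volume; two applications of \<open>osc_triangle\<close> connect \<open>T\<close> to
  \<open>A'\<close> and then to \<open>T'\<close>.\<close>

lemma osc_neighbor:
 assumes T: "T \<in> M" "T' \<in> M" and f: "f \<in> fc T" "f \<in> fc T'"
 shows "osc u (ih T) (ih T') \<le> ennreal (osc_const * hs T * vol T) * (grad_mass (ih T) + grad_mass (ih T'))"
proof -
 note [measurable] = ug_borel
 define h where "h = hs T"
 define m where "m = vol T"
 define G where "G = grad_mass (ih T) + grad_mass (ih T')"
 \<comment> \<open>Serves three convex sets at once; the ball needs the most, with diameter at most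
   2h and volume at most 2 * vol_ratio * m.\<close>
 define e where "e = 4 * 2 ^ DIM('a) * shape_const * vol_ratio * h * m"
 have h0: "0 < h" "0 < m" using vol_pos[OF T(1)] by (auto simp: h_def m_def)
 note C1 = shape_const(1)
 note R = ratio_bounds
 let ?G = "vol_ratio * m"
 have n: "vol T' \<le> ?G" "hs T' \<le> 2 * h" "m \<le> vol_ratio * vol T'" "h \<le> 2 * hs T'"
  using neighbor_sizes[OF T f] neighbor_sizes[OF T(2,1) f(2,1)] by (auto simp: m_def h_def)
 have e0: "0 \<le> e" using h0 C1 R by (simp add: e_def)
 have v1: "x \<le> vol_ratio * x" if "0 \<le> x" for x using mult_right_mono[OF R(1) that] by simp
 let ?I = "ennreal e"
 define E where "E = ?I * G"
 have le_E: "osc u K K \<le> E" if "osc u K K \<le> ennreal x * grad_mass K" "x \<le> e" "grad_mass K \<le> G" for K x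
  using that(1) mult_mono[OF ennreal_leI[OF that(2)] that(3)] unfolding E_def by simp
 have G: "grad_mass (ih T) \<le> G" "grad_mass (ih T') \<le> G" by (auto simp: G_def)
 have D: "0 \<le> (2::real) ^ DIM('a) * shape_const * h * m" using h0 C1 by simp
 then have D': "2 ^ DIM('a) * shape_const * h * m \<le> vol_ratio * (2 ^ DIM('a) * shape_const * h * m)" by (rule v1)
 let ?H = "(vol_ratio * (2 ^ DIM('a) * shape_const * h * m))"
 have e4: "4 * ?H = e" by (simp add: e_def)
 let ?B = "osc u (ih T)"
 have ET: "?B (ih T) \<le> E"
 proof (rule le_E[OF osc_element[OF T(1)] _ G(1)])
  show "2 ^ DIM('a) * (shape_const * hs T) * vol T \<le> e" unfolding h_def[symmetric] m_def[symmetric] using D D' e4 by argo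
 qed
 let ?K = "(shape_const * hs T')"
 have ET': "osc u (ih T') (ih T') \<le> E"
 proof (rule le_E[OF osc_element[OF T(2)] _ G(2)])
  have "2 ^ DIM('a) * ?K * vol T' \<le> 2 ^ DIM('a) * (shape_const * (2 * h)) * ?G" using n C1 vol_pos[OF T(2)] by (intro mult_mono mult_nonneg_nonneg) auto
  also have "... = 2 * ?H" by simp
  finally show "2 ^ DIM('a) * ?K * vol T' \<le> e" using D D' e4 by argo
 qed
 define q where "q = vol_ratio / cap_ratio"
 have q1: "1 \<le> q" using R by (simp add: q_def)
 let ?C = "ennreal q"
 let ?J = "?C * (E + E + E)"
 have "?B (ih T') \<le> ?C * ?J"
 \<comment> \<open>Equality occurs when the mean at a face is taken over \<open>T\<close>
   itself.\<close>
 proof (cases "T = T'")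
  case True
  have "1 * (1 * (E + 0 + 0)) \<le> ?C * ?J" using q1 by (intro mult_mono add_mono) auto
  then show ?thesis using ET True by simp
 next
  case False
  define r where "r = min h (hs T') / (DIM('a) * shape_const)"
  define B where "B = ball (mid f) r"
  define A where "A = B \<inter> ih T"
  define A' where "A' = B \<inter> ih T'"
  let ?L = "4 * real DIM('a) * shape_const^2"
  \<comment> \<open>Makes s * shape_const * h a quarter of h / (d * shape_const), which is below the
    radius \<open>r\<close> although the size of the neighbor may be half as large.\<close>
  define s where "s = 1 / ?L"
  have dC: "1 \<le> real DIM('a) * shape_const" "1 \<le> ?L" using mult_mono[of 1 "real DIM('a)" 1 shape_const] mult_mono[of 1 "4 * real DIM('a)" 1 "shape_const^2"] C1 dim by auto
  have s: "0 < s" "s \<le> 1" using dC(2) by (auto simp: s_def)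
  have sC: "s * (shape_const * x) = x / 4 / (DIM('a) * shape_const)" for x by (simp add: s_def power2_eq_square)
  have r: "0 < r" "r \<le> h" using dC h0 by (auto simp: r_def divide_le_eq min_le_iff_disj)
  have small: "s * (shape_const * hs T) < r" "s * ?K < r"
   unfolding sC r_def using n dC(1) mesh_size_pos[of "DIM('a)" "lev T'"] by (intro divide_strict_right_mono; simp add: h_def[symmetric] min_less_iff_conj; linarith)+
  have sub: "B \<subseteq> hull_of T \<union> hull_of T'"
   unfolding B_def by (rule mid_ball[OF T False f]) (use dC in \<open>auto simp: r_def h_def intro!: divide_right_mono\<close>)
  then have "B \<subseteq> interior (closure \<Omega>)" using T cover unfolding B_def by (intro interior_maximal) auto
  then have B\<Omega>: "B \<subseteq> \<Omega>" by (simp only: polyhedral_interior_closure[OF poly])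
  have mids: "mid f \<in> hull_of T" "mid f \<in> hull_of T'" using mid_in_hull[OF M_full[OF T(1)] f(1)] mid_in_hull[OF M_full[OF T(2)] f(2)] by (auto simp: hull_of_def)
  have cr: "cap_ratio * vol_ratio = s ^ DIM('a)" using R by (simp add: cap_ratio_def s_def)
  let ?D = "cap_ratio * m"
  have "?D \<le> s ^ DIM('a) * m" unfolding cr[symmetric] using R h0 by simp
  then have vA: "ennreal ?D \<le> emeasure lborel A" using cap_volume[OF T(1) mids(1) s small(1)] unfolding A_def B_def m_def by (meson ennreal_leI order_trans)
  have "?D \<le> s ^ DIM('a) * vol T'" unfolding cr[symmetric] using n R by simp
  then have vA': "ennreal ?D \<le> emeasure lborel A'" using cap_volume[OF T(2) mids(2) s small(2)] unfolding A'_def B_def by (meson ennreal_leI order_trans)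
  let ?A = "ennreal ?G"
  let ?E = "emeasure lborel (ih T')"
  let ?F = "emeasure lborel (ih T)"
  have mT: "?F \<le> ?A" "?E \<le> ?A" using ih_volume[OF T(1)] ih_volume[OF T(2)] n v1[of m] h0 by (auto simp: m_def)
  have "emeasure lborel A' \<le> ?E" by (rule emeasure_mono) (auto simp: A'_def)
  then have mA': "emeasure lborel A' \<le> ?A" using mT(2) by simp
  have AE_B: "AE x in lborel. x \<in> B --> x \<in> ih T \<or> x \<in> ih T'" using hull_interior_AE[OF M_full[OF T(1)]] hull_interior_AE[OF M_full[OF T(2)]]
   by eventually_elim (use sub in \<open>auto simp: hull_of_def\<close>)
  have EB: "osc u B B \<le> E"
  proof (rule le_E[OF osc_self])
   show "open B" "convex B" by (auto simp: B_def)
   show "diameter B \<le> 2 * h" using r by (simp add: B_def)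
   have "emeasure lborel B \<le> emeasure lborel (ih T \<union> ih T')" by (rule emeasure_mono_AE) (use AE_B in \<open>auto\<close>)
   also have "... \<le> ?F + ?E" by (rule emeasure_subadditive) auto
   also have "... \<le> ?A + ?A" using mT by (rule add_mono)
   also have "... = ennreal (2 * ?G)" using R h0 by (simp add: ennreal_plus[symmetric])
   finally show "emeasure lborel B \<le> ennreal (2 * ?G)" .
   show "2 ^ DIM('a) * (2 * h) * (2 * ?G) \<le> e" using C1 R h0 by (simp add: e_def)
   have "grad_mass B \<le> (NN x. (indicator (ih T) x * ennreal (norm (g x)) + indicator (ih T') x * ennreal (norm (g x))))" unfolding grad_mass_def
    by (rule nn_integral_mono_AE) (use AE_B in \<open>auto elim!: eventually_mono simp: indicator_def\<close>)
   also have "... = G" unfolding G_def grad_mass_def by (rule nn_integral_add) auto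
   finally show "grad_mass B \<le> G" .
  qed (use h0 R B\<Omega> in auto)
  have [measurable]: "A \<in> sets borel" "A' \<in> sets borel" by (auto simp: A_def A'_def B_def)
  have sub: "A \<subseteq> ih T" "A' \<subseteq> ih T'" "A \<subseteq> B" "A' \<subseteq> B" by (auto simp: A_def A'_def)
  have canc: "X \<le> ?C * Y" if "ennreal ?D * X \<le> ?A * Y" for X Y using ennreal_cancel[OF _ _ that] R h0 by (simp add: q_def)
  \<comment> \<open>Passing from \<open>T\<close> through \<open>A\<close> to \<open>A'\<close>, the
    facet is crossed inside the ball.\<close>
  have "ennreal ?D * ?B A' \<le> emeasure lborel A * ?B A'" using vA by (rule mult_right_mono) simp
  also have "... \<le> emeasure lborel A' * ?B A + ?F * osc u A A'" by (rule osc_triangle) auto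
  also have "... \<le> ?A * E + ?A * E" using order_trans[OF osc_mono[OF order_refl sub(1)] ET] order_trans[OF osc_mono[OF sub(3,4)] EB] by (intro add_mono mult_mono mA' mT) auto
  finally have "?B A' \<le> ?C * (E + E)" by (intro canc) (simp add: distrib_left)
  moreover have "1 * E \<le> ?C * E" using q1 by (intro mult_right_mono) auto
  ultimately have X: "?B A' + E \<le> ?J" unfolding distrib_left by (intro add_mono) auto
  have "ennreal ?D * ?B (ih T') \<le> emeasure lborel A' * ?B (ih T')" using vA' by (rule mult_right_mono) simp
  also have "... \<le> ?E * ?B A' + ?F * osc u A' (ih T')" by (rule osc_triangle) auto
  also have "... \<le> ?A * ?B A' + ?A * E" using order_trans[OF osc_mono[OF sub(2) order_refl] ET'] by (intro add_mono mult_mono mT) auto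
  finally have "?B (ih T') \<le> ?C * (?B A' + E)" by (intro canc) (simp add: distrib_left)
  also have "... \<le> ?C * ?J" using X by (rule mult_left_mono) simp
  finally show ?thesis .
 qed
 also have "E + E + E = ennreal (3 * e) * G"
 proof -
  have "E + E + E = (?I + ?I + ?I) * G" by (simp only: E_def distrib_right)
  also have "?I + ?I + ?I = ennreal (3 * e)" using e0 by (simp flip: ennreal_plus)
  finally show ?thesis .
 qed
 also have "?C * (?C * (ennreal (3 * e) * G)) = ennreal (q * q * (3 * e)) * G" using q1 e0 by (simp add: ennreal_mult mult.assoc)
 also have "q * q * (3 * e) = osc_const * hs T * vol T" by (simp add: q_def e_def osc_const_def h_def m_def power2_eq_square)
 finally show ?thesis unfolding G_def .
qed

end

end

section \<open>The local residuals\<close>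

text \<open>The tangent line of t^p at the power mean \<open>s\<close> is integrated; this choice of
  the point of contact gives the constant 1 for every \<open>p\<close>.\<close>

lemma power_mean:
 fixes k :: "'a::euclidean_space => real"
 assumes [measurable]: "k \<in> borel_measurable borel" "K \<in> sets borel" and k: "!!x. 0 \<le> k x" and m: "emeasure lborel K = ennreal m" "0 < m" and p: "1 \<le> p"
  and N: "(NN x. indicator K x * ennreal (k x powr p)) = ennreal N" "0 \<le> N"
 shows "(NN x. indicator K x * ennreal (k x)) \<le> ennreal (m * (N / m) powr (1 / p))"
proof (cases "N = 0")
 case True
 then have "AE x in lborel. indicator K x * ennreal (k x powr p) = 0" using N by (subst nn_integral_0_iff_AE[symmetric]) auto
 then have "AE x in lborel. indicator K x * ennreal (k x) = 0" by auto
 then have "(NN x. indicator K x * ennreal (k x)) = 0" by (simp add: nn_integral_0_iff_AE)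
 then show ?thesis by simp
next
 case False
 define s where "s = (N / m) powr (1 / p)"
 have Nm: "0 < N / m" using False N m by simp
 have s: "0 < s" using False m by (simp add: s_def)
 have sp: "s powr p = N / m" using m p N(2) by (simp add: s_def powr_powr)
 let ?D = "(1 - 1 / p)"
 let ?A = "s * ?D"
 let ?B = "s / p / s powr p"
 have tangent: "k x \<le> ?B * k x powr p + ?A" for x
 proof (cases "k x = 0")
  case True
  then show ?thesis using s p by simp
 next
  case False
  then have "((k x / s) powr p) powr (1 / p) * 1 powr ?D \<le> 1 / p * (k x / s) powr p + ?D * 1" using s using p by (intro Youngs_inequality_0) auto
  then have "k x / s \<le> 1 / p * (k x / s) powr p + ?D" using p k[of x] s by (simp add: powr_powr)
  then have "s * (k x / s) \<le> s * (1 / p * (k x / s) powr p + ?D)" using s by (intro mult_left_mono) auto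
  then show ?thesis using s by (simp add: powr_divide distrib_left)
 qed
 have c: "0 \<le> ?B" "0 \<le> ?A" using s p by auto
 have split: "ennreal (a * b + e) = ennreal a * ennreal b + ennreal e" if "0 \<le> a" "0 \<le> b" "0 \<le> e" for a b e using that by (simp add: ennreal_mult)
 let ?C = "ennreal ?A"
 let ?E = "ennreal ?B"
 have "(NN x. indicator K x * ennreal (k x)) \<le> (NN x. ?E * (indicator K x * ennreal (k x powr p)) + ?C * indicator K x)"
 proof (rule nn_integral_mono)
  fix x
  have "ennreal (k x) \<le> ?E * ennreal (k x powr p) + ?C" using ennreal_leI[OF tangent[of x]] unfolding split[OF c(1) powr_ge_zero c(2)] .
  then show "indicator K x * ennreal (k x) \<le> ?E * (indicator K x * ennreal (k x powr p)) + ?C * indicator K x" by (simp add: indicator_def)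
 qed
 also have "... = ?E * ennreal N + ?C * ennreal m" by (simp add: nn_integral_add nn_integral_cmult N m)
 also have "... = ennreal (?B * N + ?A * m)"
 proof -
  have "ennreal (?A * m) = ?C * ennreal m" using c m by (intro ennreal_mult) auto
  then show ?thesis using split[OF c(1) N(2) mult_nonneg_nonneg[OF c(2) less_imp_le[OF m(2)]]] by simp
 qed
 also have "?B * N + ?A * m = m * s" unfolding sp using Nm m by (simp add: field_simps)
 finally show ?thesis by (simp add: s_def)
qed

text \<open>A sum is at most its length times its largest term. The factor is a p-th power, so its
  p-th root is independent of \<open>p\<close>.\<close>

lemma sum_powr_le:
 fixes x :: "'i => real"
 assumes S: "finite S" and x: "!!i. i \<in> S ==> 0 \<le> x i" and p: "0 < p"
 shows "(\<Sum>i\<in>S. x i) powr p \<le> real (card S) powr p * (\<Sum>i\<in>S. x i powr p)"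
proof (cases "S = {}")
 case False
 obtain j where j: "j \<in> S" "!!i. i \<in> S ==> x i \<le> x j" using obtains_MAX[OF S False, of x] S by (metis Max_ge finite_imageI imageI)
 have "(\<Sum>i\<in>S. x i) powr p \<le> (real (card S) * x j) powr p" using sum_bounded_above[of S x "x j"] j using x p by (intro powr_mono2) (auto intro: sum_nonneg)
 also have "... \<le> real (card S) powr p * (\<Sum>i\<in>S. x i powr p)" using S j(1) by (auto simp: powr_mult intro!: mult_left_mono member_le_sum)
 finally show ?thesis .
qed simp

lemma add_powr_le: "0 \<le> x ==> 0 \<le> y ==> 0 < p ==> (x + y) powr p \<le> 2 powr p * (x powr p + y powr p)" for x y p :: real
 using sum_powr_le[of "UNIV :: bool set" "%b. if b then x else y" p] by (simp add: UNIV_bool add.commute)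

definition (in bisection_setting) resid_sum_const :: "real => real" where
 "resid_sum_const \<gamma> = 1 + resid_const \<gamma> * (2 * (real DIM('a) + 1)) * ((real DIM('a) + 1) * (1 + 2 * vol_ratio))"

context bisection_mesh
begin

lemma card_face_elements: "card {T \<in> M. f \<in> fc T} \<le> 2"
proof (rule ccontr)
 assume "\<not> card {T \<in> M. f \<in> fc T} \<le> 2"
 then have "3 \<le> card {T \<in> M. f \<in> fc T}" by simp
 then obtain S where S: "S \<subseteq> {T \<in> M. f \<in> fc T}" "card S = 3" by (rule obtain_subset_with_card_n)
 then obtain A B C where ABC: "S = {A, B, C}" "A ~= B" "B ~= C" "A ~= C" by (auto simp: card_3_iff)
 have m: "A \<in> M" "B \<in> M" "C \<in> M" "f \<in> fc A" "f \<in> fc B" "f \<in> fc C" using S(1) ABC(1) by auto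
 obtain p where p: "verts A = insert p f" "p \<notin> f" using vfacet_insert[OF m(4)] .
 obtain q where q: "verts B = insert q f" "q \<notin> f" using vfacet_insert[OF m(5)] .
 obtain r where r: "verts C = insert r f" "r \<notin> f" using vfacet_insert[OF m(6)] .
 show False using conforming_disjoint[OF conf] m(1-3) ABC(2-4) three_simplices_overlap[of p f q r] M_full[OF m(1)] M_full[OF m(2)] M_full[OF m(3)] by (metis hull_of_def p q r)
qed

context
 fixes u :: "'a => real" and g :: "'a => 'a"
 assumes W: "borel_weak \<Omega> u g" and iu: "integrable lborel (%x. indicator \<Omega> x * u x)"
begin

lemma integrable_shift: "T \<in> M ==> integrable lborel (%x. indicator (hull_of T) x * (u x - z))"
 using hull_integrable[OF iu _ ug_borel(1)[OF W]] simplex_integrable_cont[OF M_full, of T "%_. z"] by (simp add: right_diff_distrib hull_of_def)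

lemma SI_shift: "T \<in> M ==> SI T (%x. u x - z) = SI T u - z * vol T"
 using SI_diff[OF hull_integrable[OF iu _ ug_borel(1)[OF W]], of T "%_. z"] simplex_integrable_cont[OF M_full, of T "%_. z"] simplex_integral_const[OF M_full, of T z] by (simp add: hull_of_def SI_def)

lemma hull_nn_integral:
 fixes k :: "'a => real"
 assumes T: "T \<in> M" and k: "integrable lborel (%x. indicator (hull_of T) x * k x)" "!!x. 0 \<le> k x"
 shows "ennreal (SI T k) = (NN x. indicator (ih T) x * ennreal (k x))"
proof -
 have "ennreal (SI T k) = (NN x. ennreal (indicator (hull_of T) x * k x))"
  unfolding SI_def simplex_integral_def hull_of_def[symmetric] using k by (intro nn_integral_eq_integral[symmetric]) auto
 also have "... = (NN x. indicator (ih T) x * ennreal (k x))"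
  by (rule nn_integral_cong_AE) (use hull_interior_AE[OF M_full[OF T]] in \<open>auto elim!: eventually_mono simp: hull_of_def\<close>)
 finally show ?thesis .
qed

text \<open>The distance of u x to the mean over \<open>T'\<close> is at most the mean of its
  distances to u z, so the left side is bounded by \<open>osc\<close> divided by the volume of
  \<open>T'\<close>.\<close>

lemma mean_oscillation:
 assumes T: "T \<in> M" "T' \<in> M" and f: "f \<in> fc T" "f \<in> fc T'"
 shows "ennreal (SI T (%x. \<bar>u x - SI T' u / vol T'\<bar>)) \<le>
  ennreal (osc_const * vol_ratio * hs T) * (grad_mass g (ih T) + grad_mass g (ih T'))"
proof -
 note [measurable] = ug_borel[OF W]
 have [measurable]: "ih S \<in> sets borel" for S by simp
 define y where "y = SI T' u / vol T'"
 have v: "0 < vol T'" "0 < vol T" using vol_pos T by auto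
 let ?C = "1 / vol T'"
 let ?A = "ennreal ?C"
 let ?B = "indicator (ih T')"
 have pt: "ennreal \<bar>u x - y\<bar> \<le> ?A * (NN z. ?B z * ennreal \<bar>u z - u x\<bar>)" for x
 proof -
  have "\<bar>u x - y\<bar> = ?C * \<bar>SI T' (%z. u z - u x)\<bar>" using v by (simp add: y_def field_simps SI_shift[OF T(2)])
  also have "... \<le> ?C * SI T' (%z. \<bar>u z - u x\<bar>)"
   unfolding SI_def simplex_integral_def using v integral_abs_bound[of lborel "%z. indicator (convex hull verts T') z * (u z - u x)"]
   by (intro mult_left_mono) (simp_all add: abs_mult)
  finally have "ennreal \<bar>u x - y\<bar> \<le> ?A * ennreal (SI T' (%z. \<bar>u z - u x\<bar>))" using v by (simp add: ennreal_mult'[symmetric])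
  also have "ennreal (SI T' (%z. \<bar>u z - u x\<bar>)) = (NN z. ?B z * ennreal \<bar>u z - u x\<bar>)"
   using integrable_abs[OF integrable_shift[OF T(2), of "u x"]] by (intro hull_nn_integral[OF T(2)]) (auto simp: abs_mult)
  finally show ?thesis .
 qed
 have "ennreal (SI T (%x. \<bar>u x - y\<bar>)) = (NN x. indicator (ih T) x * ennreal \<bar>u x - y\<bar>)"
  using integrable_abs[OF integrable_shift[OF T(1), of y]] by (intro hull_nn_integral[OF T(1)]) (auto simp: abs_mult)
 also have "... \<le> (NN x. indicator (ih T) x * (?A * (NN z. ?B z * ennreal \<bar>u z - u x\<bar>)))" using pt by (intro nn_integral_mono mult_left_mono) auto
 also have "... = (NN x. ?A * (NN z. indicator (ih T) x * ?B z * ennreal \<bar>u z - u x\<bar>))" by (simp add: mult.assoc nn_integral_cmult mult.left_commute)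
 also have "... = ?A * osc u (ih T) (ih T')" unfolding osc_def by (rule nn_integral_cmult) measurable
 also have "... \<le> ?A * (ennreal (osc_const * hs T * vol T) * (grad_mass g (ih T) + grad_mass g (ih T')))" by (intro mult_left_mono osc_neighbor[OF W T f]) auto
 also have "... = ennreal (?C * (osc_const * hs T * vol T)) * (grad_mass g (ih T) + grad_mass g (ih T'))" using v by (subst ennreal_mult'[of "?C"]) (auto simp: mult.assoc)
 also have "?C * (osc_const * hs T * vol T) \<le> osc_const * vol_ratio * hs T"
 using ratio_bounds shape_const(1) neighbor_sizes(1)[OF T(2,1) f(2,1)] v by (simp add: osc_const_def divide_le_eq)
 finally show ?thesis unfolding y_def by (meson ennreal_leI mult_right_mono order_trans zero_le)
qed

text \<open>A face may belong to two elements; the mean in \<open>avg\<close> is taken over an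
  arbitrary one of them.\<close>

definition rep :: "'a set => 'a tagged" where "rep f = (SOME T. T \<in> M \<and> f \<in> fc T)"

definition avg :: "'a set => real" where "avg f = SI (rep f) u / vol (rep f)"

lemma rep: "T \<in> M ==> f \<in> fc T ==> rep f \<in> M \<and> f \<in> fc (rep f)" unfolding rep_def by (rule someI_ex) blast

text \<open>The bound in \<open>projection_system\<close> for the face values
  \<open>avg\<close>.\<close>

definition resid :: "'a tagged => real" where
 "resid T = (real DIM('a) + 1) * (real DIM('a) + 2) * (real DIM('a))^2 / vol T * (\<Sum>f\<in>fc T. SI T (%x. \<bar>u x - avg f\<bar>))"

lemma SI_abs_nonneg: "0 \<le> SI T (%x. \<bar>k x\<bar>)" by (simp add: SI_def simplex_integral_def)

lemma resid_nonneg: "T \<in> M ==> 0 \<le> resid T"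
 unfolding resid_def using vol_pos by (intro mult_nonneg_nonneg sum_nonneg SI_abs_nonneg divide_nonneg_nonneg) (auto simp: less_imp_le)

context
 fixes \<rho> :: "'a tagged => real" and \<gamma> p :: real and N :: "'a tagged => real"
 assumes \<rho>: "!!T. T \<in> M ==> 0 < \<rho> T" and graded: "!!T T'. dm.nbr T T' ==> \<rho> T \<le> \<gamma> * \<rho> T'" and \<gamma>: "1 \<le> \<gamma>" and p: "1 \<le> p"
  and N: "!!T. T \<in> M ==> (NN x. indicator (ih T) x * ennreal (norm (g x) powr p)) = ennreal (N T)" "!!T. T \<in> M ==> 0 \<le> N T"
begin

definition pm :: "'a tagged => real" where "pm T = (N T / vol T) powr (1 / p)"

lemma pm_powr: "T \<in> M ==> vol T * (\<rho> T * pm T) powr p = \<rho> T powr p * N T" using N(2)[of T] vol_pos[of T] p by (simp add: pm_def powr_mult powr_powr)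

lemma grad_mass_pm: "T \<in> M ==> grad_mass g (ih T) \<le> ennreal (vol T * pm T)" unfolding grad_mass_def[OF W] pm_def
 by (rule power_mean) (use ug_borel[OF W] ih_volume vol_pos p N in auto)

text \<open>The oscillation gains one mesh size, which cancels against 2^(lev/d); the volume in the
  denominator cancels against that in \<open>grad_mass_pm\<close>.\<close>

lemma resid_bound:
 assumes T: "T \<in> M"
 shows "\<rho> T * 2 powr (lev T / DIM('a)) * resid T \<le> resid_const \<gamma> * (\<Sum>f\<in>fc T. \<rho> T * pm T + \<rho> (rep f) * pm (rep f))"
proof -
 define k where "k = (real DIM('a) + 1) * (real DIM('a) + 2) * (real DIM('a))^2"
 have v: "0 < vol T" using vol_pos[OF T] .
 have o: "0 \<le> osc_const" unfolding osc_const_def using ratio_bounds shape_const(1) by simp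
 let ?A = "2 powr (lev T / DIM('a))"
 have hs: "?A * hs T = 1" by (simp add: mesh_size_def powr_add[symmetric])
 have pm0: "0 \<le> pm S" for S by (simp add: pm_def)
 let ?B = "\<rho> T"
 have one: "?B * SI T (%x. \<bar>u x - avg f\<bar>) \<le> osc_const * vol_ratio^2 * hs T * vol T * \<gamma> * (?B * pm T + \<rho> (rep f) * pm (rep f))"
  if f: "f \<in> fc T" for f
 proof -
  define S where "S = rep f"
  have S: "S \<in> M" "f \<in> fc S" using rep[OF T f] by (auto simp: S_def)
  let ?C = "osc_const * vol_ratio * hs T"
  have "ennreal (SI T (%x. \<bar>u x - avg f\<bar>)) \<le> ennreal ?C * (ennreal (vol T * pm T) + ennreal (vol S * pm S))"
   using mean_oscillation[OF T S(1) f S(2)] mult_left_mono[OF add_mono[OF grad_mass_pm[OF T] grad_mass_pm[OF S(1)]]]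
   unfolding avg_def S_def[symmetric] by (meson order_trans zero_le)
  also have "... = ennreal (?C * (vol T * pm T + vol S * pm S))"
   using o ratio_bounds v vol_pos[OF S(1)] pm0 by (simp add: ennreal_mult[symmetric] ennreal_plus[symmetric] less_imp_le del: ennreal_plus)
  finally have "SI T (%x. \<bar>u x - avg f\<bar>) \<le> ?C * (vol T * pm T + vol S * pm S)" using o ratio_bounds v vol_pos[OF S(1)] pm0 by (simp add: less_imp_le)
  also have "... \<le> ?C * (vol_ratio * vol T * pm T + vol_ratio * vol T * pm S)"
  using v pm0[of T] neighbor_sizes(1)[OF T S(1) f S(2)] pm0[of S] o ratio_bounds by (auto simp: less_imp_le intro!: mult_right_mono mult_left_mono add_mono)
  also have "... = osc_const * vol_ratio^2 * hs T * vol T * (pm T + pm S)" by (simp add: power2_eq_square algebra_simps)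
  finally have "?B * SI T (%x. \<bar>u x - avg f\<bar>) \<le> ?B * (osc_const * vol_ratio^2 * hs T * vol T * (pm T + pm S))" using \<rho>[OF T] by simp
  also have "... = osc_const * vol_ratio^2 * hs T * vol T * (?B * pm T + ?B * pm S)" by argo
  also have "... \<le> osc_const * vol_ratio^2 * hs T * vol T * (\<gamma> * ?B * pm T + \<gamma> * \<rho> S * pm S)"
  proof -
   have "?B \<le> \<gamma> * \<rho> S"
   proof (cases "T = S")
    case False
    then have "dm.nbr T S" using T S f by (auto simp: dm.nbr_def)
    then show ?thesis by (rule graded)
   qed (use \<gamma> \<rho>[OF S(1)] in simp)
   then have "?B * pm S \<le> \<gamma> * \<rho> S * pm S" using pm0 by (intro mult_right_mono)
   moreover have "?B * pm T \<le> \<gamma> * ?B * pm T" using \<gamma> \<rho>[OF T] pm0 by (intro mult_right_mono) auto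
   ultimately show ?thesis using o v by (intro mult_left_mono add_mono) (auto simp: less_imp_le)
  qed
  finally show ?thesis by (simp add: S_def algebra_simps)
 qed
 have "?B * ?A * resid T = k / vol T * ?A * (\<Sum>f\<in>fc T. ?B * SI T (%x. \<bar>u x - avg f\<bar>))"
  unfolding resid_def k_def[symmetric] sum_distrib_left by (simp add: mult_ac)
 also have "... \<le> k / vol T * ?A * (\<Sum>f\<in>fc T. osc_const * vol_ratio^2 * hs T * vol T * \<gamma> * (?B * pm T + \<rho> (rep f) * pm (rep f)))"
  using v one by (intro mult_left_mono sum_mono) (auto simp: k_def)
 also have "... = resid_const \<gamma> * (?A * hs T) * (\<Sum>f\<in>fc T. ?B * pm T + \<rho> (rep f) * pm (rep f))"
  using v unfolding sum_distrib_left[symmetric] resid_const_def k_def by simp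
 finally show ?thesis by (simp add: hs)
qed

lemma sum_elements_faces: "(\<Sum>T\<in>M. \<Sum>f\<in>fc T. k T f) = (\<Sum>f\<in>dm.Fa. \<Sum>T | T \<in> M \<and> f \<in> fc T. k T f)" for k :: "'a tagged => 'a set => real"
 by (simp add: sum_El_faces sum_Fa sum.swap)

text \<open>An element represents at most its d + 1 faces, and each face belongs to at most two
  elements.\<close>

lemma rep_sum:
 assumes y: "!!T. T \<in> M ==> 0 \<le> y T"
 shows "(\<Sum>T\<in>M. \<Sum>f\<in>fc T. y (rep f)) \<le> 2 * (real DIM('a) + 1) * (\<Sum>T\<in>M. y T)"
proof -
 have "(\<Sum>T\<in>M. \<Sum>f\<in>fc T. y (rep f)) \<le> (\<Sum>f\<in>dm.Fa. 2 * (\<Sum>T | T \<in> M \<and> f \<in> fc T. y T))" unfolding sum_elements_faces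
 proof (rule sum_mono)
  fix f assume "f \<in> dm.Fa"
  then have r: "rep f \<in> M" "f \<in> fc (rep f)" using rep by auto
  let ?A = "(\<Sum>T | T \<in> M \<and> f \<in> fc T. y (rep f))"
  have "?A \<le> 2 * y (rep f)" using card_face_elements[of f] y[OF r(1)] by (simp add: mult_right_mono)
  also have "y (rep f) \<le> (\<Sum>T | T \<in> M \<and> f \<in> fc T. y T)" using finite_M r y by (intro member_le_sum) auto
  finally show "?A \<le> 2 * (\<Sum>T | T \<in> M \<and> f \<in> fc T. y T)" by simp
 qed
 also have "... = 2 * (\<Sum>T\<in>M. \<Sum>f\<in>fc T. y T)" unfolding sum_distrib_left[symmetric] sum_elements_faces ..
 finally show ?thesis using card_vfacets(2)[OF M_full] by (simp add: sum_distrib_left sum_distrib_right sum.distrib algebra_simps)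
qed

lemma resid_sum: "(\<Sum>T\<in>M. vol T * (\<rho> T * 2 powr (lev T / DIM('a)) * resid T) powr p) \<le> resid_sum_const \<gamma> powr p * (\<Sum>T\<in>M. \<rho> T powr p * N T)"
proof -
 define D where "D = real DIM('a) + 1"
 define R where "R = resid_const \<gamma>"
 define y where "y T = vol T * (\<rho> T * pm T) powr p" for T
 have D: "1 \<le> D" by (simp add: D_def)
 have vr: "1 \<le> vol_ratio" by (rule ratio_bounds)
 have R0: "0 \<le> R" unfolding R_def resid_const_def osc_const_def using ratio_bounds shape_const(1) \<gamma> by simp
 have x0: "0 \<le> \<rho> T * pm T" if "T \<in> M" for T using \<rho>[OF that] by (simp add: pm_def)
 have y0: "0 \<le> y T" if "T \<in> M" for T using vol_pos[OF that] by (simp add: y_def)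
 let ?A = "(R * (2 * D)) powr p"
 have "vol T * (\<rho> T * 2 powr (lev T / DIM('a)) * resid T) powr p \<le> ?A * (\<Sum>f\<in>fc T. y T + vol_ratio * y (rep f))" if T: "T \<in> M" for T
 proof -
  have c: "card (fc T) = DIM('a) + 1" "finite (fc T)" using card_vfacets[OF M_full[OF T]] by auto
  have x: "0 \<le> \<rho> T * pm T + \<rho> (rep f) * pm (rep f)" if "f \<in> fc T" for f using x0[OF T] x0[of "rep f"] rep[OF T that] by auto
  let ?B = "(\<Sum>f\<in>fc T. \<rho> T * pm T + \<rho> (rep f) * pm (rep f))"
  have "(\<rho> T * 2 powr (lev T / DIM('a)) * resid T) powr p \<le> (R * ?B) powr p"
   using resid_bound[OF T] resid_nonneg[OF T] \<rho>[OF T] p by (intro powr_mono2) (auto simp: R_def)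
  also have "... = R powr p * ?B powr p" by (intro powr_mult sum_nonneg)
  also have "... \<le> R powr p * (D powr p * (\<Sum>f\<in>fc T. (\<rho> T * pm T + \<rho> (rep f) * pm (rep f)) powr p))"
   using sum_powr_le[of "fc T" "%f. \<rho> T * pm T + \<rho> (rep f) * pm (rep f)" p] c x p by (intro mult_left_mono) (auto simp: D_def add_ac)
  also have "... \<le> R powr p * (D powr p * (\<Sum>f\<in>fc T. 2 powr p * ((\<rho> T * pm T) powr p + (\<rho> (rep f) * pm (rep f)) powr p)))"
   using x0[OF T] x0 rep[OF T] p by (intro mult_left_mono sum_mono add_powr_le) auto
  also have "... = ?A * (\<Sum>f\<in>fc T. (\<rho> T * pm T) powr p + (\<rho> (rep f) * pm (rep f)) powr p)" by (simp add: sum_distrib_left[symmetric] powr_mult)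
  finally have "vol T * (\<rho> T * 2 powr (lev T / DIM('a)) * resid T) powr p \<le>
    vol T * (?A * (\<Sum>f\<in>fc T. (\<rho> T * pm T) powr p + (\<rho> (rep f) * pm (rep f)) powr p))" using vol_pos[OF T] by simp
  also have "... = ?A * (\<Sum>f\<in>fc T. y T + vol T * (\<rho> (rep f) * pm (rep f)) powr p)" by (simp add: sum_distrib_left y_def algebra_simps)
  also have "... \<le> ?A * (\<Sum>f\<in>fc T. y T + vol_ratio * y (rep f))"
  proof (intro mult_left_mono sum_mono add_left_mono)
   fix f assume f: "f \<in> fc T"
   show "vol T * (\<rho> (rep f) * pm (rep f)) powr p \<le> vol_ratio * y (rep f)"
    using mult_right_mono[OF neighbor_sizes(1)[of "rep f" T f], of "(\<rho> (rep f) * pm (rep f)) powr p"] rep[OF T f] T f by (simp add: y_def)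
  qed simp
  finally show ?thesis .
 qed
 then have "(\<Sum>T\<in>M. vol T * (\<rho> T * 2 powr (lev T / DIM('a)) * resid T) powr p) \<le> (\<Sum>T\<in>M. ?A * (\<Sum>f\<in>fc T. y T + vol_ratio * y (rep f)))"
  by (rule sum_mono)
 also have "... = ?A * ((\<Sum>T\<in>M. \<Sum>f\<in>fc T. y T) + vol_ratio * (\<Sum>T\<in>M. \<Sum>f\<in>fc T. y (rep f)))" by (simp add: sum_distrib_left sum.distrib distrib_left)
 also have "(\<Sum>T\<in>M. \<Sum>f\<in>fc T. y T) = D * (\<Sum>T\<in>M. y T)" using card_vfacets(2)[OF M_full] by (simp add: sum_distrib_right sum.distrib algebra_simps D_def)
 also have "?A * (D * (\<Sum>T\<in>M. y T) + vol_ratio * (\<Sum>T\<in>M. \<Sum>f\<in>fc T. y (rep f))) \<le>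
   ?A * (D * (\<Sum>T\<in>M. y T) + vol_ratio * (2 * D * (\<Sum>T\<in>M. y T)))" using rep_sum[of y] y0 vr by (intro mult_left_mono add_left_mono) (auto simp: D_def)
 also have "... = ?A * ((D * (1 + 2 * vol_ratio)) * (\<Sum>T\<in>M. y T))" by argo
 \<comment> \<open>A factor at least 1 is replaced by its p-th power, to keep the constant in the
   form c^p.\<close>
 also have "... \<le> ?A * ((D * (1 + 2 * vol_ratio)) powr p * (\<Sum>T\<in>M. y T))"
 using mult_mono[OF D, of 1 "1 + 2 * vol_ratio"] vr D powr_mono[OF p] y0 by (intro mult_left_mono mult_right_mono sum_nonneg) auto
 also have "... = (R * (2 * D) * (D * (1 + 2 * vol_ratio))) powr p * (\<Sum>T\<in>M. y T)" by (simp add: powr_mult[symmetric])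
 also have "... \<le> resid_sum_const \<gamma> powr p * (\<Sum>T\<in>M. y T)" using R0 D vr p y0 unfolding resid_sum_const_def R_def[symmetric] D_def[symmetric]
  by (intro mult_right_mono powr_mono2 sum_nonneg) auto
 finally show ?thesis by (simp add: y_def pm_powr)
qed

end

end

end

section \<open>The gradient of the projection\<close>

text \<open>Collects the factors of \<open>cr_grad_bound\<close>, \<open>discrete_Lp\<close> and
  \<open>resid_sum\<close>; neither \<open>p\<close> nor the mesh enters.\<close>

definition (in bisection_setting) grad_const :: "real => real => real => real => real" where "grad_const \<gamma> b \<delta> K = 2 * (DIM('a) * shape_const * (real DIM('a) + 1)) *
  (2 * (1 + b^2 * (real DIM('a) + 1) / \<delta>^2) * (1 + 2 * (unit_ball_vol DIM('a) * shape_const ^ (DIM('a) + 1)) * K^2) + 1) * resid_sum_const \<gamma>"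

lemma inner_left_cancel: "(%h. h \<bullet> a) = (%h. h \<bullet> b) ==> a = b" by (metis inner_commute vector_eq_rdot)

context bisection_mesh
begin

definition cr_grad :: "('a set => real) => 'a tagged => 'a" where "cr_grad x T = (\<Sum>f\<in>fc T. x f *\<^sub>R (- DIM('a) *\<^sub>R bary_grad (verts T) (opp (verts T) f)))"

lemma pf_has_derivative: "(pf T x has_derivative (%h. h \<bullet> cr_grad x T)) (at y)"
proof -
 have "((%y. \<Sum>f\<in>fc T. x f * cr_basis (verts T) f y) has_derivative
   (%h. \<Sum>f\<in>fc T. x f * ((- DIM('a) *\<^sub>R bary_grad (verts T) (opp (verts T) f)) \<bullet> h))) (at y)" by (intro derivative_intros cr_basis_has_derivative)
 then show ?thesis unfolding pf_def cr_grad_def by (simp add: inner_sum_right inner_commute mult.assoc)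
qed

text \<open>Basis functions of an element sum to one, so subtracting a constant from all
  coefficients changes the function by a constant.\<close>

lemma cr_grad_shift:
 assumes T: "T \<in> M"
 shows "cr_grad (%f. x f + (y f - z)) T = cr_grad (%f. x f + y f) T"
proof -
 let ?A = "pf T (%f. x f + (y f - z))"
 have "?A = (%v. pf T (%f. x f + y f) v - z)" using cr_basis_sum[OF M_full[OF T]] by (simp add: pf_def fun_eq_iff algebra_simps sum_subtractf flip: sum_distrib_left)
 then have "(?A has_derivative (%h. h \<bullet> cr_grad (%f. x f + y f) T)) (at 0)"
  using has_derivative_diff[OF pf_has_derivative[of T "%f. x f + y f" 0] has_derivative_const[of z]] by simp
 from has_derivative_unique[OF pf_has_derivative this]
 show ?thesis by (rule inner_left_cancel)
qed

lemma grad_NC_eq: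
 assumes Q: "!!T x. T \<in> M ==> x \<in> ih T ==> Q x = pf T w x"
 shows "grad_NC (hull_of ` M) Q x = (\<Sum>T\<in>M. indicator (ih T) x *\<^sub>R cr_grad w T)"
proof (cases "\<exists>T\<in>M. x \<in> ih T")
 case True
 then obtain T where T: "T \<in> M" "x \<in> ih T" by auto
 have "x \<in> ih T' \<longleftrightarrow> T' = T" if "T' \<in> M" for T' using ih_disjoint[OF T(1) that] T(2) interior_subset by auto
 then have "(\<Sum>T\<in>M. indicator (ih T) x *\<^sub>R cr_grad w T) = (\<Sum>T'\<in>M. if T' = T then cr_grad w T' else 0)" by (intro sum.cong) auto
 then have s: "(\<Sum>T\<in>M. indicator (ih T) x *\<^sub>R cr_grad w T) = cr_grad w T" using T(1) finite_M by simp
 have d: "GDERIV Q x :> cr_grad w T" unfolding gderiv_def by (rule has_derivative_transform_within_open[OF pf_has_derivative _ T(2)]) (auto simp: Q[OF T(1)])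
 then have "(THE D. GDERIV Q x :> D) = cr_grad w T" by (rule the_equality) (use d has_derivative_unique inner_left_cancel in \<open>unfold gderiv_def, blast\<close>)
 then show ?thesis using s by (auto simp: grad_NC_def)
next
 case False
 then show ?thesis by (simp add: grad_NC_def)
qed

lemma cr_grad_bound:
 assumes T: "T \<in> M"
 shows "norm (cr_grad x T) \<le> DIM('a) * shape_const * 2 powr (lev T / DIM('a)) * (\<Sum>f\<in>fc T. \<bar>x f\<bar>)"
proof -
 let ?A = "2 powr (lev T / DIM('a))"
 have hs: "hs T * ?A = 1" by (simp add: mesh_size_def powr_add[symmetric])
 have "norm (cr_grad x T) \<le> (\<Sum>f\<in>fc T. \<bar>x f\<bar> * (DIM('a) * (shape_const * ?A)))" unfolding cr_grad_def
 proof (rule order_trans[OF norm_sum sum_mono])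
  fix f assume f: "f \<in> fc T"
  let ?b = "bary_grad (verts T) (opp (verts T) f)"
  have "norm ?b * hs T * ?A \<le> shape_const * ?A" using shape_const(5)[OF lev[OF T], of "opp (verts T) f"] opp_in[OF f] by simp
  then show "norm (x f *\<^sub>R (- DIM('a) *\<^sub>R ?b)) \<le> \<bar>x f\<bar> * (DIM('a) * (shape_const * ?A))" by (simp add: mult.assoc hs mult_left_mono abs_mult)
 qed
 then show ?thesis unfolding sum_distrib_right[symmetric] by argo
qed

text \<open>After subtraction of the element mean \<open>z\<close> the coefficients split into
  \<open>x\<close>, controlled by \<open>discrete_Lp\<close>, and y - z, controlled by the local
  residual. Both parts end in \<open>resid_sum\<close>.\<close>

lemma gradient_estimate:
 assumes W: "borel_weak \<Omega> u g" and iu: "integrable lborel (%x. indicator \<Omega> x * u x)"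
  and v: "v \<in> borel_measurable (lebesgue_on \<Omega>)" "AE x in lborel. x \<in> \<Omega> --> u x = v x"
  and \<rho>: "!!T. T \<in> M ==> 0 < \<rho> T" and graded: "!!T T'. dm.nbr T T' ==> \<rho> T \<le> \<gamma> * \<rho> T'" and \<gamma>: "1 \<le> \<gamma>" and p: "1 \<le> p"
  and N: "!!T. T \<in> M ==> (NN x. indicator (ih T) x * ennreal (norm (g x) powr p)) = ennreal (N T)" "!!T. T \<in> M ==> 0 \<le> N T"
  and adm: "dm.admissible b1 b \<delta>" and \<epsilon>: "0 < \<epsilon>" and K: "!!N. (\<Sum>i<N. (1 / (1 + \<epsilon>)) ^ i * real (i + 1) ^ DIM('a)) \<le> K"
  and b: "\<gamma> * (1 + \<epsilon>) \<le> b1" "\<gamma> / 2 powr (1 / DIM('a)) * 2 powr \<bar>1/2 - 1/p\<bar> * (1 + \<epsilon>) \<le> b1"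
   "\<gamma> * 2 powr (1 / DIM('a)) * 2 powr \<bar>1/2 - 1/p\<bar> * (1 + \<epsilon>) \<le> b"
 shows "(\<Sum>T\<in>M. vol T * (\<rho> T * norm (cr_grad (%f. Q_CR \<Omega> (hull_of ` M) v (mid f)) T)) powr p) \<le>
  grad_const \<gamma> b \<delta> K powr p * (\<Sum>T\<in>M. \<rho> T powr p * N T)"
proof -
 define A where "A = unit_ball_vol DIM('a) * shape_const ^ (DIM('a) + 1)"
 define y where "y = avg u"
 define x where "x f = Q_CR \<Omega> (hull_of ` M) v (mid f) - y f" for f
 let ?C = "(real DIM('a) + 1)"
 let ?I = "1 + b^2 * ?C / \<delta>^2"
 define C where "C = 2 * ?I * (1 + 2 * A * K^2)"
 define D where "D = DIM('a) * shape_const * ?C"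
 define l where "l T = \<rho> T * 2 powr (lev T / DIM('a))" for T
 let ?D = "dm.local_size x"
 define X where "X T = l T * ?D T" for T
 define R where "R T = l T * resid u T" for T
 have um: "u \<in> borel_measurable borel" using W by (simp add: borel_weak_def)
 have A0: "0 \<le> A" using shape_const(1) by (simp add: A_def)
 have C1: "1 \<le> C" using mult_mono[of 1 "?I" 1 "1 + 2 * A * K^2"] A0 unfolding C_def mult.assoc by auto
 have r0: "0 \<le> resid u T" if "T \<in> M" for T by (rule resid_nonneg[OF W iu that])
 have XR: "0 \<le> X T" "0 \<le> R T" if "T \<in> M" for T using \<rho>[OF that] r0[OF that] by (auto simp: X_def R_def l_def dm.local_size_nonneg)
 have sol: "dm.solves x (resid u)" using projection_system(2)[OF v(1) um v(2) iu, of y] by (simp add: x_def[abs_def] resid_def[OF W iu, abs_def] y_def)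
 have rt: "dm.rt \<rho> = l" unfolding l_def by (intro ext dm.rt_def[where \<rho> = \<rho>, OF sol r0 \<rho> graded nbr_lev adm \<epsilon> growth[folded A_def] A0 K \<gamma>])
 let ?B = "(\<Sum>T\<in>M. vol T * R T powr p)"
 let ?G = "(\<Sum>T\<in>M. vol T * X T powr p)"
 have disc: "?G \<le> C powr (p / 2) * ?B"
  using dm.discrete_Lp[where \<rho> = \<rho>, OF sol r0 \<rho> graded nbr_lev adm \<epsilon> growth[folded A_def] A0 K \<gamma> p b] unfolding rt X_def R_def C_def by simp
 let ?A = "cr_grad (%f. Q_CR \<Omega> (hull_of ` M) v (mid f))"
 have pt: "\<rho> T * norm (?A T) \<le> D * (X T + R T)" if T: "T \<in> M" for T
 proof -
  define z where "z = SI T u / vol T"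
  define k where "k = 2 powr (lev T / DIM('a))"
  have V: "0 < vol T" by (rule vol_pos[OF T])
  have c: "card (fc T) = DIM('a) + 1" "finite (fc T)" using card_vfacets[OF M_full[OF T]] by auto
  have yz: "\<bar>y f - z\<bar> \<le> SI T (%x. \<bar>u x - y f\<bar>) / vol T" if "f \<in> fc T" for f
  proof -
   have "\<bar>SI T (%x. u x - y f)\<bar> \<le> SI T (%x. \<bar>u x - y f\<bar>)"
    unfolding SI_def simplex_integral_def using integral_abs_bound[of lborel "%x. indicator (convex hull verts T) x * (u x - y f)"] by (simp add: abs_mult)
   moreover have "SI T (%x. u x - y f) = - (vol T * (y f - z))" unfolding SI_shift[OF W iu T] using V by (simp add: z_def field_simps)
   ultimately show ?thesis using V by (simp add: abs_mult pos_le_divide_eq mult.commute)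
  qed
  let ?E = "(\<Sum>f\<in>fc T. \<bar>x f + (y f - z)\<bar>)"
  have "?E \<le> (\<Sum>f\<in>fc T. ?D T + SI T (%x. \<bar>u x - y f\<bar>) / vol T)"
  proof (rule sum_mono)
   fix f assume f: "f \<in> fc T"
   have "\<bar>x f\<bar> \<le> ?D T" unfolding dm.local_size_def using c(2) f member_le_sum[of f "fc T" "%f. (x f)^2"] by (intro real_le_rsqrt) auto
   then show "\<bar>x f + (y f - z)\<bar> \<le> ?D T + SI T (%x. \<bar>u x - y f\<bar>) / vol T" using yz[OF f] by simp
  qed
  also have "... = ?C * ?D T + 1 / vol T * (\<Sum>f\<in>fc T. SI T (%x. \<bar>u x - y f\<bar>))" by (simp add: sum.distrib c(1) sum_divide_distrib)
  also have "... \<le> ?C * ?D T + ?C * resid u T"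
  proof -
   have S: "0 \<le> 1 / vol T * (\<Sum>f\<in>fc T. SI T (%x. \<bar>u x - y f\<bar>))" using V SI_abs_nonneg[OF W iu] by (intro mult_nonneg_nonneg sum_nonneg) auto
   let ?H = "(?C * (real DIM('a) + 2) * (real DIM('a))^2)"
   have "1 * 1 * 1 * 1 \<le> ?C * ?H" unfolding mult.assoc by (intro mult_mono) auto
   then have "1 * (1 / vol T * (\<Sum>f\<in>fc T. SI T (%x. \<bar>u x - y f\<bar>))) \<le>
     ?C * ?H * (1 / vol T * (\<Sum>f\<in>fc T. SI T (%x. \<bar>u x - y f\<bar>)))" using S by (intro mult_right_mono) auto
   then show ?thesis unfolding resid_def[OF W iu] y_def by argo
  qed
  finally have s: "?E \<le> ?C * (?D T + resid u T)" by argo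
  have "?A T = cr_grad (%f. x f + (y f - z)) T" unfolding cr_grad_shift[OF T] by (simp add: x_def)
  then have "norm (?A T) \<le> DIM('a) * shape_const * k * ?E" using cr_grad_bound[OF T] by (simp add: k_def)
  also have "... \<le> DIM('a) * shape_const * k * (?C * (?D T + resid u T))" using s shape_const(1) by (simp add: k_def)
  finally have "\<rho> T * norm (?A T) \<le>
    \<rho> T * (DIM('a) * shape_const * k * (?C * (?D T + resid u T)))" using \<rho>[OF T] by simp
  then show ?thesis by (simp add: D_def X_def R_def l_def k_def algebra_simps)
 qed
 let ?F = "resid_sum_const \<gamma> powr p * (\<Sum>T\<in>M. \<rho> T powr p * N T)"
 have R: "?B \<le> ?F" unfolding R_def l_def by (rule resid_sum[OF W iu \<rho> graded \<gamma> p N])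
 have "(\<Sum>T\<in>M. vol T * (\<rho> T * norm (?A T)) powr p) \<le> (\<Sum>T\<in>M. vol T * (D powr p * (2 powr p * (X T powr p + R T powr p))))"
 proof (intro sum_mono mult_left_mono)
  fix T assume T: "T \<in> M"
  have "(\<rho> T * norm (?A T)) powr p \<le> (D * (X T + R T)) powr p" using pt[OF T] \<rho>[OF T] p by (intro powr_mono2) auto
  also have "... \<le> D powr p * (2 powr p * (X T powr p + R T powr p))" using XR[OF T] p by (auto simp: powr_mult intro!: mult_left_mono add_powr_le)
  finally show "(\<rho> T * norm (?A T)) powr p \<le> D powr p * (2 powr p * (X T powr p + R T powr p))" .
 qed (use vol_pos in \<open>auto intro: less_imp_le\<close>)
 also have "... = (2 * D) powr p * (?G + ?B)" by (simp add: powr_mult sum_distrib_left sum.distrib algebra_simps)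
 also have "... \<le> (2 * D) powr p * ((C + 1) powr p * ?B)"
 proof (rule mult_left_mono)
  have s0: "0 \<le> ?B" using less_imp_le[OF vol_pos] by (intro sum_nonneg mult_nonneg_nonneg) auto
  \<comment> \<open>Towards C^(p/2) + 1 \<le> (C + 1)^p, which merges the two parts within the form
    c^p.\<close>
  have "C powr (p / 2) \<le> C powr (p - 1) * C" using C1 p powr_mono[of "p / 2" "p - 1 + 1" C] by (simp add: powr_diff)
  also have "... \<le> (C + 1) powr (p - 1) * C" using C1 p by (intro mult_right_mono powr_mono2) auto
  moreover have "1 \<le> (C + 1) powr (p - 1)" using C1 p by (intro ge_one_powr_ge_zero) auto
  moreover have "(C + 1) powr p = (C + 1) powr (p - 1) * (C + 1)" using C1 by (simp add: powr_diff)
  ultimately have "C powr (p / 2) + 1 \<le> (C + 1) powr p" by argo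
  from mult_right_mono[OF this s0]
  show "?G + ?B \<le> (C + 1) powr p * ?B" using disc by argo
 qed simp
 also have "... \<le> (2 * D) powr p * ((C + 1) powr p * ?F)" using R by (intro mult_left_mono) auto
 finally show ?thesis by (simp add: powr_mult grad_const_def D_def C_def A_def)
qed

end

section \<open>Weighted norms\<close>

context bisection_mesh
begin

lemma nbr_dist: assumes "dm.nbr T T'" shows "dist_CR (hull_of ` M) (hull_of T) (hull_of T') = 1"
proof -
 obtain f where f: "T \<in> M" "T' \<in> M" "T ~= T'" "f \<in> fc T" "f \<in> fc T'" using assms by (auto simp: dm.nbr_def)
 then have ne: "hull_of T ~= hull_of T'" using conf by (auto simp: conforming_def inj_on_def)
 have "convex hull f facet_of hull_of T" "convex hull f facet_of hull_of T'" unfolding hull_of_def using f facet_of_hull[OF M_full] by auto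
 moreover from this have "convex hull f \<in> faces (hull_of ` M)" using f(1) by (auto simp: faces_def)
 ultimately have 1: "(hull_of T, hull_of T') \<in> face_neighbors (hull_of ` M) ^^ 1" using f ne by (auto simp: face_neighbors_def)
 have "1 \<le> N" if "(hull_of T, hull_of T') \<in> face_neighbors (hull_of ` M) ^^ N" for N using that ne by (cases N) auto
 then show ?thesis unfolding dist_CR_def by (intro antisym Inf_lower Inf_greatest) (use 1 in \<open>auto simp: one_enat_def simp del: relpow.simps\<close>)
qed

lemma AE_ih_ex: "T \<in> M ==> AE x in lborel. P x ==> \<exists>x\<in>ih T. P x"
proof (rule ccontr)
 assume T: "T \<in> M" and P: "AE x in lborel. P x" and "\<not> (\<exists>x\<in>ih T. P x)"
 then have "AE x in lborel. x \<notin> ih T" by auto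
 then show False using ih_volume[OF T] vol_pos[OF T] by (auto simp: AE_iff_null_sets[symmetric])
qed

lemma AE_lebesgue_on: "S \<in> sets lebesgue ==> (AE x in lebesgue_on S. P x) \<longleftrightarrow> (AE x in lborel. x \<in> S --> P x)" for S :: "'a set"
 by (simp add: AE_restrict_space_iff AE_completion_iff)

text \<open>\<open>r T\<close> is the essential infimum. Bounds that hold almost everywhere hold at
  some actual point of the open element, which shows that it is finite and positive.\<close>

lemma weight_values:
 assumes w: "weight_with_grading \<Omega> (hull_of ` M) \<gamma> \<rho>"
 obtains r where "!!T. T \<in> M ==> 0 < r T" "!!T T'. dm.nbr T T' ==> r T \<le> \<gamma> * r T'"
  "!!T. T \<in> M ==> AE x in lborel. x \<in> ih T --> r T \<le> \<rho> x \<and> \<rho> x \<le> \<gamma> * r T"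
proof -
 define i where "i T = ess_inf_on (hull_of T) \<rho>" for T
 have g: "1 \<le> \<gamma>" using w by (simp add: weight_with_grading_def)
 have pos: "AE x in lborel. x \<in> \<Omega> --> 0 < \<rho> x" using w \<Omega>_sets by (simp add: weight_with_grading_def AE_lebesgue_on)
 let ?A = "ereal \<gamma>"
 have bd: "AE x in lborel. x \<in> ih T --> i T \<le> ereal (\<rho> x) \<and> ereal (\<rho> x) \<le> ?A * i T" if T: "T \<in> M" for T
 proof -
  have m: "hull_of T \<in> sets lebesgue" using hull_compact[OF T] by (simp add: borel_compact)
  have "AE x in lborel. x \<in> hull_of T --> ereal (\<rho> x) \<le> ess_sup_on (hull_of T) \<rho>"
   "AE x in lborel. x \<in> hull_of T --> - ereal (\<rho> x) \<le> esssup (lebesgue_on (hull_of T)) (%x. - ereal (\<rho> x))"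
   unfolding AE_lebesgue_on[OF m, symmetric] ess_sup_on_def by (rule esssup_AE)+
  then show ?thesis
  proof eventually_elim
   case (elim x)
   show ?case using elim interior_subset[of "hull_of T"] w T by (auto simp: weight_with_grading_def i_def ess_inf_on_def ereal_uminus_le_reorder)
  qed
 qed
 have fin: "\<exists>t>0. i T = ereal t" if T: "T \<in> M" for T
 proof -
  have "AE x in lborel. (x \<in> ih T --> 0 < \<rho> x) \<and> (x \<in> ih T --> i T \<le> ereal (\<rho> x) \<and> ereal (\<rho> x) \<le> ?A * i T)"
   using pos bd[OF T] by eventually_elim (use ih_sub[OF T] in auto)
  then obtain x where x: "0 < \<rho> x" "i T \<le> ereal (\<rho> x)" "ereal (\<rho> x) \<le> ?A * i T" using AE_ih_ex[OF T] by blast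
  have "0 < ?A * i T" by (rule less_le_trans[OF _ x(3)]) (use x(1) in simp)
  then show ?thesis using g x(2) by (cases "i T") (auto simp: zero_less_mult_iff)
 qed
 then obtain r where r: "!!T. T \<in> M ==> 0 < r T" "!!T. T \<in> M ==> i T = ereal (r T)" by metis
 show thesis
 proof (rule that[OF r(1)])
  fix T T' assume n: "dm.nbr T T'"
  then have T: "T \<in> M" "T' \<in> M" by (auto simp: dm.nbr_def)
  show "r T \<le> \<gamma> * r T'" using r(2) T w nbr_dist[OF dm.nbr_sym[OF n]] by (simp add: weight_with_grading_def i_def)
 next
  fix T assume T: "T \<in> M"
  show "AE x in lborel. x \<in> ih T --> r T \<le> \<rho> x \<and> \<rho> x \<le> \<gamma> * r T" using bd[OF T] by (simp add: r(2)[OF T])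
 qed
qed

text \<open>The domain is bounded, and t \<le> 1 + t^q for finite exponents.\<close>

lemma Lp_integrable:
 fixes u :: "'a => real"
 assumes u: "u \<in> Lp \<Omega> p" and p: "1 \<le> p"
 shows "integrable (lebesgue_on \<Omega>) u"
proof -
 let ?A = "lebesgue_on \<Omega>"
 have um: "u \<in> borel_measurable ?A" and fin: "Lp_norm \<Omega> p u < \<infinity>" using u by (auto simp: Lp_def)
 have S: "emeasure ?A (space ?A) < \<infinity>" using emeasure_bounded_finite[OF bounded_\<Omega>] \<Omega>_sets by (simp add: emeasure_restrict_space)
 have "\<exists>h. (\<integral>\<^sup>+x. h x \<partial>?A) < \<infinity> \<and> (AE x in ?A. ennreal (norm (u x)) \<le> h x)"
 proof (cases "p = \<infinity>")
  case True
  define B where "B = esssup ?A (%x. ennreal (norm (u x)))"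
  have "(\<integral>\<^sup>+x. B \<partial>?A) < \<infinity>" using S fin True by (simp add: Lp_norm_def B_def ennreal_mult_less_top)
  moreover have "AE x in ?A. ennreal (norm (u x)) \<le> B" unfolding B_def by (rule esssup_AE)
  ultimately show ?thesis by blast
 next
  case False
  define q where "q = enn2real p"
  have q: "1 \<le> q" using p False enn2real_mono[of 1 p] by (simp add: q_def less_top)
  have "(\<integral>\<^sup>+x. ennreal (norm (u x) powr q) \<partial>?A) < \<infinity>"
   using fin False unfolding Lp_norm_def ennpowr_def q_def by (auto simp: less_top split: if_splits)
  then have "(\<integral>\<^sup>+x. 1 + ennreal (norm (u x) powr q) \<partial>?A) < \<infinity>" using S um by (simp add: nn_integral_add)
  moreover have "ennreal (norm (u x)) \<le> 1 + ennreal (norm (u x) powr q)" for x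
  proof -
   have "norm (u x) \<le> 1 + norm (u x) powr q" using powr_mono[OF q, of "norm (u x)"] by (fastforce simp: add_increasing2)
   then have "ennreal (norm (u x)) \<le> ennreal (1 + norm (u x) powr q)" by (rule ennreal_leI)
   then show ?thesis by simp
  qed
  ultimately show ?thesis by auto
 qed
 then obtain h where h: "(\<integral>\<^sup>+x. h x \<partial>?A) < \<infinity>" "AE x in ?A. ennreal (norm (u x)) \<le> h x" by auto
 show ?thesis by (rule integrableI_bounded[OF um]) (rule le_less_trans[OF nn_integral_mono_AE[OF h(2)] h(1)])
qed

lemma integrable_representative:
 fixes u u' :: "'a => real"
 assumes u: "integrable (lebesgue_on \<Omega>) u" and u': "u' \<in> borel_measurable borel" "AE x in lborel. x \<in> \<Omega> --> u' x = u x"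
 shows "integrable lborel (%x. indicator \<Omega> x * u' x)"
proof -
 have [measurable]: "\<Omega> \<in> sets borel" "u' \<in> borel_measurable borel" using \<Omega>_sets u'(1) by auto
 have "integrable lebesgue (%x. indicator \<Omega> x *\<^sub>R u x)" using u by (simp add: integrable_restrict_space)
 then have "integrable lebesgue (%x. indicator \<Omega> x * u' x)" by (rule Bochner_Integration.integrable_cong_AE_imp)
   (use AE_completion[OF u'(2)] in \<open>auto elim!: eventually_mono intro: measurable_completion\<close>)
 then show ?thesis by (simp add: integrable_completion)
qed

lemma integral_pieces:
 assumes G: "!!T. T \<in> M ==> G T \<in> borel_measurable borel"
 shows "(\<integral>\<^sup>+x. (\<Sum>T\<in>M. indicator (ih T) x * G T x) \<partial>lebesgue_on \<Omega>) = (\<Sum>T\<in>M. NN x. indicator (ih T) x * G T x)"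
proof -
 have m: "(%x. indicator (ih T) x * G T x) \<in> borel_measurable lborel" if "T \<in> M" for T using G[OF that] by simp
 have "(\<integral>\<^sup>+x. (\<Sum>T\<in>M. indicator (ih T) x * G T x) \<partial>lebesgue_on \<Omega>) =
   (\<integral>\<^sup>+x. (\<Sum>T\<in>M. indicator (ih T) x * G T x) \<partial>lebesgue)"
 proof -
  have "indicator (ih T) x * G T x * indicator \<Omega> x = indicator (ih T) x * G T x" if "T \<in> M" for T x using ih_sub[OF that] by (auto simp: indicator_def)
  then show ?thesis using \<Omega>_sets by (simp add: nn_integral_restrict_space sum_distrib_right)
 qed
 also have "... = (NN x. (\<Sum>T\<in>M. indicator (ih T) x * G T x))" by (intro nn_integral_completion borel_measurable_sum)
 finally show ?thesis using m by (simp add: nn_integral_sum)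
qed

lemma AE_pieces:
 assumes "!!T. T \<in> M ==> AE x in lborel. x \<in> ih T --> P T x"
 shows "AE x in lebesgue_on \<Omega>. \<exists>T\<in>M. x \<in> ih T \<and> P T x"
proof -
 have "AE x in lborel. \<forall>T\<in>M. x \<in> ih T --> P T x" using assms finite_M by (subst AE_ball_countable) (auto intro: countable_finite)
 with \<Omega>_AE show ?thesis using \<Omega>_sets by (auto simp: AE_lebesgue_on)
qed

lemma sum_pieces: "T \<in> M ==> x \<in> ih T ==> (\<Sum>S\<in>M. indicator (ih S) x * G S) = (G T :: ennreal)"
proof -
 assume T: "T \<in> M" "x \<in> ih T"
 have "x \<in> ih S \<longleftrightarrow> S = T" if "S \<in> M" for S using ih_disjoint[OF T(1) that] T interior_subset by auto
 then have "(\<Sum>S\<in>M. indicator (ih S) x * G S) = (\<Sum>S\<in>M. if S = T then G S else 0)" by (intro sum.cong) auto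
 then show ?thesis using T(1) finite_M by simp
qed

end

section \<open>Stability\<close>

lemma ennpowr_le:
 assumes JI: "J \<le> ennreal (c powr q) * I" and c: "0 < c" and q: "0 < q"
 shows "ennpowr J (1 / q) \<le> ennreal c * ennpowr I (1 / q)"
proof (cases "I = \<infinity>")
 case True
 then show ?thesis using c by (simp add: ennpowr_def)
next
 case False
 then obtain i where i: "I = ennreal i" "0 \<le> i" by (cases I) auto
 have Ji: "J \<le> ennreal (c powr q * i)" using JI by (simp add: i ennreal_mult)
 then have "J ~= \<infinity>" by (auto simp: top_unique)
 then obtain j where j: "J = ennreal j" "0 \<le> j" by (cases J) auto
 have "j powr (1 / q) \<le> (c powr q * i) powr (1 / q)" using Ji i(2) using j q by (intro powr_mono2) auto
 also have "... = c * i powr (1 / q)" using c q by (simp add: powr_mult powr_powr)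
 finally show ?thesis using c by (simp add: ennpowr_def i j ennreal_mult[symmetric])
qed

text \<open>Otherwise the powers of a / c would stay below V / m. This is the passage to p =
  \<infinity>, with \<open>m\<close> the volume of one element.\<close>

lemma le_of_powr_growth:
 fixes a c m V :: real
 assumes le: "!!q. 2 \<le> q ==> m * a powr q \<le> c powr q * V" and m: "0 < m" and a: "0 \<le> a" "0 \<le> c"
 shows "a \<le> c"
proof (rule ccontr)
 assume "\<not> a \<le> c"
 then have ac: "c < a" by simp
 show False
 proof (cases "c = 0")
  case True
  then show False using le[of 2] ac m by (simp add: mult_le_0_iff)
 next
  case False
  then have c: "0 < c" using a by simp
  obtain n where n: "V / m < (a / c) ^ n" using real_arch_pow[of "a / c" "V / m"] ac c by auto
  also have "... \<le> (a / c) ^ (n + 2)" using ac c by (intro power_increasing) auto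
  finally have "V * c ^ (n + 2) < m * a ^ (n + 2)" using m c by (simp add: power_divide divide_less_eq less_divide_eq mult_ac)
  then show False using le[of "real (n + 2)"] ac c by (simp only: powr_realpow) (simp add: mult_ac)
 qed
qed

lemma (in bisection_setting) grad_const_pos: "1 \<le> \<gamma> ==> 0 < grad_const \<gamma> b \<delta> K"
using ratio_bounds shape_const(1) by (auto simp: resid_sum_const_def resid_const_def osc_const_def grad_const_def intro!: add_nonneg_pos mult_pos_pos)

context bisection_mesh
begin

context
 fixes \<gamma> \<epsilon> b1 b \<delta> K :: real and \<rho> u :: "'a => real" and g g' :: "'a => 'a" and u' :: "'a => real" and r :: "'a tagged => real"
 assumes adm: "dm.admissible b1 b \<delta>" and \<epsilon>: "0 < \<epsilon>" and \<gamma>: "1 \<le> \<gamma>"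
  and K: "!!N. (\<Sum>i<N. (1 / (1 + \<epsilon>)) ^ i * real (i + 1) ^ DIM('a)) \<le> K" and r: "!!T. T \<in> M ==> 0 < r T" "!!T T'. dm.nbr T T' ==> r T \<le> \<gamma> * r T'"
   "!!T. T \<in> M ==> AE x in lborel. x \<in> ih T --> r T \<le> \<rho> x \<and> \<rho> x \<le> \<gamma> * r T" and u: "integrable (lebesgue_on \<Omega>) u"
  and W: "borel_weak \<Omega> u' g'" and eq: "AE x in lborel. x \<in> \<Omega> --> u' x = u x \<and> g' x = g x"
begin

definition G :: "'a tagged => 'a" where "G = cr_grad (%f. Q_CR \<Omega> (hull_of ` M) u (mid f))"

definition exponent_ok :: "real => bool" where
 "exponent_ok q \<longleftrightarrow> \<gamma> * (1 + \<epsilon>) \<le> b1 \<and> \<gamma> / 2 powr (1 / DIM('a)) * 2 powr \<bar>1/2 - 1/q\<bar> * (1 + \<epsilon>) \<le> b1 \<and>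
   \<gamma> * 2 powr (1 / DIM('a)) * 2 powr \<bar>1/2 - 1/q\<bar> * (1 + \<epsilon>) \<le> b"

lemma eq1: "AE x in lborel. x \<in> \<Omega> --> u' x = u x" using eq by auto

lemma iu: "integrable lborel (%x. indicator \<Omega> x * u' x)" by (rule integrable_representative[OF u _ eq1]) (use W in \<open>simp add: borel_weak_def\<close>)

lemma elements_estimate:
 assumes q: "1 \<le> q" and ok: "exponent_ok q"
 shows "ennreal (\<Sum>T\<in>M. vol T * (r T * norm (G T)) powr q) \<le> ennreal (grad_const \<gamma> b \<delta> K powr q) *
  (\<Sum>T\<in>M. NN x. indicator (ih T) x * ennreal ((r T * norm (g' x)) powr q))"
proof -
 define n where "n T = (NN x. indicator (ih T) x * ennreal (norm (g' x) powr q))" for T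
 have n: "(NN x. indicator (ih T) x * ennreal ((r T * norm (g' x)) powr q)) = ennreal (r T powr q) * n T" if "T \<in> M" for T using W by (auto simp: borel_weak_def n_def powr_mult ennreal_mult mult_ac nn_integral_cmult[symmetric])
 let ?A = "grad_const \<gamma> b \<delta> K"
 have C: "0 < ?A" using \<gamma> by (rule grad_const_pos)
 show ?thesis
 \<comment> \<open>An infinite integral makes the right-hand side infinite; otherwise all terms are
   real numbers.\<close>
 proof (cases "\<exists>T\<in>M. n T = \<infinity>")
  case True
  then obtain T where "T \<in> M" "n T = \<infinity>" by auto
  then have "(\<Sum>T\<in>M. ennreal (r T powr q) * n T) = \<infinity>" using finite_M r(1)[of T] by force
  then show ?thesis using C n by simp
 next
  case False
  then have N: "n T = ennreal (enn2real (n T))" if "T \<in> M" for T using that by (simp add: less_top)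
  have N': "(NN x. indicator (ih T) x * ennreal (norm (g' x) powr q)) = ennreal (enn2real (n T))" if "T \<in> M" for T using N[OF that] by (simp add: n_def)
  let ?B = "?A powr q * (\<Sum>T\<in>M. r T powr q * enn2real (n T))"
  let ?C = "(\<Sum>T\<in>M. vol T * (r T * norm (G T)) powr q)"
  have "?C \<le> ?B" unfolding G_def by (rule gradient_estimate[OF W iu borel_measurable_integrable[OF u] eq1 r(1,2) \<gamma> q N' _ adm \<epsilon> K])
    (use ok in \<open>auto simp: exponent_ok_def\<close>)
  then have "ennreal ?C \<le>
    ennreal ?B" by (rule ennreal_leI)
  also have "... = ennreal (?A powr q) * (\<Sum>T\<in>M. ennreal (r T powr q) * n T)" using N by (simp add: ennreal_mult sum_nonneg sum_ennreal[symmetric])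
  finally show ?thesis using n by simp
 qed
qed

lemma projection_gradient: "grad_NC (hull_of ` M) (Q_CR \<Omega> (hull_of ` M) u) x = (\<Sum>T\<in>M. indicator (ih T) x *\<^sub>R G T)" unfolding G_def
 by (rule grad_NC_eq, rule projection_system(1)[OF borel_measurable_integrable[OF u] _ eq1 iu]) (use W in \<open>auto simp: borel_weak_def\<close>)

lemma projection_gradient_ih: "T \<in> M ==> x \<in> ih T ==> grad_NC (hull_of ` M) (Q_CR \<Omega> (hull_of ` M) u) x = G T"
proof -
 assume T: "T \<in> M" "x \<in> ih T"
 have "x \<in> ih S \<longleftrightarrow> S = T" if "S \<in> M" for S using ih_disjoint[OF T(1) that] T interior_subset by auto
 then have "(\<Sum>S\<in>M. indicator (ih S) x *\<^sub>R G S) = (\<Sum>S\<in>M. if S = T then G S else 0)" by (intro sum.cong) auto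
 then show ?thesis using T(1) finite_M by (simp add: projection_gradient)
qed

text \<open>Replaces the weight by its element values: from below for the given gradient, from
  above, at the price of \<gamma>, for the projected one.\<close>

lemma weighted_AE: "AE x in lebesgue_on \<Omega>. \<exists>T\<in>M. x \<in> ih T \<and> r T * norm (g' x) \<le> norm (\<rho> x *\<^sub>R g x) \<and>
   norm (\<rho> x *\<^sub>R grad_NC (hull_of ` M) (Q_CR \<Omega> (hull_of ` M) u) x) \<le> \<gamma> * (r T * norm (G T))"
proof (rule AE_pieces)
 fix T assume T: "T \<in> M"
 let ?A = "(hull_of ` M)"
 show "AE x in lborel. x \<in> ih T --> r T * norm (g' x) \<le> norm (\<rho> x *\<^sub>R g x) \<and>
   norm (\<rho> x *\<^sub>R grad_NC ?A (Q_CR \<Omega> ?A u) x) \<le> \<gamma> * (r T * norm (G T))" using r(3)[OF T] eq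
 proof eventually_elim
  case (elim x)
  show ?case
  proof (intro impI)
   assume x: "x \<in> ih T"
   then have e: "r T \<le> \<rho> x" "\<rho> x \<le> \<gamma> * r T" "g' x = g x" using elim ih_sub[OF T] by auto
   then show "r T * norm (g' x) \<le> norm (\<rho> x *\<^sub>R g x) \<and>
    norm (\<rho> x *\<^sub>R grad_NC ?A (Q_CR \<Omega> ?A u) x) \<le> \<gamma> * (r T * norm (G T))"
    using r(1)[OF T] mult_right_mono[OF e(1), of "norm (g x)"] mult_right_mono[OF e(2), of "norm (G T)"] by (simp add: projection_gradient_ih[OF T x])
  qed
 qed
qed

lemma finite_exponent_stability:
 assumes q: "1 \<le> q" and ok: "exponent_ok q"
 shows "(\<integral>\<^sup>+x. ennreal (norm (\<rho> x *\<^sub>R grad_NC (hull_of ` M) (Q_CR \<Omega> (hull_of ` M) u) x) powr q) \<partial>lebesgue_on \<Omega>) \<le>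
  ennreal ((\<gamma> * grad_const \<gamma> b \<delta> K) powr q) * (\<integral>\<^sup>+x. ennreal (norm (\<rho> x *\<^sub>R g x) powr q) \<partial>lebesgue_on \<Omega>)"
proof -
 have gm: "g' \<in> borel_measurable borel" using W by (simp add: borel_weak_def)
 let ?B = "grad_const \<gamma> b \<delta> K"
 have C: "0 < ?B" using \<gamma> by (rule grad_const_pos)
 let ?C = "lebesgue_on \<Omega>"
 have "(\<integral>\<^sup>+x. ennreal (norm (\<rho> x *\<^sub>R grad_NC (hull_of ` M) (Q_CR \<Omega> (hull_of ` M) u) x) powr q) \<partial>?C) \<le>
   (\<integral>\<^sup>+x. (\<Sum>T\<in>M. indicator (ih T) x * ennreal ((\<gamma> * (r T * norm (G T))) powr q)) \<partial>?C)"
  by (rule nn_integral_mono_AE, rule eventually_mono[OF weighted_AE]) (use q in \<open>auto simp: sum_pieces intro!: powr_mono2\<close>)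
 also have "... = (\<Sum>T\<in>M. NN x. indicator (ih T) x * ennreal ((\<gamma> * (r T * norm (G T))) powr q))" by (rule integral_pieces) simp
 also have "... = (\<Sum>T\<in>M. ennreal (\<gamma> powr q * (vol T * (r T * norm (G T)) powr q)))"
 proof (intro sum.cong refl)
  fix T assume T: "T \<in> M"
  let ?A = "(NN x. indicator (ih T) x * ennreal ((\<gamma> * (r T * norm (G T))) powr q))"
  have "?A =
    ennreal (vol T) * ennreal ((\<gamma> * (r T * norm (G T))) powr q)" by (simp add: ih_volume[OF T] nn_integral_multc)
  also have "... = ennreal (\<gamma> powr q * (vol T * (r T * norm (G T)) powr q))" using vol_pos[OF T] by (simp add: powr_mult ennreal_mult[symmetric])
  finally show "?A = ennreal (\<gamma> powr q * (vol T * (r T * norm (G T)) powr q))" .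
 qed
 also have "... = ennreal (\<gamma> powr q) * ennreal (\<Sum>T\<in>M. vol T * (r T * norm (G T)) powr q)"
  using less_imp_le[OF vol_pos] by (simp add: ennreal_mult[symmetric] sum_nonneg flip: sum_distrib_left)
 also have "... \<le> ennreal (\<gamma> powr q) * (ennreal (?B powr q) * (\<Sum>T\<in>M. NN x. indicator (ih T) x * ennreal ((r T * norm (g' x)) powr q)))"
  by (intro mult_left_mono elements_estimate[OF q ok]) auto
 also have "... = ennreal ((\<gamma> * ?B) powr q) * (\<integral>\<^sup>+x. (\<Sum>T\<in>M. indicator (ih T) x * ennreal ((r T * norm (g' x)) powr q)) \<partial>?C)"
  using gm by (simp add: powr_mult ennreal_mult mult.assoc integral_pieces)
 also have "... \<le> ennreal ((\<gamma> * ?B) powr q) * (\<integral>\<^sup>+x. ennreal (norm (\<rho> x *\<^sub>R g x) powr q) \<partial>?C)"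
  by (rule mult_left_mono, rule nn_integral_mono_AE, rule eventually_mono[OF weighted_AE])
   (use q r(1) in \<open>auto simp: sum_pieces less_imp_le simp del: norm_scaleR intro!: powr_mono2\<close>)
 finally show ?thesis .
qed

text \<open>The projected gradient is constant on each element. With the right-hand side bounded by
  \<open>s\<close>, the estimates for all q \<ge> 2 share one constant, and growth in
  \<open>q\<close> yields the bound element by element.\<close>

lemma infinite_exponent_stability:
 assumes ok: "!!q. 2 \<le> q ==> exponent_ok q" and \<rho>m: "\<rho> \<in> borel_measurable (lebesgue_on \<Omega>)"
 shows "esssup (lebesgue_on \<Omega>) (%x. ennreal (norm (\<rho> x *\<^sub>R grad_NC (hull_of ` M) (Q_CR \<Omega> (hull_of ` M) u) x))) \<le>
  ennreal (\<gamma> * grad_const \<gamma> b \<delta> K) * esssup (lebesgue_on \<Omega>) (%x. ennreal (norm (\<rho> x *\<^sub>R g x)))"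
proof -
 define C where "C = grad_const \<gamma> b \<delta> K"
 let ?C = "lebesgue_on \<Omega>"
 define S where "S = esssup ?C (%x. ennreal (norm (\<rho> x *\<^sub>R g x)))"
 have gm: "g' \<in> borel_measurable borel" using W by (simp add: borel_weak_def)
 have C: "0 < C" unfolding C_def using \<gamma> by (rule grad_const_pos)
 show ?thesis
 proof (cases "S = \<infinity>")
  case True
  then show ?thesis unfolding C_def[symmetric] S_def[symmetric] using C \<gamma> by simp
 next
  case False
  then obtain s where s: "S = ennreal s" "0 \<le> s" by (cases S) auto
  have "AE x in ?C. ennreal (norm (\<rho> x *\<^sub>R g x)) \<le> S" unfolding S_def by (rule esssup_AE)
  with weighted_AE have b: "AE x in ?C. \<exists>T\<in>M. x \<in> ih T \<and> r T * norm (g' x) \<le> s" by eventually_elim (auto simp: s simp del: norm_scaleR)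
  have a: "r T * norm (G T) \<le> C * s" if T: "T \<in> M" for T
  proof (rule le_of_powr_growth[of "vol T" _ _ "\<Sum>T\<in>M. vol T"])
   fix q :: real assume q: "2 \<le> q"
   let ?A = "(\<Sum>T\<in>M. NN x. indicator (ih T) x * ennreal ((r T * norm (g' x)) powr q))"
   have "?A = (\<integral>\<^sup>+x. (\<Sum>T\<in>M. indicator (ih T) x * ennreal ((r T * norm (g' x)) powr q)) \<partial>?C)" using gm by (intro integral_pieces[symmetric]) auto
   also have "... \<le> (\<integral>\<^sup>+x. (\<Sum>T\<in>M. indicator (ih T) x * ennreal (s powr q)) \<partial>?C)" by (rule nn_integral_mono_AE, rule eventually_mono[OF b])
     (use q r(1) in \<open>auto simp: sum_pieces less_imp_le intro!: powr_mono2\<close>)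
   finally have B: "?A \<le> ennreal ((\<Sum>T\<in>M. vol T) * s powr q)" using less_imp_le[OF vol_pos] by (simp add: nn_integral_multc ih_volume integral_pieces ennreal_mult[symmetric] sum_distrib_right)
   have "ennreal (vol T * (r T * norm (G T)) powr q) \<le> ennreal (\<Sum>T\<in>M. vol T * (r T * norm (G T)) powr q)"
    using finite_M T less_imp_le[OF vol_pos] by (intro ennreal_leI member_le_sum) auto
   also have "... \<le> ennreal (C powr q) * ?A" unfolding C_def using q by (intro elements_estimate ok) auto
   also have "... \<le> ennreal (C powr q) * ennreal ((\<Sum>T\<in>M. vol T) * s powr q)" by (rule mult_left_mono[OF B]) simp
   also have "... = ennreal ((C * s) powr q * (\<Sum>T\<in>M. vol T))" using less_imp_le[OF vol_pos] by (simp add: powr_mult sum_nonneg ennreal_mult[symmetric])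
   finally show "vol T * (r T * norm (G T)) powr q \<le> (C * s) powr q * (\<Sum>T\<in>M. vol T)" using less_imp_le[OF vol_pos] by (simp add: sum_nonneg)
  qed (use vol_pos[OF T] r(1)[OF T] C s in auto)
  let ?B = "grad_NC (hull_of ` M) (Q_CR \<Omega> (hull_of ` M) u)"
  have m: "?B \<in> borel_measurable ?C" by (auto simp: projection_gradient[abs_def] intro!: measurable_restrict_space1 measurable_completion)
  have "esssup ?C (%x. ennreal (norm (\<rho> x *\<^sub>R ?B x))) \<le> ennreal (\<gamma> * C * s)"
  proof (rule esssup_I)
   show "AE x in ?C. ennreal (norm (\<rho> x *\<^sub>R ?B x)) \<le> ennreal (\<gamma> * C * s)" using weighted_AE
   proof eventually_elim
    case (elim x)
    then obtain T where T: "T \<in> M" "norm (\<rho> x *\<^sub>R ?B x) \<le> \<gamma> * (r T * norm (G T))" by auto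
    have "\<gamma> * (r T * norm (G T)) \<le> \<gamma> * (C * s)" using a[OF T(1)] \<gamma> by simp
    from order_trans[OF T(2) this] show ?case unfolding mult.assoc by (rule ennreal_leI)
   qed
  qed (use m \<rho>m in measurable)
  then show ?thesis unfolding C_def[symmetric] S_def[symmetric] s(1) using C \<gamma> s(2) by (simp add: ennreal_mult[symmetric])
 qed
qed

end

end

text \<open>The bounds sqrt 2 \<le> 1.41422 and ln 2 \<le> 25/36 reduce the claim to an inequality
  linear in r = sqrt (D + 2) with rational coefficients, which is checked for each of the thirty
  dimensions.\<close>

lemma threshold_dim_32:
 fixes d :: nat
 assumes d: "3 \<le> d" "d \<le> 32"
 shows "2 powr (1 / real d + 1 / 2) < (real d + sqrt (real d + 2)) / (real d - sqrt (real d + 2))"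
proof -
 define D r where "D = real d" and "r = sqrt (D + 2)"
 have D: "3 \<le> D" using d by (simp add: D_def)
 have r2: "r^2 = D + 2" and r0: "0 < r" using D by (auto simp: r_def)
 have rD: "r < D"
 proof -
  have "3 * D \<le> D * D" using D by simp
  then have "D + 2 < D^2" using D unfolding power2_eq_square by argo
  then show ?thesis unfolding r_def using D by (intro real_less_lsqrt) auto
 qed
 have s2: "sqrt 2 \<le> 141422 / 100000" by (rule real_le_lsqrt) (auto simp: power2_eq_square)
 let ?A = "241422 / 100000 * D - 25 / 36"
 let ?B = "(41422 / 100000 * D^2 + 25 / 36 * D)"
 \<comment> \<open>The value of \<open>r\<close> above which 1.41422 D (D - r) < (D + r)(D -
   25/36).\<close>
 define q where "q = ?B / ?A"
 have den: "0 < ?A" using D by simp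
 have "?B^2 < (D + 2) * ?A^2"
 proof -
  have "d \<in> set [3..<33]" unfolding set_upt using d by auto
  then show ?thesis unfolding D_def by (simp add: upt_rec power2_eq_square) (elim disjE; simp)
 qed
 then have "q^2 < r^2" by (simp add: q_def r2 power_divide divide_less_eq)
 then have "q < r" using r0 by (simp add: power2_less_imp_less)
 then have main: "141422 / 100000 * D * (D - r) < (D + r) * (D - 25 / 36)" using den by (simp add: q_def pos_divide_less_eq field_simps power2_eq_square)
 \<comment> \<open>Together with the bound for ln 2 this gives 2^(1/D) (D - 25/36) \<le> D.\<close>
 have "exp (- (ln 2 / D)) \<ge> 1 + - (ln 2 / D)" by (rule exp_ge_add_one_self)
 moreover have "ln 2 / D \<le> 25 / 36 / D" using ln2_le_25_over_36 D by (intro divide_right_mono) auto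
 ultimately have "1 - 25 / 36 / D \<le> exp (- (ln 2 / D))" by simp
 then have e: "(D - 25 / 36) / D \<le> 2 powr (- (1 / D))" by (simp add: powr_def diff_divide_distrib)
 let ?C = "2 powr (1 / D)"
 have "?C * ((D - 25 / 36) / D) \<le> ?C * 2 powr (- (1 / D))" using e by (intro mult_left_mono) auto
 also have "... = 1" by (simp add: powr_add[symmetric])
 finally have k: "?C * (D - 25 / 36) \<le> D" using D by simp
 have "2 powr (1 / D + 1 / 2) * (D - r) * (D - 25 / 36) = sqrt 2 * (?C * (D - 25 / 36)) * (D - r)" by (simp add: powr_add powr_half_sqrt)
 also have "... \<le> 141422 / 100000 * D * (D - r)" using k s2 rD D by (intro mult_right_mono mult_mono) auto
 also note main
 finally have "2 powr (1 / D + 1 / 2) * (D - r) < D + r" using D by simp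
 then show ?thesis using rD by (simp add: pos_less_divide_eq D_def r_def)
qed

lemma exponent_half: "1 \<le> p ==> \<bar>1 / 2 - enn2real (inverse p)\<bar> \<le> 1 / 2"
proof (cases p)
 case (real r)
 assume "1 \<le> p"
 then have r: "1 \<le> r" using real by simp
 then have "enn2real (inverse p) = inverse r" using real by (simp add: inverse_ennreal)
 moreover have "0 \<le> inverse r" "inverse r \<le> 1" using r by (auto simp: inverse_le_1_iff)
 ultimately show ?thesis by argo
qed simp

text \<open>For p = 2 it suffices that 2^(1/d) \<le> 1 + 1/d stays below 1 + 2 / sqrt (d +
  2).\<close>

lemma threshold_unweighted:
 fixes d :: nat
 assumes d: "2 \<le> d"
 shows "ereal (1 * grading_factor d 2) < CR_threshold d" and "d \<le> 32 ==> 1 \<le> p ==> ereal (1 * grading_factor d p) < CR_threshold d"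
proof -
 have e: "enn2real (inverse 2) = 1 / 2"
  by (metis enn2real_ennreal ennreal_numeral inverse_ennreal inverse_eq_divide zero_le_numeral zero_less_numeral order.strict_implies_order divide_nonneg_nonneg zero_le_one)
 let ?A = "grading_factor d"
 let ?B = "1 / real d"
 have g2: "?A 2 = 2 powr ?B" by (simp add: grading_factor_def e)
 show "ereal (1 * ?A 2) < CR_threshold d"
 proof (cases "d = 2")
  case False
  then have d3: "3 \<le> d" using d by simp
  have "2 powr ?B \<le> 1 + ?B" using d by (intro two_powr_inverse_le) simp
  also have "?B < 2 / sqrt (real d + 2)"
  proof -
   have "sqrt (real d + 2) < 2 * real d"
   proof (rule real_less_lsqrt)
    have "3 * real d \<le> real d * real d" using d3 by simp
    moreover have "3 \<le> real d" using d3 by simp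
    ultimately show "real d + 2 < (2 * real d)^2" unfolding power2_eq_square by argo
   qed (use d in auto)
   then show ?thesis using d by (simp add: field_simps)
  qed
  also have "1 + 2 / sqrt (real d + 2) \<le> (real d + sqrt (real d + 2)) / (real d - sqrt (real d + 2))" by (rule CR_threshold_square(1)[OF d3])
  finally show ?thesis by (simp add: CR_threshold_def g2)
 qed (simp add: CR_threshold_def)
 assume d32: "d \<le> 32" and p: "1 \<le> p"
 show "ereal (1 * ?A p) < CR_threshold d"
 proof (cases "d = 2")
  case False
  have "?A p \<le> 2 powr (?B + 1 / 2)" unfolding grading_factor_def using exponent_half[OF p] by simp
  then show ?thesis using threshold_dim_32[of d] d d32 False by (simp add: CR_threshold_def)
 qed (simp add: CR_threshold_def)
qed

lemma (in bisection_mesh) constant_weight: "weight_with_grading \<Omega> (hull_of ` M) 1 (%_. 1)"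
proof -
 have fin: "emeasure lborel \<Omega> < \<infinity>" using bounded_\<Omega> by (rule emeasure_bounded_finite)
 have L: "(%_. 1 :: real) \<in> Lp \<Omega> 1" using fin \<Omega>_sets by (simp add: Lp_norm_def ennpowr_def emeasure_restrict_space Lp_def)
 let ?A = "(%_. 1)"
 have s: "ess_sup_on S ?A = 1" "ess_inf_on S ?A = 1" if S: "S \<in> hull_of ` M" for S
 proof -
  obtain T where T: "T \<in> M" "S = hull_of T" using S by auto
  have "hull_of T \<in> sets borel" using hull_compact[OF T(1)] by (rule borel_compact)
  moreover have "emeasure lborel (ih T) \<le> emeasure lborel (hull_of T)" using calculation interior_subset by (intro emeasure_mono) auto
  ultimately have "emeasure (lebesgue_on S) (space (lebesgue_on S)) ~= 0" using T vol_pos[OF T(1)] ih_volume[OF T(1)] by (auto simp: emeasure_restrict_space)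
  then show "ess_sup_on S ?A = 1" "ess_inf_on S ?A = 1" by (auto simp: ess_sup_on_def ess_inf_on_def esssup_const)
 qed
 show ?thesis unfolding weight_with_grading_def using L s by simp
qed

text \<open>The conditions are assumed for every \<open>s\<close> up to |1/2 - 1/p|, because p =
  \<infinity> is reached through finite exponents.\<close>

lemma (in bisection_mesh) weighted_stability:
 assumes w: "weight_with_grading \<Omega> (hull_of ` M) \<gamma> \<rho>" and p: "1 \<le> p" and adm: "dm.admissible b1 b \<delta>" and \<epsilon>: "0 < \<epsilon>"
  and K: "!!N. (\<Sum>i<N. (1 / (1 + \<epsilon>)) ^ i * real (i + 1) ^ DIM('a)) \<le> K"
  and ok: "!!s. 0 \<le> s ==> s \<le> \<bar>1 / 2 - enn2real (inverse p)\<bar> ==> \<gamma> * (1 + \<epsilon>) \<le> b1 \<and>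
   \<gamma> / 2 powr (1 / DIM('a)) * 2 powr s * (1 + \<epsilon>) \<le> b1 \<and> \<gamma> * 2 powr (1 / DIM('a)) * 2 powr s * (1 + \<epsilon>) \<le> b"
  and u: "u \<in> W1 \<Omega> p"
 shows "Lp_norm \<Omega> p (%x. \<rho> x *\<^sub>R grad_NC (hull_of ` M) (Q_CR \<Omega> (hull_of ` M) u) x)
  \<le> ennreal (\<gamma> * grad_const \<gamma> b \<delta> K) * Lp_norm \<Omega> p (%x. \<rho> x *\<^sub>R weak_gradient \<Omega> u x)"
proof -
 have \<gamma>: "1 \<le> \<gamma>" and \<rho>m: "\<rho> \<in> borel_measurable (lebesgue_on \<Omega>)" using w by (auto simp: weight_with_grading_def Lp_def)
 obtain r where r: "!!T. T \<in> M ==> 0 < r T" "!!T T'. dm.nbr T T' ==> r T \<le> \<gamma> * r T'"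
  "!!T. T \<in> M ==> AE x in lborel. x \<in> ih T --> r T \<le> \<rho> x \<and> \<rho> x \<le> \<gamma> * r T" using weight_values[OF w] by auto
 have "has_weak_gradient \<Omega> u (weak_gradient \<Omega> u)" using u someI[of "has_weak_gradient \<Omega> u"] unfolding W1_def weak_gradient_def by auto
 then obtain u' g' where W: "borel_weak \<Omega> u' g'" and eq: "AE x in lborel. x \<in> \<Omega> --> u' x = u x \<and> g' x = weak_gradient \<Omega> u x"
  using borel_representative[OF open_\<Omega>] by blast
 have ui: "integrable (lebesgue_on \<Omega>) u" using u p by (auto simp: W1_def intro: Lp_integrable)
 note ctx = adm \<epsilon> \<gamma> K r ui W eq
 let ?A = "exponent_ok \<gamma> \<epsilon> b1 b"
 have ex: "?A q" if "\<bar>1/2 - 1/q\<bar> \<le> \<bar>1 / 2 - enn2real (inverse p)\<bar>" for q using ok[of "\<bar>1/2 - 1/q\<bar>"] that by (simp add: exponent_ok_def[OF ctx])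
 show ?thesis
 proof (cases "p = \<infinity>")
  case True
  have "?A q" if "2 \<le> q" for q
  proof -
   have "\<bar>1/2 - 1/q\<bar> \<le> \<bar>1 / 2 - enn2real (inverse p)\<bar>" using that True by simp
   then show ?thesis by (rule ex)
  qed
  then show ?thesis using infinite_exponent_stability[OF ctx _ \<rho>m] True by (simp add: Lp_norm_def)
 next
  case False
  define q where "q = enn2real p"
  have q: "1 \<le> q" using p False enn2real_mono[of 1 p] by (simp add: q_def less_top)
  have pq: "p = ennreal q" using False by (simp add: q_def less_top)
  have "?A q" using q by (auto simp: pq inverse_ennreal inverse_eq_divide intro!: ex)
  from finite_exponent_stability[OF ctx q this] show ?thesis unfolding Lp_norm_def using False q \<gamma> grad_const_pos[OF \<gamma>] by (simp add: ennpowr_le flip: q_def)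
 qed
qed

theorem corollary6p6:
  fixes \<Omega> :: "'a::euclidean_space set" and M\<^sub>0 :: "'a tagged set"
  assumes "2 \<le> DIM('a)"
    and "polyhedral_domain \<Omega>"
    and "matching_neighbor_condition M\<^sub>0 \<Omega>"
  shows
    "(\<forall>\<gamma>::real. \<exists>c::real. \<forall>p::ennreal. \<forall>M \<rho>.
        1 \<le> p \<and> BiSec_mesh \<Omega> M\<^sub>0 M \<and> weight_with_grading \<Omega> (hull_of ` M) \<gamma> \<rho> \<and>
        ereal (\<gamma> * grading_factor DIM('a) p) < CR_threshold DIM('a) \<longrightarrow>
        (\<forall>u\<in>W1 \<Omega> p.
           Lp_norm \<Omega> p (\<lambda>x. \<rho> x *\<^sub>R grad_NC (hull_of ` M) (Q_CR \<Omega> (hull_of ` M) u) x)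
             \<le> ennreal c * Lp_norm \<Omega> p (\<lambda>x. \<rho> x *\<^sub>R weak_gradient \<Omega> u x)))
     \<and> (\<exists>c::real. \<forall>M. BiSec_mesh \<Omega> M\<^sub>0 M \<longrightarrow>
        (\<forall>u\<in>W1 \<Omega> 2.
           Lp_norm \<Omega> 2 (grad_NC (hull_of ` M) (Q_CR \<Omega> (hull_of ` M) u))
             \<le> ennreal c * Lp_norm \<Omega> 2 (weak_gradient \<Omega> u)))
     \<and> (DIM('a) \<le> 32 \<longrightarrow>
        (\<exists>c::real. \<forall>p::ennreal. \<forall>M. 1 \<le> p \<and> BiSec_mesh \<Omega> M\<^sub>0 M \<longrightarrow>
          (\<forall>u\<in>W1 \<Omega> p.
             Lp_norm \<Omega> p (grad_NC (hull_of ` M) (Q_CR \<Omega> (hull_of ` M) u))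
               \<le> ennreal c * Lp_norm \<Omega> p (weak_gradient \<Omega> u))))"
proof -
 interpret bisection_setting \<Omega> M\<^sub>0 using assms by unfold_locales
 let ?A = "Lp_norm \<Omega>"
 let ?B = "BiSec_mesh \<Omega> M\<^sub>0"
 let ?C = "weak_gradient \<Omega>"
 let ?E = "Q_CR \<Omega>"
 let ?F = "W1 \<Omega>"
 let ?G = "weight_with_grading \<Omega>"
 have main: "\<exists>c::real. \<forall>p::ennreal. \<forall>M \<rho>.
    1 \<le> p \<and> ?B M \<and> ?G (hull_of ` M) \<gamma> \<rho> \<and>
    ereal (\<gamma> * grading_factor DIM('a) p) < CR_threshold DIM('a) --> (\<forall>u\<in>?F p.
      ?A p (%x. \<rho> x *\<^sub>R grad_NC (hull_of ` M) (?E (hull_of ` M) u) x)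
       \<le> ennreal c * ?A p (%x. \<rho> x *\<^sub>R ?C u x))" for \<gamma> :: real
 proof -
  let ?D = "real DIM('a)"
  obtain \<epsilon> b1 b \<delta> where \<epsilon>: "0 < \<epsilon>" and c: "1 \<le> b1" "b1 \<le> b" "0 < \<delta>"
   "(?D - 2) * (?D * (b1 + 1 / b1 + 2) + (b^2 / b1 + b1 / b^2 + 2)) \<le> 4 * (?D^2 - \<delta>)"
   and ok: "!!s. 0 \<le> s ==> s \<le> 1/2 ==> 1 \<le> \<gamma> ==> ereal (\<gamma> * 2 powr (1 / ?D + s)) < CR_threshold DIM('a) ==>
    \<gamma> * (1 + \<epsilon>) \<le> b1 \<and> \<gamma> / 2 powr (1 / ?D) * 2 powr s * (1 + \<epsilon>) \<le> b1 \<and>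
    \<gamma> * 2 powr (1 / ?D) * 2 powr s * (1 + \<epsilon>) \<le> b" by (rule uniform_constants[OF dim, of \<gamma>]) blast
  obtain K where K: "!!N. (\<Sum>i<N. (1 / (1 + \<epsilon>)) ^ i * real (i + 1) ^ DIM('a)) \<le> K" using geometric_moment_bounded[where d = "DIM('a)", OF \<epsilon>] by auto
  let ?H = "\<gamma> * grad_const \<gamma> b \<delta> K"
  show ?thesis
  \<comment> \<open>\<open>K\<close>, \<open>b\<close> and \<delta> were obtained from the dimension
    and \<gamma> alone, so one constant serves all exponents, meshes, weights and functions.\<close>
  proof (intro exI[of _ "?H"] allI impI ballI)
   fix p :: ennreal and M \<rho> u
   assume a: "1 \<le> p \<and> ?B M \<and> ?G (hull_of ` M) \<gamma> \<rho> \<and>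
    ereal (\<gamma> * grading_factor DIM('a) p) < CR_threshold DIM('a)" and u: "u \<in> ?F p"
   interpret bisection_mesh \<Omega> M\<^sub>0 M by unfold_locales (use a in blast)
   have g: "1 \<le> \<gamma>" using a by (simp add: weight_with_grading_def)
   show "?A p (%x. \<rho> x *\<^sub>R grad_NC (hull_of ` M) (?E (hull_of ` M) u) x)
    \<le> ennreal ?H * ?A p (%x. \<rho> x *\<^sub>R ?C u x)"
   proof (rule weighted_stability[OF _ _ _ \<epsilon> K _ u, of _ _ b1])
    show "dm.admissible b1 b \<delta>" unfolding dm.admissible_def using c by simp
    fix s assume s: "0 \<le> s" "s \<le> \<bar>1 / 2 - enn2real (inverse p)\<bar>"
    have "\<gamma> * 2 powr (1 / ?D + s) \<le> \<gamma> * grading_factor DIM('a) p" unfolding grading_factor_def using s g by simp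
    then have "ereal (\<gamma> * 2 powr (1 / ?D + s)) < CR_threshold DIM('a)" using a by (meson ereal_less_eq(3) le_less_trans)
    then show "\<gamma> * (1 + \<epsilon>) \<le> b1 \<and> \<gamma> / 2 powr (1 / DIM('a)) * 2 powr s * (1 + \<epsilon>) \<le> b1 \<and>
     \<gamma> * 2 powr (1 / DIM('a)) * 2 powr s * (1 + \<epsilon>) \<le> b" using ok[of s] s exponent_half[of p] a g by simp
   qed (use a in auto)
  qed
 qed
 \<comment> \<open>Grading 1 and the constant weight yield both unweighted claims, with one constant
   for all \<open>p\<close>.\<close>
 obtain c where c: "!!p M. 1 \<le> p ==> ?B M ==> ereal (1 * grading_factor DIM('a) p) < CR_threshold DIM('a) ==>
   \<forall>u\<in>?F p. ?A p (grad_NC (hull_of ` M) (?E (hull_of ` M) u)) \<le> ennreal c * ?A p (?C u)"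
 proof -
  from main[of 1] obtain c :: real where c: "!!p M \<rho>.
    1 \<le> p \<and> ?B M \<and> ?G (hull_of ` M) 1 \<rho> \<and>
    ereal (1 * grading_factor DIM('a) p) < CR_threshold DIM('a) ==> (\<forall>u\<in>?F p.
      ?A p (%x. \<rho> x *\<^sub>R grad_NC (hull_of ` M) (?E (hull_of ` M) u) x)
       \<le> ennreal c * ?A p (%x. \<rho> x *\<^sub>R ?C u x))" by auto
  show thesis
  proof (rule that)
   fix p :: ennreal and M
   assume a: "1 \<le> p" "?B M" "ereal (1 * grading_factor DIM('a) p) < CR_threshold DIM('a)"
   interpret bisection_mesh \<Omega> M\<^sub>0 M by unfold_locales (rule a)
   show "\<forall>u\<in>?F p. ?A p (grad_NC (hull_of ` M) (?E (hull_of ` M) u)) \<le> ennreal c * ?A p (?C u)" using c[of p M "%_. 1"] a constant_weight by simp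
  qed
 qed
 show ?thesis
 proof (intro conjI impI)
  show "\<exists>c::real. \<forall>M. ?B M --> (\<forall>u\<in>?F 2.
    ?A 2 (grad_NC (hull_of ` M) (?E (hull_of ` M) u)) \<le> ennreal c * ?A 2 (?C u))" using c[of 2] threshold_unweighted(1)[OF dim] by auto
  assume "DIM('a) \<le> 32"
  then show "\<exists>c::real. \<forall>p::ennreal. \<forall>M. 1 \<le> p \<and> ?B M --> (\<forall>u\<in>?F p.
    ?A p (grad_NC (hull_of ` M) (?E (hull_of ` M) u)) \<le> ennreal c * ?A p (?C u))" using c threshold_unweighted(2)[OF dim] by auto
 qed (use main in blast)
qed

end
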